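(* Let $d\ge 1$ and let $a,b\in\mathbb{R}^d$ with $a,b\neq 0$ and $a\neq b$. For $n,L\ge1$ let $(Y_l(\cdot))_{0\le l\le L}$ be the pre-activations of the randomly initialized ResNet of width $n$ and depth $L$ described in the context (with the same weights used for both inputs), and define the neural covariance kernel $$\hat q_t(a,b) = \frac{\langle Y_{\lfloor tL\rfloor}(a), Y_{\lfloor tL\rfloor}(b)\rangle}{n}, \qquad t\in[0,1].$$ Then there is a constant $C$ depending only on $\|a\|$, $\|b\|$ and $d$ such that for all $n, L\ge 1$ $$\sup_{t\in[0,1]} \left\|\hat q_t(a,b) - q_t(a,b)\right\|_{L_2} \le C\left(\frac{1}{\sqrt n}+\frac{1}{\sqrt L}\right),$$ where $q_t(a,b)$ is the solution of the differential flow $$\frac{d q_t(a,b)}{dt} = \frac12\,\frac{f(c_t(a,b))}{c_t(a,b)}\, q_t(a,b), \qquad c_t(a,b) = \frac{q_t(a,b)}{\sqrt{q_t(a,a)}\sqrt{q_t(b,b)}}, \qquad q_0(a,b) = \frac{\langle a,b\rangle}{d},$$ with $f:[-1,1]\to[-1,1]$ given by $$f(z) = \frac1\pi\left(z\arcsin(z)+\sqrt{1-z^2}\right)+\frac12 z.$$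
   Context: ResNet architecture: for input dimension $d$, width $n$ and depth $L$ and input $x\in\mathbb{R}^d$, $$Y_0(x) = W_{in} x, \qquad Y_l(x) = Y_{l-1}(x) + \frac{1}{\sqrt L} W_l\, \phi(Y_{l-1}(x)), \quad l = 1,\dots,L,$$ where $\phi(u)=\max(u,0)$ is the ReLU function applied coordinatewise, $W_{in}\in\mathbb{R}^{n\times d}$ and $W_l\in\mathbb{R}^{n\times n}$. All entries of all weight matrices are independent, with $W_{in}^{ij}\sim\mathcal{N}(0,1/d)$ and $W_l^{ij}\sim\mathcal{N}(0,1/n)$. The dependence of $Y_l$ on $n$ and $L$ is omitted from the notation. For a random variable $X$, $\|X\|_{L_2} = (\mathbb{E}[\|X\|^2])^{1/2}$. The flow is to be read for all pairs of nonzero inputs, including the diagonal pairs $(a,a)$ and $(b,b)$, for which $c_t\equiv1$. When $c_t(a,b)=0$, the expression $\frac{f(c_t(a,b))}{c_t(a,b)}q_t(a,b)$ is understood as its continuous extension $f(c_t(a,b))\sqrt{q_t(a,a)}\sqrt{q_t(b,b)}$. *)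

theory Defs
  imports "HOL-Probability.Probability"
begin

text \<open>
  Inputs live in \<open>real ^ 'd\<close>, so the input dimension is \<open>CARD('d)\<close>. The width \<open>n\<close> and the depth
  \<open>L\<close> are natural numbers: a vector of length \<open>n\<close> is a function on \<open>nat\<close> of which only the
  components \<open>i < n\<close> are used, and an \<open>n\<close> by \<open>n\<close> matrix is treated likewise.
\<close>

definition relu :: "real \<Rightarrow> real" where
  "relu u = max u 0"

primrec resnet ::
  "nat \<Rightarrow> nat \<Rightarrow> (nat \<Rightarrow> 'd::finite \<Rightarrow> real) \<Rightarrow> (nat \<Rightarrow> nat \<Rightarrow> nat \<Rightarrow> real) \<Rightarrow>
   real ^ 'd \<Rightarrow> nat \<Rightarrow> nat \<Rightarrow> real"
where
  "resnet n L Win W x 0 = (\<lambda>i. \<Sum>j\<in>UNIV. Win i j * x $ j)"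
| "resnet n L Win W x (Suc l) =
     (\<lambda>i. resnet n L Win W x l i
        + 1 / sqrt (real L) * (\<Sum>j<n. W (Suc l) i j * relu (resnet n L Win W x l j)))"

definition neural_kernel ::
  "nat \<Rightarrow> nat \<Rightarrow> (nat \<Rightarrow> 'd::finite \<Rightarrow> real) \<Rightarrow> (nat \<Rightarrow> nat \<Rightarrow> nat \<Rightarrow> real) \<Rightarrow>
   real \<Rightarrow> real ^ 'd \<Rightarrow> real ^ 'd \<Rightarrow> real"
where
  "neural_kernel n L Win W t x y =
     (let l = nat \<lfloor>t * real L\<rfloor>
      in (\<Sum>i<n. resnet n L Win W x l i * resnet n L Win W y l i) / real n)"

text \<open>
  Joint independence of all entries is expressed for the single family obtained by gluing the
  input weights (indices \<open>Inl (i, j)\<close>) and the hidden weights (indices \<open>Inr (l, i, j)\<close>).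
  The second parameter of \<open>normal_density\<close> is the standard deviation, not the variance.
\<close>

definition gaussian_resnet_weights ::
  "'w measure \<Rightarrow> nat \<Rightarrow> nat \<Rightarrow> (nat \<Rightarrow> 'd::finite \<Rightarrow> 'w \<Rightarrow> real) \<Rightarrow>
   (nat \<Rightarrow> nat \<Rightarrow> nat \<Rightarrow> 'w \<Rightarrow> real) \<Rightarrow> bool"
where
  "gaussian_resnet_weights M n L Win W \<longleftrightarrow>
     prob_space M \<and>
     prob_space.indep_vars M (\<lambda>_. borel)
       (case_sum (\<lambda>(i, j). Win i j) (\<lambda>(l, i, j). W l i j))
       (({..<n} \<times> UNIV) <+> ({1..L} \<times> {..<n} \<times> {..<n})) \<and>
     (\<forall>i<n. \<forall>j. distributed M lborel (Win i j)
        (\<lambda>x. ennreal (normal_density 0 (sqrt (1 / real CARD('d))) x))) \<and>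
     (\<forall>l\<in>{1..L}. \<forall>i<n. \<forall>j<n. distributed M lborel (W l i j)
        (\<lambda>x. ennreal (normal_density 0 (sqrt (1 / real n)) x)))"

text \<open>The norm takes values in \<open>ennreal\<close>, so that a non-square-integrable variable has norm \<open>\<infinity>\<close>.\<close>

definition L2_norm :: "'w measure \<Rightarrow> ('w \<Rightarrow> 'b::real_normed_vector) \<Rightarrow> ennreal" where
  "L2_norm M X =
     (let I = (\<integral>\<^sup>+ \<omega>. ennreal ((norm (X \<omega>))\<^sup>2) \<partial>M)
      in if I = \<infinity> then \<infinity> else ennreal (sqrt (enn2real I)))"

definition flow_f :: "real \<Rightarrow> real" where
  "flow_f z = 1 / pi * (z * arcsin z + sqrt (1 - z\<^sup>2)) + 1 / 2 * z"

definition flow_corr :: "('a \<Rightarrow> 'a \<Rightarrow> real) \<Rightarrow> 'a \<Rightarrow> 'a \<Rightarrow> real" where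
  "flow_corr Q x y = Q x y / (sqrt (Q x x) * sqrt (Q y y))"

text \<open>At zero correlation, \<open>f(c) / c * q\<close> is replaced by its continuous extension.\<close>

definition flow_rhs :: "('a \<Rightarrow> 'a \<Rightarrow> real) \<Rightarrow> 'a \<Rightarrow> 'a \<Rightarrow> real" where
  "flow_rhs Q x y =
     (let c = flow_corr Q x y
      in 1 / 2 * (if c = 0 then flow_f c * sqrt (Q x x) * sqrt (Q y y)
                  else flow_f c / c * Q x y))"

text \<open>
  The flow is imposed for all pairs of nonzero inputs, diagonal pairs included. Positivity on the
  diagonal and the range condition on the correlation say that the right-hand side is meaningful:
  \<open>c\<close> is defined and lies in the domain \<open>[-1,1]\<close> of \<open>f\<close> (\<open>arcsin\<close> is unspecified elsewhere).
\<close>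

definition covariance_flow :: "(real \<Rightarrow> real ^ 'd::finite \<Rightarrow> real ^ 'd \<Rightarrow> real) \<Rightarrow> bool" where
  "covariance_flow q \<longleftrightarrow>
     (\<forall>x y. x \<noteq> 0 \<longrightarrow> y \<noteq> 0 \<longrightarrow>
        q 0 x y = inner x y / real CARD('d) \<and>
        (\<forall>t\<in>{0..1}.
           0 < q t x x \<and>
           flow_corr (q t) x y \<in> {-1..1} \<and>
           ((\<lambda>s. q s x y) has_real_derivative flow_rhs (q t) x y) (at t within {0..1})))"

end

theory Submission
  imports Defs
begin

text \<open>
  Write \<open>q\<close> for the flow and \<open>E h(p + N(0, S))\<close> for the smoothing of a function \<open>h\<close> of a pair of
  pre-activations by a centred Gaussian of covariance \<open>S\<close>. Conditionally on layer \<open>k\<close>, the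
  increments of the neurons are independent Gaussian pairs whose covariance \<open>S'\<^sub>k / L\<close> is the empirical
  covariance of the activations. Hence, for a fixed final layer \<open>l\<close>, the neuron average of \<open>h\<close>
  smoothed by \<open>q\<^sub>l - q\<^sub>k\<close> changes from layer \<open>k\<close> to \<open>k + 1\<close> by a martingale increment, which contributes
  \<open>O(n\<^sup>-\<^sup>1\<^sup>/\<^sup>2)\<close> in total, plus the effect of replacing the covariance \<open>q\<^sub>k\<^sub>+\<^sub>1 - q\<^sub>k\<close> by \<open>S'\<^sub>k / L\<close>.
  Taking for \<open>h\<close> the entries of the activation covariance closes the system by Gronwall's inequality.

  The smoothing of \<open>relu(x)\<^sup>2\<close> is Lipschitz in the variance, so the diagonal entries come first. For
  \<open>relu(x) relu(y)\<close> the Lipschitz constant in the correlation entry is bounded, uniformly up to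
  degenerate covariances, but in the variances it blows up like \<open>(l / L - k / L)\<^sup>-\<^sup>1\<^sup>/\<^sup>2\<close>. This is integrable, and it only
  multiplies diagonal errors that are already known to be small. It also grows with the
  size of the neurons, so the cross term is stopped when a diagonal entry becomes large; Doob's inequality
  shows that this is rare, and on that event the diagonal second-moment bounds suffice.
\<close>

section \<open>Gaussian averages and rotation invariance\<close>

text \<open>By the closed form of the kernel, the flow is q' = E relu(X) relu(Y) for (X, Y) centred
  Gaussian with covariance q. Smoothing by q_l - q_k interpolates between the quantities to be
  compared: at k = l it leaves the empirical average, while before the input layer is drawn the full
  covariance q_l remains, as q_0 is the covariance of the input layer. Conditional expectations are
  replaced by integration over single coordinates of a finite product of standard Gaussians: a
  function known at layer k is one that ignores later coordinates. Integrating out one weight adds a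
  rank-one matrix to the smoothing covariance, by rotation invariance. The obstacle is that E
  relu(X) relu(Y) depends on the variances through standard deviations, and q_l - q_k has small
  variances for k near l. Covariances are compared in two moves: variances at fixed correlation
  coefficient, then correlation at fixed variances. The second move is made between nonnegative
  correlations; flow increments have this sign because f >= 0, activation covariances because relu
  >= 0, whereas q_0(a, b) itself may be negative.\<close>

definition gauss :: "real measure" where
  "gauss = density lborel std_normal_density"

lemma sets_gauss [measurable_cong, simp]: "sets gauss = sets borel"
  by (simp add: gauss_def)

lemma space_gauss [simp]: "space gauss = UNIV"
  by (simp add: gauss_def)

lemma prob_space_gauss: "prob_space gauss"
  unfolding gauss_def by (rule prob_space_normal_density) simp

interpretation gauss: prob_space gauss
  by (rule prob_space_gauss)

lemma measure_gauss_UNIV [simp]: "measure gauss UNIV = 1"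
  using gauss.prob_space by simp

interpretation gg: pair_prob_space gauss gauss ..

lemma nn_integral_gauss:
  assumes [measurable]: "f \<in> borel_measurable borel"
  shows "(\<integral>\<^sup>+x. f x \<partial>gauss) = (\<integral>\<^sup>+x. ennreal (std_normal_density x) * f x \<partial>lborel)"
  unfolding gauss_def by (subst nn_integral_density) auto

text \<open>Two one-dimensional affine substitutions under Fubini: u = c x - s y for fixed y, then v
  = (s u + y) / c for fixed u. The Jacobians \<open>\<bar>c\<bar>\<close> and
  \<open>1 / \<bar>c\<bar>\<close> cancel. For c = 0 the rotation is a swap of the coordinates with
  one reflection.\<close>

lemma nn_integral_lborel2_rotate:
  fixes G :: "real \<times> real \<Rightarrow> ennreal"
  assumes [measurable]: "G \<in> borel_measurable (borel \<Otimes>\<^sub>M borel)" and cs: "c\<^sup>2 + s\<^sup>2 = (1::real)"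
  shows "(\<integral>\<^sup>+x. \<integral>\<^sup>+y. G (c * x - s * y, s * x + c * y) \<partial>lborel \<partial>lborel)
       = (\<integral>\<^sup>+x. \<integral>\<^sup>+y. G (x, y) \<partial>lborel \<partial>lborel)"
proof (cases "c = 0")
  case True
  then have s: "s = 1 \<or> s = -1" using cs by (simp add: power2_eq_1_iff)
  then have abs: "\<bar>s\<bar> = 1" "s \<noteq> 0" by auto
  have 1: "(\<integral>\<^sup>+y. G (- s * y, z) \<partial>lborel) = (\<integral>\<^sup>+y. G (y, z) \<partial>lborel)" for z
    using nn_integral_real_affine[of "\<lambda>y. G (y, z)" "-s" 0] abs by simp
  have "(\<integral>\<^sup>+x. \<integral>\<^sup>+y. G (c * x - s * y, s * x + c * y) \<partial>lborel \<partial>lborel)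
      = (\<integral>\<^sup>+x. \<integral>\<^sup>+y. G (y, s * x) \<partial>lborel \<partial>lborel)"
    using True 1 by simp
  also have "\<dots> = (\<integral>\<^sup>+x. \<integral>\<^sup>+y. G (y, x) \<partial>lborel \<partial>lborel)"
    using nn_integral_real_affine[of "\<lambda>x. \<integral>\<^sup>+y. G (y, x) \<partial>lborel" "s" 0] abs by simp
  also have "\<dots> = (\<integral>\<^sup>+x. \<integral>\<^sup>+y. G (x, y) \<partial>lborel \<partial>lborel)"
    by (rule lborel_pair.Fubini') simp
  finally show ?thesis .
next
  case False
  \<comment> \<open>The Jacobian is carried as a factor on both sides and cancelled at the end,
    which avoids division in \<open>ennreal\<close>.\<close>
  define e where "e = ennreal \<bar>c\<bar>"
  have e: "e \<noteq> 0" "e \<noteq> \<infinity>" using False by (auto simp: e_def)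
  have inner: "e * (\<integral>\<^sup>+x. G (c * x - s * y, s * x + c * y) \<partial>lborel)
     = (\<integral>\<^sup>+u. G (u, (s * u + y) / c) \<partial>lborel)" for y
  proof -
    have "(s * (- s * y + c * x) + y) / c = s * x + c * y" for x
    proof -
      have "s * (- s * y + c * x) + y = y * (1 - s\<^sup>2) + c * s * x"
        by (simp add: algebra_simps power2_eq_square)
      also have "1 - s\<^sup>2 = c\<^sup>2" using cs by simp
      finally show ?thesis using False by (simp add: field_simps power2_eq_square)
    qed
    then show ?thesis
      using nn_integral_real_affine[of "\<lambda>u. G (u, (s * u + y) / c)" c "- s * y"] False
      by (simp add: e_def algebra_simps)
  qed
  have outer: "(\<integral>\<^sup>+y. G (u, (s * u + y) / c) \<partial>lborel) = e * (\<integral>\<^sup>+v. G (u, v) \<partial>lborel)" for u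
  proof -
    have "(\<integral>\<^sup>+y. G (u, (s * u + y) / c) \<partial>lborel)
       = ennreal \<bar>c\<bar> * (\<integral>\<^sup>+v. G (u, (s * u + (- s * u + c * v)) / c) \<partial>lborel)"
      by (rule nn_integral_real_affine) (use False in auto)
    then show ?thesis using False by (simp add: e_def)
  qed
  have "e * (\<integral>\<^sup>+x. \<integral>\<^sup>+y. G (c * x - s * y, s * x + c * y) \<partial>lborel \<partial>lborel)
      = e * (\<integral>\<^sup>+y. \<integral>\<^sup>+x. G (c * x - s * y, s * x + c * y) \<partial>lborel \<partial>lborel)"
    by (subst lborel_pair.Fubini') auto
  also have "\<dots> = (\<integral>\<^sup>+y. \<integral>\<^sup>+u. G (u, (s * u + y) / c) \<partial>lborel \<partial>lborel)"
    by (subst nn_integral_cmult[symmetric]) (auto simp: inner)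
  also have "\<dots> = (\<integral>\<^sup>+u. \<integral>\<^sup>+y. G (u, (s * u + y) / c) \<partial>lborel \<partial>lborel)"
    by (rule lborel_pair.Fubini') auto
  also have "\<dots> = e * (\<integral>\<^sup>+u. \<integral>\<^sup>+y. G (u, y) \<partial>lborel \<partial>lborel)"
    by (subst nn_integral_cmult[symmetric]) (auto simp: outer)
  finally show ?thesis using e by (simp add: ennreal_mult_cancel_left)
qed

lemma nn_integral_gauss2:
  assumes [measurable]: "G \<in> borel_measurable (borel \<Otimes>\<^sub>M borel)"
  shows "(\<integral>\<^sup>+x. \<integral>\<^sup>+y. G (x, y) \<partial>gauss \<partial>gauss)
     = (\<integral>\<^sup>+x. \<integral>\<^sup>+y. ennreal (std_normal_density x * std_normal_density y) * G (x, y) \<partial>lborel \<partial>lborel)"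
  by (simp add: nn_integral_gauss nn_integral_cmult[symmetric] ennreal_mult mult.assoc)

text \<open>The joint density is a function \<open>K\<close> of x^2 + y^2, which rotations preserve,
  so it can be absorbed into the integrand of the Lebesgue statement.\<close>

lemma nn_integral_gauss2_rotate:
  assumes [measurable]: "G \<in> borel_measurable (borel \<Otimes>\<^sub>M borel)"
    and cs: "c\<^sup>2 + s\<^sup>2 = (1::real)"
  shows "(\<integral>\<^sup>+x. \<integral>\<^sup>+y. G (c * x - s * y, s * x + c * y) \<partial>gauss \<partial>gauss)
       = (\<integral>\<^sup>+x. \<integral>\<^sup>+y. G (x, y) \<partial>gauss \<partial>gauss)"
proof -
  define K where "K = (\<lambda>v::real. exp (- v / 2) / (2 * pi))"
  define H where "H = (\<lambda>p. ennreal (K ((fst p)\<^sup>2 + (snd p)\<^sup>2)) * G p)"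
  have [measurable]: "K \<in> borel_measurable borel" unfolding K_def by measurable
  have [measurable]: "H \<in> borel_measurable (borel \<Otimes>\<^sub>M borel)"
    unfolding H_def by measurable
  have sq: "(c * x - s * y)\<^sup>2 + (s * x + c * y)\<^sup>2 = x\<^sup>2 + y\<^sup>2" for x y
  proof -
    have "(c * x - s * y)\<^sup>2 + (s * x + c * y)\<^sup>2 = (c\<^sup>2 + s\<^sup>2) * (x\<^sup>2 + y\<^sup>2)" by algebra
    then show ?thesis using cs by simp
  qed
  have d: "std_normal_density x * std_normal_density y = K (x\<^sup>2 + y\<^sup>2)" for x y
    by (simp add: std_normal_density_def K_def exp_add[symmetric] exp_diff field_simps)
  have "(\<integral>\<^sup>+x. \<integral>\<^sup>+y. G (c * x - s * y, s * x + c * y) \<partial>gauss \<partial>gauss)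
     = (\<integral>\<^sup>+x. \<integral>\<^sup>+y. H (c * x - s * y, s * x + c * y) \<partial>lborel \<partial>lborel)"
    using nn_integral_gauss2[of "\<lambda>p. G (c * fst p - s * snd p, s * fst p + c * snd p)"]
    by (simp add: H_def d sq)
  also have "\<dots> = (\<integral>\<^sup>+x. \<integral>\<^sup>+y. H (x, y) \<partial>lborel \<partial>lborel)"
    by (rule nn_integral_lborel2_rotate) (use cs in auto)
  also have "\<dots> = (\<integral>\<^sup>+x. \<integral>\<^sup>+y. G (x, y) \<partial>gauss \<partial>gauss)"
    by (simp add: nn_integral_gauss2 H_def d)
  finally show ?thesis .
qed

text \<open>As an equality of measures, the invariance transports integrability of signed functions
  together with their integrals.\<close>

lemma distr_gauss2_rotate:
  assumes cs: "c\<^sup>2 + s\<^sup>2 = (1::real)"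
  shows "distr (gauss \<Otimes>\<^sub>M gauss) (gauss \<Otimes>\<^sub>M gauss) (\<lambda>p. (c * fst p - s * snd p, s * fst p + c * snd p))
    = gauss \<Otimes>\<^sub>M gauss" (is "distr ?M ?M ?R = ?M")
proof (rule measure_eqI)
  fix A assume "A \<in> sets (distr ?M ?M ?R)"
  then have A: "A \<in> sets ?M" by simp
  then have A': "A \<in> sets (borel \<Otimes>\<^sub>M borel)"
    using sets_pair_measure_cong[OF sets_gauss sets_gauss] by blast
  have [measurable]: "?R \<in> measurable ?M ?M" by measurable
  have "emeasure (distr ?M ?M ?R) A = (\<integral>\<^sup>+p. indicator A p \<partial>distr ?M ?M ?R)"
    using A by simp
  also have "\<dots> = (\<integral>\<^sup>+p. indicator A (?R p) \<partial>?M)"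
    using A by (subst nn_integral_distr) auto
  also have "\<dots> = (\<integral>\<^sup>+x. \<integral>\<^sup>+y. indicator A (c * x - s * y, s * x + c * y) \<partial>gauss \<partial>gauss)"
    using A by (subst gauss.nn_integral_fst[symmetric]) (auto intro!: borel_measurable_indicator' simp: pred_def)
  also have "\<dots> = (\<integral>\<^sup>+x. \<integral>\<^sup>+y. indicator A (x, y) \<partial>gauss \<partial>gauss)"
    using A' cs by (intro nn_integral_gauss2_rotate) auto
  also have "\<dots> = emeasure ?M A"
    using A by (simp add: gauss.emeasure_pair_measure)
  finally show "emeasure (distr ?M ?M ?R) A = emeasure ?M A" .
qed simp

lemma integral_gauss2_rotate:
  fixes F :: "real \<Rightarrow> real \<Rightarrow> real"
  assumes F: "integrable (gauss \<Otimes>\<^sub>M gauss) (\<lambda>(x, y). F x y)" and cs: "c\<^sup>2 + s\<^sup>2 = (1::real)"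
  shows "integrable (gauss \<Otimes>\<^sub>M gauss) (\<lambda>(x, y). F (c * x - s * y) (s * x + c * y))"
    and "(\<integral>x. \<integral>y. F (c * x - s * y) (s * x + c * y) \<partial>gauss \<partial>gauss) = (\<integral>x. \<integral>y. F x y \<partial>gauss \<partial>gauss)"
proof -
  let ?M = "gauss \<Otimes>\<^sub>M gauss" and ?R = "\<lambda>p. (c * fst p - s * snd p, s * fst p + c * snd p)"
  have R[measurable]: "?R \<in> measurable ?M ?M" by measurable
  have "integrable (distr ?M ?M ?R) (\<lambda>(x, y). F x y)"
    using F distr_gauss2_rotate[OF cs] by simp
  then have "integrable ?M (\<lambda>p. case ?R p of (x, y) \<Rightarrow> F x y)"
    by (rule integrable_distr[OF R])
  then show I: "integrable ?M (\<lambda>(x, y). F (c * x - s * y) (s * x + c * y))"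
    by (simp add: case_prod_unfold)
  have "(\<integral>x. \<integral>y. F (c * x - s * y) (s * x + c * y) \<partial>gauss \<partial>gauss)
      = (\<integral>p. (case ?R p of (x, y) \<Rightarrow> F x y) \<partial>?M)"
    using gg.integral_fst'[OF I] by (simp add: case_prod_unfold)
  also have "\<dots> = (\<integral>p. (case p of (x, y) \<Rightarrow> F x y) \<partial>distr ?M ?M ?R)"
    using F by (subst integral_distr) auto
  also have "\<dots> = (\<integral>x. \<integral>y. F x y \<partial>gauss \<partial>gauss)"
    using gg.integral_fst'[OF F] distr_gauss2_rotate[OF cs] by simp
  finally show "(\<integral>x. \<integral>y. F (c * x - s * y) (s * x + c * y) \<partial>gauss \<partial>gauss) = (\<integral>x. \<integral>y. F x y \<partial>gauss \<partial>gauss)" .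
qed

section \<open>Measurable functions of polynomial growth\<close>

lemma borel_measurable_fst_real [measurable]:
  "(fst :: 'a::second_countable_topology \<times> 'b::second_countable_topology \<Rightarrow> 'a) \<in> borel_measurable borel"
  by (intro borel_measurable_continuous_onI continuous_intros)

lemma borel_measurable_snd_real [measurable]:
  "(snd :: 'a::second_countable_topology \<times> 'b::second_countable_topology \<Rightarrow> 'b) \<in> borel_measurable borel"
  by (intro borel_measurable_continuous_onI continuous_intros)

text \<open>Growth is measured by an arbitrary size function \<open>\<nu>\<close>, so that one
  notion serves normed spaces (\<open>pgrow\<close>) and finite products of Gaussians
  (\<open>pb\<close>). The class is closed under algebra, composition and Gaussian averaging, and
  its real-valued members are integrable in the Gaussian cases; integrability thus becomes a
  syntactic side condition.\<close>

definition pbd :: "'m measure \<Rightarrow> ('m \<Rightarrow> real) \<Rightarrow> ('m \<Rightarrow> 'b::real_normed_vector) \<Rightarrow> bool" where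
  "pbd M \<nu> f \<longleftrightarrow> (\<forall>x. 0 \<le> \<nu> x) \<and> f \<in> borel_measurable M \<and> (\<exists>C m. \<forall>x. norm (f x) \<le> C * (1 + \<nu> x) ^ m)"

abbreviation pgrow :: "('a::real_normed_vector \<Rightarrow> 'b::real_normed_vector) \<Rightarrow> bool" where
  "pgrow \<equiv> pbd borel norm"

lemma pbdI:
  "f \<in> borel_measurable M \<Longrightarrow> (\<And>x. 0 \<le> \<nu> x) \<Longrightarrow> (\<And>x. norm (f x) \<le> C * (1 + \<nu> x) ^ m) \<Longrightarrow> pbd M \<nu> f"
  unfolding pbd_def by blast

lemma pbd_measurable: "pbd M \<nu> f \<Longrightarrow> f \<in> borel_measurable M"
  by (simp add: pbd_def)

lemma pbd_nonneg: "pbd M \<nu> f \<Longrightarrow> 0 \<le> \<nu> x"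
  by (simp add: pbd_def)

lemma pbdE:
  assumes "pbd M \<nu> f"
  obtains C m where "C \<ge> 0" "\<And>x. norm (f x) \<le> C * (1 + \<nu> x) ^ m"
proof -
  obtain C m where C: "\<And>x. norm (f x) \<le> C * (1 + \<nu> x) ^ m" using assms by (auto simp: pbd_def)
  have "norm (f x) \<le> \<bar>C\<bar> * (1 + \<nu> x) ^ m" for x
    using C[of x] pbd_nonneg[OF assms, of x] by (meson abs_ge_self mult_right_mono order_trans zero_le_power add_nonneg_nonneg zero_le_one)
  then show thesis using that[of "\<bar>C\<bar>" m] by simp
qed

lemma pbdE2:
  assumes "pbd M \<nu> f" "pbd M \<nu> g"
  obtains C m where "C \<ge> 0" "\<And>x. norm (f x) \<le> C * (1 + \<nu> x) ^ m" "\<And>x. norm (g x) \<le> C * (1 + \<nu> x) ^ m"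
proof -
  obtain C m where C: "C \<ge> 0" "\<And>x. norm (f x) \<le> C * (1 + \<nu> x) ^ m" using pbdE[OF assms(1)] by blast
  obtain D k where D: "D \<ge> 0" "\<And>x. norm (g x) \<le> D * (1 + \<nu> x) ^ k" using pbdE[OF assms(2)] by blast
  have le: "A * (1 + \<nu> x) ^ i \<le> (C + D) * (1 + \<nu> x) ^ (m + k)" if "A \<le> C + D" "0 \<le> A" "i \<le> m + k" for A i x
    using that pbd_nonneg[OF assms(1), of x] by (intro mult_mono power_increasing) auto
  show thesis
  proof (rule that)
    show "0 \<le> C + D" using C D by simp
    show "norm (f x) \<le> (C + D) * (1 + \<nu> x) ^ (m + k)" for x
      by (rule order_trans[OF C(2) le]) (use C D in auto)
    show "norm (g x) \<le> (C + D) * (1 + \<nu> x) ^ (m + k)" for x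
      by (rule order_trans[OF D(2) le]) (use C D in auto)
  qed
qed

lemma pbd_const: "(\<And>x. 0 \<le> \<nu> x) \<Longrightarrow> pbd M \<nu> (\<lambda>_. c)"
  by (rule pbdI[of _ _ _ "norm c" 0]) auto

lemma pbd_compose:
  fixes h :: "'a::real_normed_vector \<Rightarrow> 'b::real_normed_vector"
  assumes h: "pgrow h" and f: "pbd M \<nu> f"
  shows "pbd M \<nu> (\<lambda>x. h (f x))"
proof -
  note pbd_measurable[OF h, measurable] pbd_measurable[OF f, measurable]
  obtain C m where C: "C \<ge> 0" "\<And>x. norm (h x) \<le> C * (1 + norm x) ^ m" using pbdE[OF h] by blast
  obtain D k where D: "D \<ge> 0" "\<And>x. norm (f x) \<le> D * (1 + \<nu> x) ^ k" using pbdE[OF f] by blast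
  show ?thesis
  proof (rule pbdI)
    fix x
    have "1 \<le> (1 + \<nu> x) ^ k" using pbd_nonneg[OF f, of x] by (simp add: one_le_power)
    then have "1 + norm (f x) \<le> (1 + D) * (1 + \<nu> x) ^ k" using D(2)[of x] by (simp add: algebra_simps)
    then have "(1 + norm (f x)) ^ m \<le> ((1 + D) * (1 + \<nu> x) ^ k) ^ m" by (rule power_mono) simp
    then have "C * (1 + norm (f x)) ^ m \<le> C * ((1 + D) * (1 + \<nu> x) ^ k) ^ m" using C(1) by (rule mult_left_mono)
    then show "norm (h (f x)) \<le> (C * (1 + D) ^ m) * (1 + \<nu> x) ^ (k * m)"
      using C(2)[of "f x"] by (simp add: power_mult_distrib mult.assoc power_mult)
    show "0 \<le> \<nu> x" by (rule pbd_nonneg[OF f])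
  qed measurable
qed

lemma pbd_Pair:
  fixes f :: "'m \<Rightarrow> 'a::{real_normed_vector,second_countable_topology}"
    and g :: "'m \<Rightarrow> 'b::{real_normed_vector,second_countable_topology}"
  assumes f: "pbd M \<nu> f" and g: "pbd M \<nu> g"
  shows "pbd M \<nu> (\<lambda>x. (f x, g x))"
proof -
  note pbd_measurable[OF f, measurable] pbd_measurable[OF g, measurable]
  obtain C m where C: "C \<ge> 0" "\<And>x. norm (f x) \<le> C * (1 + \<nu> x) ^ m" "\<And>x. norm (g x) \<le> C * (1 + \<nu> x) ^ m"
    using pbdE2[OF f g] by blast
  show ?thesis
  proof (rule pbdI)
    fix x
    have "norm (f x, g x) \<le> norm (f x) + norm (g x)" by (rule norm_Pair_le)
    then show "norm (f x, g x) \<le> (2 * C) * (1 + \<nu> x) ^ m" using C(2,3)[of x] by linarith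
  qed (use pbd_nonneg[OF f] in auto)
qed

lemma pbd_add:
  fixes f :: "'m \<Rightarrow> 'a::{real_normed_vector,second_countable_topology}"
  assumes f: "pbd M \<nu> f" and g: "pbd M \<nu> g"
  shows "pbd M \<nu> (\<lambda>x. f x + g x)"
proof -
  note pbd_measurable[OF f, measurable] pbd_measurable[OF g, measurable]
  obtain C m where C: "C \<ge> 0" "\<And>x. norm (f x) \<le> C * (1 + \<nu> x) ^ m" "\<And>x. norm (g x) \<le> C * (1 + \<nu> x) ^ m"
    using pbdE2[OF f g] by blast
  show ?thesis
  proof (rule pbdI)
    fix x
    have "norm (f x + g x) \<le> norm (f x) + norm (g x)" by (rule norm_triangle_ineq)
    then show "norm (f x + g x) \<le> (2 * C) * (1 + \<nu> x) ^ m" using C(2,3)[of x] by linarith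
  qed (use pbd_nonneg[OF f] in auto)
qed

lemma pbd_mult:
  fixes f g :: "'m \<Rightarrow> real"
  assumes f: "pbd M \<nu> f" and g: "pbd M \<nu> g"
  shows "pbd M \<nu> (\<lambda>x. f x * g x)"
proof -
  note pbd_measurable[OF f, measurable] pbd_measurable[OF g, measurable]
  obtain C m where C: "C \<ge> 0" "\<And>x. norm (f x) \<le> C * (1 + \<nu> x) ^ m" "\<And>x. norm (g x) \<le> C * (1 + \<nu> x) ^ m"
    using pbdE2[OF f g] by blast
  show ?thesis
  proof (rule pbdI)
    fix x
    have "norm (f x * g x) \<le> (C * (1 + \<nu> x) ^ m) * (C * (1 + \<nu> x) ^ m)"
      unfolding norm_mult using C pbd_nonneg[OF f, of x] by (intro mult_mono) auto
    then show "norm (f x * g x) \<le> (C * C) * (1 + \<nu> x) ^ (m + m)" by (simp add: power_add mult_ac)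
  qed (use pbd_nonneg[OF f] in auto)
qed

lemma pbd_mono:
  assumes f: "pbd M \<nu> f" and "g \<in> borel_measurable M" and "\<And>x. norm (g x) \<le> norm (f x)"
  shows "pbd M \<nu> g"
proof -
  obtain C m where C: "C \<ge> 0" "\<And>x. norm (f x) \<le> C * (1 + \<nu> x) ^ m" using pbdE[OF f] by blast
  show ?thesis by (rule pbdI) (use assms C pbd_nonneg[OF f] in \<open>auto intro: order_trans\<close>)
qed

lemma pbd_minus:
  fixes f :: "'m \<Rightarrow> 'a::{real_normed_vector,second_countable_topology}"
  assumes f: "pbd M \<nu> f" and g: "pbd M \<nu> g"
  shows "pbd M \<nu> (\<lambda>x. f x - g x)"
proof -
  have "pbd M \<nu> (\<lambda>x. - g x)" using pbd_measurable[OF g] by (intro pbd_mono[OF g]) auto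
  from pbd_add[OF f this] show ?thesis by simp
qed

lemma pbd_sum:
  fixes f :: "'i \<Rightarrow> 'm \<Rightarrow> real"
  assumes "\<And>i. i \<in> A \<Longrightarrow> pbd M \<nu> (f i)" "\<And>x. 0 \<le> \<nu> x"
  shows "pbd M \<nu> (\<lambda>x. \<Sum>i\<in>A. f i x)"
  using assms by (induction A rule: infinite_finite_induct) (auto intro!: pbd_const pbd_add)

lemma pbd_power:
  fixes f :: "'m \<Rightarrow> real"
  assumes "pbd M \<nu> f"
  shows "pbd M \<nu> (\<lambda>x. f x ^ k)"
  by (induction k) (use assms pbd_nonneg[OF assms] in \<open>auto intro!: pbd_const pbd_mult\<close>)

lemma pbd_fst: 
  fixes f :: "'m \<Rightarrow> 'a::{real_normed_vector,second_countable_topology} \<times> 'b::{real_normed_vector,second_countable_topology}"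
  assumes "pbd M \<nu> f" shows "pbd M \<nu> (\<lambda>x. fst (f x))"
proof (rule pbd_mono[OF assms])
  note pbd_measurable[OF assms, measurable]
  show "(\<lambda>x. fst (f x)) \<in> borel_measurable M" by measurable
  show "norm (fst (f x)) \<le> norm (f x)" for x using norm_fst_le[of "fst (f x)" "snd (f x)"] by simp
qed

lemma pbd_snd: 
  fixes f :: "'m \<Rightarrow> 'a::{real_normed_vector,second_countable_topology} \<times> 'b::{real_normed_vector,second_countable_topology}"
  assumes "pbd M \<nu> f" shows "pbd M \<nu> (\<lambda>x. snd (f x))"
proof (rule pbd_mono[OF assms])
  note pbd_measurable[OF assms, measurable]
  show "(\<lambda>x. snd (f x)) \<in> borel_measurable M" by measurable
  show "norm (snd (f x)) \<le> norm (f x)" for x using norm_snd_le[of "snd (f x)" "fst (f x)"] by simp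
qed

lemma pgrow_id: "pgrow (\<lambda>x. x)"
  by (rule pbdI[of _ _ _ 1 1]) auto

lemma pgrow_const: "pgrow (\<lambda>_. c)"
  by (rule pbd_const) simp

lemma pbd_abs:
  fixes f :: "'m \<Rightarrow> real"
  assumes "pbd M \<nu> f" shows "pbd M \<nu> (\<lambda>x. \<bar>f x\<bar>)"
  using pbd_measurable[OF assms] by (intro pbd_mono[OF assms]) auto

lemma pbd_relu:
  fixes f :: "'m \<Rightarrow> real"
  assumes "pbd M \<nu> f" shows "pbd M \<nu> (\<lambda>x. relu (f x))"
  using pbd_measurable[OF assms] by (intro pbd_mono[OF assms]) (auto simp: relu_def[abs_def])

lemma pbd_sqrt:
  fixes f :: "'m \<Rightarrow> real"
  assumes f: "pbd M \<nu> f" shows "pbd M \<nu> (\<lambda>x. sqrt (f x))"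
proof (rule pbd_mono)
  show "pbd M \<nu> (\<lambda>x. 1 + \<bar>f x\<bar>)" by (intro pbd_add pbd_const pbd_abs f pbd_nonneg[OF f])
  show "(\<lambda>x. sqrt (f x)) \<in> borel_measurable M" using pbd_measurable[OF f] by measurable
  show "norm (sqrt (f x)) \<le> norm (1 + \<bar>f x\<bar>)" for x
  proof -
    have "sqrt \<bar>f x\<bar> = \<bar>sqrt (f x)\<bar>" by (cases "f x \<ge> 0") (auto simp: real_sqrt_minus)
    then have "\<bar>sqrt (f x)\<bar>\<^sup>2 = \<bar>f x\<bar>" by (metis abs_ge_zero real_sqrt_pow2)
    also have "\<dots> \<le> (1 + \<bar>f x\<bar>)\<^sup>2" unfolding power2_sum by simp
    finally have "\<bar>sqrt (f x)\<bar> \<le> 1 + \<bar>f x\<bar>" by (rule power2_le_imp_le) simp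
    then show ?thesis by simp
  qed
qed

lemmas pbd_intros = pbd_add pbd_mult pbd_minus pbd_Pair pbd_fst pbd_snd pbd_power pbd_abs pbd_relu pgrow_id pgrow_const

lemma integrable_gauss_power: "integrable gauss (\<lambda>z. \<bar>z\<bar> ^ k)"
proof -
  have "integrable lborel (\<lambda>x. std_normal_density x * \<bar>x\<bar> ^ k)"
    using integrable_std_normal_moment_abs[of k] by simp
  then show ?thesis unfolding gauss_def by (subst integrable_density) auto
qed

lemma integrable_gauss_poly: "integrable gauss (\<lambda>z. (c + \<bar>z\<bar>) ^ k)"
  by (simp add: binomial_ring) (intro Bochner_Integration.integrable_sum integrable_mult_left integrable_mult_right integrable_gauss_power)

lemma measurable_borel_gauss:
  fixes h :: "'a::second_countable_topology \<times> real \<Rightarrow> 'b::topological_space"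
  assumes "h \<in> borel_measurable borel"
  shows "h \<in> borel_measurable (borel \<Otimes>\<^sub>M gauss)"
proof -
  have "sets (borel \<Otimes>\<^sub>M gauss) = sets (borel :: ('a \<times> real) measure)"
    by (subst borel_prod[symmetric]) (rule sets_pair_measure_cong[OF refl sets_gauss])
  then show ?thesis using assms by (simp cong: measurable_cong_sets)
qed

text \<open>The inequality 1 + |(x, z)| <= (1 + |x|) (1 + |z|) separates the growth in the parameter
  from an absolute Gaussian moment.\<close>

lemma pgrow_integral:
  fixes h :: "'a::{real_normed_vector,second_countable_topology} \<times> real \<Rightarrow> real"
  assumes "pgrow h"
  shows "pgrow (\<lambda>x. \<integral>z. h (x, z) \<partial>gauss)" "integrable gauss (\<lambda>z. h (x, z))"
proof -
  note pbd_measurable[OF assms, measurable]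
  obtain C m where C: "C \<ge> 0" "\<And>x. norm (h x) \<le> C * (1 + norm x) ^ m" using pbdE[OF assms(1)] by blast
  have bnd: "\<bar>h (x, z)\<bar> \<le> C * (1 + norm x) ^ m * (1 + \<bar>z\<bar>) ^ m" for x z
  proof -
    have "norm (x, z) \<le> norm x + \<bar>z\<bar>" using norm_Pair_le[of x z] by simp
    moreover have "0 \<le> norm x * \<bar>z\<bar>" by simp
    ultimately have "1 + norm (x, z) \<le> (1 + norm x) * (1 + \<bar>z\<bar>)"
      unfolding distrib_left distrib_right mult_1 mult_1_right by linarith
    then have "(1 + norm (x, z)) ^ m \<le> ((1 + norm x) * (1 + \<bar>z\<bar>)) ^ m" by (rule power_mono) simp
    then have "C * (1 + norm (x, z)) ^ m \<le> C * ((1 + norm x) * (1 + \<bar>z\<bar>)) ^ m" using C(1) by (rule mult_left_mono)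
    then show ?thesis using C(2)[of "(x, z)"] by (simp add: power_mult_distrib mult.assoc)
  qed
  have int: "integrable gauss (\<lambda>z. C * (1 + norm x) ^ m * (1 + \<bar>z\<bar>) ^ m)" for x :: 'a
    by (intro integrable_mult_right integrable_gauss_poly)
  show I: "integrable gauss (\<lambda>z. h (x, z))" for x
    by (rule Bochner_Integration.integrable_bound[OF int]) (use bnd[of x] C(1) in \<open>auto intro!: AE_I2 simp: abs_mult\<close>)
  show "pgrow (\<lambda>x. \<integral>z. h (x, z) \<partial>gauss)"
  proof (rule pbdI)
    fix x
    have "\<bar>\<integral>z. h (x, z) \<partial>gauss\<bar> \<le> (\<integral>z. \<bar>h (x, z)\<bar> \<partial>gauss)" by (rule integral_abs_bound)
    also have "\<dots> \<le> (\<integral>z. C * (1 + norm x) ^ m * (1 + \<bar>z\<bar>) ^ m \<partial>gauss)"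
      using I int bnd by (intro integral_mono) auto
    also have "\<dots> = (C * (\<integral>z. (1 + \<bar>z\<bar>) ^ m \<partial>gauss)) * (1 + norm x) ^ m" by simp
    finally show "norm (\<integral>z. h (x, z) \<partial>gauss) \<le> (C * (\<integral>z. (1 + \<bar>z\<bar>) ^ m \<partial>gauss)) * (1 + norm x) ^ m" unfolding real_norm_def .
    show "(\<lambda>x. \<integral>z. h (x, z) \<partial>gauss) \<in> borel_measurable borel"
      by (rule gauss.borel_measurable_lebesgue_integral) (simp add: case_prod_unfold measurable_borel_gauss[OF pbd_measurable[OF assms]])
  qed simp
qed

lemma pgrow_integrable:
  fixes h :: "real \<Rightarrow> real"
  assumes "pgrow h" shows "integrable gauss h"
proof -
  have "pgrow (\<lambda>p::real \<times> real. h (snd p))"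
    by (intro pbd_compose[OF assms] pbd_intros)
  from pgrow_integral(2)[OF this] show ?thesis by simp
qed

lemma pgrow_integrable2:
  fixes h :: "real \<times> real \<Rightarrow> real"
  assumes h: "pgrow h" shows "integrable (gauss \<Otimes>\<^sub>M gauss) h"
proof (rule gg.Fubini_integrable)
  have "sets (gauss \<Otimes>\<^sub>M gauss) = sets (borel :: (real \<times> real) measure)"
    by (subst borel_prod[symmetric]) (rule sets_pair_measure_cong[OF sets_gauss sets_gauss])
  then show "h \<in> borel_measurable (gauss \<Otimes>\<^sub>M gauss)"
    using pbd_measurable[OF h] by (simp cong: measurable_cong_sets)
  have "pgrow (\<lambda>p. \<bar>h p\<bar>)" by (intro pbd_intros h)
  from pgrow_integrable[OF pgrow_integral(1)[OF this]]
  show "integrable gauss (\<lambda>x. \<integral>y. norm (h (x, y)) \<partial>gauss)" by simp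
  show "AE x in gauss. integrable gauss (\<lambda>y. h (x, y))"
    using pgrow_integral(2)[OF h] by simp
qed

lemma gauss_rotate:
  fixes F :: "real \<times> real \<Rightarrow> real"
  assumes F: "pgrow F" and cs: "c\<^sup>2 + s\<^sup>2 = (1::real)"
  shows "(\<integral>x. \<integral>y. F (c * x - s * y, s * x + c * y) \<partial>gauss \<partial>gauss) = (\<integral>x. \<integral>y. F (x, y) \<partial>gauss \<partial>gauss)"
  using integral_gauss2_rotate(2)[of "\<lambda>x y. F (x, y)", OF _ cs] pgrow_integrable2[OF F] by simp

lemma gauss_Fubini:
  fixes F :: "real \<times> real \<Rightarrow> real"
  assumes F: "pgrow F"
  shows "(\<integral>x. \<integral>y. F (x, y) \<partial>gauss \<partial>gauss) = (\<integral>y. \<integral>x. F (x, y) \<partial>gauss \<partial>gauss)"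
  using gg.Fubini_integral[of "\<lambda>x y. F (x, y)"] pgrow_integrable2[OF F] by simp

text \<open>Rotate so that p x + q y becomes a multiple of one coordinate; the other coordinate then
  integrates to 1.\<close>

lemma gauss_merge:
  fixes H :: "real \<Rightarrow> real"
  assumes H: "pgrow H"
  shows "(\<integral>x. \<integral>y. H (p * x + q * y) \<partial>gauss \<partial>gauss) = (\<integral>x. H (sqrt (p\<^sup>2 + q\<^sup>2) * x) \<partial>gauss)"
proof (cases "p = 0 \<and> q = 0")
  case True then show ?thesis by (simp add: gauss.prob_space)
next
  case False
  define u where "u = sqrt (p\<^sup>2 + q\<^sup>2)"
  have u2: "u\<^sup>2 = p\<^sup>2 + q\<^sup>2" by (simp add: u_def)
  have u0: "u \<noteq> 0" using False by (auto simp: u_def sum_power2_eq_zero_iff)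
  have cs: "(p / u)\<^sup>2 + (- q / u)\<^sup>2 = 1"
  proof -
    have "u\<^sup>2 / u\<^sup>2 = 1" using u0 by simp
    then show ?thesis by (simp add: power_divide add_divide_distrib[symmetric] u2[symmetric])
  qed
  have P: "pgrow (\<lambda>z::real \<times> real. H (u * fst z))"
    by (intro pbd_compose[OF H] pbd_intros)
  have "(\<integral>x. \<integral>y. H (u * (p / u * x - - q / u * y)) \<partial>gauss \<partial>gauss) = (\<integral>x. \<integral>y. H (u * x) \<partial>gauss \<partial>gauss)"
    using gauss_rotate[OF P cs] by simp
  moreover have "u * (p / u * x - - q / u * y) = p * x + q * y" for x y
    using u0 by (simp add: field_simps)
  ultimately show ?thesis by (simp add: u_def gauss.prob_space)
qed

section \<open>Gaussian smoothing with a given covariance\<close>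

text \<open>The parameters are the entries of a lower triangular factor of the covariance. In these
  coordinates a change of the standard deviations at fixed correlation is a scaling of the
  rows.\<close>

definition gop :: "real \<Rightarrow> real \<Rightarrow> real \<Rightarrow> (real \<times> real \<Rightarrow> real) \<Rightarrow> real \<times> real \<Rightarrow> real" where
  "gop \<alpha> \<kappa> \<tau> h p = (\<integral>u. \<integral>z. h (fst p + \<alpha> * z, snd p + \<kappa> * z + \<tau> * u) \<partial>gauss \<partial>gauss)"

text \<open>Positive semidefiniteness of ((s, r), (r, t)) by its principal minors; degenerate
  matrices are included, because the smoothing covariance vanishes at the last layer.\<close>

definition psd :: "real \<Rightarrow> real \<Rightarrow> real \<Rightarrow> bool" where
  "psd s t r \<longleftrightarrow> 0 \<le> s \<and> 0 \<le> t \<and> r\<^sup>2 \<le> s * t"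

text \<open>Expectation of \<open>h\<close> at \<open>p\<close> plus a centred Gaussian with covariance \<open>((s, r), (r, t))\<close>, through its
  Cholesky factor. For \<open>s = 0\<close>, where \<open>psd\<close> forces \<open>r = 0\<close>, the convention \<open>x / 0 = 0\<close> gives the right factor.\<close>

definition gcov :: "real \<Rightarrow> real \<Rightarrow> real \<Rightarrow> (real \<times> real \<Rightarrow> real) \<Rightarrow> real \<times> real \<Rightarrow> real" where
  "gcov s t r = gop (sqrt s) (r / sqrt s) (sqrt (t - r\<^sup>2 / s))"

lemma pbd_gop:
  fixes h :: "real \<times> real \<Rightarrow> real" and a k t :: "'m \<Rightarrow> real"
  assumes h: "pgrow h" and "pbd M \<nu> a" "pbd M \<nu> k" "pbd M \<nu> t" "pbd M \<nu> p"
  shows "pbd M \<nu> (\<lambda>w. gop (a w) (k w) (t w) h (p w))"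
proof -
  \<comment> \<open>Point, coefficients and the two Gaussian variables are packed into one tuple, so
    that joint polynomial growth follows from averaging twice.\<close>
  have 1: "pgrow (\<lambda>x :: (((real \<times> real) \<times> real \<times> real \<times> real) \<times> real) \<times> real.
     h (fst (fst (fst (fst x))) + fst (snd (fst (fst x))) * snd x,
        snd (fst (fst (fst x))) + fst (snd (snd (fst (fst x)))) * snd x + snd (snd (snd (fst (fst x)))) * snd (fst x)))"
    by (intro pbd_compose[OF h] pbd_intros)
  have "pgrow (\<lambda>x. gop (fst (snd x)) (fst (snd (snd x))) (snd (snd (snd x))) h (fst x))"
    unfolding gop_def using pgrow_integral(1)[OF pgrow_integral(1)[OF 1]] by simp
  from pbd_compose[OF this, of M \<nu> "\<lambda>w. (p w, a w, k w, t w)"] show ?thesis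
    using assms by (simp add: pbd_Pair)
qed

lemma psd_bounds:
  assumes "psd s t r"
  shows "\<bar>r / sqrt s\<bar> \<le> sqrt t" "0 \<le> t - r\<^sup>2 / s" "t - r\<^sup>2 / s \<le> t"
    "sqrt s * (r / sqrt s) = r" "(r / sqrt s)\<^sup>2 = r\<^sup>2 / s"
proof -
  have a: "0 \<le> s" "0 \<le> t" "r\<^sup>2 \<le> s * t" using assms by (auto simp: psd_def)
  show sq: "(r / sqrt s)\<^sup>2 = r\<^sup>2 / s" using a by (simp add: power_divide)
  have le: "r\<^sup>2 / s \<le> t" using a by (cases "s = 0") (auto simp: field_simps)
  show "\<bar>r / sqrt s\<bar> \<le> sqrt t" by (rule real_le_rsqrt) (simp only: power2_abs sq le)
  show "0 \<le> t - r\<^sup>2 / s" "t - r\<^sup>2 / s \<le> t" using le a by auto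
  show "sqrt s * (r / sqrt s) = r" using a by (cases "s = 0") auto
qed

text \<open>The determinant condition for the sum reduces to 2 r r' <= s t' + s' t, which follows
  from the two given conditions and the inequality between arithmetic and geometric means.\<close>

lemma psd_add:
  assumes "psd s t r" "psd s' t' r'"
  shows "psd (s + s') (t + t') (r + r')"
proof -
  have a: "0 \<le> s" "0 \<le> t" "r\<^sup>2 \<le> s * t" "0 \<le> s'" "0 \<le> t'" "r'\<^sup>2 \<le> s' * t'" using assms by (auto simp: psd_def)
  have "(r * r')\<^sup>2 \<le> (s * t) * (s' * t')" unfolding power_mult_distrib using a by (intro mult_mono) auto
  also have "4 * \<dots> \<le> (s * t' + s' * t)\<^sup>2"
  proof -
    have "0 \<le> (s * t' - s' * t)\<^sup>2" by simp
    then show ?thesis by (simp add: power2_eq_square algebra_simps)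
  qed
  finally have "(2 * (r * r'))\<^sup>2 \<le> (s * t' + s' * t)\<^sup>2" by (simp add: power_mult_distrib)
  then have "2 * (r * r') \<le> s * t' + s' * t" by (rule power2_le_imp_le) (use a in simp)
  then show ?thesis using a by (simp add: psd_def power2_eq_square algebra_simps)
qed

lemma psd_rank1: "psd (v\<^sup>2) (w\<^sup>2) (v * w)"
  by (simp add: psd_def power_mult_distrib)

lemma psd_0 [simp]: "psd 0 0 0"
  by (simp add: psd_def)

lemma pbd_gcov:
  fixes h :: "real \<times> real \<Rightarrow> real" and s t r :: "'m \<Rightarrow> real"
  assumes h: "pgrow h" and s: "pbd M \<nu> s" and t: "pbd M \<nu> t" and r: "pbd M \<nu> r" and p: "pbd M \<nu> p"
    and psd: "\<And>w. psd (s w) (t w) (r w)"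
  shows "pbd M \<nu> (\<lambda>w. gcov (s w) (t w) (r w) h (p w))"
proof -
  note [measurable] = pbd_measurable[OF s] pbd_measurable[OF t] pbd_measurable[OF r]
  note b = psd_bounds[OF psd]
  have t0: "0 \<le> t w" for w using psd[of w] by (simp add: psd_def)
  show ?thesis unfolding gcov_def
  proof (intro pbd_gop h p)
    show "pbd M \<nu> (\<lambda>w. sqrt (s w))" by (intro pbd_sqrt s)
    show "pbd M \<nu> (\<lambda>w. r w / sqrt (s w))"
      by (rule pbd_mono[OF pbd_sqrt[OF t]]) (use b(1) t0 in auto)
    show "pbd M \<nu> (\<lambda>w. sqrt (t w - (r w)\<^sup>2 / s w))"
      by (rule pbd_mono[OF pbd_sqrt[OF t]]) (use b(2,3) t0 in auto)
  qed
qed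

lemma gcov_0 [simp]: "gcov 0 0 0 h p = h p"
  by (simp add: gcov_def gop_def)

lemma pgrow_affine:
  fixes h :: "real \<times> real \<Rightarrow> real"
  assumes h: "pgrow h"
  shows "pgrow (\<lambda>z. h (x + a * z, y + b * z))"
    "pgrow (\<lambda>z::real\<times>real. h (x + a * fst z + a' * snd z, y + b * fst z + b' * snd z))"
    "pgrow (\<lambda>z::(real\<times>real)\<times>real. h (x + a * fst (fst z) + a' * snd (fst z) + a'' * snd z, y + b * fst (fst z) + b' * snd (fst z) + b'' * snd z))"
  by (intro pbd_compose[OF h] pbd_intros)+

text \<open>Semigroup property of Gaussian smoothing: an independent Gaussian along (v, w)
  contributes its rank-one covariance. A rotation gathers the first coordinate
  \<open>v * z + A * z1\<close> into one variable; the second coordinate keeps an extra independent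
  part \<open>\<mu>\<close>, which \<open>gauss_merge\<close> combines with
  \<open>T\<close>.\<close>

lemma gcov_add:
  fixes h :: "real \<times> real \<Rightarrow> real"
  assumes h: "pgrow h" and psd: "psd s t r"
  shows "(\<integral>z. gcov s t r h (fst p + v * z, snd p + w * z) \<partial>gauss) = gcov (s + v\<^sup>2) (t + w\<^sup>2) (r + v * w) h p"
proof -
  define A K T where "A = sqrt s" and "K = r / sqrt s" and "T = sqrt (t - r\<^sup>2 / s)"
  define A' where "A' = sqrt (s + v\<^sup>2)"
  obtain x y where p: "p = (x, y)" by (cases p)
  note b = psd_bounds[OF psd]
  have s0: "0 \<le> s" "0 \<le> t" using psd by (auto simp: psd_def)
  have A2: "A\<^sup>2 = s" using s0 by (simp add: A_def)
  have A'2: "A'\<^sup>2 = A\<^sup>2 + v\<^sup>2" using s0 by (simp add: A'_def A2)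
  have T2: "T\<^sup>2 = t - K\<^sup>2" using b by (simp add: T_def K_def)
  have AK: "A * K = r" using b by (simp add: A_def K_def)
  have Fub: "(\<integral>z. gcov s t r h (fst p + v * z, snd p + w * z) \<partial>gauss)
    = (\<integral>u. \<integral>z. \<integral>z1. h (x + v * z + A * z1, y + w * z + K * z1 + T * u) \<partial>gauss \<partial>gauss \<partial>gauss)"
  proof -
    have "pgrow (\<lambda>z::real\<times>real. \<integral>z1. h (x + v * fst z + A * z1, y + w * fst z + K * z1 + T * snd z) \<partial>gauss)"
      using pgrow_integral(1)[OF pgrow_affine(3)[OF h, of x v 0 A y w T K]] by (simp add: add_ac)
    from gauss_Fubini[OF this] show ?thesis
      by (simp add: gcov_def gop_def p A_def K_def T_def)
  qed
  show ?thesis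
  \<comment> \<open>If \<open>A'\<close> vanishes, the first coordinate is deterministic and r = 0,
    so only the two noises of the second coordinate have to be merged.\<close>
  proof (cases "A' = 0")
    case True
    then have 0: "s = 0" "v = 0" using A'2 A2 s0 by (auto simp: add_nonneg_eq_0_iff)
    then have r0: "r = 0" using psd by (simp add: psd_def)
    have H: "pgrow (\<lambda>q. h (x, y + q))" using pgrow_affine(1)[OF h, of x 0 y 1] by simp
    show ?thesis unfolding Fub
      using gauss_merge[OF H, of T w] s0
      by (simp add: gcov_def gop_def 0 r0 p A_def K_def T_def add_ac)
  next
    case False
    \<comment> \<open>\<open>\<mu>\<close> and \<open>K'\<close> are the components of (w, K) in the
      orthonormal frame (A, -v) / A', (v, A) / A'.\<close>
    define K' \<mu> where "K' = (r + v * w) / A'" and "\<mu> = (w * A - K * v) / A'"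
    have cs: "(A / A')\<^sup>2 + (- v / A')\<^sup>2 = 1"
    proof -
      have "A'\<^sup>2 / A'\<^sup>2 = 1" using False by simp
      then show ?thesis by (simp add: power_divide add_divide_distrib[symmetric] A'2[symmetric])
    qed
    have K\<mu>: "K'\<^sup>2 + \<mu>\<^sup>2 = K\<^sup>2 + w\<^sup>2"
    proof -
      have "(A * K + v * w)\<^sup>2 + (w * A - K * v)\<^sup>2 = (K\<^sup>2 + w\<^sup>2) * (A\<^sup>2 + v\<^sup>2)" by algebra
      then have "((r + v * w)\<^sup>2 + (w * A - K * v)\<^sup>2) / A'\<^sup>2 = K\<^sup>2 + w\<^sup>2" using False by (simp add: AK A'2[symmetric])
      then show ?thesis unfolding K'_def \<mu>_def power_divide add_divide_distrib[symmetric] .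
    qed
    have rot: "(\<integral>z. \<integral>z1. h (x + v * z + A * z1, y + w * z + K * z1 + T * u) \<partial>gauss \<partial>gauss)
       = (\<integral>z. \<integral>z1. h (x + A' * z1, y + K' * z1 + (T * u + \<mu> * z)) \<partial>gauss \<partial>gauss)" for u
    proof -
      have e1: "x + v * (A / A' * z - - v / A' * z1) + A * (- v / A' * z + A / A' * z1) = x + A' * z1" for z z1
      proof -
        have "v * (A / A' * z - - v / A' * z1) + A * (- v / A' * z + A / A' * z1) = (A\<^sup>2 + v\<^sup>2) / A' * z1"
          using False by (simp add: field_simps power2_eq_square)
        also have "\<dots> = A' * z1" unfolding A'2[symmetric] using False by (simp add: power2_eq_square)
        finally show ?thesis by simp
      qed
      have e2: "y + w * (A / A' * z - - v / A' * z1) + K * (- v / A' * z + A / A' * z1) + T * u = y + K' * z1 + (T * u + \<mu> * z)" for z z1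
        unfolding K'_def \<mu>_def AK[symmetric] using False by (simp add: field_simps)
      have "pgrow (\<lambda>z::real\<times>real. h (x + v * fst z + A * snd z, y + w * fst z + K * snd z + T * u))"
        using pgrow_affine(2)[OF h, of x v A "y + T * u" w K] by (simp add: add_ac)
      from gauss_rotate[OF this cs, unfolded fst_conv snd_conv e1 e2] show ?thesis by simp
    qed
    have H: "pgrow (\<lambda>q::real. \<integral>z1. h (x + A' * z1, y + K' * z1 + q) \<partial>gauss)"
      using pgrow_integral(1)[OF pgrow_affine(2)[OF h, of x 0 A' y 1 K']] by (simp add: add_ac)
    have T': "T\<^sup>2 + \<mu>\<^sup>2 = t + w\<^sup>2 - (r + v * w)\<^sup>2 / (s + v\<^sup>2)"
    proof -
      have "K'\<^sup>2 = (r + v * w)\<^sup>2 / (s + v\<^sup>2)" by (simp add: K'_def power_divide A'2 A2)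
      then show ?thesis using K\<mu> T2 by simp
    qed
    show ?thesis unfolding Fub rot gauss_merge[OF H] T'
      by (simp add: gcov_def gop_def p K'_def A'_def)
  qed
qed

text \<open>Fubini for two independent noises. Together with \<open>gcov_add\<close> it rewrites two
  different smoothings of one function as the same smoothing of two functions, which can then be
  compared pointwise.\<close>

lemma gcov_commute:
  fixes h :: "real \<times> real \<Rightarrow> real"
  assumes h: "pgrow h"
  shows "(\<integral>z. gcov s t r h (fst p + v * z, snd p + w * z) \<partial>gauss)
    = gcov s t r (\<lambda>q. \<integral>z. h (fst q + v * z, snd q + w * z) \<partial>gauss) p"
proof -
  define A K T where "A = sqrt s" and "K = r / sqrt s" and "T = sqrt (t - r\<^sup>2 / s)"
  obtain x y where p: "p = (x, y)" by (cases p)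
  have 1: "pgrow (\<lambda>z::real\<times>real. \<integral>z1. h (x + v * fst z + A * z1, y + w * fst z + K * z1 + T * snd z) \<partial>gauss)"
    using pgrow_integral(1)[OF pgrow_affine(3)[OF h, of x v 0 A y w T K]] by (simp add: add_ac)
  have 2: "pgrow (\<lambda>z::real\<times>real. h (x + v * fst z + A * snd z, y + w * fst z + K * snd z + T * u))" for u
    using pgrow_affine(2)[OF h, of x v A "y + T * u" w K] by (simp add: add_ac)
  show ?thesis
    unfolding gcov_def gop_def p
    unfolding K_def[symmetric]
    unfolding A_def[symmetric] T_def[symmetric]
    using gauss_Fubini[OF 1] gauss_Fubini[OF 2] by (simp add: add_ac)
qed

section \<open>Gaussian moments and moments of the smoothing\<close>

lemma integral_gauss: 
  assumes [measurable]: "f \<in> borel_measurable borel"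
  shows "(\<integral>z. f z \<partial>gauss) = (\<integral>z. std_normal_density z * f z \<partial>lborel)"
  unfolding gauss_def by (subst integral_density) auto

lemma gauss_moment_1: "(\<integral>z. z \<partial>gauss) = 0"
  using integral_std_normal_moment_odd[of 0] by (simp add: integral_gauss)

lemma gauss_moment_2: "(\<integral>z. z\<^sup>2 \<partial>gauss) = 1"
  using integral_std_normal_moment_even[of 1] by (simp add: integral_gauss)

lemma gauss_moment_3: "(\<integral>z. z ^ 3 \<partial>gauss) = 0"
  using integral_std_normal_moment_odd[of 1] by (simp add: integral_gauss numeral_3_eq_3)

lemma gauss_moment_4: "(\<integral>z. z ^ 4 \<partial>gauss) = 3"
  using integral_std_normal_moment_even[of 2] by (simp add: integral_gauss fact_numeral)

lemma integrable_gauss_powers: "integrable gauss (\<lambda>z. z)" "integrable gauss (\<lambda>z. z ^ k)"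
  by (intro pgrow_integrable pbd_intros)+

text \<open>As a single integral over the product measure, the smoothing can be estimated by
  integrating one pointwise bound.\<close>

lemma gop_pair:
  fixes h :: "real \<times> real \<Rightarrow> real"
  assumes h: "pgrow h"
  shows "gop \<alpha> \<kappa> \<tau> h p = (\<integral>q. h (fst p + \<alpha> * snd q, snd p + \<kappa> * snd q + \<tau> * fst q) \<partial>(gauss \<Otimes>\<^sub>M gauss))"
    and "integrable (gauss \<Otimes>\<^sub>M gauss) (\<lambda>q. h (fst p + \<alpha> * snd q, snd p + \<kappa> * snd q + \<tau> * fst q))"
proof -
  have "pgrow (\<lambda>q::real\<times>real. h (fst p + \<alpha> * snd q, snd p + \<kappa> * snd q + \<tau> * fst q))"
    by (intro pbd_compose[OF h] pbd_intros)
  note i = pgrow_integrable2[OF this]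
  show "integrable (gauss \<Otimes>\<^sub>M gauss) (\<lambda>q. h (fst p + \<alpha> * snd q, snd p + \<kappa> * snd q + \<tau> * fst q))" by (rule i)
  show "gop \<alpha> \<kappa> \<tau> h p = (\<integral>q. h (fst p + \<alpha> * snd q, snd p + \<kappa> * snd q + \<tau> * fst q) \<partial>(gauss \<Otimes>\<^sub>M gauss))"
    using gg.integral_fst'[OF i] by (simp add: gop_def)
qed

lemma gauss2_fst:
  assumes f: "pgrow (f :: real \<Rightarrow> real)"
  shows "(\<integral>q. f (fst q) \<partial>(gauss \<Otimes>\<^sub>M gauss)) = (\<integral>z. f z \<partial>gauss)" "integrable (gauss \<Otimes>\<^sub>M gauss) (\<lambda>q. f (fst q))"
    "(\<integral>q. f (snd q) \<partial>(gauss \<Otimes>\<^sub>M gauss)) = (\<integral>z. f z \<partial>gauss)" "integrable (gauss \<Otimes>\<^sub>M gauss) (\<lambda>q. f (snd q))"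
proof -
  have "pgrow (\<lambda>q::real\<times>real. f (fst q))" "pgrow (\<lambda>q::real\<times>real. f (snd q))"
    by (intro pbd_compose[OF f] pbd_intros)+
  note i = this[THEN pgrow_integrable2]
  show "integrable (gauss \<Otimes>\<^sub>M gauss) (\<lambda>q. f (fst q))" "integrable (gauss \<Otimes>\<^sub>M gauss) (\<lambda>q. f (snd q))" by (fact i)+
  show "(\<integral>q. f (fst q) \<partial>(gauss \<Otimes>\<^sub>M gauss)) = (\<integral>z. f z \<partial>gauss)" "(\<integral>q. f (snd q) \<partial>(gauss \<Otimes>\<^sub>M gauss)) = (\<integral>z. f z \<partial>gauss)"
    using gg.integral_fst'[OF i(1)] gg.integral_fst'[OF i(2)] by simp_all
qed

lemma gauss2_prod:
  assumes "pgrow (f :: real \<Rightarrow> real)" "pgrow (g :: real \<Rightarrow> real)"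
  shows "(\<integral>q. f (fst q) * g (snd q) \<partial>(gauss \<Otimes>\<^sub>M gauss)) = (\<integral>z. f z \<partial>gauss) * (\<integral>z. g z \<partial>gauss)"
    "integrable (gauss \<Otimes>\<^sub>M gauss) (\<lambda>q. f (fst q) * g (snd q))"
proof -
  have "pgrow (\<lambda>q::real\<times>real. f (fst q) * g (snd q))"
    by (intro pbd_compose[OF assms(1)] pbd_compose[OF assms(2)] pbd_intros)
  note i = pgrow_integrable2[OF this]
  show "integrable (gauss \<Otimes>\<^sub>M gauss) (\<lambda>q. f (fst q) * g (snd q))" by (rule i)
  show "(\<integral>q. f (fst q) * g (snd q) \<partial>(gauss \<Otimes>\<^sub>M gauss)) = (\<integral>z. f z \<partial>gauss) * (\<integral>z. g z \<partial>gauss)"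
    using gg.integral_fst'[OF i] by simp
qed

lemma gauss2_moments:
  "(\<integral>q. (snd q)\<^sup>2 \<partial>(gauss \<Otimes>\<^sub>M gauss)) = 1" "(\<integral>q. (\<kappa> * snd q + \<tau> * fst q)\<^sup>2 \<partial>(gauss \<Otimes>\<^sub>M gauss)) = \<kappa>\<^sup>2 + \<tau>\<^sup>2"
  "integrable (gauss \<Otimes>\<^sub>M gauss) (\<lambda>q. (snd q)\<^sup>2)" "integrable (gauss \<Otimes>\<^sub>M gauss) (\<lambda>q. (\<kappa> * snd q + \<tau> * fst q)\<^sup>2)"
proof -
  have sq: "pgrow (\<lambda>z::real. z\<^sup>2)" by (intro pbd_intros)
  note 1 = gauss2_fst[OF sq, unfolded gauss_moment_2]
  note 2 = gauss2_prod[OF pgrow_id pgrow_id, unfolded gauss_moment_1]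
  have e: "(\<kappa> * snd q + \<tau> * fst q)\<^sup>2 = \<kappa>\<^sup>2 * (snd q)\<^sup>2 + (2 * \<kappa> * \<tau> * (fst q * snd q) + \<tau>\<^sup>2 * (fst q)\<^sup>2)" for q :: "real \<times> real"
    by (simp add: power2_eq_square algebra_simps)
  show "(\<integral>q. (snd q)\<^sup>2 \<partial>(gauss \<Otimes>\<^sub>M gauss)) = 1" "integrable (gauss \<Otimes>\<^sub>M gauss) (\<lambda>q. (snd q)\<^sup>2)" by (fact 1)+
  show "integrable (gauss \<Otimes>\<^sub>M gauss) (\<lambda>q. (\<kappa> * snd q + \<tau> * fst q)\<^sup>2)"
    unfolding e using 1 2 by simp
  show "(\<integral>q. (\<kappa> * snd q + \<tau> * fst q)\<^sup>2 \<partial>(gauss \<Otimes>\<^sub>M gauss)) = \<kappa>\<^sup>2 + \<tau>\<^sup>2"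
    unfolding e using 1 2 by simp
qed

lemma gauss2_prob [simp]: "measure (gauss \<Otimes>\<^sub>M gauss) UNIV = 1"
  using gg.P.prob_space by (simp add: space_pair_measure)

text \<open>The smoothing depends on the triangular factor only through the covariance. For
  \<open>\<alpha> = 0\<close> the factor is not unique, and \<open>\<kappa>\<close> and
  \<open>\<tau>\<close> are merged into one standard deviation.\<close>

lemma gop_eq_gcov:
  fixes h :: "real \<times> real \<Rightarrow> real"
  assumes h: "pgrow h" and nn: "0 \<le> \<alpha>" "0 \<le> \<tau>"
  shows "gop \<alpha> \<kappa> \<tau> h p = gcov (\<alpha>\<^sup>2) (\<kappa>\<^sup>2 + \<tau>\<^sup>2) (\<alpha> * \<kappa>) h p"
proof (cases "\<alpha> = 0")
  case True
  have "pgrow (\<lambda>q. h (fst p, snd p + q))" using pgrow_affine(1)[OF h, of "fst p" 0 "snd p" 1] by simp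
  from gauss_merge[OF this, of \<tau> \<kappa>] True show ?thesis
    by (simp add: gcov_def gop_def add_ac)
next
  case False
  then show ?thesis using nn by (simp add: gcov_def power_mult_distrib)
qed

lemma gcov_fst:
  assumes g: "pgrow (g :: real \<Rightarrow> real)"
  shows "gcov s t r (\<lambda>q. g (fst q)) p = (\<integral>z. g (fst p + sqrt s * z) \<partial>gauss)"
  by (simp add: gcov_def gop_def)

lemma gcov_snd:
  assumes g: "pgrow (g :: real \<Rightarrow> real)" and psd: "psd s t r"
  shows "gcov s t r (\<lambda>q. g (snd q)) p = (\<integral>z. g (snd p + sqrt t * z) \<partial>gauss)"
proof -
  have "pgrow (\<lambda>q. g (snd p + q))" by (intro pbd_compose[OF g] pbd_intros)
  from gauss_merge[OF this, of "sqrt (t - r\<^sup>2 / s)" "r / sqrt s"] psd_bounds[OF psd]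
  show ?thesis by (simp add: gcov_def gop_def add_ac)
qed

lemma gauss_quad: "(\<integral>z. (x + a * z)\<^sup>2 \<partial>gauss) = x\<^sup>2 + a\<^sup>2"
proof -
  have "(x + a * z)\<^sup>2 = x\<^sup>2 + (2 * x * a * z + a\<^sup>2 * z\<^sup>2)" for z
    by (simp add: power2_eq_square algebra_simps)
  then show ?thesis using integrable_gauss_powers by (simp add: gauss_moment_1 gauss_moment_2)
qed

lemma gauss_quart: "(\<integral>z. (x + a * z) ^ 4 \<partial>gauss) = x ^ 4 + 6 * x\<^sup>2 * a\<^sup>2 + 3 * (a\<^sup>2)\<^sup>2"
proof -
  have "(x + a * z) ^ 4 = x ^ 4 + (4 * x ^ 3 * a * z + (6 * x\<^sup>2 * a\<^sup>2 * z\<^sup>2 + (4 * x * a ^ 3 * z ^ 3 + (a\<^sup>2)\<^sup>2 * z ^ 4)))" for z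
    by (simp add: power4_eq_xxxx power2_eq_square power3_eq_cube algebra_simps)
  then show ?thesis using integrable_gauss_powers by (simp add: gauss_moment_1 gauss_moment_2 gauss_moment_3 gauss_moment_4)
qed

lemma gcov_moments:
  assumes psd: "psd s t r"
  shows "gcov s t r (\<lambda>q. (fst q)\<^sup>2) p = (fst p)\<^sup>2 + s" "gcov s t r (\<lambda>q. (snd q)\<^sup>2) p = (snd p)\<^sup>2 + t"
    "gcov s t r (\<lambda>q. fst q * snd q) p = fst p * snd p + r"
    "gcov s t r (\<lambda>q. (fst q) ^ 4) p = fst p ^ 4 + 6 * (fst p)\<^sup>2 * s + 3 * s\<^sup>2"
    "gcov s t r (\<lambda>q. (snd q) ^ 4) p = snd p ^ 4 + 6 * (snd p)\<^sup>2 * t + 3 * t\<^sup>2"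
proof -
  have nn: "0 \<le> s" "0 \<le> t" using psd by (auto simp: psd_def)
  have sq: "pgrow (\<lambda>z::real. z ^ k)" for k by (intro pbd_intros)
  show "gcov s t r (\<lambda>q. (fst q)\<^sup>2) p = (fst p)\<^sup>2 + s" "gcov s t r (\<lambda>q. (snd q)\<^sup>2) p = (snd p)\<^sup>2 + t"
    "gcov s t r (\<lambda>q. (fst q) ^ 4) p = fst p ^ 4 + 6 * (fst p)\<^sup>2 * s + 3 * s\<^sup>2"
    "gcov s t r (\<lambda>q. (snd q) ^ 4) p = snd p ^ 4 + 6 * (snd p)\<^sup>2 * t + 3 * t\<^sup>2"
    using nn by (simp_all add: gcov_fst[OF sq] gcov_snd[OF sq psd] gauss_quad gauss_quart)
  have e: "(x + a * z) * (y + k * z + q) = x * (y + q) + ((a * (y + q) + x * k) * z + a * k * z\<^sup>2)" for x a z y k q :: real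
    by (simp add: power2_eq_square algebra_simps)
  have i: "(\<integral>z. (x + a * z) * (y + k * z + q) \<partial>gauss) = x * (y + q) + a * k" for x a y k q
    unfolding e using integrable_gauss_powers by (simp add: gauss_moment_1 gauss_moment_2)
  show "gcov s t r (\<lambda>q. fst q * snd q) p = fst p * snd p + r"
    unfolding gcov_def gop_def fst_conv snd_conv i psd_bounds(4)[OF psd]
    using integrable_gauss_powers by (simp add: distrib_left gauss_moment_1)
qed

lemma gcov_bounded_diff:
  fixes h1 h2 :: "real \<times> real \<Rightarrow> real"
  assumes h: "pgrow h1" "pgrow h2" and c: "\<And>q. \<bar>h1 q - h2 q\<bar> \<le> c"
  shows "\<bar>gcov s t r h1 p - gcov s t r h2 p\<bar> \<le> c"
proof -
  have *: "\<bar>\<integral>q. h1 (f q) - h2 (f q) \<partial>(gauss \<Otimes>\<^sub>M gauss)\<bar> \<le> c"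
    if "integrable (gauss \<Otimes>\<^sub>M gauss) (\<lambda>q. h1 (f q))" "integrable (gauss \<Otimes>\<^sub>M gauss) (\<lambda>q. h2 (f q))" for f
  proof -
    have "\<bar>\<integral>q. h1 (f q) - h2 (f q) \<partial>(gauss \<Otimes>\<^sub>M gauss)\<bar> \<le> (\<integral>q. \<bar>h1 (f q) - h2 (f q)\<bar> \<partial>(gauss \<Otimes>\<^sub>M gauss))"
      by (rule integral_abs_bound)
    also have "\<dots> \<le> (\<integral>q. c \<partial>(gauss \<Otimes>\<^sub>M gauss))"
      using that c by (intro integral_mono integrable_abs Bochner_Integration.integrable_diff) auto
    finally show ?thesis by (simp add: space_pair_measure)
  qed
  define f where "f = (\<lambda>q. (fst p + sqrt s * snd q, snd p + (r / sqrt s) * snd q + sqrt (t - r\<^sup>2 / s) * fst q))"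
  note g1 = gop_pair[OF h(1), where \<alpha> = "sqrt s" and \<kappa> = "r / sqrt s" and \<tau> = "sqrt (t - r\<^sup>2 / s)" and p = p, folded f_def]
  note g2 = gop_pair[OF h(2), where \<alpha> = "sqrt s" and \<kappa> = "r / sqrt s" and \<tau> = "sqrt (t - r\<^sup>2 / s)" and p = p, folded f_def]
  have f: "(fst p + sqrt s * snd q, snd p + (r / sqrt s) * snd q + sqrt (t - r\<^sup>2 / s) * fst q) = f q" for q
    by (simp add: f_def)
  show ?thesis
    unfolding gcov_def g1(1)[unfolded f] g2(1)[unfolded f]
    using *[OF g1(2)[unfolded f] g2(2)[unfolded f]] g1(2)[unfolded f] g2(2)[unfolded f] by simp
qed

text \<open>A first-order expansion with bounded remainder makes the Gaussian smoothing of \<open>relu\<^sup>2\<close>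
  Lipschitz in the variance: the linear term integrates to zero.\<close>

lemma relu_square_expansion: "\<bar>(relu (x + h))\<^sup>2 - (relu x)\<^sup>2 - 2 * relu x * h\<bar> \<le> h\<^sup>2"
proof -
  consider "x \<ge> 0" "x + h \<ge> 0" | "x \<ge> 0" "x + h < 0" | "x < 0" "x + h \<ge> 0" | "x < 0" "x + h < 0" by linarith
  then show ?thesis
  proof cases
    case 1 then show ?thesis by (simp add: relu_def power2_eq_square algebra_simps)
  next
    case 2
    have "x * (x + 2 * h) \<le> 0" using 2 by (intro mult_nonneg_nonpos) auto
    moreover have "h\<^sup>2 + x * (x + 2 * h) = (x + h)\<^sup>2" by (simp add: power2_eq_square algebra_simps)
    ultimately have "\<bar>x * (x + 2 * h)\<bar> \<le> h\<^sup>2" using zero_le_power2[of "x + h"] by linarith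
    moreover have "(relu (x + h))\<^sup>2 - (relu x)\<^sup>2 - 2 * relu x * h = - (x * (x + 2 * h))"
      using 2 by (simp add: relu_def power2_eq_square algebra_simps)
    ultimately show ?thesis by simp
  next
    case 3
    then have "(x + h)\<^sup>2 \<le> h\<^sup>2" by (intro power_mono) auto
    then show ?thesis using 3 by (simp add: relu_def)
  next
    case 4 then show ?thesis by (simp add: relu_def)
  qed
qed

lemma gauss_relu_square_mono_var:
  assumes st: "0 \<le> s" "s \<le> s'"
  shows "\<bar>(\<integral>z. (relu (x + sqrt s' * z))\<^sup>2 \<partial>gauss) - (\<integral>z. (relu (x + sqrt s * z))\<^sup>2 \<partial>gauss)\<bar> \<le> s' - s"
proof -
  define d where "d = sqrt (s' - s)"
  have d2: "d\<^sup>2 = s' - s" using st by (simp add: d_def)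
  have H: "pgrow (\<lambda>q. (relu (x + q))\<^sup>2)" by (intro pbd_intros)
  \<comment> \<open>The larger Gaussian is split into one of variance s and an independent one of
    variance s' - s; the expansion is applied to the second alone.\<close>
  have 1: "(\<integral>z. (relu (x + sqrt s' * z))\<^sup>2 \<partial>gauss) = (\<integral>u. \<integral>z. (relu (x + sqrt s * u + d * z))\<^sup>2 \<partial>gauss \<partial>gauss)"
    using gauss_merge[OF H, of "sqrt s" d] st by (simp add: d2 add_ac)
  have i1: "integrable gauss (\<lambda>z. (relu (y + d * z))\<^sup>2)" for y
    by (intro pgrow_integrable pbd_intros)
  have inner: "\<bar>(\<integral>z. (relu (y + d * z))\<^sup>2 \<partial>gauss) - (relu y)\<^sup>2\<bar> \<le> s' - s" for y
  proof -
    have i2: "integrable gauss (\<lambda>z. (relu (y + d * z))\<^sup>2 - (relu y)\<^sup>2 - 2 * relu y * (d * z))"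
      by (intro pgrow_integrable pbd_intros)
    have i5: "integrable gauss (\<lambda>z. (d * z)\<^sup>2)"
      by (intro pgrow_integrable pbd_intros)
    have i6: "integrable gauss (\<lambda>z. 2 * relu y * (d * z))"
      by (intro pgrow_integrable pbd_intros)
    have eq: "(\<integral>z. (relu (y + d * z))\<^sup>2 - (relu y)\<^sup>2 - 2 * relu y * (d * z) \<partial>gauss)
      = (\<integral>z. (relu (y + d * z))\<^sup>2 \<partial>gauss) - (relu y)\<^sup>2"
    proof -
      have "(\<integral>z. (relu (y + d * z))\<^sup>2 - (relu y)\<^sup>2 - 2 * relu y * (d * z) \<partial>gauss)
        = (\<integral>z. (relu (y + d * z))\<^sup>2 - (relu y)\<^sup>2 \<partial>gauss) - (\<integral>z. 2 * relu y * (d * z) \<partial>gauss)"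
        by (intro Bochner_Integration.integral_diff Bochner_Integration.integrable_diff i1 i6) simp
      moreover have "(\<integral>z. (relu (y + d * z))\<^sup>2 - (relu y)\<^sup>2 \<partial>gauss) = (\<integral>z. (relu (y + d * z))\<^sup>2 \<partial>gauss) - (\<integral>z. (relu y)\<^sup>2 \<partial>gauss)"
        by (intro Bochner_Integration.integral_diff i1) simp
      moreover have "(\<integral>z. 2 * relu y * (d * z) \<partial>gauss) = 0" by (simp add: gauss_moment_1)
      ultimately show ?thesis by simp
    qed
    have "\<bar>\<integral>z. (relu (y + d * z))\<^sup>2 - (relu y)\<^sup>2 - 2 * relu y * (d * z) \<partial>gauss\<bar>
      \<le> (\<integral>z. \<bar>(relu (y + d * z))\<^sup>2 - (relu y)\<^sup>2 - 2 * relu y * (d * z)\<bar> \<partial>gauss)"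
      by (rule integral_abs_bound)
    also have "\<dots> \<le> (\<integral>z. (d * z)\<^sup>2 \<partial>gauss)"
      by (intro integral_mono integrable_abs i2 i5 relu_square_expansion)
    also have "\<dots> = s' - s" by (simp add: power_mult_distrib gauss_moment_2 d2)
    finally show ?thesis unfolding eq .
  qed
  have "pgrow (\<lambda>q::real\<times>real. (relu (x + sqrt s * fst q + d * snd q))\<^sup>2)" by (intro pbd_intros)
  note i3 = pgrow_integrable[OF pgrow_integral(1)[OF this], unfolded fst_conv snd_conv]
  have i4: "integrable gauss (\<lambda>u. (relu (x + sqrt s * u))\<^sup>2)" by (intro pgrow_integrable pbd_intros)
  have "\<bar>(\<integral>u. (\<integral>z. (relu (x + sqrt s * u + d * z))\<^sup>2 \<partial>gauss) - (relu (x + sqrt s * u))\<^sup>2 \<partial>gauss)\<bar>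
    \<le> (\<integral>u. \<bar>(\<integral>z. (relu (x + sqrt s * u + d * z))\<^sup>2 \<partial>gauss) - (relu (x + sqrt s * u))\<^sup>2\<bar> \<partial>gauss)"
    by (rule integral_abs_bound)
  also have "\<dots> \<le> (\<integral>u. s' - s \<partial>gauss)"
    by (intro integral_mono inner integrable_abs Bochner_Integration.integrable_diff i3 i4 gauss.integrable_const)
  finally have fin: "\<bar>(\<integral>u. (\<integral>z. (relu (x + sqrt s * u + d * z))\<^sup>2 \<partial>gauss) - (relu (x + sqrt s * u))\<^sup>2 \<partial>gauss)\<bar> \<le> s' - s" by simp
  have "(\<integral>u. (\<integral>z. (relu (x + sqrt s * u + d * z))\<^sup>2 \<partial>gauss) - (relu (x + sqrt s * u))\<^sup>2 \<partial>gauss)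
    = (\<integral>u. \<integral>z. (relu (x + sqrt s * u + d * z))\<^sup>2 \<partial>gauss \<partial>gauss) - (\<integral>u. (relu (x + sqrt s * u))\<^sup>2 \<partial>gauss)"
    by (rule Bochner_Integration.integral_diff[OF i3 i4])
  with fin show ?thesis unfolding 1 by simp
qed

lemma gcov_relu_square_diff:
  assumes "psd s t r" "psd s' t' r'"
  shows "\<bar>gcov s' t' r' (\<lambda>q. (relu (fst q))\<^sup>2) p - gcov s t r (\<lambda>q. (relu (fst q))\<^sup>2) p\<bar> \<le> \<bar>s' - s\<bar>"
    "\<bar>gcov s' t' r' (\<lambda>q. (relu (snd q))\<^sup>2) p - gcov s t r (\<lambda>q. (relu (snd q))\<^sup>2) p\<bar> \<le> \<bar>t' - t\<bar>"
proof -
  have g: "pgrow (\<lambda>z. (relu z)\<^sup>2)" by (intro pbd_intros)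
  have nn: "0 \<le> s" "0 \<le> t" "0 \<le> s'" "0 \<le> t'" using assms by (auto simp: psd_def)
  have "\<bar>(\<integral>z. (relu (x + sqrt s' * z))\<^sup>2 \<partial>gauss) - (\<integral>z. (relu (x + sqrt s * z))\<^sup>2 \<partial>gauss)\<bar> \<le> \<bar>s' - s\<bar>"
    if "0 \<le> s" "0 \<le> s'" for s s' x
    using gauss_relu_square_mono_var[of s s' x] gauss_relu_square_mono_var[of s' s x] that
    by (cases "s \<le> s'") (auto simp: abs_minus_commute)
  then show "\<bar>gcov s' t' r' (\<lambda>q. (relu (fst q))\<^sup>2) p - gcov s t r (\<lambda>q. (relu (fst q))\<^sup>2) p\<bar> \<le> \<bar>s' - s\<bar>"
    "\<bar>gcov s' t' r' (\<lambda>q. (relu (snd q))\<^sup>2) p - gcov s t r (\<lambda>q. (relu (snd q))\<^sup>2) p\<bar> \<le> \<bar>t' - t\<bar>"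
    using nn by (auto simp: gcov_fst[OF g] gcov_snd[OF g assms(1)] gcov_snd[OF g assms(2)])
qed

text \<open>The two functions are the halves of z^2 on either side of 0, and they have equal
  integrals by symmetry.\<close>

lemma gauss_relu_square: 
  shows "(\<integral>z. (relu z)\<^sup>2 \<partial>gauss) = 1 / 2" "(\<integral>z. (relu (- z))\<^sup>2 \<partial>gauss) = 1 / 2"
proof -
  have i: "integrable gauss (\<lambda>z. (relu z)\<^sup>2)" "integrable gauss (\<lambda>z. (relu (-z))\<^sup>2)"
  proof -
    show "integrable gauss (\<lambda>z. (relu z)\<^sup>2)" by (intro pgrow_integrable pbd_intros)
    have "integrable gauss (\<lambda>z. (relu (0 - z))\<^sup>2)" by (intro pgrow_integrable pbd_intros)
    then show "integrable gauss (\<lambda>z. (relu (-z))\<^sup>2)" by simp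
  qed
  have [measurable]: "relu \<in> borel_measurable borel" by (simp add: relu_def[abs_def])
  have "(\<integral>z. (relu z)\<^sup>2 \<partial>gauss) = (\<integral>z. (relu (-z))\<^sup>2 \<partial>gauss)"
    unfolding integral_gauss[of "\<lambda>z. (relu z)\<^sup>2", simplified] integral_gauss[of "\<lambda>z. (relu (-z))\<^sup>2", simplified]
    using lborel_integral_real_affine[of "-1" "\<lambda>z. std_normal_density z * (relu z)\<^sup>2" 0]
    by (simp add: std_normal_density_def)
  moreover have "(\<integral>z. (relu z)\<^sup>2 \<partial>gauss) + (\<integral>z. (relu (-z))\<^sup>2 \<partial>gauss) = (\<integral>z. z\<^sup>2 \<partial>gauss)"
  proof -
    have "(relu z)\<^sup>2 + (relu (-z))\<^sup>2 = z\<^sup>2" for z by (simp add: relu_def max_def)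
    then show ?thesis using Bochner_Integration.integral_add[OF i] by simp
  qed
  ultimately show "(\<integral>z. (relu z)\<^sup>2 \<partial>gauss) = 1 / 2" "(\<integral>z. (relu (- z))\<^sup>2 \<partial>gauss) = 1 / 2"
    by (simp_all add: gauss_moment_2)
qed

lemma relu_mult: "0 \<le> a \<Longrightarrow> relu (a * x) = a * relu x"
  by (auto simp: relu_def max_def mult_le_0_iff zero_le_mult_iff)

text \<open>The factor 1/2 is the growth rate of the variances: it matches the solution exp(t / 2)
  of the flow on the diagonal.\<close>

lemma gcov_relu_square_0:
  assumes "psd s t r"
  shows "gcov s t r (\<lambda>q. (relu (fst q))\<^sup>2) (0, 0) = s / 2" "gcov s t r (\<lambda>q. (relu (snd q))\<^sup>2) (0, 0) = t / 2"
proof -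
  have g: "pgrow (\<lambda>z. (relu z)\<^sup>2)" by (intro pbd_intros)
  have nn: "0 \<le> s" "0 \<le> t" using assms by (auto simp: psd_def)
  then show "gcov s t r (\<lambda>q. (relu (fst q))\<^sup>2) (0, 0) = s / 2" "gcov s t r (\<lambda>q. (relu (snd q))\<^sup>2) (0, 0) = t / 2"
    by (simp_all add: gcov_fst[OF g] gcov_snd[OF g assms] relu_mult power_mult_distrib gauss_relu_square)
qed

section \<open>Effect of moving the base point of a smoothed function\<close>

lemma gauss2_abs_le:
  fixes f :: "real \<times> real \<Rightarrow> real"
  assumes "integrable (gauss \<Otimes>\<^sub>M gauss) f" "integrable (gauss \<Otimes>\<^sub>M gauss) (\<lambda>q. (f q)\<^sup>2)"
  shows "(\<integral>q. \<bar>f q\<bar> \<partial>(gauss \<Otimes>\<^sub>M gauss)) \<le> sqrt (\<integral>q. (f q)\<^sup>2 \<partial>(gauss \<Otimes>\<^sub>M gauss))"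
proof (rule real_le_rsqrt)
  have "0 \<le> gg.P.variance (\<lambda>q. \<bar>f q\<bar>)" by (rule gg.P.variance_positive)
  then show "(\<integral>q. \<bar>f q\<bar> \<partial>(gauss \<Otimes>\<^sub>M gauss))\<^sup>2 \<le> (\<integral>q. (f q)\<^sup>2 \<partial>(gauss \<Otimes>\<^sub>M gauss))"
    using gg.P.variance_eq[of "\<lambda>q. \<bar>f q\<bar>"] assms by simp
qed

lemma gauss2_linear:
  "integrable (gauss \<Otimes>\<^sub>M gauss) (\<lambda>q. \<kappa> * snd q + \<tau> * fst q)"
  "integrable (gauss \<Otimes>\<^sub>M gauss) (\<lambda>q. \<bar>\<kappa> * snd q + \<tau> * fst q\<bar>)"
  "(\<integral>q. \<bar>\<kappa> * snd q + \<tau> * fst q\<bar> \<partial>(gauss \<Otimes>\<^sub>M gauss)) \<le> sqrt (\<kappa>\<^sup>2 + \<tau>\<^sup>2)"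
  "integrable (gauss \<Otimes>\<^sub>M gauss) (\<lambda>q. \<bar>snd q\<bar>)"
  "(\<integral>q. \<bar>snd q\<bar> \<partial>(gauss \<Otimes>\<^sub>M gauss)) \<le> 1"
  "integrable (gauss \<Otimes>\<^sub>M gauss) (\<lambda>q. \<bar>snd q\<bar> * \<bar>\<kappa> * snd q + \<tau> * fst q\<bar>)"
  "(\<integral>q. \<bar>snd q\<bar> * \<bar>\<kappa> * snd q + \<tau> * fst q\<bar> \<partial>(gauss \<Otimes>\<^sub>M gauss)) \<le> sqrt (\<kappa>\<^sup>2 + \<tau>\<^sup>2)"
proof -
  show i: "integrable (gauss \<Otimes>\<^sub>M gauss) (\<lambda>q. \<kappa> * snd q + \<tau> * fst q)"
    by (intro pgrow_integrable2 pbd_intros)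
  show "integrable (gauss \<Otimes>\<^sub>M gauss) (\<lambda>q. \<bar>\<kappa> * snd q + \<tau> * fst q\<bar>)"
    by (intro pgrow_integrable2 pbd_intros)
  show "(\<integral>q. \<bar>\<kappa> * snd q + \<tau> * fst q\<bar> \<partial>(gauss \<Otimes>\<^sub>M gauss)) \<le> sqrt (\<kappa>\<^sup>2 + \<tau>\<^sup>2)"
    using gauss2_abs_le[OF i gauss2_moments(4)] by (simp only: gauss2_moments)
  have j: "integrable (gauss \<Otimes>\<^sub>M gauss) (\<lambda>q. snd q)"
    by (intro pgrow_integrable2 pbd_intros)
  show "integrable (gauss \<Otimes>\<^sub>M gauss) (\<lambda>q. \<bar>snd q\<bar>)"
    by (intro pgrow_integrable2 pbd_intros)
  show "(\<integral>q. \<bar>snd q\<bar> \<partial>(gauss \<Otimes>\<^sub>M gauss)) \<le> 1"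
    using gauss2_abs_le[OF j gauss2_moments(3)] by (simp add: gauss2_moments)
  show k: "integrable (gauss \<Otimes>\<^sub>M gauss) (\<lambda>q. \<bar>snd q\<bar> * \<bar>\<kappa> * snd q + \<tau> * fst q\<bar>)"
    by (intro pgrow_integrable2 pbd_intros)
  define c where "c = sqrt (\<kappa>\<^sup>2 + \<tau>\<^sup>2)"
  show "(\<integral>q. \<bar>snd q\<bar> * \<bar>\<kappa> * snd q + \<tau> * fst q\<bar> \<partial>(gauss \<Otimes>\<^sub>M gauss)) \<le> sqrt (\<kappa>\<^sup>2 + \<tau>\<^sup>2)"
  proof (cases "c = 0")
    case True
    then have "\<kappa> = 0" "\<tau> = 0" by (auto simp: c_def sum_power2_eq_zero_iff)
    then show ?thesis by simp
  next
    case False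
    then have c: "c > 0" by (auto simp: c_def sum_power2_gt_zero_iff intro!: real_sqrt_gt_zero)
    \<comment> \<open>Young's inequality with weight \<open>c\<close>, the standard deviation of the
      second factor; after integration both terms contribute c / 2.\<close>
    have le: "\<bar>snd q\<bar> * \<bar>\<kappa> * snd q + \<tau> * fst q\<bar> \<le> c / 2 * (snd q)\<^sup>2 + 1 / (2 * c) * (\<kappa> * snd q + \<tau> * fst q)\<^sup>2" for q
    proof -
      define a b where "a = \<bar>snd q\<bar>" and "b = \<bar>\<kappa> * snd q + \<tau> * fst q\<bar>"
      have "0 \<le> (c * a - b)\<^sup>2 / (2 * c)" using c by simp
      also have "\<dots> = c / 2 * a\<^sup>2 + 1 / (2 * c) * b\<^sup>2 - a * b" using c by (simp add: power2_eq_square field_simps)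
      finally show ?thesis by (simp add: a_def b_def)
    qed
    have "(\<integral>q. \<bar>snd q\<bar> * \<bar>\<kappa> * snd q + \<tau> * fst q\<bar> \<partial>(gauss \<Otimes>\<^sub>M gauss))
      \<le> (\<integral>q. c / 2 * (snd q)\<^sup>2 + 1 / (2 * c) * (\<kappa> * snd q + \<tau> * fst q)\<^sup>2 \<partial>(gauss \<Otimes>\<^sub>M gauss))"
      by (intro integral_mono k le Bochner_Integration.integrable_add integrable_mult_right gauss2_moments)
    also have "\<dots> = c / 2 + 1 / (2 * c) * (\<kappa>\<^sup>2 + \<tau>\<^sup>2)"
      by (subst Bochner_Integration.integral_add) (auto intro!: integrable_mult_right gauss2_moments simp: gauss2_moments)
    also have "\<kappa>\<^sup>2 + \<tau>\<^sup>2 = c\<^sup>2" by (simp add: c_def)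
    also have "c / 2 + 1 / (2 * c) * c\<^sup>2 = c" using c by (simp add: power2_eq_square)
    finally show ?thesis by (simp add: c_def)
  qed
qed

text \<open>Lipschitz with a constant that grows linearly in the arguments, the natural class for
  products of two Lipschitz functions. The noise estimates hold for every function of this
  class.\<close>

definition qlip :: "(real \<times> real \<Rightarrow> real) \<Rightarrow> bool" where
  "qlip h \<longleftrightarrow> pgrow h \<and> (\<forall>x y x' y'. \<bar>h (x, y) - h (x', y')\<bar> \<le> (\<bar>x\<bar> + \<bar>y\<bar> + \<bar>x'\<bar> + \<bar>y'\<bar>) * (\<bar>x - x'\<bar> + \<bar>y - y'\<bar>))"

lemma qlip_products:
  fixes f g :: "real \<Rightarrow> real"
  assumes f: "pgrow f" "\<And>x. \<bar>f x\<bar> \<le> \<bar>x\<bar>" "\<And>x y. \<bar>f x - f y\<bar> \<le> \<bar>x - y\<bar>"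
  shows "qlip (\<lambda>p. f (fst p) * f (snd p))" "qlip (\<lambda>p. (f (fst p))\<^sup>2)" "qlip (\<lambda>p. (f (snd p))\<^sup>2)"
proof -
  have 1: "\<bar>f x * f y - f x' * f y'\<bar> \<le> (\<bar>x\<bar> + \<bar>y\<bar> + \<bar>x'\<bar> + \<bar>y'\<bar>) * (\<bar>x - x'\<bar> + \<bar>y - y'\<bar>)" for x y x' y'
  proof -
    have "f x * f y - f x' * f y' = f x * (f y - f y') + (f x - f x') * f y'" by (simp add: algebra_simps)
    then have "\<bar>f x * f y - f x' * f y'\<bar> \<le> \<bar>f x\<bar> * \<bar>f y - f y'\<bar> + \<bar>f x - f x'\<bar> * \<bar>f y'\<bar>"
      by (metis abs_mult abs_triangle_ineq)
    also have "\<dots> \<le> \<bar>x\<bar> * \<bar>y - y'\<bar> + \<bar>x - x'\<bar> * \<bar>y'\<bar>"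
      using f(2,3) by (intro add_mono mult_mono) auto
    also have "\<dots> \<le> (\<bar>x\<bar> + \<bar>y\<bar> + \<bar>x'\<bar> + \<bar>y'\<bar>) * (\<bar>x - x'\<bar> + \<bar>y - y'\<bar>)"
      by (simp add: algebra_simps add_increasing add_increasing2)
    finally show ?thesis .
  qed
  have 2: "\<bar>(f x)\<^sup>2 - (f x')\<^sup>2\<bar> \<le> (\<bar>x\<bar> + a + \<bar>x'\<bar> + b) * (\<bar>x - x'\<bar> + c)" if "0 \<le> a" "0 \<le> b" "0 \<le> c" for x x' a b c
  proof -
    have "(f x)\<^sup>2 - (f x')\<^sup>2 = (f x + f x') * (f x - f x')" by (simp add: power2_eq_square algebra_simps)
    then have "\<bar>(f x)\<^sup>2 - (f x')\<^sup>2\<bar> = \<bar>f x + f x'\<bar> * \<bar>f x - f x'\<bar>" by (simp add: abs_mult)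
    also have "\<dots> \<le> (\<bar>x\<bar> + a + \<bar>x'\<bar> + b) * (\<bar>x - x'\<bar> + c)"
    proof (intro mult_mono)
      show "\<bar>f x + f x'\<bar> \<le> \<bar>x\<bar> + a + \<bar>x'\<bar> + b" using f(2)[of x] f(2)[of x'] that by linarith
      show "\<bar>f x - f x'\<bar> \<le> \<bar>x - x'\<bar> + c" using f(3)[of x x'] that by linarith
    qed (use that in auto)
    finally show ?thesis .
  qed
  show "qlip (\<lambda>p. f (fst p) * f (snd p))"
    unfolding qlip_def by (intro conjI pbd_mult pbd_compose[OF f(1)] pbd_intros) (use 1 in simp)
  show "qlip (\<lambda>p. (f (fst p))\<^sup>2)"
    unfolding qlip_def by (intro conjI pbd_power pbd_compose[OF f(1)] pbd_intros) (use 2 in simp)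
  have "\<bar>(f y)\<^sup>2 - (f y')\<^sup>2\<bar> \<le> (\<bar>x\<bar> + \<bar>y\<bar> + \<bar>x'\<bar> + \<bar>y'\<bar>) * (\<bar>x - x'\<bar> + \<bar>y - y'\<bar>)" for x y x' y'
    using 2[of "\<bar>x\<bar>" "\<bar>x'\<bar>" "\<bar>x - x'\<bar>" y y'] by (simp add: add_ac)
  then show "qlip (\<lambda>p. (f (snd p))\<^sup>2)"
    unfolding qlip_def by (intro conjI pbd_power pbd_compose[OF f(1)] pbd_intros) simp
qed

lemmas qlip_id = qlip_products[OF pgrow_id, simplified]

lemma relu_bounds: "\<bar>relu x\<bar> \<le> \<bar>x\<bar>" "\<bar>relu x - relu y\<bar> \<le> \<bar>x - y\<bar>" "0 \<le> relu x"
  by (auto simp: relu_def max_def)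

lemmas qlip_relu = qlip_products[of relu, OF pbd_relu[OF pgrow_id] relu_bounds(1,2)]

text \<open>The square is taken because (\<xi>, \<eta>) will be the Gaussian increment of a neuron
  in one layer: second moments of order 1/L multiply the size of the base point, and fourth moments
  account for the growth of \<open>h\<close>.\<close>

lemma gcov_increment:
  assumes h: "qlip h" and psd: "psd s t r"
  shows "(gcov s t r h (x + \<xi>, y + \<eta>) - gcov s t r h (x, y))\<^sup>2
    \<le> 48 * (x\<^sup>2 + y\<^sup>2 + s + t) * (\<xi>\<^sup>2 + \<eta>\<^sup>2) + 24 * (\<xi> ^ 4 + \<eta> ^ 4)"
proof -
  let ?M = "gauss \<Otimes>\<^sub>M gauss"
  define A K T where "A = sqrt s" and "K = r / sqrt s" and "T = sqrt (t - r\<^sup>2 / s)"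
  note b = psd_bounds[OF psd]
  have nn: "0 \<le> s" "0 \<le> t" using psd by (auto simp: psd_def)
  have A0: "0 \<le> A" using nn by (simp add: A_def)
  have KT: "sqrt (K\<^sup>2 + T\<^sup>2) = sqrt t" using b by (simp add: K_def T_def)
  have g: "pgrow h" and L: "\<And>x y x' y'. \<bar>h (x, y) - h (x', y')\<bar> \<le> (\<bar>x\<bar> + \<bar>y\<bar> + \<bar>x'\<bar> + \<bar>y'\<bar>) * (\<bar>x - x'\<bar> + \<bar>y - y'\<bar>)"
    using h by (auto simp: qlip_def)
  define P Q where "P = (\<lambda>q. h (x + \<xi> + A * snd q, y + \<eta> + K * snd q + T * fst q))"
    and "Q = (\<lambda>q. h (x + A * snd q, y + K * snd q + T * fst q))"
  have P: "gcov s t r h (x + \<xi>, y + \<eta>) = (\<integral>q. P q \<partial>?M)" "integrable ?M P"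
    using gop_pair[OF g, where \<alpha> = A and \<kappa> = K and \<tau> = T and p = "(x + \<xi>, y + \<eta>)"]
    by (simp_all add: gcov_def A_def K_def T_def P_def)
  have Q: "gcov s t r h (x, y) = (\<integral>q. Q q \<partial>?M)" "integrable ?M Q"
    using gop_pair[OF g, where \<alpha> = A and \<kappa> = K and \<tau> = T and p = "(x, y)"]
    by (simp_all add: gcov_def A_def K_def T_def Q_def)
  \<comment> \<open>The first-order bound will be \<open>a * (2 * B + a + 2 * c)\<close>, where
    \<open>a\<close> measures the shift, \<open>B\<close> the base point and \<open>c\<close> the
    standard deviations. Squaring it yields the constants 48 = 12 * 4 and 24 = 3 * 8.\<close>
  define a where "a = \<bar>\<xi>\<bar> + \<bar>\<eta>\<bar>"
  define B where "B = \<bar>x\<bar> + \<bar>y\<bar>"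
  define c where "c = sqrt s + sqrt t"
  have abs4: "\<bar>x + \<xi> + u\<bar> + \<bar>y + \<eta> + k + t\<bar> + \<bar>x + u\<bar> + \<bar>y + k + t\<bar> \<le> 2 * (\<bar>x\<bar> + \<bar>y\<bar>) + (\<bar>\<xi>\<bar> + \<bar>\<eta>\<bar>) + 2 * w + 2 * \<bar>k + t\<bar>"
    if "\<bar>u\<bar> = w" for x \<xi> u y \<eta> k t w :: real
    using that abs_triangle_ineq[of "x + \<xi>" u] abs_triangle_ineq[of x \<xi>] abs_triangle_ineq[of "y + \<eta>" "k + t"]
      abs_triangle_ineq[of y \<eta>] abs_triangle_ineq[of x u] abs_triangle_ineq[of y "k + t"]
    by (simp add: add.assoc)
  have le: "\<bar>P q - Q q\<bar> \<le> a * (2 * B + a) + (2 * a * A * \<bar>snd q\<bar> + 2 * a * \<bar>K * snd q + T * fst q\<bar>)" for q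
  proof -
    have "\<bar>P q - Q q\<bar> \<le> (\<bar>x + \<xi> + A * snd q\<bar> + \<bar>y + \<eta> + K * snd q + T * fst q\<bar> + \<bar>x + A * snd q\<bar> + \<bar>y + K * snd q + T * fst q\<bar>) * a"
      unfolding P_def Q_def a_def by (rule order_trans[OF L]) simp
    also have "\<dots> \<le> (2 * B + a + 2 * (A * \<bar>snd q\<bar>) + 2 * \<bar>K * snd q + T * fst q\<bar>) * a"
    proof (rule mult_right_mono)
      have "\<bar>A * snd q\<bar> = A * \<bar>snd q\<bar>" using A0 by (simp add: abs_mult)
      then show "\<bar>x + \<xi> + A * snd q\<bar> + \<bar>y + \<eta> + K * snd q + T * fst q\<bar> + \<bar>x + A * snd q\<bar> + \<bar>y + K * snd q + T * fst q\<bar>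
       \<le> 2 * B + a + 2 * (A * \<bar>snd q\<bar>) + 2 * \<bar>K * snd q + T * fst q\<bar>"
        unfolding B_def a_def by (rule abs4)
    qed (simp add: a_def)
    finally show ?thesis by (simp add: algebra_simps)
  qed
  have "\<bar>\<integral>q. P q - Q q \<partial>?M\<bar> \<le> (\<integral>q. \<bar>P q - Q q\<bar> \<partial>?M)" by (rule integral_abs_bound)
  also have "\<dots> \<le> (\<integral>q. a * (2 * B + a) + (2 * a * A * \<bar>snd q\<bar> + 2 * a * \<bar>K * snd q + T * fst q\<bar>) \<partial>?M)"
    by (intro integral_mono le integrable_abs Bochner_Integration.integrable_diff P Q Bochner_Integration.integrable_add
        integrable_mult_right gauss2_linear gg.P.integrable_const)
  also have "\<dots> = a * (2 * B + a) + (2 * a * A * (\<integral>q. \<bar>snd q\<bar> \<partial>?M) + 2 * a * (\<integral>q. \<bar>K * snd q + T * fst q\<bar> \<partial>?M))"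
  proof -
    have "(\<integral>q. 2 * a * A * \<bar>snd q\<bar> + 2 * a * \<bar>K * snd q + T * fst q\<bar> \<partial>?M)
      = 2 * a * A * (\<integral>q. \<bar>snd q\<bar> \<partial>?M) + 2 * a * (\<integral>q. \<bar>K * snd q + T * fst q\<bar> \<partial>?M)"
      by (subst Bochner_Integration.integral_add) (intro integrable_mult_right gauss2_linear, intro integrable_mult_right gauss2_linear, simp)
    moreover have "(\<integral>q. a * (2 * B + a) + (2 * a * A * \<bar>snd q\<bar> + 2 * a * \<bar>K * snd q + T * fst q\<bar>) \<partial>?M)
      = (\<integral>q. a * (2 * B + a) \<partial>?M) + (\<integral>q. 2 * a * A * \<bar>snd q\<bar> + 2 * a * \<bar>K * snd q + T * fst q\<bar> \<partial>?M)"
      by (intro Bochner_Integration.integral_add gg.P.integrable_const Bochner_Integration.integrable_add integrable_mult_right gauss2_linear)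
    ultimately show ?thesis by (simp add: space_pair_measure)
  qed
  also have "\<dots> \<le> a * (2 * B + a) + (2 * a * A * 1 + 2 * a * sqrt t)"
    unfolding KT[symmetric] using A0 by (intro add_mono mult_left_mono gauss2_linear order_refl) (auto simp: a_def)
  also have "\<dots> = a * (2 * B + a + 2 * c)" by (simp add: c_def A_def algebra_simps)
  finally have D: "\<bar>gcov s t r h (x + \<xi>, y + \<eta>) - gcov s t r h (x, y)\<bar> \<le> a * (2 * B + a + 2 * c)"
    unfolding P(1) Q(1) using P(2) Q(2) by simp
  have sq: "(u + v)\<^sup>2 \<le> 2 * (u\<^sup>2 + v\<^sup>2)" for u v :: real
    using zero_le_power2[of "u - v"] by (simp add: power2_eq_square algebra_simps)
  have a2: "a\<^sup>2 \<le> 2 * (\<xi>\<^sup>2 + \<eta>\<^sup>2)" using sq[of "\<bar>\<xi>\<bar>" "\<bar>\<eta>\<bar>"] by (simp add: a_def)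
  have B2: "B\<^sup>2 \<le> 2 * (x\<^sup>2 + y\<^sup>2)" using sq[of "\<bar>x\<bar>" "\<bar>y\<bar>"] by (simp add: B_def)
  have c2: "c\<^sup>2 \<le> 2 * (s + t)" using sq[of "sqrt s" "sqrt t"] nn by (simp add: c_def)
  have a4: "(a\<^sup>2)\<^sup>2 \<le> 8 * (\<xi> ^ 4 + \<eta> ^ 4)"
  proof -
    have "(a\<^sup>2)\<^sup>2 \<le> (2 * (\<xi>\<^sup>2 + \<eta>\<^sup>2))\<^sup>2" by (rule power_mono[OF a2]) simp
    also have "\<dots> = 4 * (\<xi>\<^sup>2 + \<eta>\<^sup>2)\<^sup>2" unfolding power_mult_distrib by simp
    also have "\<dots> \<le> 4 * (2 * ((\<xi>\<^sup>2)\<^sup>2 + (\<eta>\<^sup>2)\<^sup>2))" by (intro mult_left_mono sq) simp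
    finally show ?thesis by simp
  qed
  have "(gcov s t r h (x + \<xi>, y + \<eta>) - gcov s t r h (x, y))\<^sup>2 \<le> (a * (2 * B + a + 2 * c))\<^sup>2"
    using D by (metis abs_ge_zero power2_abs power_mono)
  also have "\<dots> = a\<^sup>2 * (2 * B + a + 2 * c)\<^sup>2" by (simp add: power_mult_distrib)
  also have "\<dots> \<le> a\<^sup>2 * (3 * (4 * B\<^sup>2 + a\<^sup>2 + 4 * c\<^sup>2))"
  proof (rule mult_left_mono)
    have "0 \<le> (2 * B - a)\<^sup>2 + (2 * B - 2 * c)\<^sup>2 + (a - 2 * c)\<^sup>2" by simp
    also have "\<dots> = 3 * (4 * B\<^sup>2 + a\<^sup>2 + 4 * c\<^sup>2) - (2 * B + a + 2 * c)\<^sup>2"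
      by (simp add: power2_eq_square algebra_simps)
    finally show "(2 * B + a + 2 * c)\<^sup>2 \<le> 3 * (4 * B\<^sup>2 + a\<^sup>2 + 4 * c\<^sup>2)" by simp
  qed simp
  also have "\<dots> = 12 * (a\<^sup>2 * (B\<^sup>2 + c\<^sup>2)) + 3 * (a\<^sup>2)\<^sup>2" by (simp add: power2_eq_square algebra_simps)
  also have "\<dots> \<le> 12 * ((2 * (\<xi>\<^sup>2 + \<eta>\<^sup>2)) * (2 * (x\<^sup>2 + y\<^sup>2) + 2 * (s + t))) + 3 * (8 * (\<xi> ^ 4 + \<eta> ^ 4))"
    using a2 B2 c2 a4 by (intro add_mono mult_left_mono mult_mono) auto
  also have "\<dots> = 48 * (x\<^sup>2 + y\<^sup>2 + s + t) * (\<xi>\<^sup>2 + \<eta>\<^sup>2) + 24 * (\<xi> ^ 4 + \<eta> ^ 4)" by (simp add: algebra_simps)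
  finally show ?thesis .
qed

section \<open>Dependence of the smoothed ReLU product on the covariance\<close>

definition relu2 :: "real \<times> real \<Rightarrow> real" where
  "relu2 p = relu (fst p) * relu (snd p)"

lemma qlip_relu2: "qlip relu2"
  using qlip_relu(1) by (simp add: relu2_def[abs_def])

lemma pgrow_relu2: "pgrow relu2"
  using qlip_relu2 by (simp add: qlip_def)

text \<open>Only the standard deviations change, by replacing \<open>\<alpha>\<close> and by scaling
  the second row with \<open>l\<close>; the correlation coefficient is the same on both sides. Since
  relu is 1-Lipschitz, the change is linear in the differences of the standard deviations.\<close>

lemma gop_scale_relu2:
  assumes nn: "0 \<le> \<alpha>" "0 \<le> \<alpha>'" "0 \<le> l"
  shows "\<bar>gop \<alpha>' (l * \<kappa>) (l * \<tau>) relu2 (x, y) - gop \<alpha> \<kappa> \<tau> relu2 (x, y)\<bar>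
    \<le> \<bar>\<alpha>' - \<alpha>\<bar> * (\<bar>y\<bar> + l * sqrt (\<kappa>\<^sup>2 + \<tau>\<^sup>2)) + \<bar>l - 1\<bar> * sqrt (\<kappa>\<^sup>2 + \<tau>\<^sup>2) * (\<bar>x\<bar> + \<alpha>)"
proof -
  let ?M = "gauss \<Otimes>\<^sub>M gauss"
  define G where "G = (\<lambda>q. \<kappa> * snd q + \<tau> * fst q)"
  define P Q where "P = (\<lambda>q. relu2 (x + \<alpha>' * snd q, y + l * G q))"
    and "Q = (\<lambda>q. relu2 (x + \<alpha> * snd q, y + G q))"
  have P: "gop \<alpha>' (l * \<kappa>) (l * \<tau>) relu2 (x, y) = (\<integral>q. P q \<partial>?M)" "integrable ?M P"
    using gop_pair[OF pgrow_relu2, where \<alpha> = \<alpha>' and \<kappa> = "l * \<kappa>" and \<tau> = "l * \<tau>" and p = "(x, y)"]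
    by (simp_all add: P_def G_def algebra_simps)
  have Q: "gop \<alpha> \<kappa> \<tau> relu2 (x, y) = (\<integral>q. Q q \<partial>?M)" "integrable ?M Q"
    using gop_pair[OF pgrow_relu2, where \<alpha> = \<alpha> and \<kappa> = \<kappa> and \<tau> = \<tau> and p = "(x, y)"]
    by (simp_all add: Q_def G_def algebra_simps)
  define da dl where "da = \<bar>\<alpha>' - \<alpha>\<bar>" and "dl = \<bar>l - 1\<bar>"
  have d0: "0 \<le> da" "0 \<le> dl" by (auto simp: da_def dl_def)
  define R where "R = sqrt (\<kappa>\<^sup>2 + \<tau>\<^sup>2)"
  have mG: "integrable ?M (\<lambda>q. \<bar>G q\<bar>)" "(\<integral>q. \<bar>G q\<bar> \<partial>?M) \<le> R" "integrable ?M (\<lambda>q. \<bar>snd q\<bar>)" "(\<integral>q. \<bar>snd q\<bar> \<partial>?M) \<le> 1"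
      "integrable ?M (\<lambda>q. \<bar>snd q\<bar> * \<bar>G q\<bar>)" "(\<integral>q. \<bar>snd q\<bar> * \<bar>G q\<bar> \<partial>?M) \<le> R"
    unfolding G_def R_def by (fact gauss2_linear)+
  have le: "\<bar>P q - Q q\<bar> \<le> da * \<bar>y\<bar> * \<bar>snd q\<bar> + (dl * \<bar>x\<bar> * \<bar>G q\<bar> + (da * l + dl * \<alpha>) * (\<bar>snd q\<bar> * \<bar>G q\<bar>))" for q
  proof -
    define z g where "z = snd q" and "g = G q"
    have "P q - Q q = (relu (x + \<alpha>' * z) - relu (x + \<alpha> * z)) * relu (y + l * g)
      + relu (x + \<alpha> * z) * (relu (y + l * g) - relu (y + g))"
      by (simp add: P_def Q_def relu2_def z_def g_def algebra_simps)
    then have "\<bar>P q - Q q\<bar> \<le> \<bar>relu (x + \<alpha>' * z) - relu (x + \<alpha> * z)\<bar> * \<bar>relu (y + l * g)\<bar>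
      + \<bar>relu (x + \<alpha> * z)\<bar> * \<bar>relu (y + l * g) - relu (y + g)\<bar>"
      by (metis abs_mult abs_triangle_ineq)
    also have "\<dots> \<le> (da * \<bar>z\<bar>) * (\<bar>y\<bar> + l * \<bar>g\<bar>) + (\<bar>x\<bar> + \<alpha> * \<bar>z\<bar>) * (dl * \<bar>g\<bar>)"
    proof (intro add_mono mult_mono)
      have "x + \<alpha>' * z - (x + \<alpha> * z) = (\<alpha>' - \<alpha>) * z" by (simp add: algebra_simps)
      then show "\<bar>relu (x + \<alpha>' * z) - relu (x + \<alpha> * z)\<bar> \<le> da * \<bar>z\<bar>"
        using relu_bounds(2)[of "x + \<alpha>' * z" "x + \<alpha> * z"] by (simp add: da_def abs_mult)
      have "y + l * g - (y + g) = (l - 1) * g" by (simp add: algebra_simps)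
      then show "\<bar>relu (y + l * g) - relu (y + g)\<bar> \<le> dl * \<bar>g\<bar>"
        using relu_bounds(2)[of "y + l * g" "y + g"] by (simp add: dl_def abs_mult)
      have "\<bar>l * g\<bar> = l * \<bar>g\<bar>" using nn by (simp add: abs_mult)
      then show "\<bar>relu (y + l * g)\<bar> \<le> \<bar>y\<bar> + l * \<bar>g\<bar>"
        using relu_bounds(1)[of "y + l * g"] abs_triangle_ineq[of y "l * g"] by linarith
      have "\<bar>\<alpha> * z\<bar> = \<alpha> * \<bar>z\<bar>" using nn by (simp add: abs_mult)
      then show "\<bar>relu (x + \<alpha> * z)\<bar> \<le> \<bar>x\<bar> + \<alpha> * \<bar>z\<bar>"
        using relu_bounds(1)[of "x + \<alpha> * z"] abs_triangle_ineq[of x "\<alpha> * z"] by linarith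
    qed (use nn d0 in auto)
    also have "\<dots> = da * \<bar>y\<bar> * \<bar>z\<bar> + (dl * \<bar>x\<bar> * \<bar>g\<bar> + (da * l + dl * \<alpha>) * (\<bar>z\<bar> * \<bar>g\<bar>))"
      by (simp add: algebra_simps)
    finally show ?thesis by (simp only: z_def g_def)
  qed
  have "\<bar>\<integral>q. P q - Q q \<partial>?M\<bar> \<le> (\<integral>q. \<bar>P q - Q q\<bar> \<partial>?M)" by (rule integral_abs_bound)
  also have "\<dots> \<le> (\<integral>q. da * \<bar>y\<bar> * \<bar>snd q\<bar> + (dl * \<bar>x\<bar> * \<bar>G q\<bar> + (da * l + dl * \<alpha>) * (\<bar>snd q\<bar> * \<bar>G q\<bar>)) \<partial>?M)"
    by (intro integral_mono le integrable_abs Bochner_Integration.integrable_diff P Q Bochner_Integration.integrable_add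
        integrable_mult_right mG)
  also have "\<dots> = da * \<bar>y\<bar> * (\<integral>q. \<bar>snd q\<bar> \<partial>?M) + (dl * \<bar>x\<bar> * (\<integral>q. \<bar>G q\<bar> \<partial>?M)
     + (da * l + dl * \<alpha>) * (\<integral>q. \<bar>snd q\<bar> * \<bar>G q\<bar> \<partial>?M))"
  proof -
    have "(\<integral>q. dl * \<bar>x\<bar> * \<bar>G q\<bar> + (da * l + dl * \<alpha>) * (\<bar>snd q\<bar> * \<bar>G q\<bar>) \<partial>?M)
      = (\<integral>q. dl * \<bar>x\<bar> * \<bar>G q\<bar> \<partial>?M) + (\<integral>q. (da * l + dl * \<alpha>) * (\<bar>snd q\<bar> * \<bar>G q\<bar>) \<partial>?M)"
      by (intro Bochner_Integration.integral_add integrable_mult_right mG)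
    moreover have "(\<integral>q. da * \<bar>y\<bar> * \<bar>snd q\<bar> + (dl * \<bar>x\<bar> * \<bar>G q\<bar> + (da * l + dl * \<alpha>) * (\<bar>snd q\<bar> * \<bar>G q\<bar>)) \<partial>?M)
      = (\<integral>q. da * \<bar>y\<bar> * \<bar>snd q\<bar> \<partial>?M) + (\<integral>q. dl * \<bar>x\<bar> * \<bar>G q\<bar> + (da * l + dl * \<alpha>) * (\<bar>snd q\<bar> * \<bar>G q\<bar>) \<partial>?M)"
      by (intro Bochner_Integration.integral_add Bochner_Integration.integrable_add integrable_mult_right mG)
    ultimately show ?thesis by simp
  qed
  also have "\<dots> \<le> da * \<bar>y\<bar> * 1 + (dl * \<bar>x\<bar> * R + (da * l + dl * \<alpha>) * R)"
    by (intro add_mono mult_left_mono mG) (use d0 nn in auto)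
  also have "\<dots> = da * (\<bar>y\<bar> + l * R) + dl * R * (\<bar>x\<bar> + \<alpha>)" by (simp add: algebra_simps)
  finally show ?thesis unfolding P(1) Q(1) using P(2) Q(2) by (simp add: da_def dl_def R_def)
qed

text \<open>Correlation is added or removed by splitting off a Gaussian part that is either shared by both
  coordinates or independent between them; conditionally on the rest, the difference is a covariance
  of two Lipschitz functions.\<close>

lemma relu_cov_bound:
  assumes nn: "0 \<le> a" "0 \<le> b"
  shows "\<bar>(\<integral>z. relu (x + a * z) * relu (y + b * z) \<partial>gauss)
    - (\<integral>z. relu (x + a * z) \<partial>gauss) * (\<integral>z. relu (y + b * z) \<partial>gauss)\<bar> \<le> 2 * (a * b)"
proof -
  \<comment> \<open>A covariance ignores constants, so both factors are centred at z = 0; then they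
    are at most a |z| and b |z|, and E z^2 = 1 gives the bound.\<close>
  define u v where "u = (\<lambda>z. relu (x + a * z) - relu x)" and "v = (\<lambda>z. relu (y + b * z) - relu y)"
  have g: "pgrow u" "pgrow v" "pgrow (\<lambda>z. u z * v z)"
    unfolding u_def v_def by (intro pbd_intros)+
  note i = g[THEN pgrow_integrable]
  have ub: "\<bar>u z\<bar> \<le> a * \<bar>z\<bar>" and vb: "\<bar>v z\<bar> \<le> b * \<bar>z\<bar>" for z
    using relu_bounds(2)[of "x + a * z" x] relu_bounds(2)[of "y + b * z" y] nn by (auto simp: u_def v_def abs_mult)
  have R: "relu (x + a * z) = u z + relu x" "relu (y + b * z) = v z + relu y" for z by (auto simp: u_def v_def)
  have "(\<integral>z. (u z + relu x) * (v z + relu y) \<partial>gauss)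
     = (\<integral>z. u z * v z + (relu x * v z + (relu y * u z + relu x * relu y)) \<partial>gauss)"
    by (simp add: algebra_simps)
  also have "\<dots> = (\<integral>z. u z * v z \<partial>gauss) + (relu x * (\<integral>z. v z \<partial>gauss) + (relu y * (\<integral>z. u z \<partial>gauss) + relu x * relu y))"
    using i by simp
  finally have 1: "(\<integral>z. (u z + relu x) * (v z + relu y) \<partial>gauss) - (\<integral>z. u z + relu x \<partial>gauss) * (\<integral>z. v z + relu y \<partial>gauss)
     = (\<integral>z. u z * v z \<partial>gauss) - (\<integral>z. u z \<partial>gauss) * (\<integral>z. v z \<partial>gauss)"
    using i by (simp add: algebra_simps)
  have az: "integrable gauss (\<lambda>z. \<bar>z\<bar>)" "(\<integral>z. \<bar>z\<bar> \<partial>gauss) \<le> 1"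
  proof -
    have ab: "pgrow (\<lambda>z::real. \<bar>z\<bar>)" by (intro pbd_intros)
    show "integrable gauss (\<lambda>z. \<bar>z\<bar>)" by (rule pgrow_integrable[OF ab])
    show "(\<integral>z. \<bar>z\<bar> \<partial>gauss) \<le> 1" using gauss2_fst(3)[OF ab] gauss2_linear(5) by simp
  qed
  have zz: "integrable gauss (\<lambda>z. z * z)" by (intro pgrow_integrable pbd_intros)
  have "\<bar>\<integral>z. u z * v z \<partial>gauss\<bar> \<le> (\<integral>z. \<bar>u z * v z\<bar> \<partial>gauss)" by (rule integral_abs_bound)
  also have "\<dots> \<le> (\<integral>z. (a * b) * (z * z) \<partial>gauss)"
  proof (rule integral_mono)
    show "\<bar>u z * v z\<bar> \<le> (a * b) * (z * z)" for z
      using mult_mono[OF ub[of z] vb[of z]] nn by (simp add: abs_mult mult_ac abs_mult_self_eq)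
  qed (use i zz in auto)
  also have "\<dots> = a * b" using gauss_moment_2 by (simp add: power2_eq_square)
  finally have 2: "\<bar>\<integral>z. u z * v z \<partial>gauss\<bar> \<le> a * b" .
  have U: "\<bar>\<integral>z. u z \<partial>gauss\<bar> \<le> a"
  proof -
    have "\<bar>\<integral>z. u z \<partial>gauss\<bar> \<le> (\<integral>z. \<bar>u z\<bar> \<partial>gauss)" by (rule integral_abs_bound)
    also have "\<dots> \<le> (\<integral>z. a * \<bar>z\<bar> \<partial>gauss)" using i az ub by (intro integral_mono) auto
    also have "\<dots> \<le> a * 1" using az nn by (simp add: mult_left_le)
    finally show ?thesis by simp
  qed
  have V: "\<bar>\<integral>z. v z \<partial>gauss\<bar> \<le> b"
  proof -
    have "\<bar>\<integral>z. v z \<partial>gauss\<bar> \<le> (\<integral>z. \<bar>v z\<bar> \<partial>gauss)" by (rule integral_abs_bound)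
    also have "\<dots> \<le> (\<integral>z. b * \<bar>z\<bar> \<partial>gauss)" using i az vb by (intro integral_mono) auto
    also have "\<dots> \<le> b * 1" using az nn by (simp add: mult_left_le)
    finally show ?thesis by simp
  qed
  have "\<bar>(\<integral>z. u z \<partial>gauss) * (\<integral>z. v z \<partial>gauss)\<bar> \<le> a * b"
    unfolding abs_mult using U V nn by (intro mult_mono) auto
  then show ?thesis unfolding R 1 using 2 by linarith
qed

text \<open>The constant 2 is independent of s and t, so the estimate stays useful when the
  smoothing covariance is almost zero.\<close>

lemma gcov_relu2_corr_mono:
  assumes "0 \<le> s" "0 \<le> t" "0 \<le> r1" "r1 \<le> r2" "psd s t r2"
  shows "\<bar>gcov s t r2 relu2 p - gcov s t r1 relu2 p\<bar> \<le> 2 * (r2 - r1)"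
proof (cases "s = 0 \<or> t = 0")
  case True
  then have "r2 = 0" using assms by (auto simp: psd_def)
  then show ?thesis using assms by simp
next
  case False
  define m where "m = sqrt (s * t)"
  have m: "m > 0" "m\<^sup>2 = s * t" using False assms by (auto simp: m_def zero_less_mult_iff)
  have r2m: "r2 \<le> m" using assms by (auto simp: m_def psd_def intro: real_le_rsqrt)
  \<comment> \<open>The fraction \<open>d\<close> of both variances is split off. It is chosen so
    that a perfectly correlated pair with variances d s and d t has covariance exactly r2 - r1. The
    remainder with correlation entry r1 is positive semidefinite because r2 <= m gives r1 <= (1 - d)
    m.\<close>
  define d where "d = (r2 - r1) / m"
  have d: "0 \<le> d" "d \<le> 1" "d * m = r2 - r1" using m r2m assms by (auto simp: d_def field_simps)
  define S T where "S = (1 - d) * s" and "T = (1 - d) * t"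
  define v w where "v = sqrt (d * s)" and "w = sqrt (d * t)"
  have v2: "v\<^sup>2 = d * s" "w\<^sup>2 = d * t" "0 \<le> v" "0 \<le> w" using d assms by (auto simp: v_def w_def)
  have vw: "v * w = r2 - r1"
  proof -
    have "v * w = sqrt ((d * s) * (d * t))" by (simp add: v_def w_def real_sqrt_mult)
    also have "(d * s) * (d * t) = (d * m)\<^sup>2" unfolding power_mult_distrib m by (simp add: power2_eq_square)
    finally show ?thesis using d m assms by simp
  qed
  have psd: "psd S T r1"
  proof -
    have "r1 \<le> (1 - d) * m" using d r2m by (simp add: algebra_simps)
    then have "r1\<^sup>2 \<le> ((1 - d) * m)\<^sup>2" using assms by (intro power_mono) auto
    also have "\<dots> = S * T" unfolding power_mult_distrib m by (simp add: S_def T_def power2_eq_square)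
    finally show ?thesis using d assms by (auto simp: psd_def S_def T_def)
  qed
  have psd': "psd (S + v\<^sup>2) T r1"
    using psd_add[OF psd, of "v\<^sup>2" 0 0] by (simp add: psd_def)
  note g = pgrow_relu2
  have g0: "pgrow (\<lambda>q::real\<times>real. \<integral>z. relu2 (fst q + a * z, snd q + b * z) \<partial>gauss)" for a b
    using pgrow_integral(1)[of "\<lambda>q. relu2 (fst (fst q) + a * snd q, snd (fst q) + b * snd q)"]
    by (simp add: pbd_compose[OF g] pbd_intros)
  \<comment> \<open>\<open>H\<close> averages over one noise shared by both coordinates and leads to
    r2. \<open>F\<close> adds noise to the second coordinate only and \<open>K\<close> then an
    independent one to the first, which leads to r1.\<close>
  define H where "H = (\<lambda>q::real\<times>real. \<integral>z. relu2 (fst q + v * z, snd q + w * z) \<partial>gauss)"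
  define F where "F = (\<lambda>q::real\<times>real. \<integral>z. relu2 (fst q + 0 * z, snd q + w * z) \<partial>gauss)"
  define K where "K = (\<lambda>q::real\<times>real. \<integral>z. F (fst q + v * z, snd q + 0 * z) \<partial>gauss)"
  have gH: "pgrow H" and gF: "pgrow F" unfolding H_def F_def by (rule g0)+
  have gK: "pgrow K"
    using pgrow_integral(1)[of "\<lambda>q. F (fst (fst q) + v * snd q, snd (fst q) + 0 * snd q)"]
    unfolding K_def by (simp add: pbd_compose[OF gF] pbd_intros)
  have sum: "S + v\<^sup>2 = s" "T + w\<^sup>2 = t" "r1 + v * w = r2" by (auto simp: S_def T_def v2 vw algebra_simps)
  have e2: "gcov s t r2 relu2 p = gcov S T r1 H p"
    using gcov_add[OF g psd, of p v w] gcov_commute[OF g, of S T r1 p v w]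
    by (simp add: sum H_def)
  have e1: "gcov s t r1 relu2 p = gcov S T r1 K p"
  proof -
    have "gcov s t r1 relu2 p = gcov (S + v\<^sup>2) T r1 F p"
      using gcov_add[OF g psd', of p 0 w] gcov_commute[OF g, of "S + v\<^sup>2" T r1 p 0 w]
      by (simp add: sum F_def)
    also have "\<dots> = gcov S T r1 K p"
      using gcov_add[OF gF psd, of p v 0] gcov_commute[OF gF, of S T r1 p v 0]
      by (simp add: K_def)
    finally show ?thesis .
  qed
  have "\<bar>H q - K q\<bar> \<le> 2 * (v * w)" for q
    using relu_cov_bound[OF v2(3,4), of "fst q" "snd q"]
    by (simp add: H_def K_def F_def relu2_def)
  then show ?thesis unfolding e1 e2 vw by (intro gcov_bounded_diff gH gK)
qed

lemma gcov_relu2_corr: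
  assumes "0 \<le> s" "0 \<le> t" "0 \<le> r1" "0 \<le> r2" "psd s t r1" "psd s t r2"
  shows "\<bar>gcov s t r2 relu2 p - gcov s t r1 relu2 p\<bar> \<le> 2 * \<bar>r2 - r1\<bar>"
  using gcov_relu2_corr_mono[of s t r1 r2 p] gcov_relu2_corr_mono[of s t r2 r1 p] assms
  by (cases "r1 \<le> r2") (auto simp: abs_minus_commute)

lemma abs_sqrt_diff_le:
  assumes "0 < s" "0 \<le> s'"
  shows "\<bar>sqrt s' - sqrt s\<bar> \<le> \<bar>s' - s\<bar> / sqrt s"
proof -
  have p: "0 < sqrt s" using assms by simp
  have "s' - s = (sqrt s' - sqrt s) * (sqrt s' + sqrt s)" using assms by (simp add: algebra_simps)
  then have "\<bar>s' - s\<bar> = \<bar>sqrt s' - sqrt s\<bar> * (sqrt s' + sqrt s)" using assms by (simp add: abs_mult)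
  then have "\<bar>sqrt s' - sqrt s\<bar> * sqrt s \<le> \<bar>s' - s\<bar>" using assms by (simp add: mult_left_mono)
  then show ?thesis using p by (simp add: field_simps)
qed

text \<open>Scale the standard deviations at fixed correlation coefficient, then correct the
  correlation at the new variances. Only the reference matrix must have positive variances. Each
  factor 3 is 1 from the scaling and 2 from re-expressing the correction through r' - r.\<close>

lemma gcov_relu2_diff:
  assumes psd: "psd s t r" "psd s' t' r'" and pos: "0 < s" "0 < t" and r: "0 \<le> r" "0 \<le> r'"
  shows "\<bar>gcov s' t' r' relu2 (x, y) - gcov s t r relu2 (x, y)\<bar>
    \<le> 2 * \<bar>r' - r\<bar> + \<bar>s' - s\<bar> / sqrt s * (\<bar>y\<bar> + 3 * sqrt t') + \<bar>t' - t\<bar> / sqrt t * (\<bar>x\<bar> + 3 * sqrt s)"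
proof -
  define \<alpha> \<kappa> \<tau> where "\<alpha> = sqrt s" and "\<kappa> = r / sqrt s" and "\<tau> = sqrt (t - r\<^sup>2 / s)"
  define \<alpha>' \<beta> \<beta>' l where "\<alpha>' = sqrt s'" and "\<beta> = sqrt t" and "\<beta>' = sqrt t'" and "l = \<beta>' / \<beta>"
  have nn: "0 \<le> s'" "0 \<le> t'" using psd by (auto simp: psd_def)
  have p: "0 < \<alpha>" "0 < \<beta>" "0 \<le> \<alpha>'" "0 \<le> \<beta>'" "0 \<le> l" using nn pos by (auto simp: \<alpha>_def \<beta>_def \<alpha>'_def \<beta>'_def l_def)
  note b = psd_bounds[OF psd(1)]
  have KT: "\<kappa>\<^sup>2 + \<tau>\<^sup>2 = \<beta>\<^sup>2" using b pos by (simp add: \<kappa>_def \<tau>_def \<beta>_def)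
  have rle: "r \<le> \<alpha> * \<beta>"
    using psd(1) unfolding \<alpha>_def \<beta>_def real_sqrt_mult[symmetric] by (intro real_le_rsqrt) (simp add: psd_def)
  define \<rho> where "\<rho> = r / (\<alpha> * \<beta>)"
  have \<rho>: "0 \<le> \<rho>" "\<rho> \<le> 1" "r = \<rho> * (\<alpha> * \<beta>)" using p r rle by (auto simp: \<rho>_def field_simps)
  \<comment> \<open>The intermediate matrix: new variances with the old correlation
    coefficient.\<close>
  define r'' where "r'' = \<rho> * (\<alpha>' * \<beta>')"
  have psd'': "psd s' t' r''"
  proof -
    have "r'' \<le> \<alpha>' * \<beta>'" using \<rho> p by (simp add: r''_def mult_left_le_one_le)
    moreover have "0 \<le> r''" using \<rho> p by (simp add: r''_def)
    ultimately have "r''\<^sup>2 \<le> (\<alpha>' * \<beta>')\<^sup>2" by (intro power_mono) auto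
    then show ?thesis using nn by (simp add: psd_def power_mult_distrib \<alpha>'_def \<beta>'_def)
  qed
  have sc: "gcov s' t' r'' relu2 (x, y) = gop \<alpha>' (l * \<kappa>) (l * \<tau>) relu2 (x, y)"
  proof -
    have "0 \<le> l * \<tau>" using p b by (simp add: \<tau>_def)
    moreover have "\<alpha>'\<^sup>2 = s'" using nn by (simp add: \<alpha>'_def)
    moreover have "(l * \<kappa>)\<^sup>2 + (l * \<tau>)\<^sup>2 = t'"
    proof -
      have "(l * \<kappa>)\<^sup>2 + (l * \<tau>)\<^sup>2 = l\<^sup>2 * (\<kappa>\<^sup>2 + \<tau>\<^sup>2)" by (simp add: power_mult_distrib algebra_simps)
      also have "\<dots> = \<beta>'\<^sup>2" unfolding KT using p by (simp add: l_def power_divide)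
      finally show ?thesis using nn by (simp add: \<beta>'_def)
    qed
    moreover have "\<alpha>' * (l * \<kappa>) = r''"
      using p by (simp add: r''_def l_def \<rho>_def \<kappa>_def \<alpha>_def[symmetric] mult_ac)
    ultimately show ?thesis using gop_eq_gcov[OF pgrow_relu2, of \<alpha>' "l * \<tau>" "l * \<kappa>" "(x, y)"] p by simp
  qed
  have "\<bar>gcov s' t' r'' relu2 (x, y) - gcov s t r relu2 (x, y)\<bar>
     \<le> \<bar>\<alpha>' - \<alpha>\<bar> * (\<bar>y\<bar> + l * \<beta>) + \<bar>l - 1\<bar> * \<beta> * (\<bar>x\<bar> + \<alpha>)"
  proof -
    have "gcov s t r relu2 (x, y) = gop \<alpha> \<kappa> \<tau> relu2 (x, y)" by (simp add: gcov_def \<alpha>_def \<kappa>_def \<tau>_def)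
    then show ?thesis unfolding sc using gop_scale_relu2[of \<alpha> \<alpha>' l \<kappa> \<tau> x y] p by (simp add: KT)
  qed
  also have "l * \<beta> = \<beta>'" using p by (simp add: l_def)
  also have "\<bar>l - 1\<bar> * \<beta> = \<bar>\<beta>' - \<beta>\<bar>"
  proof -
    have "\<bar>l - 1\<bar> * \<beta> = \<bar>(l - 1) * \<beta>\<bar>" using p by (simp add: abs_mult)
    also have "(l - 1) * \<beta> = \<beta>' - \<beta>" using p by (simp add: l_def left_diff_distrib)
    finally show ?thesis .
  qed
  finally have 1: "\<bar>gcov s' t' r'' relu2 (x, y) - gcov s t r relu2 (x, y)\<bar>
     \<le> \<bar>\<alpha>' - \<alpha>\<bar> * (\<bar>y\<bar> + \<beta>') + \<bar>\<beta>' - \<beta>\<bar> * (\<bar>x\<bar> + \<alpha>)" .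
  have 2: "\<bar>gcov s' t' r' relu2 (x, y) - gcov s' t' r'' relu2 (x, y)\<bar> \<le> 2 * \<bar>r' - r''\<bar>"
    using psd psd'' nn r \<rho> p by (intro gcov_relu2_corr) (auto simp: r''_def)
  have 3: "\<bar>r - r''\<bar> \<le> \<bar>\<alpha>' - \<alpha>\<bar> * \<beta>' + \<bar>\<beta>' - \<beta>\<bar> * \<alpha>"
  proof -
    have "r'' - r = \<rho> * ((\<alpha>' - \<alpha>) * \<beta>' + (\<beta>' - \<beta>) * \<alpha>)" by (simp add: r''_def \<rho>(3) algebra_simps)
    then have "\<bar>r'' - r\<bar> = \<rho> * \<bar>(\<alpha>' - \<alpha>) * \<beta>' + (\<beta>' - \<beta>) * \<alpha>\<bar>" using \<rho> by (simp add: abs_mult)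
    also have "\<dots> \<le> \<bar>(\<alpha>' - \<alpha>) * \<beta>' + (\<beta>' - \<beta>) * \<alpha>\<bar>" using \<rho> by (simp add: mult_left_le_one_le)
    also have "\<dots> \<le> \<bar>(\<alpha>' - \<alpha>) * \<beta>'\<bar> + \<bar>(\<beta>' - \<beta>) * \<alpha>\<bar>" by (rule abs_triangle_ineq)
    finally show ?thesis using p by (simp add: abs_mult abs_minus_commute)
  qed
  have "\<bar>gcov s' t' r' relu2 (x, y) - gcov s t r relu2 (x, y)\<bar>
    \<le> 2 * \<bar>r' - r\<bar> + \<bar>\<alpha>' - \<alpha>\<bar> * (\<bar>y\<bar> + 3 * \<beta>') + \<bar>\<beta>' - \<beta>\<bar> * (\<bar>x\<bar> + 3 * \<alpha>)"
  proof -
    have "\<bar>r' - r''\<bar> \<le> \<bar>r' - r\<bar> + \<bar>r - r''\<bar>" by simp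
    moreover have "\<bar>gcov s' t' r' relu2 (x, y) - gcov s t r relu2 (x, y)\<bar>
      \<le> \<bar>gcov s' t' r' relu2 (x, y) - gcov s' t' r'' relu2 (x, y)\<bar> + \<bar>gcov s' t' r'' relu2 (x, y) - gcov s t r relu2 (x, y)\<bar>"
      by simp
    ultimately show ?thesis using 1 2 3 unfolding distrib_left by linarith
  qed
  also have "\<dots> \<le> 2 * \<bar>r' - r\<bar> + \<bar>s' - s\<bar> / sqrt s * (\<bar>y\<bar> + 3 * \<beta>') + \<bar>t' - t\<bar> / sqrt t * (\<bar>x\<bar> + 3 * \<alpha>)"
    using abs_sqrt_diff_le[OF pos(1) nn(1)] abs_sqrt_diff_le[OF pos(2) nn(2)] p
    by (intro add_mono mult_right_mono order_refl) (auto simp: \<alpha>_def \<alpha>'_def \<beta>_def \<beta>'_def)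
  finally show ?thesis by (simp add: \<alpha>_def \<beta>'_def)
qed

section \<open>The closed form of the kernel and the flow\<close>

lemma flow_f_ends [simp]: "flow_f 1 = 1" "flow_f (-1) = 0"
  by (simp_all add: flow_f_def)

text \<open>The two terms with 1 / sqrt(1 - z^2) cancel. The remaining derivative takes values in
  [0, 1], which is the source of monotonicity and of the Lipschitz constant 1.\<close>

lemma flow_f_deriv:
  assumes "-1 < z" "z < 1"
  shows "(flow_f has_real_derivative arcsin z / pi + 1 / 2) (at z)"
proof -
  have z2: "z\<^sup>2 < 1" using assms by (simp add: abs_square_less_1 abs_less_iff)
  then have p: "0 < 1 - z\<^sup>2" by simp
  have 1: "((\<lambda>z. z * arcsin z) has_real_derivative arcsin z + z * inverse (sqrt (1 - z\<^sup>2))) (at z)"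
    by (auto intro!: derivative_eq_intros DERIV_arcsin assms)
  have "((\<lambda>z. 1 - z\<^sup>2) has_real_derivative - 2 * z) (at z)"
    by (auto intro!: derivative_eq_intros)
  from DERIV_chain2[OF DERIV_real_sqrt[OF p] this]
  have 2: "((\<lambda>z. sqrt (1 - z\<^sup>2)) has_real_derivative - z * inverse (sqrt (1 - z\<^sup>2))) (at z)"
    by (simp add: field_simps)
  have "((\<lambda>z. 1 / pi * (z * arcsin z + sqrt (1 - z\<^sup>2)) + 1 / 2 * z) has_real_derivative
    1 / pi * (arcsin z + z * inverse (sqrt (1 - z\<^sup>2)) + - z * inverse (sqrt (1 - z\<^sup>2))) + 1 / 2 * 1) (at z)"
    by (intro DERIV_add DERIV_cmult 1 2 DERIV_ident)
  then show ?thesis unfolding flow_f_def[abs_def] by simp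
qed

lemma flow_f_continuous: "-1 \<le> a \<Longrightarrow> b \<le> 1 \<Longrightarrow> continuous_on {a..b} flow_f"
  unfolding flow_f_def[abs_def] by (intro continuous_intros) auto

lemma flow_f_mono:
  assumes "-1 \<le> a" "a \<le> b" "b \<le> 1"
  shows "flow_f a \<le> flow_f b"
proof (rule DERIV_nonneg_imp_increasing_open[OF assms(2) _ flow_f_continuous[OF assms(1,3)]])
  fix x assume x: "a < x" "x < b"
  then have "- (pi / 2) \<le> arcsin x" using assms by (intro arcsin_lbound) auto
  then have "0 \<le> arcsin x / pi + 1 / 2" by (simp add: field_simps)
  then show "\<exists>y. DERIV flow_f x :> y \<and> 0 \<le> y" using flow_f_deriv[of x] x assms by auto
qed

lemma flow_f_lip_mono:
  assumes "-1 \<le> a" "a \<le> b" "b \<le> 1"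
  shows "flow_f b - flow_f a \<le> b - a"
proof -
  have "a - flow_f a \<le> b - flow_f b"
  proof (rule DERIV_nonneg_imp_increasing_open[OF assms(2)])
    show "continuous_on {a..b} (\<lambda>z. z - flow_f z)"
      by (intro continuous_intros flow_f_continuous assms)
    fix x assume x: "a < x" "x < b"
    then have "arcsin x \<le> pi / 2" using assms by (intro arcsin_ubound) auto
    then have "0 \<le> 1 - (arcsin x / pi + 1 / 2)" by (simp add: field_simps)
    moreover have "DERIV (\<lambda>z. z - flow_f z) x :> 1 - (arcsin x / pi + 1 / 2)"
      using flow_f_deriv[of x] x assms by (intro DERIV_diff DERIV_ident) auto
    ultimately show "\<exists>y. DERIV (\<lambda>z. z - flow_f z) x :> y \<and> 0 \<le> y" by blast
  qed
  then show ?thesis by simp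
qed

lemma flow_f_lipschitz: "a \<in> {-1..1} \<Longrightarrow> b \<in> {-1..1} \<Longrightarrow> \<bar>flow_f a - flow_f b\<bar> \<le> \<bar>a - b\<bar>"
  using flow_f_mono[of a b] flow_f_mono[of b a] flow_f_lip_mono[of a b] flow_f_lip_mono[of b a]
  by (cases "a \<le> b") auto

lemma flow_f_range: "z \<in> {-1..1} \<Longrightarrow> 0 \<le> flow_f z \<and> flow_f z \<le> 1"
  using flow_f_mono[of "-1" z] flow_f_mono[of z 1] by auto

text \<open>The half-line third moment of exp(-x^2), rescaled by x = c z with c^2 = k / 2; Jacobian
  and cube together give the factor c^4. It is the radial integral in slope coordinates, with k = 1
  + w^2.\<close>

lemma nn_integral_cube_exp:
  fixes k :: real
  assumes k: "k > 0"
  shows "(\<integral>\<^sup>+z. ennreal (z ^ 3 * exp (- z\<^sup>2 * k / 2)) * indicator {0..} z \<partial>lborel) = ennreal (2 / k\<^sup>2)"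
proof -
  define c where "c = sqrt (k / 2)"
  have c: "c > 0" "c\<^sup>2 = k / 2" using k by (auto simp: c_def)
  have "(\<integral>\<^sup>+x. ennreal (indicator {0..} x *\<^sub>R (exp (- x\<^sup>2) * x ^ (2 * 1 + 1))) \<partial>lborel) = ennreal (fact 1 / 2)"
  proof -
    note g = gaussian_moment_odd_pos[of 1, unfolded has_bochner_integral_iff]
    show ?thesis unfolding conjunct2[OF g, symmetric]
      by (rule nn_integral_eq_integral[OF conjunct1[OF g]]) (auto simp: indicator_def)
  qed
  then have m: "(\<integral>\<^sup>+x. ennreal (indicator {0..} x * (exp (- x\<^sup>2) * x ^ 3)) \<partial>lborel) = ennreal (1 / 2)"
    by (simp add: numeral_3_eq_3)
  have "(\<integral>\<^sup>+x. ennreal (indicator {0..} x * (exp (- x\<^sup>2) * x ^ 3)) \<partial>lborel)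
    = ennreal \<bar>c\<bar> * (\<integral>\<^sup>+z. ennreal (indicator {0..} (0 + c * z) * (exp (- (0 + c * z)\<^sup>2) * (0 + c * z) ^ 3)) \<partial>lborel)"
    by (rule nn_integral_real_affine) (use c in auto)
  also have "\<dots> = (\<integral>\<^sup>+z. ennreal (c ^ 4) * (ennreal (z ^ 3 * exp (- z\<^sup>2 * k / 2)) * indicator {0..} z) \<partial>lborel)"
  proof (subst nn_integral_cmult[symmetric], measurable, intro nn_integral_cong)
    fix z :: real
    have 1: "indicator {0..} (c * z) = (indicator {0..} z :: real)" using c by (simp add: indicator_def zero_le_mult_iff)
    have 2: "(c * z)\<^sup>2 = z\<^sup>2 * k / 2" by (simp add: power_mult_distrib c)
    have 3: "c * (exp (- (c * z)\<^sup>2) * (c * z) ^ 3) = c ^ 4 * (z ^ 3 * exp (- z\<^sup>2 * k / 2))"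
      unfolding 2 by (simp add: power_mult_distrib power4_eq_xxxx power3_eq_cube)
    show "ennreal \<bar>c\<bar> * ennreal (indicator {0..} (0 + c * z) * (exp (- (0 + c * z)\<^sup>2) * (0 + c * z) ^ 3))
      = ennreal (c ^ 4) * (ennreal (z ^ 3 * exp (- z\<^sup>2 * k / 2)) * indicator {0..} z)"
    proof (cases "0 \<le> z")
      case True
      have "ennreal \<bar>c\<bar> * ennreal (exp (- (c * z)\<^sup>2) * (c * z) ^ 3) = ennreal (c * (exp (- (c * z)\<^sup>2) * (c * z) ^ 3))"
        using c True by (simp add: ennreal_mult)
      also have "\<dots> = ennreal (c ^ 4) * ennreal (z ^ 3 * exp (- z\<^sup>2 * k / 2))"
        unfolding 3 using c True by (simp add: ennreal_mult)
      finally show ?thesis using True c by (simp add: 1)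
    next
      case False
      then show ?thesis by (simp add: 1)
    qed
  qed
  also have "\<dots> = ennreal (c ^ 4) * (\<integral>\<^sup>+z. ennreal (z ^ 3 * exp (- z\<^sup>2 * k / 2)) * indicator {0..} z \<partial>lborel)"
    by (rule nn_integral_cmult) simp
  finally have eq: "ennreal (c ^ 4) * (\<integral>\<^sup>+z. ennreal (z ^ 3 * exp (- z\<^sup>2 * k / 2)) * indicator {0..} z \<partial>lborel) = ennreal (1 / 2)"
    using m by simp
  have "c ^ 4 = (c\<^sup>2)\<^sup>2" by simp
  then have c4: "c ^ 4 = k\<^sup>2 / 4" unfolding c by (simp add: power_divide)
  have "ennreal (c ^ 4) * (\<integral>\<^sup>+z. ennreal (z ^ 3 * exp (- z\<^sup>2 * k / 2)) * indicator {0..} z \<partial>lborel)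
    = ennreal (c ^ 4) * ennreal (2 / k\<^sup>2)"
    unfolding eq using k by (simp add: c4 ennreal_mult[symmetric])
  then show ?thesis using c by (simp add: ennreal_mult_cancel_left)
qed

text \<open>\<open>F\<close> is an explicit primitive with limit c / 4 at infinity. At the lower end
  1 + (c / \<sigma>)^2 = 1 / \<sigma>^2 and arctan(c / \<sigma>) = arcsin c turn it into the square
  root and arcsine of \<open>flow_f\<close>.\<close>

lemma nn_integral_slope:
  fixes c :: real
  assumes c: "-1 < c" "c < 1"
  defines "\<sigma> \<equiv> sqrt (1 - c\<^sup>2)"
  shows "(\<integral>\<^sup>+w. ennreal ((c + \<sigma> * w) / (pi * (1 + w\<^sup>2)\<^sup>2)) * indicator {- c / \<sigma>..} w \<partial>lborel) = ennreal (flow_f c / 2)"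
proof -
  have c2: "c\<^sup>2 < 1" using c by (simp add: abs_square_less_1 abs_less_iff)
  have s: "\<sigma> > 0" "\<sigma>\<^sup>2 = 1 - c\<^sup>2" using c2 by (auto simp: \<sigma>_def)
  define F where "F = (\<lambda>w::real. (c / 2 * (w / (1 + w\<^sup>2) + arctan w) - \<sigma> / (2 * (1 + w\<^sup>2))) / pi)"
  have "(\<integral>\<^sup>+w. ennreal ((c + \<sigma> * w) / (pi * (1 + w\<^sup>2)\<^sup>2)) * indicator {- c / \<sigma>..} w \<partial>lborel) = (c / 4) - F (- c / \<sigma>)"
  proof (rule nn_integral_FTC_atLeast)
    fix w :: real
    have k: "1 + w\<^sup>2 \<noteq> 0" "1 + w\<^sup>2 > 0" by (auto simp: add_pos_nonneg add_nonneg_eq_0_iff)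
    have D1: "((\<lambda>w. 1 + w\<^sup>2) has_real_derivative 2 * w) (at w)"
      by (auto intro!: derivative_eq_intros)
    have 1: "((\<lambda>w. w / (1 + w\<^sup>2) + arctan w) has_real_derivative 2 / (1 + w\<^sup>2)\<^sup>2) (at w)"
    proof (rule DERIV_cong[OF DERIV_add[OF DERIV_divide[OF DERIV_ident D1 k(1)] DERIV_arctan]])
      have e: "inverse (1 + w\<^sup>2) = (1 + w\<^sup>2) / (1 + w\<^sup>2)\<^sup>2" using k by (simp add: power2_eq_square inverse_eq_divide)
      show "(1 * (1 + w\<^sup>2) - w * (2 * w)) / ((1 + w\<^sup>2) * (1 + w\<^sup>2)) + inverse (1 + w\<^sup>2) = 2 / (1 + w\<^sup>2)\<^sup>2"
        unfolding e power2_eq_square[of "1 + w\<^sup>2"] add_divide_distrib[symmetric] by (simp add: power2_eq_square)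
    qed
    have 2: "((\<lambda>w. 1 / (2 * (1 + w\<^sup>2))) has_real_derivative - w / (1 + w\<^sup>2)\<^sup>2) (at w)"
    proof (rule DERIV_cong[OF DERIV_divide[OF DERIV_const[of 1] DERIV_cmult[OF D1, of 2]]])
      show "2 * (1 + w\<^sup>2) \<noteq> 0" using k by simp
      show "(0 * (2 * (1 + w\<^sup>2)) - 1 * (2 * (2 * w))) / (2 * (1 + w\<^sup>2) * (2 * (1 + w\<^sup>2))) = - w / (1 + w\<^sup>2)\<^sup>2"
        using k unfolding power2_eq_square[of "1 + w\<^sup>2"] by (simp add: divide_simps) (simp add: algebra_simps)
    qed
    have "((\<lambda>w. (c / 2 * (w / (1 + w\<^sup>2) + arctan w) - \<sigma> * (1 / (2 * (1 + w\<^sup>2)))) / pi) has_real_derivative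
      (c / 2 * (2 / (1 + w\<^sup>2)\<^sup>2) - \<sigma> * (- w / (1 + w\<^sup>2)\<^sup>2)) / pi) (at w)"
      by (intro DERIV_cdivide DERIV_diff DERIV_cmult 1 2)
    moreover have "(c / 2 * (2 / (1 + w\<^sup>2)\<^sup>2) - \<sigma> * (- w / (1 + w\<^sup>2)\<^sup>2)) / pi = (c + \<sigma> * w) / (pi * (1 + w\<^sup>2)\<^sup>2)"
      using k by (simp add: field_simps)
    ultimately show "DERIV F w :> (c + \<sigma> * w) / (pi * (1 + w\<^sup>2)\<^sup>2)" by (simp add: F_def)
    show "0 \<le> (c + \<sigma> * w) / (pi * (1 + w\<^sup>2)\<^sup>2)" if "- c / \<sigma> \<le> w"
      using that s by (simp add: field_simps)
    have "((\<lambda>w::real. w / (1 + w\<^sup>2)) \<longlongrightarrow> 0) at_top" "((\<lambda>w::real. \<sigma> / (2 * (1 + w\<^sup>2))) \<longlongrightarrow> 0) at_top"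
    proof -
      have inv: "((\<lambda>w::real. 1 / w) \<longlongrightarrow> 0) at_top"
        using tendsto_inverse_0_at_top[OF filterlim_ident] by (simp add: inverse_eq_divide)
      show L: "((\<lambda>w::real. w / (1 + w\<^sup>2)) \<longlongrightarrow> 0) at_top"
      proof (rule tendsto_sandwich[OF _ _ tendsto_const inv])
        show "eventually (\<lambda>w::real. 0 \<le> w / (1 + w\<^sup>2)) at_top"
          using eventually_ge_at_top[of 0] by eventually_elim simp
        show "eventually (\<lambda>w::real. w / (1 + w\<^sup>2) \<le> 1 / w) at_top"
          using eventually_gt_at_top[of 0]
        proof eventually_elim
          fix w :: real assume "0 < w"
          moreover from this have "0 < 1 + w\<^sup>2" by (simp add: add_pos_nonneg)
          ultimately show "w / (1 + w\<^sup>2) \<le> 1 / w" by (simp add: field_simps power2_eq_square)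
        qed
      qed
      show "((\<lambda>w::real. \<sigma> / (2 * (1 + w\<^sup>2))) \<longlongrightarrow> 0) at_top"
      proof (rule tendsto_sandwich[OF _ _ tendsto_const])
        show "((\<lambda>w. \<sigma> * (w / (1 + w\<^sup>2))) \<longlongrightarrow> 0) at_top" using tendsto_mult_left[OF L, of \<sigma>] by simp
        show "eventually (\<lambda>w::real. 0 \<le> \<sigma> / (2 * (1 + w\<^sup>2))) at_top"
          using s by (intro always_eventually allI divide_nonneg_nonneg) auto
        show "eventually (\<lambda>w::real. \<sigma> / (2 * (1 + w\<^sup>2)) \<le> \<sigma> * (w / (1 + w\<^sup>2))) at_top"
          using eventually_ge_at_top[of 1]
        proof eventually_elim
          fix w :: real assume w: "1 \<le> w"
          have k: "0 < 1 + w\<^sup>2" by (simp add: add_pos_nonneg)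
          have "\<sigma> / (2 * (1 + w\<^sup>2)) = \<sigma> * (1 / 2) / (1 + w\<^sup>2)" by simp
          also have "\<dots> \<le> \<sigma> * w / (1 + w\<^sup>2)" using s w k by (intro divide_right_mono mult_left_mono) auto
          finally show "\<sigma> / (2 * (1 + w\<^sup>2)) \<le> \<sigma> * (w / (1 + w\<^sup>2))" by simp
        qed
      qed
    qed
    then have "(F \<longlongrightarrow> (c / 2 * (0 + pi / 2) - 0) / pi) at_top"
      unfolding F_def by (intro tendsto_intros tendsto_arctan_at_top) auto
    then show "(F \<longlongrightarrow> c / 4) at_top" by simp
  qed measurable
  also have "c / 4 - F (- c / \<sigma>) = flow_f c / 2"
  proof -
    have "1 + (- c / \<sigma>)\<^sup>2 = 1 / \<sigma>\<^sup>2" using s by (simp add: power_divide field_simps)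
    then have k: "1 + (- c / \<sigma>)\<^sup>2 = 1 / (\<sigma> * \<sigma>)" by (simp add: power2_eq_square)
    have at: "arctan (- c / \<sigma>) = - arcsin c" using arcsin_arctan[OF c] by (simp add: \<sigma>_def arctan_minus)
    have "F (- c / \<sigma>) = (c / 2 * (- c * \<sigma> - arcsin c) - \<sigma> * \<sigma>\<^sup>2 / 2) / pi"
      unfolding F_def k at using s(1) by (simp add: power2_eq_square)
    also have "\<dots> = - (\<sigma> + c * arcsin c) / (2 * pi)"
      unfolding s(2) by (simp add: field_simps power2_eq_square)
    finally show ?thesis unfolding flow_f_def \<sigma>_def[symmetric] by (simp add: field_simps)
  qed
  finally show ?thesis .
qed

text \<open>The substitution \<open>u = w z\<close> (slope coordinates) decouples the two integrations.\<close>

lemma gauss_relu_corr: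
  assumes c: "-1 < c" "c < 1"
  shows "(\<integral>z. \<integral>u. relu z * relu (c * z + sqrt (1 - c\<^sup>2) * u) \<partial>gauss \<partial>gauss) = flow_f c / 2"
proof -
  define \<sigma> where "\<sigma> = sqrt (1 - c\<^sup>2)"
  have c2: "c\<^sup>2 < 1" using c by (simp add: abs_square_less_1 abs_less_iff)
  have s: "\<sigma> > 0" using c2 by (auto simp: \<sigma>_def)
  have [measurable]: "relu \<in> borel_measurable borel" by (simp add: relu_def[abs_def])
  have pg: "pgrow (\<lambda>q::real\<times>real. relu (fst q) * relu (c * fst q + \<sigma> * snd q))" by (intro pbd_intros)
  define I where "I = (\<integral>z. \<integral>u. relu z * relu (c * z + \<sigma> * u) \<partial>gauss \<partial>gauss)"
  have "ennreal I = ennreal (\<integral>q. relu (fst q) * relu (c * fst q + \<sigma> * snd q) \<partial>(gauss \<Otimes>\<^sub>M gauss))"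
    using gg.integral_fst'[OF pgrow_integrable2[OF pg]] by (simp add: I_def)
  also have "\<dots> = (\<integral>\<^sup>+q. ennreal (relu (fst q) * relu (c * fst q + \<sigma> * snd q)) \<partial>(gauss \<Otimes>\<^sub>M gauss))"
    by (rule nn_integral_eq_integral[symmetric, OF pgrow_integrable2[OF pg]]) (simp add: relu_bounds)
  also have "\<dots> = (\<integral>\<^sup>+z. \<integral>\<^sup>+u. ennreal (relu z * relu (c * z + \<sigma> * u)) \<partial>gauss \<partial>gauss)"
    by (subst gauss.nn_integral_fst[symmetric]) auto
  also have "\<dots> = (\<integral>\<^sup>+z. \<integral>\<^sup>+u. ennreal (std_normal_density z * std_normal_density u) * ennreal (relu z * relu (c * z + \<sigma> * u)) \<partial>lborel \<partial>lborel)"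
    using nn_integral_gauss2[of "\<lambda>q. ennreal (relu (fst q) * relu (c * fst q + \<sigma> * snd q))"] by simp
  also have "\<dots> = (\<integral>\<^sup>+z. \<integral>\<^sup>+w. ennreal (relu (c + \<sigma> * w) / (2 * pi)) * (ennreal (z ^ 3 * exp (- z\<^sup>2 * (1 + w\<^sup>2) / 2)) * indicator {0..} z) \<partial>lborel \<partial>lborel)"
  proof (rule nn_integral_cong)
    fix z :: real
    show "(\<integral>\<^sup>+u. ennreal (std_normal_density z * std_normal_density u) * ennreal (relu z * relu (c * z + \<sigma> * u)) \<partial>lborel)
      = (\<integral>\<^sup>+w. ennreal (relu (c + \<sigma> * w) / (2 * pi)) * (ennreal (z ^ 3 * exp (- z\<^sup>2 * (1 + w\<^sup>2) / 2)) * indicator {0..} z) \<partial>lborel)"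
    proof (cases "z > 0")
      case False
      then have "relu z = 0" "z ^ 3 * indicator {0..} z = 0" by (auto simp: relu_def indicator_def)
      then show ?thesis using False by (cases "z = 0") (auto simp: indicator_def)
    next
      case True
      \<comment> \<open>The cube of z collects the Jacobian, relu z = z and one factor from the
        homogeneity of relu; what remains depends on w alone, apart from the exponential.\<close>
      have e: "z * (std_normal_density z * std_normal_density (z * w) * (relu z * relu (c * z + \<sigma> * (z * w))))
         = relu (c + \<sigma> * w) / (2 * pi) * (z ^ 3 * exp (- z\<^sup>2 * (1 + w\<^sup>2) / 2))" for w
      proof -
        have "relu (c * z + \<sigma> * (z * w)) = z * relu (c + \<sigma> * w)"
          using relu_mult[of z "c + \<sigma> * w"] True by (simp add: algebra_simps)
        moreover have "relu z = z" using True by (simp add: relu_def)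
        moreover have "std_normal_density z * std_normal_density (z * w) = exp (- z\<^sup>2 * (1 + w\<^sup>2) / 2) / (2 * pi)"
          by (simp add: std_normal_density_def exp_add[symmetric] power_mult_distrib algebra_simps add_divide_distrib diff_divide_distrib)
        ultimately show ?thesis by (simp add: power3_eq_cube)
      qed
      have "(\<integral>\<^sup>+u. ennreal (std_normal_density z * std_normal_density u) * ennreal (relu z * relu (c * z + \<sigma> * u)) \<partial>lborel)
        = ennreal \<bar>z\<bar> * (\<integral>\<^sup>+w. ennreal (std_normal_density z * std_normal_density (0 + z * w)) * ennreal (relu z * relu (c * z + \<sigma> * (0 + z * w))) \<partial>lborel)"
        by (rule nn_integral_real_affine) (use True in auto)
      also have "\<dots> = (\<integral>\<^sup>+w. ennreal (z * (std_normal_density z * std_normal_density (z * w) * (relu z * relu (c * z + \<sigma> * (z * w))))) \<partial>lborel)"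
        using True by (subst nn_integral_cmult[symmetric]) (auto simp: ennreal_mult'[symmetric] relu_bounds intro!: nn_integral_cong)
      also have "\<dots> = (\<integral>\<^sup>+w. ennreal (relu (c + \<sigma> * w) / (2 * pi)) * (ennreal (z ^ 3 * exp (- z\<^sup>2 * (1 + w\<^sup>2) / 2)) * indicator {0..} z) \<partial>lborel)"
        unfolding e using True by (intro nn_integral_cong) (simp add: ennreal_mult'[symmetric] relu_bounds)
      finally show ?thesis .
    qed
  qed
  also have "\<dots> = (\<integral>\<^sup>+w. \<integral>\<^sup>+z. ennreal (relu (c + \<sigma> * w) / (2 * pi)) * (ennreal (z ^ 3 * exp (- z\<^sup>2 * (1 + w\<^sup>2) / 2)) * indicator {0..} z) \<partial>lborel \<partial>lborel)"
    by (rule lborel_pair.Fubini') simp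
  also have "\<dots> = (\<integral>\<^sup>+w. ennreal ((c + \<sigma> * w) / (pi * (1 + w\<^sup>2)\<^sup>2)) * indicator {- c / \<sigma>..} w \<partial>lborel)"
  proof (rule nn_integral_cong)
    fix w :: real
    have k: "1 + w\<^sup>2 > 0" by (auto simp: add_pos_nonneg)
    have "(\<integral>\<^sup>+z. ennreal (relu (c + \<sigma> * w) / (2 * pi)) * (ennreal (z ^ 3 * exp (- z\<^sup>2 * (1 + w\<^sup>2) / 2)) * indicator {0..} z) \<partial>lborel)
       = ennreal (relu (c + \<sigma> * w) / (2 * pi)) * ennreal (2 / (1 + w\<^sup>2)\<^sup>2)"
      unfolding nn_integral_cube_exp[OF k, symmetric] by (rule nn_integral_cmult) simp
    also have "\<dots> = ennreal (relu (c + \<sigma> * w) / (pi * (1 + w\<^sup>2)\<^sup>2))"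
      by (subst ennreal_mult'[symmetric]) (auto simp: relu_bounds)
    also have "\<dots> = ennreal ((c + \<sigma> * w) / (pi * (1 + w\<^sup>2)\<^sup>2)) * indicator {- c / \<sigma>..} w"
      using s by (auto simp: relu_def indicator_def max_def field_simps)
    finally show "(\<integral>\<^sup>+z. ennreal (relu (c + \<sigma> * w) / (2 * pi)) * (ennreal (z ^ 3 * exp (- z\<^sup>2 * (1 + w\<^sup>2) / 2)) * indicator {0..} z) \<partial>lborel)
      = ennreal ((c + \<sigma> * w) / (pi * (1 + w\<^sup>2)\<^sup>2)) * indicator {- c / \<sigma>..} w" .
  qed
  also have "\<dots> = ennreal (flow_f c / 2)" using nn_integral_slope[OF c] by (simp add: \<sigma>_def)
  finally have eq: "ennreal I = ennreal (flow_f c / 2)" .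
  have "0 \<le> I" unfolding I_def by (intro Bochner_Integration.integral_nonneg mult_nonneg_nonneg relu_bounds)
  moreover have "0 \<le> flow_f c / 2"
    using flow_f_mono[of "-1" c] c by simp
  ultimately show ?thesis using eq by (simp add: I_def \<sigma>_def)
qed


text \<open>By homogeneity of relu the standard deviations factor out. This identifies the
  right-hand side of the flow with the mean of relu(X) relu(Y). The values c = 1 and c = -1, where
  the slope coordinates degenerate, are computed directly.\<close>

lemma gcov_relu2_0:
  assumes st: "0 < s" "0 < t" and c: "c \<in> {-1..1}" and r: "r = c * (sqrt s * sqrt t)"
  shows "gcov s t r relu2 (0, 0) = flow_f c / 2 * (sqrt s * sqrt t)"
proof -
  define \<sigma> where "\<sigma> = sqrt (1 - c\<^sup>2)"
  have c2: "0 \<le> 1 - c\<^sup>2" using c by (simp add: abs_square_le_1 abs_le_iff)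
  have p: "0 < sqrt s" "0 < sqrt t" using st by auto
  have 1: "r / sqrt s = sqrt t * c" using p by (simp add: r)
  have 2: "sqrt (t - r\<^sup>2 / s) = sqrt t * \<sigma>"
  proof -
    have "r\<^sup>2 / s = t * c\<^sup>2" using st by (simp add: r power_mult_distrib)
    then have "t - r\<^sup>2 / s = t * (1 - c\<^sup>2)" by (simp add: algebra_simps)
    then show ?thesis by (simp add: \<sigma>_def real_sqrt_mult)
  qed
  have "gcov s t r relu2 (0, 0) = (\<integral>u. \<integral>z. relu (sqrt s * z) * relu (sqrt t * (c * z + \<sigma> * u)) \<partial>gauss \<partial>gauss)"
    unfolding gcov_def gop_def 1 2 relu2_def by (simp add: algebra_simps)
  also have "\<dots> = (\<integral>u. \<integral>z. (sqrt s * sqrt t) * (relu z * relu (c * z + \<sigma> * u)) \<partial>gauss \<partial>gauss)"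
  proof -
    have "relu (sqrt s * z) * relu (sqrt t * v) = (sqrt s * sqrt t) * (relu z * relu v)" for z v
      using p by (simp add: relu_mult)
    then show ?thesis by (simp only:)
  qed
  also have "\<dots> = (sqrt s * sqrt t) * (\<integral>u. \<integral>z. relu z * relu (c * z + \<sigma> * u) \<partial>gauss \<partial>gauss)" by simp
  also have "(\<integral>u. \<integral>z. relu z * relu (c * z + \<sigma> * u) \<partial>gauss \<partial>gauss) = flow_f c / 2"
  proof -
    consider "c = 1" | "c = -1" | "-1 < c" "c < 1" using c by fastforce
    then show ?thesis
    proof cases
      case 1
      then show ?thesis using gauss_relu_square by (simp add: \<sigma>_def power2_eq_square)
    next
      case 2
      have e: "relu z * relu (- z) = 0" for z by (auto simp: relu_def max_def)
      have "(\<integral>z. relu z * relu (- z) \<partial>gauss) = 0" unfolding e by simp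
      then show ?thesis using 2 by (simp add: \<sigma>_def)
    next
      case 3
      have "pgrow (\<lambda>q::real\<times>real. relu (snd q) * relu (c * snd q + \<sigma> * fst q))" by (intro pbd_intros)
      from gauss_Fubini[OF this] gauss_relu_corr[OF 3] show ?thesis by (simp add: \<sigma>_def)
    qed
  qed
  finally show ?thesis by simp
qed


section \<open>Estimates for the covariance flow\<close>

text \<open>The lower bound makes the variances of a flow increment at least proportional to the
  elapsed time; this controls how fast the smoothing degenerates.\<close>

lemma exp_half_bounds:
  fixes s t :: real
  assumes "0 \<le> s" "s \<le> t" "t \<le> 1"
  shows "(t - s) / 2 \<le> exp (t / 2) - exp (s / 2)" "exp (t / 2) - exp (s / 2) \<le> t - s"
    "1 \<le> exp (t / 2)" "exp (t / 2) \<le> 2"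
proof -
  show 1: "1 \<le> exp (t / 2)" using assms by simp
  have "exp (t / 2) \<le> exp (1 / 2)" using assms by simp
  also have "exp (1 / 2 :: real) \<le> 1 + 1 / 2 + (1 / 2)\<^sup>2" by (rule exp_bound) auto
  also have "\<dots> \<le> 2" by (simp add: power2_eq_square)
  finally show 2: "exp (t / 2) \<le> 2" .
  have s1: "1 \<le> exp (s / 2)" using assms by simp
  have e: "(t - s) / 2 \<le> exp ((t - s) / 2) - 1" using exp_ge_add_one_self[of "(t - s) / 2"] by linarith
  have "1 * ((t - s) / 2) \<le> exp (s / 2) * (exp ((t - s) / 2) - 1)"
    by (rule mult_mono[OF s1 e]) (use assms in auto)
  also have "\<dots> = exp (t / 2) - exp (s / 2)"
    by (simp add: algebra_simps exp_add[symmetric] diff_divide_distrib)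
  finally show "(t - s) / 2 \<le> exp (t / 2) - exp (s / 2)" by simp
  have e: "1 - exp (- ((t - s) / 2)) \<le> (t - s) / 2" using exp_ge_add_one_self[of "- ((t - s) / 2)"] by linarith
  have "exp (t / 2) * (1 - exp (- ((t - s) / 2))) \<le> 2 * ((t - s) / 2)"
    by (rule mult_mono[OF 2 e]) (use assms in auto)
  moreover have "exp (t / 2) * (1 - exp (- ((t - s) / 2))) = exp (t / 2) - exp (s / 2)"
    by (simp add: algebra_simps exp_add[symmetric] diff_divide_distrib)
  ultimately show "exp (t / 2) - exp (s / 2) \<le> t - s" by simp
qed

lemma exp_half_taylor:
  fixes t \<delta> :: real
  assumes "0 \<le> t" "0 \<le> \<delta>" "t + \<delta> \<le> 1"
  shows "\<bar>exp ((t + \<delta>) / 2) - exp (t / 2) - \<delta> * (exp (t / 2) / 2)\<bar> \<le> \<delta>\<^sup>2"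
proof -
  have 1: "1 + \<delta> / 2 \<le> exp (\<delta> / 2)" by (rule exp_ge_add_one_self)
  have 2: "exp (\<delta> / 2) \<le> 1 + \<delta> / 2 + (\<delta> / 2)\<^sup>2" by (rule exp_bound) (use assms in auto)
  have 3: "0 \<le> exp (\<delta> / 2) - 1 - \<delta> / 2" "exp (\<delta> / 2) - 1 - \<delta> / 2 \<le> (\<delta> / 2)\<^sup>2" using 1 2 by linarith+
  have "exp (t / 2) \<le> 2" using exp_half_bounds(4)[of t t] assms by simp
  from mult_mono[OF this 3(2)] 3 have "exp (t / 2) * (exp (\<delta> / 2) - 1 - \<delta> / 2) \<le> 2 * (\<delta> / 2)\<^sup>2" by simp
  moreover have "0 \<le> exp (t / 2) * (exp (\<delta> / 2) - 1 - \<delta> / 2)" using 3 by (intro mult_nonneg_nonneg) auto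
  moreover have "exp (t / 2) * (exp (\<delta> / 2) - 1 - \<delta> / 2) = exp ((t + \<delta>) / 2) - exp (t / 2) - \<delta> * (exp (t / 2) / 2)"
    by (simp add: algebra_simps exp_add[symmetric] add_divide_distrib)
  moreover have "2 * (\<delta> / 2)\<^sup>2 \<le> \<delta>\<^sup>2" by (simp add: power2_eq_square)
  ultimately show ?thesis by linarith
qed

text \<open>On the diagonal the correlation is 1 and f(1) = 1, so the equation is the linear one q'
  = q / 2 and q exp(-t / 2) is constant.\<close>

lemma covariance_flow_diag:
  fixes x :: "real ^ 'd::finite"
  assumes q: "covariance_flow q" and x: "x \<noteq> 0" and t: "t \<in> {0..1}"
  shows "q t x x = (norm x)\<^sup>2 / real CARD('d) * exp (t / 2)"
proof -
  have rhs: "flow_rhs (q s) x x = q s x x / 2" if "s \<in> {0..1}" for s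
  proof -
    have "0 < q s x x" using q x that by (auto simp: covariance_flow_def)
    then have "flow_corr (q s) x x = 1" by (simp add: flow_corr_def)
    then show ?thesis by (simp add: flow_rhs_def)
  qed
  have "\<exists>c. \<forall>s\<in>{0..1}. q s x x * exp (- s / 2) = c"
  proof (rule has_field_derivative_zero_constant)
    fix s :: real assume s: "s \<in> {0..1}"
    have "((\<lambda>s. q s x x) has_real_derivative q s x x / 2) (at s within {0..1})"
      using q x s rhs[OF s] unfolding covariance_flow_def by metis
    moreover have "((\<lambda>s. exp (- s / 2)) has_real_derivative - exp (- s / 2) / 2) (at s within {0..1})"
      by (auto intro!: derivative_eq_intros)
    ultimately have "((\<lambda>s. q s x x * exp (- s / 2)) has_real_derivative
        q s x x / 2 * exp (- s / 2) + - exp (- s / 2) / 2 * q s x x) (at s within {0..1})"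
      by (rule DERIV_mult)
    then show "((\<lambda>s. q s x x * exp (- s / 2)) has_real_derivative 0) (at s within {0..1})" by simp
  qed simp
  then obtain c where c: "\<And>s. s \<in> {0..1} \<Longrightarrow> q s x x * exp (- s / 2) = c" by blast
  have "q 0 x x = (norm x)\<^sup>2 / real CARD('d)"
    using q x by (simp add: covariance_flow_def power2_norm_eq_inner)
  then have "q t x x * exp (- t / 2) = (norm x)\<^sup>2 / real CARD('d)" using c[of 0] c[OF t] by simp
  then have "q t x x * exp (- t / 2) * exp (t / 2) = (norm x)\<^sup>2 / real CARD('d) * exp (t / 2)" by simp
  then show ?thesis by (simp add: mult.assoc exp_add[symmetric])
qed

text \<open>The only facts about the flow used in the probabilistic part:
  increments are positive semidefinite with a nonnegative off-diagonal entry, and one explicit Euler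
  step has quadratic error.\<close>

definition flow_path :: "real \<Rightarrow> real \<Rightarrow> (real \<Rightarrow> real) \<Rightarrow> bool" where
  "flow_path \<alpha> \<beta> u \<longleftrightarrow> 0 < \<alpha> \<and> 0 < \<beta> \<and>
     (\<forall>t\<in>{0..1}. \<bar>u t\<bar> \<le> sqrt (\<alpha> * \<beta>) * exp (t / 2)) \<and>
     (\<forall>s t. 0 \<le> s \<longrightarrow> s \<le> t \<longrightarrow> t \<le> 1 \<longrightarrow> 0 \<le> u t - u s \<and> u t - u s \<le> sqrt (\<alpha> * \<beta>) * (exp (t / 2) - exp (s / 2))) \<and>
     (\<forall>t \<delta>. 0 \<le> t \<longrightarrow> 0 \<le> \<delta> \<longrightarrow> t + \<delta> \<le> 1 \<longrightarrow>
        \<bar>u (t + \<delta>) - u t - \<delta> * gcov (\<alpha> * exp (t / 2)) (\<beta> * exp (t / 2)) (u t) relu2 (0, 0)\<bar> \<le> 2 * sqrt (\<alpha> * \<beta>) * \<delta>\<^sup>2)"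

text \<open>Let v be the geometric mean of the two diagonal entries and c = u / v. The equation
  reads u' = f(c) v / 2, while v' = v / 2. As 0 <= f <= 1, both u and v - u are nondecreasing; this
  gives the sign of the increments and, for the matrices, their semidefiniteness.\<close>

lemma covariance_flow_path:
  fixes a b :: "real ^ 'd::finite"
  assumes q: "covariance_flow q" and ab: "a \<noteq> 0" "b \<noteq> 0"
  shows "flow_path ((norm a)\<^sup>2 / real CARD('d)) ((norm b)\<^sup>2 / real CARD('d)) (\<lambda>t. q t a b)"
proof -
  define \<alpha> \<beta> where "\<alpha> = (norm a)\<^sup>2 / real CARD('d)" and "\<beta> = (norm b)\<^sup>2 / real CARD('d)"
  define u where "u = (\<lambda>t. q t a b)"
  define g where "g = sqrt (\<alpha> * \<beta>)"
  define v where "v = (\<lambda>t::real. g * exp (t / 2))"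
  define c where "c = (\<lambda>t. u t / v t)"
  define F where "F = (\<lambda>t. flow_f (c t) * v t)"
  have pos: "0 < \<alpha>" "0 < \<beta>" using ab by (auto simp: \<alpha>_def \<beta>_def)
  then have g: "0 < g" by (simp add: g_def)
  have v: "0 < v t" for t using g by (simp add: v_def)
  have sv: "sqrt (\<alpha> * exp (t / 2)) * sqrt (\<beta> * exp (t / 2)) = v t" for t
  proof -
    have "sqrt (\<alpha> * exp (t / 2)) * sqrt (\<beta> * exp (t / 2)) = sqrt ((\<alpha> * \<beta>) * (exp (t / 2))\<^sup>2)"
      unfolding real_sqrt_mult[symmetric] by (simp add: power2_eq_square mult_ac)
    then show ?thesis by (simp add: v_def g_def real_sqrt_mult)
  qed
  have qd: "q t a a = \<alpha> * exp (t / 2)" "q t b b = \<beta> * exp (t / 2)" if "t \<in> {0..1}" for t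
    using covariance_flow_diag[OF q ab(1) that] covariance_flow_diag[OF q ab(2) that]
    by (simp_all add: \<alpha>_def \<beta>_def)
  have corr: "flow_corr (q t) a b = c t" if "t \<in> {0..1}" for t
    by (simp add: flow_corr_def qd[OF that] sv c_def u_def)
  have c: "c t \<in> {-1..1}" if "t \<in> {0..1}" for t
  proof -
    have "flow_corr (q t) a b \<in> {-1..1}" using q ab that unfolding covariance_flow_def by blast
    then show ?thesis using corr[OF that] by simp
  qed
  have uc: "u t = c t * v t" for t using v[of t] by (simp add: c_def)
  have rhs: "flow_rhs (q t) a b = F t / 2" if t: "t \<in> {0..1}" for t
    unfolding flow_rhs_def corr[OF t] Let_def qd[OF t] using sv[of t] uc[of t] v[of t]
    by (simp add: F_def u_def mult.assoc)
  have du: "(u has_real_derivative F t / 2) (at t within {0..1})" if t: "t \<in> {0..1}" for t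
    unfolding rhs[OF t, symmetric] u_def using q ab t unfolding covariance_flow_def by blast
  have F: "0 \<le> F t \<and> F t \<le> v t" if t: "t \<in> {0..1}" for t
    using flow_f_range[OF c[OF t]] v[of t] by (simp add: F_def mult_left_le_one_le)
  have dv: "(v has_real_derivative v t / 2) (at t within {0..1})" for t
    unfolding v_def by (auto intro!: derivative_eq_intros)
  have mvt: "\<exists>z\<in>{s..t}. w t - w s = (t - s) * w' z" if st: "0 \<le> s" "s \<le> t" "t \<le> 1"
    and w: "\<And>t. t \<in> {0..1} \<Longrightarrow> (w has_real_derivative w' t) (at t within {0..1})" for w w' :: "real \<Rightarrow> real" and s t
  proof -
    have "\<exists>z\<in>{s..t}. w t - w s = (\<lambda>x. w' z * x) (t - s)"
    proof (rule mvt_very_simple[OF st(2)])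
      fix x assume x: "s \<le> x" "x \<le> t"
      have "(w has_real_derivative w' x) (at x within {s..t})"
        using w[of x] x st by (auto intro: DERIV_subset)
      then show "(w has_derivative (\<lambda>y. w' x * y)) (at x within {s..t})" by (simp add: has_field_derivative_def)
    qed
    then show ?thesis by (simp add: mult.commute)
  qed
  have incr: "0 \<le> u t - u s \<and> u t - u s \<le> v t - v s" if st: "0 \<le> s" "s \<le> t" "t \<le> 1" for s t
  proof -
    obtain z where z: "z \<in> {s..t}" "u t - u s = (t - s) * (F z / 2)" using mvt[OF st du] by blast
    have "((\<lambda>t. v t - u t) has_real_derivative v t / 2 - F t / 2) (at t within {0..1})" if "t \<in> {0..1}" for t
      by (intro DERIV_diff dv du that)
    from mvt[OF st this] obtain y where y: "y \<in> {s..t}" "(v t - u t) - (v s - u s) = (t - s) * (v y / 2 - F y / 2)" by blast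
    have "0 \<le> (t - s) * (F z / 2)" using F[of z] z st by (intro mult_nonneg_nonneg) auto
    moreover have "0 \<le> (t - s) * (v y / 2 - F y / 2)" using F[of y] y st by (intro mult_nonneg_nonneg) auto
    ultimately show ?thesis using z y by simp
  qed
  \<comment> \<open>The Euler error only needs F = f(c) v to be Lipschitz along the path. The 3 is
    one for the change of v under bounded f, and two for the change of c, rewritten as (c z - c t) v
    t = (u z - u t) - c z (v z - v t).\<close>
  have Flip: "\<bar>F z - F t\<bar> \<le> 3 * (v z - v t)" if st: "0 \<le> t" "t \<le> z" "z \<le> 1" for t z
  proof -
    have I: "t \<in> {0..1}" "z \<in> {0..1}" using st by auto
    have vm: "v t \<le> v z" using incr[OF st] by linarith
    have "F z - F t = flow_f (c z) * (v z - v t) + (flow_f (c z) - flow_f (c t)) * v t" by (simp add: F_def algebra_simps)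
    then have "\<bar>F z - F t\<bar> \<le> \<bar>flow_f (c z) * (v z - v t)\<bar> + \<bar>(flow_f (c z) - flow_f (c t)) * v t\<bar>" by simp
    also have "\<dots> \<le> (v z - v t) + \<bar>c z - c t\<bar> * v t"
    proof (rule add_mono)
      show "\<bar>flow_f (c z) * (v z - v t)\<bar> \<le> v z - v t"
        using flow_f_range[OF c[OF I(2)]] vm by (simp add: abs_mult mult_left_le_one_le)
      show "\<bar>(flow_f (c z) - flow_f (c t)) * v t\<bar> \<le> \<bar>c z - c t\<bar> * v t"
        using flow_f_lipschitz[OF c[OF I(2)] c[OF I(1)]] v[of t] by (simp add: abs_mult mult_right_mono)
    qed
    also have "\<bar>c z - c t\<bar> * v t = \<bar>(u z - u t) - c z * (v z - v t)\<bar>"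
    proof -
      have "\<bar>c z - c t\<bar> * v t = \<bar>(c z - c t) * v t\<bar>" using v[of t] by (simp add: abs_mult)
      also have "(c z - c t) * v t = (u z - u t) - c z * (v z - v t)" using uc[of z] uc[of t] by (simp add: algebra_simps)
      finally show ?thesis .
    qed
    also have "\<dots> \<le> \<bar>u z - u t\<bar> + \<bar>c z * (v z - v t)\<bar>" by simp
    also have "\<dots> \<le> (v z - v t) + (v z - v t)"
      using incr[OF st] c[OF I(2)] vm by (intro add_mono) (auto simp: abs_mult mult_left_le_one_le)
    finally show ?thesis by simp
  qed
  have gc: "gcov (\<alpha> * exp (t / 2)) (\<beta> * exp (t / 2)) (u t) relu2 (0, 0) = F t / 2" if t: "t \<in> {0..1}" for t
    using gcov_relu2_0[OF _ _ c[OF t], of "\<alpha> * exp (t / 2)" "\<beta> * exp (t / 2)" "u t"] pos uc[of t]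
    by (simp add: sv F_def)
  show ?thesis
    unfolding flow_path_def \<alpha>_def[symmetric] \<beta>_def[symmetric] u_def[symmetric] g_def[symmetric]
  proof (intro conjI allI impI ballI)
    show "0 < \<alpha>" "0 < \<beta>" by (fact pos)+
    show "\<bar>u t\<bar> \<le> g * exp (t / 2)" if "t \<in> {0..1}" for t
    proof -
      have "\<bar>u t\<bar> = \<bar>c t\<bar> * v t" using v[of t] by (simp add: uc[of t] abs_mult)
      also have "\<dots> \<le> 1 * v t" using c[OF that] v[of t] by (intro mult_right_mono) auto
      finally show ?thesis by (simp add: v_def)
    qed
    fix s t :: real assume st: "0 \<le> s" "s \<le> t" "t \<le> 1"
    show "0 \<le> u t - u s" "u t - u s \<le> g * (exp (t / 2) - exp (s / 2))"
      using incr[OF st] by (auto simp: v_def algebra_simps)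
  next
    fix t \<delta> :: real assume td: "0 \<le> t" "0 \<le> \<delta>" "t + \<delta> \<le> 1"
    have I: "t \<in> {0..1}" "t \<le> t + \<delta>" using td by auto
    obtain z where z: "z \<in> {t..t + \<delta>}" "u (t + \<delta>) - u t = \<delta> * (F z / 2)" using mvt[OF td(1) I(2) td(3) du] by auto
    have "\<bar>u (t + \<delta>) - u t - \<delta> * (F t / 2)\<bar> = \<delta> / 2 * \<bar>F z - F t\<bar>"
    proof -
      have "u (t + \<delta>) - u t - \<delta> * (F t / 2) = \<delta> / 2 * (F z - F t)" unfolding z(2) by (simp add: algebra_simps)
      then have "\<bar>u (t + \<delta>) - u t - \<delta> * (F t / 2)\<bar> = \<bar>\<delta> / 2 * (F z - F t)\<bar>" by (rule arg_cong)
      also have "\<dots> = \<delta> / 2 * \<bar>F z - F t\<bar>" using td unfolding abs_mult by simp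
      finally show ?thesis .
    qed
    also have "\<dots> \<le> \<delta> / 2 * (3 * (g * \<delta>))"
    proof (rule mult_left_mono)
      have "v z - v t = g * (exp (z / 2) - exp (t / 2))" by (simp add: v_def algebra_simps)
      also have "\<dots> \<le> g * \<delta>" using exp_half_bounds(2)[of t z] z td g by (intro mult_left_mono) auto
      finally show "\<bar>F z - F t\<bar> \<le> 3 * (g * \<delta>)" using Flip[of t z] z td by auto
    qed (use td in simp)
    also have "\<dots> \<le> 2 * g * \<delta>\<^sup>2" using g td by (simp add: power2_eq_square)
    finally show "\<bar>u (t + \<delta>) - u t - \<delta> * gcov (\<alpha> * exp (t / 2)) (\<beta> * exp (t / 2)) (u t) relu2 (0, 0)\<bar> \<le> 2 * g * \<delta>\<^sup>2"
      unfolding gc[OF I(1)] .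
  qed
qed

section \<open>Products of standard Gaussians\<close>

definition gprod :: "'i set \<Rightarrow> ('i \<Rightarrow> real) measure" where
  "gprod I = (\<Pi>\<^sub>M i\<in>I. gauss)"

abbreviation pb :: "'i set \<Rightarrow> (('i \<Rightarrow> real) \<Rightarrow> 'b::real_normed_vector) \<Rightarrow> bool" where
  "pb I f \<equiv> pbd (gprod I) (\<lambda>w. \<Sum>i\<in>I. \<bar>w i\<bar>) f"

interpretation gprod: product_prob_space "\<lambda>_. gauss" I for I
  by unfold_locales

lemma prob_space_gprod: "prob_space (gprod I)"
  unfolding gprod_def by (rule prob_space_PiM) (rule prob_space_gauss)

lemma pb_const: "pb I (\<lambda>_. c)"
  by (rule pbd_const) (simp add: sum_nonneg)

lemma pb_component:
  assumes "finite I" "i \<in> I"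
  shows "pb I (\<lambda>w. w i)"
proof (rule pbdI)
  have "(\<lambda>w. w i) \<in> measurable (gprod I) gauss"
    unfolding gprod_def by (rule measurable_component_singleton) (fact assms)
  then show "(\<lambda>w. w i) \<in> borel_measurable (gprod I)" by (simp cong: measurable_cong_sets)
  show "norm (w i) \<le> 1 * (1 + (\<Sum>i\<in>I. \<bar>w i\<bar>)) ^ 1" for w
    using member_le_sum[of i I "\<lambda>i. \<bar>w i\<bar>"] assms by simp
qed (simp add: sum_nonneg)

lemma pb_integrable:
  fixes f :: "('i \<Rightarrow> real) \<Rightarrow> real"
  assumes I: "finite I" and f: "pb I f"
  shows "integrable (gprod I) f"
proof -
  obtain C m where C: "C \<ge> 0" "\<And>w. norm (f w) \<le> C * (1 + (\<Sum>i\<in>I. \<bar>w i\<bar>)) ^ m" using pbdE[OF f] by blast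
  \<comment> \<open>The size function is dominated by a product over the coordinates, whose integral
    factorises into one-dimensional moments.\<close>
  have prod: "1 + (\<Sum>i\<in>I. \<bar>w i\<bar>) \<le> (\<Prod>i\<in>I. 1 + \<bar>w i\<bar>)" for w :: "'i \<Rightarrow> real"
    using I
  proof (induction I rule: finite_induct)
    case (insert i I)
    have "1 + (\<Sum>i\<in>insert i I. \<bar>w i\<bar>) \<le> (1 + \<bar>w i\<bar>) * (1 + (\<Sum>i\<in>I. \<bar>w i\<bar>))"
      using insert by (simp add: algebra_simps sum_nonneg)
    also have "\<dots> \<le> (1 + \<bar>w i\<bar>) * (\<Prod>i\<in>I. 1 + \<bar>w i\<bar>)" using insert by (intro mult_left_mono) auto
    finally show ?case using insert by simp
  qed simp
  have "integrable (gprod I) (\<lambda>w. C * (\<Prod>i\<in>I. (1 + \<bar>w i\<bar>) ^ m))"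
    unfolding gprod_def by (intro integrable_mult_right gprod.product_integrable_prod I integrable_gauss_poly)
  then show ?thesis
  proof (rule Bochner_Integration.integrable_bound)
    show "f \<in> borel_measurable (gprod I)" by (rule pbd_measurable[OF f])
    have "norm (f w) \<le> C * (\<Prod>i\<in>I. (1 + \<bar>w i\<bar>) ^ m)" for w
    proof -
      have "(1 + (\<Sum>i\<in>I. \<bar>w i\<bar>)) ^ m \<le> (\<Prod>i\<in>I. 1 + \<bar>w i\<bar>) ^ m"
        by (intro power_mono prod) (simp add: sum_nonneg)
      then have "C * (1 + (\<Sum>i\<in>I. \<bar>w i\<bar>)) ^ m \<le> C * (\<Prod>i\<in>I. (1 + \<bar>w i\<bar>) ^ m)"
        unfolding prod_power_distrib using C(1) by (intro mult_left_mono)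
      then show ?thesis using C(2)[of w] by linarith
    qed
    moreover have "0 \<le> C * (\<Prod>i\<in>I. (1 + \<bar>w i\<bar>) ^ m)" for w :: "'i \<Rightarrow> real"
      using C(1) by (intro mult_nonneg_nonneg prod_nonneg) auto
    ultimately show "AE w in gprod I. norm (f w) \<le> norm (C * (\<Prod>i\<in>I. (1 + \<bar>w i\<bar>) ^ m))"
      by (intro AE_I2) (simp only: real_norm_def abs_of_nonneg)
  qed
qed

lemma measurable_gprod_upd:
  assumes "i \<in> I"
  shows "(\<lambda>(w, z). w(i := z)) \<in> measurable (gprod I \<Otimes>\<^sub>M gauss) (gprod I)"
proof -
  have "insert i I = I" using assms by auto
  then show ?thesis
    using measurable_add_dim[of i I "\<lambda>_. gauss"] by (simp add: gprod_def)
qed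

lemma pb_resample:
  fixes g :: "('i \<Rightarrow> real) \<Rightarrow> real"
  assumes I: "finite I" "i \<in> I" and g: "pb I g"
  shows "pb I (\<lambda>w. \<integral>z. g (w(i := z)) \<partial>gauss)"
proof -
  obtain C m where C: "C \<ge> 0" "\<And>w. norm (g w) \<le> C * (1 + (\<Sum>i\<in>I. \<bar>w i\<bar>)) ^ m" using pbdE[OF g] by blast
  have m: "(\<lambda>p. g ((fst p)(i := snd p))) \<in> borel_measurable (gprod I \<Otimes>\<^sub>M gauss)"
    using measurable_compose[OF measurable_gprod_upd[OF I(2)] pbd_measurable[OF g]] by (simp add: case_prod_unfold)
  have bnd: "\<bar>g (w(i := z))\<bar> \<le> C * (1 + (\<Sum>i\<in>I. \<bar>w i\<bar>)) ^ m * (1 + \<bar>z\<bar>) ^ m" for w z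
  proof -
    have "(\<Sum>j\<in>I. \<bar>(w(i := z)) j\<bar>) = \<bar>z\<bar> + (\<Sum>j\<in>I - {i}. \<bar>w j\<bar>)"
      using I by (subst sum.remove[of _ i]) auto
    also have "(\<Sum>j\<in>I - {i}. \<bar>w j\<bar>) \<le> (\<Sum>j\<in>I. \<bar>w j\<bar>)" using I by (intro sum_mono2) auto
    finally have le: "(\<Sum>j\<in>I. \<bar>(w(i := z)) j\<bar>) \<le> \<bar>z\<bar> + (\<Sum>j\<in>I. \<bar>w j\<bar>)" by simp
    have "0 \<le> (\<Sum>j\<in>I. \<bar>w j\<bar>) * \<bar>z\<bar>" by (intro mult_nonneg_nonneg sum_nonneg) auto
    with le have "1 + (\<Sum>j\<in>I. \<bar>(w(i := z)) j\<bar>) \<le> (1 + (\<Sum>i\<in>I. \<bar>w i\<bar>)) * (1 + \<bar>z\<bar>)"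
      unfolding distrib_left distrib_right mult_1 mult_1_right by linarith
    then have "(1 + (\<Sum>j\<in>I. \<bar>(w(i := z)) j\<bar>)) ^ m \<le> ((1 + (\<Sum>i\<in>I. \<bar>w i\<bar>)) * (1 + \<bar>z\<bar>)) ^ m"
      by (rule power_mono) (simp add: sum_nonneg add_nonneg_nonneg)
    then have "C * (1 + (\<Sum>j\<in>I. \<bar>(w(i := z)) j\<bar>)) ^ m \<le> C * ((1 + (\<Sum>i\<in>I. \<bar>w i\<bar>)) * (1 + \<bar>z\<bar>)) ^ m"
      using C(1) by (rule mult_left_mono)
    then show ?thesis using C(2)[of "w(i := z)"] by (simp add: power_mult_distrib mult.assoc)
  qed
  show ?thesis
  proof (rule pbdI)
    show "(\<lambda>w. \<integral>z. g (w(i := z)) \<partial>gauss) \<in> borel_measurable (gprod I)"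
      using m by (intro gauss.borel_measurable_lebesgue_integral) (simp add: case_prod_unfold)
    fix w :: "'i \<Rightarrow> real"
    have b: "integrable gauss (\<lambda>z. C * (1 + (\<Sum>i\<in>I. \<bar>w i\<bar>)) ^ m * (1 + \<bar>z\<bar>) ^ m)"
      by (intro integrable_mult_right integrable_gauss_poly)
    have "\<bar>\<integral>z. g (w(i := z)) \<partial>gauss\<bar> \<le> (\<integral>z. C * (1 + (\<Sum>i\<in>I. \<bar>w i\<bar>)) ^ m * (1 + \<bar>z\<bar>) ^ m \<partial>gauss)"
    proof (cases "integrable gauss (\<lambda>z. g (w(i := z)))")
      case True
      have "\<bar>\<integral>z. g (w(i := z)) \<partial>gauss\<bar> \<le> (\<integral>z. \<bar>g (w(i := z))\<bar> \<partial>gauss)" by (rule integral_abs_bound)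
      also have "\<dots> \<le> (\<integral>z. C * (1 + (\<Sum>i\<in>I. \<bar>w i\<bar>)) ^ m * (1 + \<bar>z\<bar>) ^ m \<partial>gauss)"
        by (intro integral_mono bnd integrable_abs True b)
      finally show ?thesis .
    next
      \<comment> \<open>The integral of a non-integrable section is 0 by convention, so the bound
        holds in this case too.\<close>
      case False
      then show ?thesis using C(1) by (simp add: not_integrable_integral_eq sum_nonneg)
    qed
    then show "norm (\<integral>z. g (w(i := z)) \<partial>gauss) \<le> (C * (\<integral>z. (1 + \<bar>z\<bar>) ^ m \<partial>gauss)) * (1 + (\<Sum>i\<in>I. \<bar>w i\<bar>)) ^ m"
      by (simp add: mult_ac)
  qed (simp add: sum_nonneg)
qed

text \<open>The replacement for conditioning: coordinate i is overwritten by an independent copy and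
  integrated out on its own. Both sides reduce to the same iterated integral over the product
  without i.\<close>

lemma gprod_resample:
  fixes g :: "('i \<Rightarrow> real) \<Rightarrow> real"
  assumes I: "finite I" "i \<in> I" and g: "pb I g"
  shows "(\<integral>w. g w \<partial>gprod I) = (\<integral>w. \<integral>z. g (w(i := z)) \<partial>gauss \<partial>gprod I)"
proof -
  define J where "J = I - {i}"
  have J: "I = insert i J" "finite J" "i \<notin> J" using I by (auto simp: J_def)
  have ins: "(\<integral>w. f w \<partial>gprod I) = (\<integral>w. \<integral>z. f (w(i := z)) \<partial>gauss \<partial>gprod J)" if "pb I f" for f :: "('i \<Rightarrow> real) \<Rightarrow> real"
    using gprod.product_integral_insert[OF J(2,3), of f] pb_integrable[OF I(1) that] by (simp add: gprod_def J(1))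
  show ?thesis using ins[OF g] ins[OF pb_resample[OF I g]] by simp
qed

text \<open>Independence of the coordinates in \<open>E\<close>, expressed pointwise; it stands in
  for measurability with respect to the remaining coordinates.\<close>

definition frozen :: "'i set \<Rightarrow> (('i \<Rightarrow> real) \<Rightarrow> 'b) \<Rightarrow> bool" where
  "frozen E f \<longleftrightarrow> (\<forall>i\<in>E. \<forall>w z. f (w(i := z)) = f w)"

lemma frozenD: "frozen E f \<Longrightarrow> i \<in> E \<Longrightarrow> f (w(i := z)) = f w"
  by (simp add: frozen_def)

lemma frozen_mono: "frozen E f \<Longrightarrow> E' \<subseteq> E \<Longrightarrow> frozen E' f"
  by (auto simp: frozen_def)

text \<open>The weights \<open>w (e j)\<close> are independent of all the other quantities, so averaging over them
  convolves \<open>h\<close> with the Gaussian of covariance \<open>\<Sum>\<^sub>j v\<^sub>j v\<^sub>j\<^sup>T\<close>.\<close>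

lemma row_average:
  fixes h :: "real \<times> real \<Rightarrow> real" and e :: "'j \<Rightarrow> 'i"
  assumes I: "finite I" and h: "pgrow h"
    and F: "pb I F" "frozen E F" and b1: "pb I b1" "frozen E b1" and b2: "pb I b2" "frozen E b2"
    and J: "finite J" "inj_on e J" "e ` J \<subseteq> I" "e ` J \<subseteq> E"
    and v1: "\<And>j. j \<in> J \<Longrightarrow> pb I (v1 j)" "\<And>j. j \<in> J \<Longrightarrow> frozen E (v1 j)"
    and v2: "\<And>j. j \<in> J \<Longrightarrow> pb I (v2 j)" "\<And>j. j \<in> J \<Longrightarrow> frozen E (v2 j)"
    and s: "pb I s" "frozen E s" and t: "pb I t" "frozen E t" and r: "pb I r" "frozen E r"
    and psd: "\<And>w. psd (s w) (t w) (r w)"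
  shows "(\<integral>w. F w * gcov (s w) (t w) (r w) h (b1 w + (\<Sum>j\<in>J. w (e j) * v1 j w), b2 w + (\<Sum>j\<in>J. w (e j) * v2 j w)) \<partial>gprod I)
    = (\<integral>w. F w * gcov (s w + (\<Sum>j\<in>J. (v1 j w)\<^sup>2)) (t w + (\<Sum>j\<in>J. (v2 j w)\<^sup>2)) (r w + (\<Sum>j\<in>J. v1 j w * v2 j w)) h (b1 w, b2 w) \<partial>gprod I)"
  using J v1 v2 s t r psd
\<comment> \<open>The covariance is generalised because each integrated weight moves its rank-one
  matrix into it.\<close>
proof (induction J arbitrary: s t r rule: finite_induct)
  case empty
  then show ?case by simp
next
  case (insert k J)
  let ?X = "\<lambda>w. b1 w + (\<Sum>j\<in>J. w (e j) * v1 j w)" and ?Y = "\<lambda>w. b2 w + (\<Sum>j\<in>J. w (e j) * v2 j w)"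
  have ek: "e k \<in> I" "e k \<in> E" using insert by auto
  have ne: "e j \<noteq> e k" if "j \<in> J" for j using insert that by (auto simp: inj_on_def)
  have X: "pb I ?X" "pb I ?Y"
    using insert.prems by (auto intro!: pbd_add pbd_mult pbd_sum b1 b2 pb_component I simp: sum_nonneg)
  have pbk: "pb I (\<lambda>w. w (e k) * v1 k w)" "pb I (\<lambda>w. w (e k) * v2 k w)"
    using insert.prems ek by (auto intro!: pbd_mult pb_component I)
  have g: "pb I (\<lambda>w. F w * gcov (s w) (t w) (r w) h (?X w + w (e k) * v1 k w, ?Y w + w (e k) * v2 k w))"
    by (intro pbd_mult pbd_gcov pbd_Pair pbd_add F h insert.prems X pbk)
  have upd: "?X (w(e k := z)) = ?X w" "?Y (w(e k := z)) = ?Y w" for w z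
    using insert.prems ne ek b1 b2 by (auto simp: frozenD[of E] intro!: sum.cong)
  have upd2: "F (w(e k := z)) = F w" "s (w(e k := z)) = s w" "t (w(e k := z)) = t w" "r (w(e k := z)) = r w"
      "v1 k (w(e k := z)) = v1 k w" "v2 k (w(e k := z)) = v2 k w" for w z
    using insert.prems ek F by (auto simp: frozenD[of E])
  have sums: "(\<Sum>j\<in>insert k J. f j) = f k + (\<Sum>j\<in>J. f j)" for f :: "'j \<Rightarrow> real" using insert.hyps by simp
  have "(\<integral>w. F w * gcov (s w) (t w) (r w) h (b1 w + (\<Sum>j\<in>insert k J. w (e j) * v1 j w), b2 w + (\<Sum>j\<in>insert k J. w (e j) * v2 j w)) \<partial>gprod I)
    = (\<integral>w. F w * gcov (s w) (t w) (r w) h (?X w + w (e k) * v1 k w, ?Y w + w (e k) * v2 k w) \<partial>gprod I)"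
    by (simp add: sums add_ac)
  also have "\<dots> = (\<integral>w. \<integral>z. F w * gcov (s w) (t w) (r w) h (?X w + z * v1 k w, ?Y w + z * v2 k w) \<partial>gauss \<partial>gprod I)"
    by (subst gprod_resample[OF I ek(1) g]) (simp only: upd upd2 fun_upd_same)
  also have "\<dots> = (\<integral>w. F w * gcov (s w + (v1 k w)\<^sup>2) (t w + (v2 k w)\<^sup>2) (r w + v1 k w * v2 k w) h (?X w, ?Y w) \<partial>gprod I)"
  proof (rule Bochner_Integration.integral_cong[OF refl])
    fix w
    have "(\<integral>z. F w * gcov (s w) (t w) (r w) h (?X w + z * v1 k w, ?Y w + z * v2 k w) \<partial>gauss)
      = F w * (\<integral>z. gcov (s w) (t w) (r w) h (?X w + z * v1 k w, ?Y w + z * v2 k w) \<partial>gauss)" by simp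
    also have "(\<integral>z. gcov (s w) (t w) (r w) h (?X w + z * v1 k w, ?Y w + z * v2 k w) \<partial>gauss)
      = gcov (s w + (v1 k w)\<^sup>2) (t w + (v2 k w)\<^sup>2) (r w + v1 k w * v2 k w) h (?X w, ?Y w)"
      using gcov_add[OF h insert.prems(14), of w "(?X w, ?Y w)" "v1 k w" "v2 k w"] by (simp add: mult.commute)
    finally show "(\<integral>z. F w * gcov (s w) (t w) (r w) h (?X w + z * v1 k w, ?Y w + z * v2 k w) \<partial>gauss)
      = F w * gcov (s w + (v1 k w)\<^sup>2) (t w + (v2 k w)\<^sup>2) (r w + v1 k w * v2 k w) h (?X w, ?Y w)" .
  qed
  also have "\<dots> = (\<integral>w. F w * gcov (s w + (v1 k w)\<^sup>2 + (\<Sum>j\<in>J. (v1 j w)\<^sup>2)) (t w + (v2 k w)\<^sup>2 + (\<Sum>j\<in>J. (v2 j w)\<^sup>2)) (r w + v1 k w * v2 k w + (\<Sum>j\<in>J. v1 j w * v2 j w)) h (b1 w, b2 w) \<partial>gprod I)"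
  proof (rule insert.IH)
    show "inj_on e J" "e ` J \<subseteq> I" "e ` J \<subseteq> E" using insert.prems by auto
    show "pb I (v1 j)" "frozen E (v1 j)" "pb I (v2 j)" "frozen E (v2 j)" if "j \<in> J" for j
      using insert.prems that by auto
    show "pb I (\<lambda>w. s w + (v1 k w)\<^sup>2)" "pb I (\<lambda>w. t w + (v2 k w)\<^sup>2)" "pb I (\<lambda>w. r w + v1 k w * v2 k w)"
      by (intro pbd_add pbd_power pbd_mult insert.prems insertI1)+
    show "frozen E (\<lambda>w. s w + (v1 k w)\<^sup>2)" "frozen E (\<lambda>w. t w + (v2 k w)\<^sup>2)" "frozen E (\<lambda>w. r w + v1 k w * v2 k w)"
      using insert.prems by (auto simp: frozen_def)
    show "psd (s w + (v1 k w)\<^sup>2) (t w + (v2 k w)\<^sup>2) (r w + v1 k w * v2 k w)" for w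
      by (intro psd_add psd_rank1 insert.prems)
  qed
  finally show ?case by (simp add: sums add.assoc)
qed

lemma psd_sum: "finite J \<Longrightarrow> psd (\<Sum>j\<in>J. (v j)\<^sup>2) (\<Sum>j\<in>J. (w j)\<^sup>2) (\<Sum>j\<in>J. v j * w j)"
  by (induction J rule: finite_induct) (auto intro: psd_add psd_rank1)

section \<open>The L2 norm on a product of Gaussians\<close>

definition nrm :: "'i set \<Rightarrow> (('i \<Rightarrow> real) \<Rightarrow> real) \<Rightarrow> real" where
  "nrm I f = sqrt (\<integral>w. (f w)\<^sup>2 \<partial>gprod I)"

lemma nrm_nonneg: "0 \<le> nrm I f"
  by (simp add: nrm_def)

lemma nrm_square: "(nrm I f)\<^sup>2 = (\<integral>w. (f w)\<^sup>2 \<partial>gprod I)"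
  by (simp add: nrm_def)

lemma measure_gprod_UNIV [simp]: "measure (gprod I) (space (gprod I)) = 1"
  using prob_space_gprod[of I] by (rule prob_space.prob_space)

lemma nrm_const [simp]: "nrm I (\<lambda>_. c) = \<bar>c\<bar>"
  by (simp add: nrm_def)

lemma nrm_cmult: "nrm I (\<lambda>w. c * f w) = \<bar>c\<bar> * nrm I f"
  by (simp add: nrm_def power_mult_distrib real_sqrt_mult)

lemma nrm_CS:
  assumes I: "finite I" and f: "pb I f" and g: "pb I g"
  shows "\<bar>\<integral>w. f w * g w \<partial>gprod I\<bar> \<le> nrm I f * nrm I g"
proof -
  define A B C where "A = (\<integral>w. (f w)\<^sup>2 \<partial>gprod I)" and "B = (\<integral>w. f w * g w \<partial>gprod I)" and "C = (\<integral>w. (g w)\<^sup>2 \<partial>gprod I)"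
  have i: "integrable (gprod I) (\<lambda>w. (f w)\<^sup>2)" "integrable (gprod I) (\<lambda>w. f w * g w)" "integrable (gprod I) (\<lambda>w. (g w)\<^sup>2)"
    by (intro pb_integrable[OF I] pbd_power pbd_mult f g)+
  have q: "0 \<le> A + (2 * t * B + t\<^sup>2 * C)" for t
  proof -
    have "0 \<le> (\<integral>w. (f w + t * g w)\<^sup>2 \<partial>gprod I)" by simp
    also have "(\<integral>w. (f w + t * g w)\<^sup>2 \<partial>gprod I) = (\<integral>w. (f w)\<^sup>2 + (2 * t * (f w * g w) + t\<^sup>2 * (g w)\<^sup>2) \<partial>gprod I)"
      by (intro Bochner_Integration.integral_cong refl) (simp add: power2_eq_square algebra_simps)
    also have "\<dots> = A + (2 * t * B + t\<^sup>2 * C)" using i by (simp add: A_def B_def C_def)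
    finally show ?thesis .
  qed
  have C0: "0 \<le> C" and A0: "0 \<le> A" by (simp_all add: C_def A_def)
  have "B\<^sup>2 \<le> A * C"
  proof (cases "C = 0")
    case True
    have "B = 0"
    proof (rule ccontr)
      assume "B \<noteq> 0"
      \<comment> \<open>With C = 0 the quadratic is affine in t; at this value of t it would equal
        -1.\<close>
      then have "2 * (- (A + 1) / (2 * B)) * B = - (A + 1)" by (simp add: field_simps)
      moreover have "0 \<le> A + 2 * t * B" for t using q[of t] True by simp
      ultimately show False by (metis add.commute add_uminus_conv_diff diff_add_cancel diff_minus_eq_add minus_add_distrib neg_0_le_iff_le not_one_le_zero)
    qed
    then show ?thesis using True by simp
  next
    case False
    then have "C > 0" using C0 by simp
    then have "0 \<le> A - B\<^sup>2 / C" using q[of "- B / C"] by (simp add: power2_eq_square field_simps)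
    then show ?thesis using \<open>C > 0\<close> by (simp add: field_simps)
  qed
  then have "\<bar>B\<bar> \<le> sqrt (A * C)" by (intro real_le_rsqrt) simp
  then show ?thesis by (simp add: nrm_def A_def B_def C_def real_sqrt_mult)
qed

lemma nrm_triangle:
  assumes I: "finite I" and f: "pb I f" and g: "pb I g"
  shows "nrm I (\<lambda>w. f w + g w) \<le> nrm I f + nrm I g"
proof -
  have i: "integrable (gprod I) (\<lambda>w. (f w)\<^sup>2)" "integrable (gprod I) (\<lambda>w. f w * g w)" "integrable (gprod I) (\<lambda>w. (g w)\<^sup>2)"
    by (intro pb_integrable[OF I] pbd_power pbd_mult f g)+
  have "(\<integral>w. (f w + g w)\<^sup>2 \<partial>gprod I) = (\<integral>w. (f w)\<^sup>2 + (2 * (f w * g w) + (g w)\<^sup>2) \<partial>gprod I)"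
    by (intro Bochner_Integration.integral_cong refl) (simp add: power2_eq_square algebra_simps)
  also have "\<dots> = (nrm I f)\<^sup>2 + (2 * (\<integral>w. f w * g w \<partial>gprod I) + (nrm I g)\<^sup>2)" using i by (simp add: nrm_square)
  also have "\<dots> \<le> (nrm I f)\<^sup>2 + (2 * (nrm I f * nrm I g) + (nrm I g)\<^sup>2)"
    using nrm_CS[OF assms] by simp
  also have "\<dots> = (nrm I f + nrm I g)\<^sup>2" by (simp add: power2_eq_square algebra_simps)
  finally have "(nrm I (\<lambda>w. f w + g w))\<^sup>2 \<le> (nrm I f + nrm I g)\<^sup>2" by (simp add: nrm_square)
  then show ?thesis by (rule power2_le_imp_le) (simp add: nrm_nonneg add_nonneg_nonneg)
qed

lemma nrm_mono:
  assumes I: "finite I" and f: "pb I f" and g: "pb I g" and le: "\<And>w. \<bar>f w\<bar> \<le> \<bar>g w\<bar>"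
  shows "nrm I f \<le> nrm I g"
proof -
  have i: "integrable (gprod I) (\<lambda>w. (f w)\<^sup>2)" "integrable (gprod I) (\<lambda>w. (g w)\<^sup>2)"
    by (intro pb_integrable[OF I] pbd_power f g)+
  have "(\<integral>w. (f w)\<^sup>2 \<partial>gprod I) \<le> (\<integral>w. (g w)\<^sup>2 \<partial>gprod I)"
    using i le by (intro integral_mono) (auto simp: abs_le_square_iff)
  then show ?thesis by (simp add: nrm_def)
qed

lemma nrm_sum:
  assumes I: "finite I" and f: "\<And>k. k \<in> A \<Longrightarrow> pb I (f k)"
  shows "nrm I (\<lambda>w. \<Sum>k\<in>A. f k w) \<le> (\<Sum>k\<in>A. nrm I (f k))"
  using f
proof (induction A rule: infinite_finite_induct)
  case (insert k A)
  have "nrm I (\<lambda>w. f k w + (\<Sum>k\<in>A. f k w)) \<le> nrm I (f k) + nrm I (\<lambda>w. \<Sum>k\<in>A. f k w)"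
    using insert.prems by (intro nrm_triangle I pbd_sum) (auto simp: sum_nonneg)
  then show ?case using insert by simp
qed auto

lemma frozen_comp: "frozen E f \<Longrightarrow> frozen E (\<lambda>w. F (f w))"
  by (simp add: frozen_def)

section \<open>One layer with independent Gaussian rows\<close>

text \<open>Neuron i has a base point (\<open>p1 i\<close>, \<open>p2 i\<close>) known before the
  layer and receives a combination of its own weights \<open>e i j\<close>, with coefficients
  \<open>v1 j\<close>, \<open>v2 j\<close> common to all neurons. \<open>E\<close> collects the
  weights of the layer. The input layer fits with base point zero and constant coefficients, a
  hidden layer with the scaled activations as coefficients.\<close>

locale rows =
  fixes I :: "'i set" and n :: nat and e :: "nat \<Rightarrow> 'j \<Rightarrow> 'i" and J :: "'j set"
    and p1 p2 :: "nat \<Rightarrow> ('i \<Rightarrow> real) \<Rightarrow> real" and v1 v2 :: "'j \<Rightarrow> ('i \<Rightarrow> real) \<Rightarrow> real"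
    and E :: "'i set"
  assumes I: "finite I" and J: "finite J" and n: "1 \<le> n"
    and inj: "\<And>i. i < n \<Longrightarrow> inj_on (e i) J" and sub: "\<And>i. i < n \<Longrightarrow> e i ` J \<subseteq> I" 
    and E: "E = (\<Union>i<n. e i ` J)"
    and disj: "\<And>i i' j j'. i < n \<Longrightarrow> i' < n \<Longrightarrow> i \<noteq> i' \<Longrightarrow> j \<in> J \<Longrightarrow> j' \<in> J \<Longrightarrow> e i j \<noteq> e i' j'"
    and p1: "\<And>i. i < n \<Longrightarrow> pb I (p1 i)" "\<And>i. i < n \<Longrightarrow> frozen E (p1 i)"
    and p2: "\<And>i. i < n \<Longrightarrow> pb I (p2 i)" "\<And>i. i < n \<Longrightarrow> frozen E (p2 i)"
    and v1: "\<And>j. j \<in> J \<Longrightarrow> pb I (v1 j)" "\<And>j. j \<in> J \<Longrightarrow> frozen E (v1 j)"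
    and v2: "\<And>j. j \<in> J \<Longrightarrow> pb I (v2 j)" "\<And>j. j \<in> J \<Longrightarrow> frozen E (v2 j)"
begin

definition x1 where "x1 i w = (\<Sum>j\<in>J. w (e i j) * v1 j w)"
definition x2 where "x2 i w = (\<Sum>j\<in>J. w (e i j) * v2 j w)"
definition V1 where "V1 w = (\<Sum>j\<in>J. (v1 j w)\<^sup>2)"
definition V2 where "V2 w = (\<Sum>j\<in>J. (v2 j w)\<^sup>2)"
definition V12 where "V12 w = (\<Sum>j\<in>J. v1 j w * v2 j w)"

lemma pbs: 
  "i < n \<Longrightarrow> pb I (x1 i)" "i < n \<Longrightarrow> pb I (x2 i)" "pb I V1" "pb I V2" "pb I V12"
  unfolding x1_def[abs_def] x2_def[abs_def] V1_def[abs_def] V2_def[abs_def] V12_def[abs_def]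
  using sub by (auto intro!: pbd_sum pbd_mult pbd_power pb_component I v1 v2 simp: sum_nonneg image_subset_iff)

lemma frozens: "frozen E V1" "frozen E V2" "frozen E V12"
  using v1(2) v2(2) by (auto simp: frozen_def V1_def V2_def V12_def intro!: sum.cong)

lemma psdV: "psd (V1 w) (V2 w) (V12 w)"
  unfolding V1_def V2_def V12_def by (rule psd_sum[OF J])

lemma subE: "i < n \<Longrightarrow> e i ` J \<subseteq> E"
  by (auto simp: E)

text \<open>\<open>F\<close> has to ignore the weights of row i only; it may involve the other rows
  of the same layer. This freedom yields the orthogonality of different neurons.\<close>

lemma average:
  assumes h: "pgrow h" and i: "i < n" and F: "pb I F" "frozen (e i ` J) F" and psd: "psd s t r"
    and b: "pb I b1" "frozen (e i ` J) b1" "pb I b2" "frozen (e i ` J) b2"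
  shows "(\<integral>w. F w * gcov s t r h (b1 w + x1 i w, b2 w + x2 i w) \<partial>gprod I)
    = (\<integral>w. F w * gcov (s + V1 w) (t + V2 w) (r + V12 w) h (b1 w, b2 w) \<partial>gprod I)"
  unfolding x1_def x2_def V1_def V2_def V12_def
  by (rule row_average[OF I h F b J inj[OF i] sub[OF i] subset_refl])
    (auto intro: frozen_mono[OF v1(2) subE[OF i]] frozen_mono[OF v2(2) subE[OF i]] pb_const v1 v2 psd simp: frozen_def[of _ "\<lambda>_. _"])

text \<open>The value at neuron i after the layer minus its conditional mean: the second term is the
  first one with the row weights integrated out.\<close>

definition m where
  "m s t r h i w = gcov s t r h (p1 i w + x1 i w, p2 i w + x2 i w) - gcov (s + V1 w) (t + V2 w) (r + V12 w) h (p1 i w, p2 i w)"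

lemma pb_m:
  assumes "pgrow h" "i < n" "psd s t r"
  shows "pb I (m s t r h i)" "pb I (\<lambda>w. gcov (s + V1 w) (t + V2 w) (r + V12 w) h (p1 i w, p2 i w))"
    "pb I (\<lambda>w. gcov s t r h (p1 i w + x1 i w, p2 i w + x2 i w))" "pb I (\<lambda>w. gcov s t r h (p1 i w, p2 i w))"
  unfolding m_def[abs_def] using assms
  by (auto intro!: pbd_minus pbd_gcov pbd_Pair pbd_add pb_const pbs p1 p2 psd_add psdV)

lemma frozen_m:
  assumes "i < n" "i' < n" "i \<noteq> i'"
  shows "frozen (e i ` J) (m s t r h i')"
proof -
  have "x1 i' (w(e i j := z)) = x1 i' w" "x2 i' (w(e i j := z)) = x2 i' w" "V1 (w(e i j := z)) = V1 w" "V2 (w(e i j := z)) = V2 w"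
    "V12 (w(e i j := z)) = V12 w" "p1 i' (w(e i j := z)) = p1 i' w" "p2 i' (w(e i j := z)) = p2 i' w"
    if j: "j \<in> J" for w z j
  proof -
    have ne: "e i' j' \<noteq> e i j" if "j' \<in> J" for j' using disj[of i' i j' j] assms j that by auto
    have ej: "e i j \<in> E" using j assms(1) by (auto simp: E)
    show "V1 (w(e i j := z)) = V1 w" "V2 (w(e i j := z)) = V2 w" "V12 (w(e i j := z)) = V12 w"
      by (rule frozenD[OF frozens(1) ej] frozenD[OF frozens(2) ej] frozenD[OF frozens(3) ej])+
    show "p1 i' (w(e i j := z)) = p1 i' w" "p2 i' (w(e i j := z)) = p2 i' w"
      by (rule frozenD[OF p1(2)[OF assms(2)] ej] frozenD[OF p2(2)[OF assms(2)] ej])+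
    show "x1 i' (w(e i j := z)) = x1 i' w" "x2 i' (w(e i j := z)) = x2 i' w"
      using ne by (auto simp: x1_def x2_def frozenD[OF v1(2) ej] frozenD[OF v2(2) ej] intro!: sum.cong)
  qed
  then show ?thesis by (auto simp: frozen_def m_def)
qed

lemma m_mean_zero:
  assumes h: "pgrow h" and i: "i < n" and F: "pb I F" "frozen (e i ` J) F" and psd: "psd s t r"
  shows "(\<integral>w. F w * m s t r h i w \<partial>gprod I) = 0"
proof -
  have eq: "(\<integral>w. F w * gcov s t r h (p1 i w + x1 i w, p2 i w + x2 i w) \<partial>gprod I)
    = (\<integral>w. F w * gcov (s + V1 w) (t + V2 w) (r + V12 w) h (p1 i w, p2 i w) \<partial>gprod I)"
    by (rule average[OF h i F psd p1(1)[OF i] frozen_mono[OF p1(2)[OF i] subE[OF i]] p2(1)[OF i] frozen_mono[OF p2(2)[OF i] subE[OF i]]])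
  have "(\<integral>w. F w * m s t r h i w \<partial>gprod I) = (\<integral>w. F w * gcov s t r h (p1 i w + x1 i w, p2 i w + x2 i w)
     - F w * gcov (s + V1 w) (t + V2 w) (r + V12 w) h (p1 i w, p2 i w) \<partial>gprod I)"
    by (simp add: m_def right_diff_distrib)
  also have "\<dots> = 0"
    by (subst Bochner_Integration.integral_diff) (auto intro!: pb_integrable[OF I] pbd_mult F pb_m h i psd simp: eq)
  finally show ?thesis .
qed

text \<open>A variance is at most the second moment about any known value: \<open>d\<close> is the
  change from the unperturbed point, and d = m + c with \<open>c\<close> independent of the row,
  hence orthogonal to \<open>m\<close>. \<open>gcov_increment\<close> bounds \<open>d\<close>, and
  Gaussian second and fourth moments V and 3 V^2 give 72 = 24 * 3.\<close>

lemma m_square: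
  assumes h: "qlip h" and i: "i < n" and F: "pb I F" "frozen E F" "\<And>w. 0 \<le> F w" and psd: "psd s t r"
  shows "(\<integral>w. F w * (m s t r h i w)\<^sup>2 \<partial>gprod I)
    \<le> (\<integral>w. F w * (48 * ((p1 i w)\<^sup>2 + (p2 i w)\<^sup>2 + s + t) * (V1 w + V2 w) + 72 * ((V1 w)\<^sup>2 + (V2 w)\<^sup>2)) \<partial>gprod I)"
proof -
  have g: "pgrow h" using h by (simp add: qlip_def)
  have nn: "0 \<le> s" "0 \<le> t" using psd by (auto simp: psd_def)
  define c where "c = (\<lambda>w. gcov (s + V1 w) (t + V2 w) (r + V12 w) h (p1 i w, p2 i w) - gcov s t r h (p1 i w, p2 i w))"
  define d where "d = (\<lambda>w. gcov s t r h (p1 i w + x1 i w, p2 i w + x2 i w) - gcov s t r h (p1 i w, p2 i w))"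
  have pm: "pb I (m s t r h i)" by (rule pb_m[OF g i psd])
  have pc: "pb I c" "pb I d" unfolding c_def d_def by (intro pbd_minus pb_m[OF g i psd])+
  have fc: "frozen (e i ` J) c"
    unfolding frozen_def
  proof (intro ballI allI)
    fix k w z assume "k \<in> e i ` J"
    then have k: "k \<in> E" using subE[OF i] by auto
    show "c (w(k := z)) = c w"
      unfolding c_def by (simp add: frozenD[OF _ k] frozens p1(2)[OF i] p2(2)[OF i])
  qed
  have F': "frozen (e i ` J) F" by (rule frozen_mono[OF F(2) subE[OF i]])
  have le1: "(\<integral>w. F w * (m s t r h i w)\<^sup>2 \<partial>gprod I) \<le> (\<integral>w. F w * (d w)\<^sup>2 \<partial>gprod I)"
  proof -
    have "d w = m s t r h i w + c w" for w by (simp add: d_def m_def c_def)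
    then have "(\<integral>w. F w * (d w)\<^sup>2 \<partial>gprod I)
       = (\<integral>w. F w * (m s t r h i w)\<^sup>2 + (2 * ((F w * c w) * m s t r h i w) + F w * (c w)\<^sup>2) \<partial>gprod I)"
      by (simp add: power2_eq_square algebra_simps)
    also have "\<dots> = (\<integral>w. F w * (m s t r h i w)\<^sup>2 \<partial>gprod I) + (2 * (\<integral>w. (F w * c w) * m s t r h i w \<partial>gprod I) + (\<integral>w. F w * (c w)\<^sup>2 \<partial>gprod I))"
    proof -
      have "integrable (gprod I) (\<lambda>w. F w * (m s t r h i w)\<^sup>2)" "integrable (gprod I) (\<lambda>w. 2 * ((F w * c w) * m s t r h i w))"
        "integrable (gprod I) (\<lambda>w. F w * (c w)\<^sup>2)"
        by (intro pb_integrable[OF I] pbd_mult pbd_power F pc pm pb_const)+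
      then show ?thesis by simp
    qed
    also have "(\<integral>w. (F w * c w) * m s t r h i w \<partial>gprod I) = 0"
      by (intro m_mean_zero g i psd pbd_mult F pc) (use F' fc in \<open>auto simp: frozen_def\<close>)
    finally have "(\<integral>w. F w * (d w)\<^sup>2 \<partial>gprod I) = (\<integral>w. F w * (m s t r h i w)\<^sup>2 \<partial>gprod I) + (\<integral>w. F w * (c w)\<^sup>2 \<partial>gprod I)" by simp
    moreover have "0 \<le> (\<integral>w. F w * (c w)\<^sup>2 \<partial>gprod I)" using F(3) by (intro Bochner_Integration.integral_nonneg mult_nonneg_nonneg) auto
    ultimately show ?thesis by simp
  qed
  have alg: "f * (c * (a + b) + 24 * (a' + b')) = (f * c) * a + ((f * c) * b + ((f * 24) * a' + (f * 24) * b'))"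
    for f c a b a' b' :: real by (simp add: algebra_simps)
  have "(\<integral>w. F w * (d w)\<^sup>2 \<partial>gprod I) \<le> (\<integral>w. (F w * (48 * ((p1 i w)\<^sup>2 + (p2 i w)\<^sup>2 + s + t))) * (x1 i w)\<^sup>2 + ((F w * (48 * ((p1 i w)\<^sup>2 + (p2 i w)\<^sup>2 + s + t))) * (x2 i w)\<^sup>2
      + ((F w * 24) * (x1 i w) ^ 4 + (F w * 24) * (x2 i w) ^ 4)) \<partial>gprod I)"
  proof (rule integral_mono)
    show "integrable (gprod I) (\<lambda>w. F w * (d w)\<^sup>2)" by (intro pb_integrable[OF I] pbd_mult pbd_power F pc)
    show "integrable (gprod I) (\<lambda>w. (F w * (48 * ((p1 i w)\<^sup>2 + (p2 i w)\<^sup>2 + s + t))) * (x1 i w)\<^sup>2 + ((F w * (48 * ((p1 i w)\<^sup>2 + (p2 i w)\<^sup>2 + s + t))) * (x2 i w)\<^sup>2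
      + ((F w * 24) * (x1 i w) ^ 4 + (F w * 24) * (x2 i w) ^ 4)))"
      by (intro pb_integrable[OF I] pbd_add pbd_mult pbd_power F pbs p1 p2 i pb_const)
    show "F w * (d w)\<^sup>2 \<le> (F w * (48 * ((p1 i w)\<^sup>2 + (p2 i w)\<^sup>2 + s + t))) * (x1 i w)\<^sup>2 + ((F w * (48 * ((p1 i w)\<^sup>2 + (p2 i w)\<^sup>2 + s + t))) * (x2 i w)\<^sup>2
      + ((F w * 24) * (x1 i w) ^ 4 + (F w * 24) * (x2 i w) ^ 4))" for w
    proof -
      have "F w * (d w)\<^sup>2 \<le> F w * (48 * ((p1 i w)\<^sup>2 + (p2 i w)\<^sup>2 + s + t) * ((x1 i w)\<^sup>2 + (x2 i w)\<^sup>2) + 24 * ((x1 i w) ^ 4 + (x2 i w) ^ 4))"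
        unfolding d_def by (intro mult_left_mono gcov_increment h psd F)
      also have "\<dots> = (F w * (48 * ((p1 i w)\<^sup>2 + (p2 i w)\<^sup>2 + s + t))) * (x1 i w)\<^sup>2 + ((F w * (48 * ((p1 i w)\<^sup>2 + (p2 i w)\<^sup>2 + s + t))) * (x2 i w)\<^sup>2
      + ((F w * 24) * (x1 i w) ^ 4 + (F w * 24) * (x2 i w) ^ 4))" by (rule alg)
      finally show ?thesis .
    qed
  qed
  also have "\<dots> = (\<integral>w. (F w * (48 * ((p1 i w)\<^sup>2 + (p2 i w)\<^sup>2 + s + t))) * V1 w + ((F w * (48 * ((p1 i w)\<^sup>2 + (p2 i w)\<^sup>2 + s + t))) * V2 w
      + ((F w * 24) * (3 * (V1 w)\<^sup>2) + (F w * 24) * (3 * (V2 w)\<^sup>2))) \<partial>gprod I)" (is "_ = integral\<^sup>L _ (\<lambda>w. ?A w + (?B w + (?C w + ?D w)))")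
  proof -
    have base: "(\<integral>w. G w * k (x1 i w, x2 i w) \<partial>gprod I) = (\<integral>w. G w * gcov (V1 w) (V2 w) (V12 w) k (0, 0) \<partial>gprod I)"
      if "pb I G" "frozen (e i ` J) G" "pgrow k" for G and k :: "real \<times> real \<Rightarrow> real"
      using average[OF that(3) i that(1,2) psd_0 pb_const[of I 0] _ pb_const[of I 0]] by (simp add: frozen_def)
    define G where "G = (\<lambda>w. F w * (48 * ((p1 i w)\<^sup>2 + (p2 i w)\<^sup>2 + s + t)))"
    have pG: "pb I G" unfolding G_def by (intro pbd_add pbd_mult pbd_power F p1 p2 i pb_const)
    have fG: "frozen (e i ` J) G"
      using F' frozen_mono[OF p1(2)[OF i] subE[OF i]] frozen_mono[OF p2(2)[OF i] subE[OF i]] by (auto simp: frozen_def G_def)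
    have pF: "pb I (\<lambda>w. F w * 24)" by (intro pbd_mult F pb_const)
    have fF: "frozen (e i ` J) (\<lambda>w. F w * 24)" using F' by (auto simp: frozen_def)
    have k: "pgrow (\<lambda>q::real\<times>real. (fst q)\<^sup>2)" "pgrow (\<lambda>q::real\<times>real. (snd q)\<^sup>2)" "pgrow (\<lambda>q::real\<times>real. (fst q) ^ 4)" "pgrow (\<lambda>q::real\<times>real. (snd q) ^ 4)"
      by (intro pbd_intros)+
    have e: "(\<integral>w. G w * (x1 i w)\<^sup>2 \<partial>gprod I) = (\<integral>w. G w * V1 w \<partial>gprod I)"
      "(\<integral>w. G w * (x2 i w)\<^sup>2 \<partial>gprod I) = (\<integral>w. G w * V2 w \<partial>gprod I)"
      "(\<integral>w. (F w * 24) * (x1 i w) ^ 4 \<partial>gprod I) = (\<integral>w. (F w * 24) * (3 * (V1 w)\<^sup>2) \<partial>gprod I)"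
      "(\<integral>w. (F w * 24) * (x2 i w) ^ 4 \<partial>gprod I) = (\<integral>w. (F w * 24) * (3 * (V2 w)\<^sup>2) \<partial>gprod I)"
      using base[OF pG fG k(1)] base[OF pG fG k(2)] base[OF pF fF k(3)] base[OF pF fF k(4)]
      by (simp_all add: gcov_moments[OF psdV])
    have i1: "integrable (gprod I) (\<lambda>w. G w * (x1 i w)\<^sup>2)" "integrable (gprod I) (\<lambda>w. G w * (x2 i w)\<^sup>2)"
       "integrable (gprod I) (\<lambda>w. (F w * 24) * (x1 i w) ^ 4)" "integrable (gprod I) (\<lambda>w. (F w * 24) * (x2 i w) ^ 4)"
       "integrable (gprod I) (\<lambda>w. G w * V1 w)" "integrable (gprod I) (\<lambda>w. G w * V2 w)"
       "integrable (gprod I) (\<lambda>w. (F w * 24) * (3 * (V1 w)\<^sup>2))" "integrable (gprod I) (\<lambda>w. (F w * 24) * (3 * (V2 w)\<^sup>2))"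
      by (intro pb_integrable[OF I] pbd_mult pbd_power pG F pbs i pb_const)+
    have add4: "(\<integral>w. f1 w + (f2 w + (f3 w + f4 w)) \<partial>gprod I) = (\<integral>w. f1 w \<partial>gprod I) + ((\<integral>w. f2 w \<partial>gprod I) + ((\<integral>w. f3 w \<partial>gprod I) + (\<integral>w. f4 w \<partial>gprod I)))"
      if "integrable (gprod I) f1" "integrable (gprod I) f2" "integrable (gprod I) f3" "integrable (gprod I) f4" for f1 f2 f3 f4 :: "('i \<Rightarrow> real) \<Rightarrow> real"
      using that by simp
    have "(\<integral>w. G w * (x1 i w)\<^sup>2 + (G w * (x2 i w)\<^sup>2 + ((F w * 24) * (x1 i w) ^ 4 + (F w * 24) * (x2 i w) ^ 4)) \<partial>gprod I)
      = (\<integral>w. G w * V1 w + (G w * V2 w + ((F w * 24) * (3 * (V1 w)\<^sup>2) + (F w * 24) * (3 * (V2 w)\<^sup>2))) \<partial>gprod I)"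
      unfolding add4[OF i1(1-4)] add4[OF i1(5-8)] e ..
    then show ?thesis by (simp only: G_def)
  qed
  also have "\<dots> = (\<integral>w. F w * (48 * ((p1 i w)\<^sup>2 + (p2 i w)\<^sup>2 + s + t) * (V1 w + V2 w) + 72 * ((V1 w)\<^sup>2 + (V2 w)\<^sup>2)) \<partial>gprod I)"
    by (intro Bochner_Integration.integral_cong refl) (simp add: algebra_simps)
  finally show ?thesis using le1 by simp
qed

text \<open>In the expanded square the mixed terms with \<open>Z\<close> vanish, and so do the
  products of different neurons. The n remaining terms carry 1 / n^2, which is the gain of averaging
  over the width. \<open>K\<close> is meant for the indicator of not having stopped.\<close>

lemma martingale_step:
  assumes h: "qlip h" and Z: "pb I Z" "frozen E Z" and K: "pb I K" "frozen E K" and psd: "psd s t r"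
  shows "(\<integral>w. (Z w + K w * ((\<Sum>i<n. m s t r h i w) / real n))\<^sup>2 \<partial>gprod I)
    \<le> (\<integral>w. (Z w)\<^sup>2 \<partial>gprod I) + (\<Sum>i<n. (\<integral>w. (K w)\<^sup>2 * (48 * ((p1 i w)\<^sup>2 + (p2 i w)\<^sup>2 + s + t) * (V1 w + V2 w) + 72 * ((V1 w)\<^sup>2 + (V2 w)\<^sup>2)) \<partial>gprod I)) / (real n)\<^sup>2"
proof -
  have g: "pgrow h" using h by (simp add: qlip_def)
  let ?m = "m s t r h"
  have pm: "pb I (?m i)" if "i < n" for i by (rule pb_m[OF g that psd])
  have e: "(Z w + K w * ((\<Sum>i<n. ?m i w) / real n))\<^sup>2 = (Z w)\<^sup>2
    + ((\<Sum>i<n. 2 / real n * ((Z w * K w) * ?m i w)) + (\<Sum>i<n. \<Sum>j<n. 1 / (real n)\<^sup>2 * (((K w)\<^sup>2 * ?m j w) * ?m i w)))" for w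
  proof -
    define S where "S = (\<Sum>i<n. ?m i w)"
    have "(\<Sum>i<n. \<Sum>j<n. 1 / (real n)\<^sup>2 * (((K w)\<^sup>2 * ?m j w) * ?m i w)) = 1 / (real n)\<^sup>2 * (K w)\<^sup>2 * (S * S)"
    proof -
      have SS: "S * S = (\<Sum>i<n. \<Sum>j<n. ?m j w * ?m i w)" by (simp add: S_def sum_product mult.commute)
      show ?thesis unfolding SS sum_distrib_left by (intro sum.cong refl) (simp add: mult_ac)
    qed
    moreover have "(\<Sum>i<n. 2 / real n * ((Z w * K w) * ?m i w)) = 2 / real n * (Z w * K w) * S"
      unfolding S_def sum_distrib_left by (intro sum.cong refl) (simp add: mult_ac)
    ultimately show ?thesis unfolding S_def[symmetric] by (simp add: power2_eq_square algebra_simps)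
  qed
  have i0: "integrable (gprod I) (\<lambda>w. (Z w)\<^sup>2)" by (intro pb_integrable[OF I] pbd_power Z)
  have i1: "integrable (gprod I) (\<lambda>w. 2 / real n * ((Z w * K w) * ?m i w))" if "i < n" for i
    by (intro pb_integrable[OF I] pbd_mult Z K pm that pb_const)
  have i2: "integrable (gprod I) (\<lambda>w. 1 / (real n)\<^sup>2 * (((K w)\<^sup>2 * ?m j w) * ?m i w))" if "i < n" "j < n" for i j
    by (intro pb_integrable[OF I] pbd_mult pbd_power K pm that pb_const)
  have z1: "(\<integral>w. (Z w * K w) * ?m i w \<partial>gprod I) = 0" if i: "i < n" for i
    by (intro m_mean_zero g i psd pbd_mult Z K)
      (use frozen_mono[OF Z(2) subE[OF i]] frozen_mono[OF K(2) subE[OF i]] in \<open>auto simp: frozen_def\<close>)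
  have z2: "(\<integral>w. ((K w)\<^sup>2 * ?m j w) * ?m i w \<partial>gprod I) = 0" if i: "i < n" and j: "j < n" and ij: "i \<noteq> j" for i j
    by (intro m_mean_zero g i psd pbd_mult pbd_power pm j K)
      (use frozen_m[OF i j ij] frozen_mono[OF K(2) subE[OF i]] in \<open>auto simp: frozen_def\<close>)
  have "(\<integral>w. (Z w + K w * ((\<Sum>i<n. ?m i w) / real n))\<^sup>2 \<partial>gprod I)
    = (\<integral>w. (Z w)\<^sup>2 \<partial>gprod I) + ((\<Sum>i<n. 2 / real n * (\<integral>w. (Z w * K w) * ?m i w \<partial>gprod I))
      + (\<Sum>i<n. \<Sum>j<n. 1 / (real n)\<^sup>2 * (\<integral>w. ((K w)\<^sup>2 * ?m j w) * ?m i w \<partial>gprod I)))"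
  proof -
    have s1: "(\<integral>w. (\<Sum>i<n. 2 / real n * ((Z w * K w) * ?m i w)) \<partial>gprod I) = (\<Sum>i<n. 2 / real n * (\<integral>w. (Z w * K w) * ?m i w \<partial>gprod I))"
      using i1 by (subst Bochner_Integration.integral_sum) auto
    have s2: "(\<integral>w. (\<Sum>j<n. 1 / (real n)\<^sup>2 * (((K w)\<^sup>2 * ?m j w) * ?m i w)) \<partial>gprod I) = (\<Sum>j<n. 1 / (real n)\<^sup>2 * (\<integral>w. ((K w)\<^sup>2 * ?m j w) * ?m i w \<partial>gprod I))"
      if "i < n" for i
      using i2[OF that] by (subst Bochner_Integration.integral_sum) auto
    have j1: "integrable (gprod I) (\<lambda>w. \<Sum>i<n. 2 / real n * ((Z w * K w) * ?m i w))"
      using i1 by (intro Bochner_Integration.integrable_sum) auto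
    have j2: "integrable (gprod I) (\<lambda>w. \<Sum>j<n. 1 / (real n)\<^sup>2 * (((K w)\<^sup>2 * ?m j w) * ?m i w))" if "i < n" for i
      using i2[OF that] by (intro Bochner_Integration.integrable_sum) auto
    have j3: "integrable (gprod I) (\<lambda>w. \<Sum>i<n. \<Sum>j<n. 1 / (real n)\<^sup>2 * (((K w)\<^sup>2 * ?m j w) * ?m i w))"
      by (rule Bochner_Integration.integrable_sum) (rule j2, simp)
    have s3: "(\<integral>w. (\<Sum>i<n. \<Sum>j<n. 1 / (real n)\<^sup>2 * (((K w)\<^sup>2 * ?m j w) * ?m i w)) \<partial>gprod I)
      = (\<Sum>i<n. \<Sum>j<n. 1 / (real n)\<^sup>2 * (\<integral>w. ((K w)\<^sup>2 * ?m j w) * ?m i w \<partial>gprod I))"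
    proof -
      have "(\<integral>w. (\<Sum>i<n. \<Sum>j<n. 1 / (real n)\<^sup>2 * (((K w)\<^sup>2 * ?m j w) * ?m i w)) \<partial>gprod I)
        = (\<Sum>i<n. \<integral>w. (\<Sum>j<n. 1 / (real n)\<^sup>2 * (((K w)\<^sup>2 * ?m j w) * ?m i w)) \<partial>gprod I)"
        by (rule Bochner_Integration.integral_sum) (rule j2, simp)
      also have "\<dots> = (\<Sum>i<n. \<Sum>j<n. 1 / (real n)\<^sup>2 * (\<integral>w. ((K w)\<^sup>2 * ?m j w) * ?m i w \<partial>gprod I))"
        by (rule sum.cong[OF refl]) (rule s2, simp)
      finally show ?thesis .
    qed
    show ?thesis
      unfolding e s1[symmetric] s3[symmetric]
      by (simp only: Bochner_Integration.integral_add i0 j1 j3 Bochner_Integration.integrable_add)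
  qed
  also have "\<dots> = (\<integral>w. (Z w)\<^sup>2 \<partial>gprod I) + (\<Sum>i<n. 1 / (real n)\<^sup>2 * (\<integral>w. (K w)\<^sup>2 * (?m i w)\<^sup>2 \<partial>gprod I))"
  proof -
    have "(\<Sum>j<n. 1 / (real n)\<^sup>2 * (\<integral>w. ((K w)\<^sup>2 * ?m j w) * ?m i w \<partial>gprod I)) = 1 / (real n)\<^sup>2 * (\<integral>w. (K w)\<^sup>2 * (?m i w)\<^sup>2 \<partial>gprod I)" if i: "i < n" for i
    proof -
      have "(\<Sum>j<n. 1 / (real n)\<^sup>2 * (\<integral>w. ((K w)\<^sup>2 * ?m j w) * ?m i w \<partial>gprod I))
        = (\<Sum>j<n. if j = i then 1 / (real n)\<^sup>2 * (\<integral>w. (K w)\<^sup>2 * (?m i w)\<^sup>2 \<partial>gprod I) else 0)"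
        using z2[OF i] by (intro sum.cong refl) (auto simp: power2_eq_square mult.assoc)
      then show ?thesis using i by simp
    qed
    then show ?thesis using z1 by simp
  qed
  also have "\<dots> \<le> (\<integral>w. (Z w)\<^sup>2 \<partial>gprod I) + (\<Sum>i<n. 1 / (real n)\<^sup>2 * (\<integral>w. (K w)\<^sup>2 * (48 * ((p1 i w)\<^sup>2 + (p2 i w)\<^sup>2 + s + t) * (V1 w + V2 w) + 72 * ((V1 w)\<^sup>2 + (V2 w)\<^sup>2)) \<partial>gprod I))"
    by (intro add_left_mono sum_mono mult_left_mono m_square h psd pbd_power K frozen_comp[of E K "\<lambda>x. x\<^sup>2"]) auto
  finally show ?thesis by (simp add: sum_divide_distrib)
qed

end

section \<open>The network\<close>

type_synonym 'd weight_index = "(nat \<times> 'd) + (nat \<times> nat \<times> nat)"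

definition weight_indices :: "nat \<Rightarrow> nat \<Rightarrow> 'd::finite weight_index set" where
  "weight_indices n L = ({..<n} \<times> UNIV) <+> ({1..L} \<times> {..<n} \<times> {..<n})"

text \<open>Here \<open>w\<close> lists standard normal variables; the standard deviations \<open>1 / sqrt d\<close> and \<open>1 / sqrt n\<close>
  of the weights are moved into the coefficients.\<close>

primrec act :: "nat \<Rightarrow> nat \<Rightarrow> real ^ 'd::finite \<Rightarrow> nat \<Rightarrow> nat \<Rightarrow> ('d weight_index \<Rightarrow> real) \<Rightarrow> real" where
  "act n L x 0 = (\<lambda>i w. \<Sum>j\<in>UNIV. w (Inl (i, j)) * (x $ j / sqrt (real CARD('d))))"
| "act n L x (Suc k) = (\<lambda>i w. act n L x k i w
     + (\<Sum>j<n. w (Inr (Suc k, i, j)) * (relu (act n L x k j w) / sqrt (real n * real L))))"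

definition msq :: "nat \<Rightarrow> nat \<Rightarrow> real ^ 'd::finite \<Rightarrow> nat \<Rightarrow> ('d weight_index \<Rightarrow> real) \<Rightarrow> real" where
  "msq n L x k w = (\<Sum>i<n. (act n L x k i w)\<^sup>2) / real n"

text \<open>\<open>rsq\<close> and \<open>rcr\<close>, divided by the depth, are the entries of the
  conditional covariance of the next increment of a neuron.\<close>

definition rsq :: "nat \<Rightarrow> nat \<Rightarrow> real ^ 'd::finite \<Rightarrow> nat \<Rightarrow> ('d weight_index \<Rightarrow> real) \<Rightarrow> real" where
  "rsq n L x k w = (\<Sum>i<n. (relu (act n L x k i w))\<^sup>2) / real n"

definition rcr :: "nat \<Rightarrow> nat \<Rightarrow> real ^ 'd::finite \<Rightarrow> real ^ 'd \<Rightarrow> nat \<Rightarrow> ('d weight_index \<Rightarrow> real) \<Rightarrow> real" where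
  "rcr n L x y k w = (\<Sum>i<n. relu (act n L x k i w) * relu (act n L y k i w)) / real n"

lemma finite_weight_indices: "finite (weight_indices n L)"
  by (simp add: weight_indices_def)

lemma pb_act:
  fixes x :: "real ^ 'd::finite"
  assumes "k \<le> L" "i < n"
  shows "pb (weight_indices n L) (act n L x k i)"
  using assms
proof (induction k arbitrary: i)
  case 0
  have "Inl (i, j) \<in> weight_indices n L" for j :: 'd using 0 by (auto simp: weight_indices_def)
  then show ?case
    by (auto intro!: pbd_sum pbd_mult pb_const pb_component finite_weight_indices simp: sum_nonneg
        simp del: times_divide_eq_right times_divide_eq_left)
next
  case (Suc k)
  have "Inr (Suc k, i, j) \<in> weight_indices n L" if "j < n" for j using Suc that by (auto simp: weight_indices_def)
  moreover have "pb (weight_indices n L) (\<lambda>w. relu (act n L x k j w) / sqrt (real n * real L))" if "j < n" for j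
    unfolding divide_inverse using Suc that by (intro pbd_mult pb_const pbd_relu) auto
  ultimately show ?case using Suc
    by (auto intro!: pbd_add pbd_sum pbd_mult pb_const pb_component finite_weight_indices simp: sum_nonneg
        simp del: times_divide_eq_right times_divide_eq_left)
qed

text \<open>A function frozen on \<open>after k\<close> is one determined by the input weights and
  the hidden layers up to k.\<close>

definition after :: "nat \<Rightarrow> 'd weight_index set" where
  "after k = {Inr (l, i, j) |l i j. k < l}"

lemma after_mono: "k \<le> k' \<Longrightarrow> after k' \<subseteq> after k"
  by (auto simp: after_def)

lemma frozen_act: "frozen (after k) (act n L x k i)"
proof (induction k arbitrary: i)
  case 0
  show ?case by (auto simp: frozen_def after_def)
next
  case (Suc k)
  have f: "frozen (after (Suc k)) (act n L x k i)" for i by (rule frozen_mono[OF Suc after_mono]) simp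
  show ?case
    unfolding frozen_def
  proof (intro ballI allI)
    fix e :: "'a weight_index" and w z assume e: "e \<in> after (Suc k)"
    then have "Inr (Suc k, i, j) \<noteq> e" for j by (auto simp: after_def)
    then show "act n L x (Suc k) i (w(e := z)) = act n L x (Suc k) i w"
      by (simp add: frozenD[OF f e])
  qed
qed

lemma frozen_funs:
  "frozen E (f :: _ \<Rightarrow> real) \<Longrightarrow> frozen E g \<Longrightarrow> frozen E (\<lambda>w. f w + g w)"
  "frozen E f \<Longrightarrow> frozen E g \<Longrightarrow> frozen E (\<lambda>w. f w * g w)"
  "frozen E f \<Longrightarrow> frozen E g \<Longrightarrow> frozen E (\<lambda>w. f w - g w)"
  "frozen E (\<lambda>w. c)"
  "(\<And>i. i \<in> A \<Longrightarrow> frozen E (F i)) \<Longrightarrow> frozen E (\<lambda>w. \<Sum>i\<in>A. (F i w :: real))"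
  by (auto simp: frozen_def intro!: sum.cong)

lemma mean_pb:
  assumes "\<And>i. i < n \<Longrightarrow> pb I (f i)"
  shows "pb I (\<lambda>w. (\<Sum>i<n. f i w) / real n)"
  unfolding divide_inverse using assms by (auto intro!: pbd_mult pbd_sum pb_const simp: sum_nonneg)

lemma pb_means:
  assumes "k \<le> L"
  shows "pb (weight_indices n L) (msq n L x k)" "pb (weight_indices n L) (rsq n L x k)" "pb (weight_indices n L) (rcr n L x y k)"
  unfolding msq_def[abs_def] rsq_def[abs_def] rcr_def[abs_def]
  using assms by (auto intro!: mean_pb pbd_power pbd_mult pbd_relu pb_act)

lemma frozen_means:
  "frozen (after k) (msq n L x k)" "frozen (after k) (rsq n L x k)" "frozen (after k) (rcr n L x y k)"
  unfolding msq_def[abs_def] rsq_def[abs_def] rcr_def[abs_def]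
  by (auto simp: frozen_def frozenD[OF frozen_act])

lemma rsq_le_msq: "0 \<le> rsq n L x k w" "rsq n L x k w \<le> msq n L x k w"
proof -
  have "(relu y)\<^sup>2 \<le> y\<^sup>2" for y using relu_bounds(1)[of y] by (simp add: abs_le_square_iff[symmetric])
  then show "0 \<le> rsq n L x k w" "rsq n L x k w \<le> msq n L x k w"
    by (auto simp: rsq_def msq_def intro!: divide_right_mono sum_mono divide_nonneg_nonneg sum_nonneg)
qed

lemma rcr_nonneg: "0 \<le> rcr n L x y k w"
  by (auto simp: rcr_def relu_bounds intro!: divide_nonneg_nonneg sum_nonneg mult_nonneg_nonneg)

lemma msq_nonneg: "0 \<le> msq n L x k w"
  by (auto simp: msq_def intro!: divide_nonneg_nonneg sum_nonneg)

lemma mean_CS: "((\<Sum>i<n. f i * g i) / real n)\<^sup>2 \<le> ((\<Sum>i<n. (f i)\<^sup>2) / real n) * ((\<Sum>i<n. (g i)\<^sup>2) / real n)"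
proof -
  have "(\<Sum>i<n. f i * g i)\<^sup>2 \<le> (\<Sum>i<n. (f i)\<^sup>2) * (\<Sum>i<n. (g i)\<^sup>2)" by (rule Cauchy_Schwarz_ineq_sum)
  then have "(\<Sum>i<n. f i * g i)\<^sup>2 / (real n)\<^sup>2 \<le> (\<Sum>i<n. (f i)\<^sup>2) * (\<Sum>i<n. (g i)\<^sup>2) / (real n)\<^sup>2" by (rule divide_right_mono) simp
  then show ?thesis by (simp add: power_divide power2_eq_square)
qed

lemma mean_square_le: "((\<Sum>i<n. f i) / real n)\<^sup>2 \<le> (\<Sum>i<n. (f i :: real)\<^sup>2) / real n"
proof (cases "n = 0")
  case False
  then show ?thesis using mean_CS[of f "\<lambda>_. 1" n] by simp
qed simp

lemma rows_hidden:
  assumes "k < L" "1 \<le> n"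
  shows "rows (weight_indices n L) n (\<lambda>i j. Inr (Suc k, i, j)) {..<n} (act n L x k) (act n L y k)
    (\<lambda>j w. relu (act n L x k j w) / sqrt (real n * real L)) (\<lambda>j w. relu (act n L y k j w) / sqrt (real n * real L))
    (\<Union>i<n. (\<lambda>j. Inr (Suc k, i, j)) ` {..<n})"
proof
  let ?I = "weight_indices n L" and ?E = "\<Union>i<n. (\<lambda>j. Inr (Suc k, i, j)) ` {..<n} :: 'a weight_index set"
  have sub: "?E \<subseteq> after k" by (auto simp: after_def)
  show "pb ?I (act n L x k i)" "pb ?I (act n L y k i)" if "i < n" for i using assms that by (auto intro: pb_act)
  show fr: "frozen ?E (act n L x k i)" "frozen ?E (act n L y k i)" for i
    by (rule frozen_mono[OF frozen_act sub])+
  show "pb ?I (\<lambda>w. relu (act n L x k j w) / sqrt (real n * real L))" "pb ?I (\<lambda>w. relu (act n L y k j w) / sqrt (real n * real L))" if "j \<in> {..<n}" for j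
    unfolding divide_inverse using assms that by (auto intro!: pbd_mult pb_const pbd_relu pb_act)
  show "frozen ?E (\<lambda>w. relu (act n L x k j w) / sqrt (real n * real L))" "frozen ?E (\<lambda>w. relu (act n L y k j w) / sqrt (real n * real L))" for j
    using fr by (simp_all add: frozen_def)
qed (use assms in \<open>auto simp: finite_weight_indices inj_on_def weight_indices_def\<close>)

lemma rows_input:
  fixes x y :: "real ^ 'd::finite"
  assumes "1 \<le> n"
  shows "rows (weight_indices n L) n (\<lambda>i j. Inl (i, j)) (UNIV :: 'd set) (\<lambda>_ _. 0) (\<lambda>_ _. 0)
    (\<lambda>j w. x $ j / sqrt (real CARD('d))) (\<lambda>j w. y $ j / sqrt (real CARD('d)))
    (\<Union>i<n. (\<lambda>j. Inl (i, j)) ` UNIV)"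
  by unfold_locales (use assms in \<open>auto simp: finite_weight_indices inj_on_def weight_indices_def frozen_def pb_const\<close>)

text \<open>The flow enters only as a \<open>flow_path\<close> with the right initial value, so the
  locale can also be instantiated at the pair (b, b). \<open>\<gamma>\<close> is a common bound
  through which all constants depend on the initial variances.\<close>

locale net =
  fixes a b :: "real ^ 'd::finite" and n L :: nat and \<alpha> \<beta> \<gamma> :: real and u :: "real \<Rightarrow> real"
  assumes n: "1 \<le> n" and L: "1 \<le> L"
    and \<alpha>: "\<alpha> = (norm a)\<^sup>2 / real CARD('d)" and \<beta>: "\<beta> = (norm b)\<^sup>2 / real CARD('d)"
    and u0: "u 0 = inner a b / real CARD('d)"
    and flow: "flow_path \<alpha> \<beta> u"
    and \<gamma>: "\<alpha> \<le> \<gamma>" "\<beta> \<le> \<gamma>" "1 \<le> \<gamma>"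
begin

abbreviation "I \<equiv> weight_indices n L :: 'd weight_index set"
abbreviation "ya \<equiv> act n L a"
abbreviation "yb \<equiv> act n L b"
definition "tm (k::nat) = real k / real L"
definition "qa k = \<alpha> * exp (tm k / 2)"
definition "qb k = \<beta> * exp (tm k / 2)"
definition "qx k = u (tm k)"

lemma pos: "0 < \<alpha>" "0 < \<beta>"
  using flow by (auto simp: flow_path_def)

lemma tm: "k \<le> L \<Longrightarrow> 0 \<le> tm k" "k \<le> L \<Longrightarrow> tm k \<le> 1" "k \<le> l \<Longrightarrow> tm k \<le> tm l" "tm (Suc k) = tm k + 1 / real L"
  using L by (auto simp: tm_def divide_right_mono add_divide_distrib)

lemma sqrt_prod_le: "sqrt (\<alpha> * \<beta>) \<le> \<gamma>"
proof -
  have "\<alpha> * \<beta> \<le> \<gamma>\<^sup>2" unfolding power2_eq_square using \<gamma> pos by (intro mult_mono) auto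
  then have "sqrt (\<alpha> * \<beta>) \<le> sqrt (\<gamma>\<^sup>2)" by (rule real_sqrt_le_mono)
  then show ?thesis using \<gamma> by simp
qed

lemma q_bounds:
  assumes "k \<le> L"
  shows "0 < qa k" "qa k \<le> 2 * \<gamma>" "0 < qb k" "qb k \<le> 2 * \<gamma>" "\<bar>qx k\<bar> \<le> 2 * \<gamma>"
proof -
  note e = exp_half_bounds(3,4)[of "tm k" "tm k"] tm(1,2)[OF assms]
  show "0 < qa k" "0 < qb k" using pos by (auto simp: qa_def qb_def)
  have "\<alpha> * exp (tm k / 2) \<le> \<gamma> * 2" "\<beta> * exp (tm k / 2) \<le> \<gamma> * 2" using e \<gamma> pos by (auto intro!: mult_mono)
  then show "qa k \<le> 2 * \<gamma>" "qb k \<le> 2 * \<gamma>" by (auto simp: qa_def qb_def)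
  have "\<bar>qx k\<bar> \<le> sqrt (\<alpha> * \<beta>) * exp (tm k / 2)" using flow e by (auto simp: flow_path_def qx_def)
  also have "\<dots> \<le> \<gamma> * 2" using e \<gamma> sqrt_prod_le by (intro mult_mono) auto
  finally show "\<bar>qx k\<bar> \<le> 2 * \<gamma>" by simp
qed

lemma incr_bounds:
  assumes "k \<le> l" "l \<le> L"
  shows "\<alpha> * ((tm l - tm k) / 2) \<le> qa l - qa k" "qa l - qa k \<le> \<gamma>" "0 \<le> qa l - qa k"
    "\<beta> * ((tm l - tm k) / 2) \<le> qb l - qb k" "qb l - qb k \<le> \<gamma>" "0 \<le> qb l - qb k"
    "0 \<le> qx l - qx k" "psd (qa l - qa k) (qb l - qb k) (qx l - qx k)"
proof -
  have t: "0 \<le> tm k" "tm k \<le> tm l" "tm l \<le> 1" using tm assms by auto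
  note e = exp_half_bounds(1,2)[OF t]
  have d: "qa l - qa k = \<alpha> * (exp (tm l / 2) - exp (tm k / 2))" "qb l - qb k = \<beta> * (exp (tm l / 2) - exp (tm k / 2))"
    by (simp_all add: qa_def qb_def algebra_simps)
  define D where "D = exp (tm l / 2) - exp (tm k / 2)"
  have D: "0 \<le> D" "D \<le> 1" "(tm l - tm k) / 2 \<le> D" using e t by (auto simp: D_def)
  show "\<alpha> * ((tm l - tm k) / 2) \<le> qa l - qa k" "\<beta> * ((tm l - tm k) / 2) \<le> qb l - qb k"
    unfolding d D_def[symmetric] using D pos by (auto intro!: mult_left_mono)
  have "\<alpha> * D \<le> \<gamma> * 1" "\<beta> * D \<le> \<gamma> * 1" using D pos \<gamma> by (intro mult_mono; simp)+
  then show "qa l - qa k \<le> \<gamma>" "qb l - qb k \<le> \<gamma>" unfolding d D_def[symmetric] by auto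
  show nn: "0 \<le> qa l - qa k" "0 \<le> qb l - qb k" unfolding d D_def[symmetric] using D pos by auto
  have u: "0 \<le> qx l - qx k" "qx l - qx k \<le> sqrt (\<alpha> * \<beta>) * D"
    using flow t unfolding flow_path_def qx_def D_def by blast+
  show "0 \<le> qx l - qx k" by (rule u)
  have "(qx l - qx k)\<^sup>2 \<le> (sqrt (\<alpha> * \<beta>) * D)\<^sup>2" using u by (intro power_mono)
  also have "\<dots> = (qa l - qa k) * (qb l - qb k)"
    unfolding d D_def[symmetric] using pos by (simp add: power_mult_distrib power2_eq_square)
  finally show "psd (qa l - qa k) (qb l - qb k) (qx l - qx k)" using nn by (simp add: psd_def)
qed

lemma psd_q: "k \<le> L \<Longrightarrow> psd (qa k) (qb k) (qx k)"
proof -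
  assume k: "k \<le> L"
  have "\<bar>qx k\<bar> \<le> sqrt (\<alpha> * \<beta>) * exp (tm k / 2)" using flow tm(1,2)[OF k] by (auto simp: flow_path_def qx_def)
  then have "\<bar>qx k\<bar>\<^sup>2 \<le> (sqrt (\<alpha> * \<beta>) * exp (tm k / 2))\<^sup>2" by (rule power_mono) simp
  also have "\<dots> = qa k * qb k" using pos by (simp add: power_mult_distrib qa_def qb_def power2_eq_square)
  finally show ?thesis using q_bounds[OF k] by (simp add: psd_def)
qed

definition T :: "(real \<times> real \<Rightarrow> real) \<Rightarrow> nat \<Rightarrow> nat \<Rightarrow> ('d weight_index \<Rightarrow> real) \<Rightarrow> real" where
  "T h l k w = (\<Sum>i<n. gcov (qa l - qa k) (qb l - qb k) (qx l - qx k) h (ya k i w, yb k i w)) / real n"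

text \<open>The conditional mean, given layer k, of the summand that neuron i contributes to
  \<open>T h l (Suc k)\<close>: the smoothing still ahead after layer k + 1, enlarged by the true
  covariance of the increment. Inserting it splits a step of \<open>T\<close> into the centred
  \<open>mart\<close> and the \<open>drift\<close>.\<close>

definition comp :: "(real \<times> real \<Rightarrow> real) \<Rightarrow> nat \<Rightarrow> nat \<Rightarrow> nat \<Rightarrow> ('d weight_index \<Rightarrow> real) \<Rightarrow> real" where
  "comp h l k i w = gcov (qa l - qa (Suc k) + rsq n L a k w / real L) (qb l - qb (Suc k) + rsq n L b k w / real L)
     (qx l - qx (Suc k) + rcr n L a b k w / real L) h (ya k i w, yb k i w)"

definition drift :: "(real \<times> real \<Rightarrow> real) \<Rightarrow> nat \<Rightarrow> nat \<Rightarrow> ('d weight_index \<Rightarrow> real) \<Rightarrow> real" where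
  "drift h l k w = (\<Sum>i<n. comp h l k i w - gcov (qa l - qa k) (qb l - qb k) (qx l - qx k) h (ya k i w, yb k i w)) / real n"

definition mart :: "(real \<times> real \<Rightarrow> real) \<Rightarrow> nat \<Rightarrow> nat \<Rightarrow> ('d weight_index \<Rightarrow> real) \<Rightarrow> real" where
  "mart h l k w = (\<Sum>i<n. gcov (qa l - qa (Suc k)) (qb l - qb (Suc k)) (qx l - qx (Suc k)) h (ya (Suc k) i w, yb (Suc k) i w) - comp h l k i w) / real n"

lemma T_Suc: "T h l (Suc k) w - T h l k w = mart h l k w + drift h l k w"
  by (simp add: T_def mart_def drift_def add_divide_distrib[symmetric] diff_divide_distrib[symmetric] sum_subtractf)

text \<open>Dictionary between the abstract layer and the network; the two factors 1 / sqrt(n L) of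
  the coefficients produce an average over neurons and the step 1 / L.\<close>

lemma layer_V:
  assumes k: "k < L"
  shows "rows.V1 {..<n} (\<lambda>j w. relu (ya k j w) / sqrt (real n * real L)) w = rsq n L a k w / real L"
    "rows.V2 {..<n} (\<lambda>j w. relu (yb k j w) / sqrt (real n * real L)) w = rsq n L b k w / real L"
    "rows.V12 {..<n} (\<lambda>j w. relu (ya k j w) / sqrt (real n * real L)) (\<lambda>j w. relu (yb k j w) / sqrt (real n * real L)) w = rcr n L a b k w / real L"
    "ya k i w + rows.x1 (\<lambda>i j. Inr (Suc k, i, j)) {..<n} (\<lambda>j w. relu (ya k j w) / sqrt (real n * real L)) i w = ya (Suc k) i w"
    "yb k i w + rows.x2 (\<lambda>i j. Inr (Suc k, i, j)) {..<n} (\<lambda>j w. relu (yb k j w) / sqrt (real n * real L)) i w = yb (Suc k) i w"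
proof -
  interpret R: rows I n "\<lambda>i j. Inr (Suc k, i, j)" "{..<n}" "ya k" "yb k"
    "\<lambda>j w. relu (ya k j w) / sqrt (real n * real L)" "\<lambda>j w. relu (yb k j w) / sqrt (real n * real L)"
    "\<Union>i<n. (\<lambda>j. Inr (Suc k, i, j)) ` {..<n}"
    by (rule rows_hidden[OF k n])
  have nL: "real n * real L > 0" using n L by simp
  have sq: "x / sqrt (real n * real L) * (y / sqrt (real n * real L)) = x * y / (real n * real L)" for x y
    using nL by (simp add: field_simps real_sqrt_mult[symmetric])
  show "R.V1 w = rsq n L a k w / real L" "R.V2 w = rsq n L b k w / real L" "R.V12 w = rcr n L a b k w / real L"
    by (simp_all add: R.V1_def R.V2_def R.V12_def rsq_def rcr_def power2_eq_square sq sum_divide_distrib[symmetric])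
  show "ya k i w + R.x1 i w = ya (Suc k) i w" "yb k i w + R.x2 i w = yb (Suc k) i w"
    by (simp_all add: R.x1_def R.x2_def)
qed

end

section \<open>Fourth moments of the activations\<close>

text \<open>Under the root, 384 = 336 + 48: the input layer contributes 336 to the squared noise,
  and all hidden layers together contribute 1584 exp 9 + 48.\<close>

definition noise_const :: real where
  "noise_const = sqrt (1584 * exp 9 + 384)"

lemma noise_const_ge: "1 \<le> noise_const"
proof -
  have "0 \<le> exp (9::real)" by simp
  then have "1 \<le> 1584 * exp 9 + (384::real)" by linarith
  then show ?thesis unfolding noise_const_def by (simp add: real_le_rsqrt)
qed

text \<open>A Gaussian increment of variance V changes y^4 in mean to y^4 + 6 y^2 V + 3 V^2. Here V
  <= msq / L, and msq^2 is at most the mean of the fourth powers, so 6 + 3 = 9 is the growth per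
  unit of depth.\<close>

lemma power4_mean_step:
  fixes x :: "real ^ 'd::finite"
  assumes k: "k < L" and n: "1 \<le> n"
  defines "Q \<equiv> \<lambda>k. (\<integral>w. (\<Sum>i<n. (act n L x k i w) ^ 4) / real n \<partial>gprod (weight_indices n L))"
  shows "Q (Suc k) \<le> (1 + 9 / real L) * Q k"
proof -
  let ?I = "weight_indices n L :: 'd weight_index set"
  interpret R: rows ?I n "\<lambda>i j. Inr (Suc k, i, j)" "{..<n}" "act n L x k" "act n L x k"
    "\<lambda>j w. relu (act n L x k j w) / sqrt (real n * real L)" "\<lambda>j w. relu (act n L x k j w) / sqrt (real n * real L)"
    "\<Union>i<n. (\<lambda>j. Inr (Suc k, i, j)) ` {..<n}"
    by (rule rows_hidden[OF k n])
  have L: "1 \<le> real L" using k by simp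
  have nL: "real n * real L > 0" using n k by simp
  have sq: "y / sqrt (real n * real L) * (y / sqrt (real n * real L)) = y * y / (real n * real L)" for y
    using nL by (simp add: field_simps real_sqrt_mult[symmetric])
  have V1: "R.V1 w = rsq n L x k w / real L" for w
    by (simp add: R.V1_def rsq_def power2_eq_square sq sum_divide_distrib[symmetric])
  have fin: "finite ?I" by (rule finite_weight_indices)
  let ?y = "act n L x k"
  have py: "pb ?I (?y i)" if "i < n" for i using k that by (auto intro: pb_act)
  have h: "pgrow (\<lambda>q::real\<times>real. (fst q) ^ 4)" by (intro pbd_intros)
  have one: "(\<integral>w. (act n L x (Suc k) i w) ^ 4 \<partial>gprod ?I) = (\<integral>w. (?y i w) ^ 4 + (6 * (?y i w)\<^sup>2 * R.V1 w + 3 * (R.V1 w)\<^sup>2) \<partial>gprod ?I)" if i: "i < n" for i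
  proof -
    have "(\<integral>w. 1 * gcov 0 0 0 (\<lambda>q. (fst q) ^ 4) (?y i w + R.x1 i w, ?y i w + R.x2 i w) \<partial>gprod ?I)
      = (\<integral>w. 1 * gcov (0 + R.V1 w) (0 + R.V2 w) (0 + R.V12 w) (\<lambda>q. (fst q) ^ 4) (?y i w, ?y i w) \<partial>gprod ?I)"
      by (rule R.average[OF h i pb_const _ psd_0 R.p1(1)[OF i] frozen_mono[OF R.p1(2)[OF i] R.subE[OF i]] R.p2(1)[OF i] frozen_mono[OF R.p2(2)[OF i] R.subE[OF i]]])
        (simp add: frozen_def)
    then show ?thesis by (simp add: gcov_moments[OF R.psdV] R.x1_def add.assoc)
  qed
  have i4: "integrable (gprod ?I) (\<lambda>w. (act n L x (Suc k) i w) ^ 4)" if "i < n" for i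
    using k that by (intro pb_integrable fin pbd_power pb_act) auto
  have i5: "integrable (gprod ?I) (\<lambda>w. (?y i w) ^ 4 + (6 * (?y i w)\<^sup>2 * R.V1 w + 3 * (R.V1 w)\<^sup>2))" if "i < n" for i
    by (intro pb_integrable fin pbd_power pbd_add pbd_mult py that R.pbs pb_const)
  have int_mean: "(\<integral>w. (\<Sum>i<n. f i w) / real n \<partial>gprod ?I) = (\<Sum>i<n. \<integral>w. f i w \<partial>gprod ?I) / real n"
    if "\<And>i. i < n \<Longrightarrow> integrable (gprod ?I) (f i)" for f :: "nat \<Rightarrow> _ \<Rightarrow> real"
  proof -
    have "(\<integral>w. (\<Sum>i<n. f i w) \<partial>gprod ?I) = (\<Sum>i<n. \<integral>w. f i w \<partial>gprod ?I)"
      by (rule Bochner_Integration.integral_sum) (use that in auto)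
    then show ?thesis by simp
  qed
  have "Q (Suc k) = (\<Sum>i<n. \<integral>w. (act n L x (Suc k) i w) ^ 4 \<partial>gprod ?I) / real n"
    unfolding Q_def by (rule int_mean[OF i4])
  also have "\<dots> = (\<Sum>i<n. \<integral>w. (?y i w) ^ 4 + (6 * (?y i w)\<^sup>2 * R.V1 w + 3 * (R.V1 w)\<^sup>2) \<partial>gprod ?I) / real n"
    using one by simp
  also have "\<dots> = (\<integral>w. (\<Sum>i<n. (?y i w) ^ 4 + (6 * (?y i w)\<^sup>2 * R.V1 w + 3 * (R.V1 w)\<^sup>2)) / real n \<partial>gprod ?I)"
    by (rule int_mean[OF i5, symmetric])
  also have "\<dots> \<le> (\<integral>w. (1 + 9 / real L) * ((\<Sum>i<n. (?y i w) ^ 4) / real n) \<partial>gprod ?I)"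
  proof (rule integral_mono)
    show "integrable (gprod ?I) (\<lambda>w. (\<Sum>i<n. (?y i w) ^ 4 + (6 * (?y i w)\<^sup>2 * R.V1 w + 3 * (R.V1 w)\<^sup>2)) / real n)"
      by (intro pb_integrable fin mean_pb pbd_power pbd_add pbd_mult py R.pbs pb_const)
    show "integrable (gprod ?I) (\<lambda>w. (1 + 9 / real L) * ((\<Sum>i<n. (?y i w) ^ 4) / real n))"
      by (intro pb_integrable fin pbd_mult mean_pb pbd_power py pb_const)
    fix w
    define A where "A = msq n L x k w"
    define P where "P = (\<Sum>i<n. (?y i w) ^ 4) / real n"
    have A0: "0 \<le> A" by (simp add: A_def msq_nonneg)
    have AP: "A\<^sup>2 \<le> P" using mean_square_le[of "\<lambda>i. (?y i w)\<^sup>2" n] by (simp add: A_def P_def msq_def)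
    have V: "0 \<le> R.V1 w" "R.V1 w \<le> A / real L"
      using rsq_le_msq[of n L x k w] by (simp_all add: V1 A_def divide_right_mono)
    have n0: "0 < real n" using n by simp
    have "(\<Sum>i<n. (?y i w) ^ 4 + (6 * (?y i w)\<^sup>2 * R.V1 w + 3 * (R.V1 w)\<^sup>2)) / real n = P + (6 * A * R.V1 w + 3 * (R.V1 w)\<^sup>2)"
      using n0 by (simp add: sum.distrib P_def A_def msq_def sum_distrib_left[symmetric] sum_distrib_right[symmetric] add_divide_distrib)
    also have "\<dots> \<le> P + (6 * A * (A / real L) + 3 * (A / real L)\<^sup>2)"
      using V A0 by (intro add_left_mono add_mono mult_left_mono power_mono) auto
    also have "\<dots> \<le> P + (6 * A\<^sup>2 / real L + 3 * A\<^sup>2 / real L)"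
    proof -
      have "(A / real L)\<^sup>2 \<le> A\<^sup>2 / real L"
      proof -
        have "(A / real L)\<^sup>2 = A\<^sup>2 / real L / real L" by (simp add: power2_eq_square)
        also have "\<dots> \<le> A\<^sup>2 / real L / 1" using L by (intro divide_left_mono) auto
        finally show ?thesis by simp
      qed
      then show ?thesis by (simp add: power2_eq_square)
    qed
    also have "\<dots> \<le> P + (6 * P / real L + 3 * P / real L)"
      using AP L by (intro add_left_mono add_mono divide_right_mono) auto
    also have "\<dots> = (1 + 9 / real L) * P" by (simp add: algebra_simps add_divide_distrib[symmetric])
    finally show "(\<Sum>i<n. (?y i w) ^ 4 + (6 * (?y i w)\<^sup>2 * R.V1 w + 3 * (R.V1 w)\<^sup>2)) / real n \<le> (1 + 9 / real L) * P" .
  qed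
  also have "\<dots> = (1 + 9 / real L) * Q k" by (simp add: Q_def)
  finally show ?thesis .
qed

text \<open>The input layer is Gaussian, hence the 3, and (1 + 9 / L)^L <= exp 9 controls all layers
  uniformly in the depth.\<close>

lemma msq_second_moment:
  fixes x :: "real ^ 'd::finite"
  assumes k: "k \<le> L" and n: "1 \<le> n"
  shows "(\<integral>w. (msq n L x k w)\<^sup>2 \<partial>gprod (weight_indices n L)) \<le> 3 * exp 9 * ((norm x)\<^sup>2 / real CARD('d))\<^sup>2"
proof -
  let ?I = "weight_indices n L :: 'd weight_index set"
  define Q where "Q k = (\<integral>w. (\<Sum>i<n. (act n L x k i w) ^ 4) / real n \<partial>gprod ?I)" for k
  have fin: "finite ?I" by (rule finite_weight_indices)
  interpret R: rows ?I n "\<lambda>i j. Inl (i, j)" "UNIV :: 'd set" "\<lambda>_ _. 0" "\<lambda>_ _. 0"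
    "\<lambda>j w. x $ j / sqrt (real CARD('d))" "\<lambda>j w. x $ j / sqrt (real CARD('d))" "\<Union>i<n. (\<lambda>j. Inl (i, j)) ` UNIV"
    by (rule rows_input[OF n])
  have h: "pgrow (\<lambda>q::real\<times>real. (fst q) ^ 4)" by (intro pbd_intros)
  have V1: "R.V1 w = (norm x)\<^sup>2 / real CARD('d)" for w
    by (simp add: R.V1_def power_divide sum_divide_distrib[symmetric] norm_vec_def L2_set_def sum_nonneg)
  have one: "(\<integral>w. (act n L x 0 i w) ^ 4 \<partial>gprod ?I) = 3 * ((norm x)\<^sup>2 / real CARD('d))\<^sup>2" if i: "i < n" for i
  proof -
    have "(\<integral>w. 1 * gcov 0 0 0 (\<lambda>q. (fst q) ^ 4) (0 + R.x1 i w, 0 + R.x2 i w) \<partial>gprod ?I)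
      = (\<integral>w. 1 * gcov (0 + R.V1 w) (0 + R.V2 w) (0 + R.V12 w) (\<lambda>q. (fst q) ^ 4) (0, 0) \<partial>gprod ?I)"
      by (rule R.average[OF h i pb_const _ psd_0 pb_const _ pb_const]) (simp_all add: frozen_def)
    moreover have "gcov (R.V1 w) (R.V2 w) (R.V12 w) (\<lambda>q. (fst q) ^ 4) (0, 0) = 3 * (R.V1 w)\<^sup>2" for w
      by (simp add: gcov_moments[OF R.psdV])
    ultimately have "(\<integral>w. (R.x1 i w) ^ 4 \<partial>gprod ?I) = (\<integral>w. 3 * (R.V1 w)\<^sup>2 \<partial>gprod ?I)" by simp
    then show ?thesis by (simp add: V1) (simp add: R.x1_def)
  qed
  have Q0: "Q 0 = 3 * ((norm x)\<^sup>2 / real CARD('d))\<^sup>2"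
  proof -
    have "(\<integral>w. (\<Sum>i<n. (act n L x 0 i w) ^ 4) \<partial>gprod ?I) = (\<Sum>i<n. \<integral>w. (act n L x 0 i w) ^ 4 \<partial>gprod ?I)"
    proof (rule Bochner_Integration.integral_sum)
      show "integrable (gprod ?I) (\<lambda>w. (act n L x 0 i w) ^ 4)" if "i \<in> {..<n}" for i
        using that by (intro pb_integrable fin pbd_power pb_act) auto
    qed
    also have "\<dots> = real n * (3 * ((norm x)\<^sup>2 / real CARD('d))\<^sup>2)" using one by simp
    finally show ?thesis using n by (simp add: Q_def)
  qed
  have "Q k \<le> (1 + 9 / real L) ^ k * Q 0" if "k \<le> L" for k
    using that
  proof (induction k)
    case (Suc k)
    have "Q (Suc k) \<le> (1 + 9 / real L) * Q k" unfolding Q_def using Suc n by (intro power4_mean_step) auto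
    also have "\<dots> \<le> (1 + 9 / real L) * ((1 + 9 / real L) ^ k * Q 0)" using Suc by (intro mult_left_mono) auto
    finally show ?case by (simp add: mult_ac)
  qed simp
  from this[OF k] have "Q k \<le> (1 + 9 / real L) ^ k * Q 0" .
  also have "\<dots> \<le> exp 9 * Q 0"
  proof (rule mult_right_mono)
    have "(1 + 9 / real L) ^ k \<le> exp (9 / real L) ^ k" by (intro power_mono exp_ge_add_one_self) auto
    also have "\<dots> = exp (real k * (9 / real L))" by (rule exp_of_nat_mult[symmetric])
    also have "\<dots> \<le> exp 9" using k by (cases "L = 0") (auto simp: field_simps)
    finally show "(1 + 9 / real L) ^ k \<le> exp 9" .
    show "0 \<le> Q 0" by (simp add: Q0)
  qed
  finally have Qk: "Q k \<le> 3 * exp 9 * ((norm x)\<^sup>2 / real CARD('d))\<^sup>2" by (simp add: Q0 mult_ac)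
  have "(\<integral>w. (msq n L x k w)\<^sup>2 \<partial>gprod ?I) \<le> Q k"
    unfolding Q_def
  proof (rule integral_mono)
    show "integrable (gprod ?I) (\<lambda>w. (msq n L x k w)\<^sup>2)" by (intro pb_integrable fin pbd_power pb_means k)
    show "integrable (gprod ?I) (\<lambda>w. (\<Sum>i<n. (act n L x k i w) ^ 4) / real n)"
      using k by (intro pb_integrable fin mean_pb pbd_power pb_act) auto
    show "(msq n L x k w)\<^sup>2 \<le> (\<Sum>i<n. (act n L x k i w) ^ 4) / real n" for w
      using mean_square_le[of "\<lambda>i. (act n L x k i w)\<^sup>2" n] by (simp add: msq_def)
  qed
  with Qk show ?thesis by simp
qed

section \<open>A discrete Gronwall inequality and a singular sum\<close>

text \<open>The geometric sequence e r^l with r = 1 + c / L satisfies the recursion with equality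
  and dominates x.\<close>

lemma discrete_gronwall:
  fixes x :: "nat \<Rightarrow> real"
  assumes nn: "0 \<le> c" "0 \<le> e" and L: "1 \<le> L"
    and le: "\<And>l. l \<le> L \<Longrightarrow> x l \<le> e + (\<Sum>k<l. c / real L * x k)" and l: "l \<le> L"
  shows "x l \<le> e * exp c"
proof -
  define r where "r = 1 + c / real L"
  have geom: "e + (\<Sum>k<l. c / real L * (e * r ^ k)) = e * r ^ l" for l
    by (induction l) (simp_all add: r_def algebra_simps)
  have "x l \<le> e * r ^ l" if "l \<le> L" for l
    using that
  proof (induction l rule: less_induct)
    case (less l)
    have "x l \<le> e + (\<Sum>k<l. c / real L * x k)" by (rule le[OF less.prems])
    also have "\<dots> \<le> e + (\<Sum>k<l. c / real L * (e * r ^ k))"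
      using less nn by (intro add_left_mono sum_mono mult_left_mono) auto
    also have "\<dots> = e * r ^ l" by (rule geom)
    finally show ?case .
  qed
  then have "x l \<le> e * r ^ l" using l by simp
  also have "\<dots> \<le> e * exp c"
  proof (rule mult_left_mono)
    have "r ^ l \<le> exp (c / real L) ^ l" unfolding r_def using nn by (intro power_mono exp_ge_add_one_self) auto
    also have "\<dots> = exp (real l * (c / real L))" by (rule exp_of_nat_mult[symmetric])
    also have "\<dots> \<le> exp c"
    proof -
      have "real l * c \<le> real L * c" using l nn by (intro mult_right_mono) auto
      then show ?thesis using L by (simp add: field_simps)
    qed
    finally show "r ^ l \<le> exp c" .
  qed (rule nn)
  finally show ?thesis .
qed

text \<open>A Riemann sum of an inverse square root singularity at k = l. After reversing the order,
  1 / sqrt(j + 1) <= 2 (sqrt(j + 1) - sqrt j) makes it telescope.\<close>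

lemma sum_inverse_sqrt:
  assumes "1 \<le> L" "l \<le> L"
  shows "(\<Sum>k<l. sqrt (real L / real (l - k)) / real L) \<le> 2"
proof -
  have "(\<Sum>k<l. sqrt (real L / real (l - k)) / real L) = (\<Sum>j<l. sqrt (real L / real (Suc j)) / real L)"
    by (rule sum.reindex_bij_witness[of _ "\<lambda>j. l - Suc j" "\<lambda>k. l - Suc k"]) auto
  also have "\<dots> = (\<Sum>j<l. 1 / sqrt (real (Suc j))) / sqrt (real L)"
  proof -
    have "sqrt (real L / real (Suc j)) / real L = 1 / sqrt (real (Suc j)) / sqrt (real L)" for j
    proof -
      have "sqrt (real L) / real L = 1 / sqrt (real L)" using assms by (simp add: field_simps)
      moreover have "sqrt (real L / real (Suc j)) / real L = sqrt (real L) / real L / sqrt (real (Suc j))"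
        by (simp add: real_sqrt_divide)
      ultimately show ?thesis by simp
    qed
    then show ?thesis by (simp add: sum_divide_distrib)
  qed
  also have "(\<Sum>j<l. 1 / sqrt (real (Suc j))) \<le> 2 * sqrt (real l)"
  proof (induction l)
    case (Suc l)
    define a b where "a = sqrt (real l)" and "b = sqrt (real (Suc l))"
    have ab: "0 \<le> a" "a \<le> b" "0 < b" "b\<^sup>2 = a\<^sup>2 + 1" by (simp_all add: a_def b_def)
    have "1 = (b - a) * (b + a)" using ab(4) by (simp add: power2_eq_square algebra_simps)
    also have "\<dots> \<le> (b - a) * (2 * b)" using ab by (intro mult_left_mono) auto
    finally have "1 / b \<le> 2 * (b - a)" using ab by (simp add: field_simps)
    then show ?case using Suc unfolding a_def b_def by simp
  qed simp
  also have "2 * sqrt (real l) / sqrt (real L) \<le> 2"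
    using assms by (simp add: field_simps)
  finally show ?thesis by (simp add: divide_right_mono)
qed

lemma integrable_const_gprod [simp]: "integrable (gprod I) (\<lambda>_. c :: real)"
proof -
  interpret prob_space "gprod I" by (rule prob_space_gprod)
  show ?thesis by simp
qed

section \<open>Martingale noise and the telescoping estimate\<close>

context net
begin

lemma fin: "finite I"
  by (rule finite_weight_indices)

lemma hidden_rows:
  assumes "k < L"
  shows "rows I n (\<lambda>i j. Inr (Suc k, i, j)) {..<n} (ya k) (yb k)
    (\<lambda>j w. relu (ya k j w) / sqrt (real n * real L)) (\<lambda>j w. relu (yb k j w) / sqrt (real n * real L))
    (\<Union>i<n. (\<lambda>j. Inr (Suc k, i, j)) ` {..<n})"
  by (rule rows_hidden[OF assms n])

lemma int_mean:
  assumes "\<And>i. i < n \<Longrightarrow> integrable (gprod I) (f i)"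
  shows "(\<integral>w. (\<Sum>i<n. f i w) / real n \<partial>gprod I) = (\<Sum>i<n. \<integral>w. f i w \<partial>gprod I) / real n"
proof -
  have "(\<integral>w. (\<Sum>i<n. f i w) \<partial>gprod I) = (\<Sum>i<n. \<integral>w. f i w \<partial>gprod I)"
    by (rule Bochner_Integration.integral_sum) (use assms in auto)
  then show ?thesis by simp
qed

lemma pb_ab: "k \<le> L \<Longrightarrow> i < n \<Longrightarrow> pb I (ya k i)" "k \<le> L \<Longrightarrow> i < n \<Longrightarrow> pb I (yb k i)"
  by (auto intro: pb_act)

text \<open>Cauchy-Schwarz over the neurons makes the activation covariance positive semidefinite,
  so the smoothing in \<open>comp\<close> has a genuine covariance.\<close>

lemma psd_comp:
  assumes "Suc k \<le> l" "l \<le> L"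
  shows "psd (qa l - qa (Suc k) + rsq n L a k w / real L) (qb l - qb (Suc k) + rsq n L b k w / real L)
     (qx l - qx (Suc k) + rcr n L a b k w / real L)"
proof (rule psd_add[OF incr_bounds(8)[OF assms]])
  have "(rcr n L a b k w)\<^sup>2 \<le> rsq n L a k w * rsq n L b k w" unfolding rcr_def rsq_def by (rule mean_CS)
  then have "(rcr n L a b k w)\<^sup>2 / (real L * real L) \<le> rsq n L a k w * rsq n L b k w / (real L * real L)"
    by (rule divide_right_mono) simp
  then show "psd (rsq n L a k w / real L) (rsq n L b k w / real L) (rcr n L a b k w / real L)"
    using rsq_le_msq(1)[of n L a k w] rsq_le_msq(1)[of n L b k w] by (simp add: psd_def power_divide power2_eq_square)
qed

lemma pb_T:
  assumes "pgrow h" "k \<le> l" "l \<le> L"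
  shows "pb I (T h l k)"
  unfolding T_def[abs_def] using assms
  by (intro mean_pb pbd_gcov pbd_Pair pb_ab pb_const incr_bounds) auto

lemma pb_comp:
  assumes "pgrow h" "Suc k \<le> l" "l \<le> L" "i < n"
  shows "pb I (comp h l k i)"
  unfolding comp_def[abs_def] divide_inverse using assms psd_comp[OF assms(2,3)]
  by (intro pbd_gcov pbd_Pair pbd_add pbd_mult pb_ab pb_const pb_means) (auto simp: divide_inverse)

lemma pb_drift:
  assumes "pgrow h" "Suc k \<le> l" "l \<le> L"
  shows "pb I (drift h l k)"
  unfolding drift_def[abs_def] using assms
  by (intro mean_pb pbd_minus pb_comp pbd_gcov pbd_Pair pb_ab pb_const incr_bounds) auto

lemma pb_mart:
  assumes "pgrow h" "Suc k \<le> l" "l \<le> L"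
  shows "pb I (mart h l k)"
  unfolding mart_def[abs_def] using assms
  by (intro mean_pb pbd_minus pb_comp pbd_gcov pbd_Pair pb_ab pb_const incr_bounds) auto

lemma frozen_mart: "frozen (after (Suc k)) (mart h l k)"
proof -
  have f: "frozen (after (Suc k)) (act n L x k i)" for x :: "real ^ 'd" and i by (rule frozen_mono[OF frozen_act after_mono]) simp
  have f2: "frozen (after (Suc k)) (rsq n L x k)" "frozen (after (Suc k)) (rcr n L x y k)" for x y :: "real ^ 'd"
    by (rule frozen_mono[OF frozen_means(2) after_mono], simp, rule frozen_mono[OF frozen_means(3) after_mono], simp)
  show ?thesis
    unfolding frozen_def mart_def comp_def
    by (simp only: frozenD[OF frozen_act] frozenD[OF f] frozenD[OF f2(1)] frozenD[OF f2(2)] cong: ball_cong) simp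
qed

text \<open>Each layer adds only 1 / (n L) to the variance: 1 / n from averaging over independent
  neurons and 1 / L from the size of their increments. The L layers together contribute the order 1
  / n.\<close>

lemma mart_step:
  assumes h: "qlip h" and kl: "k < l" "l \<le> L" and Z: "pb I Z" "frozen (after k) Z"
    and K: "pb I K" "frozen (after k) K" "\<And>w. \<bar>K w\<bar> \<le> 1"
  shows "(\<integral>w. (Z w + K w * mart h l k w)\<^sup>2 \<partial>gprod I) \<le> (\<integral>w. (Z w)\<^sup>2 \<partial>gprod I) + (1584 * exp 9 + 48) * \<gamma>\<^sup>2 / (real n * real L)"
proof -
  have k: "k < L" "Suc k \<le> l" using kl by auto
  interpret R: rows I n "\<lambda>i j. Inr (Suc k, i, j)" "{..<n}" "ya k" "yb k"
    "\<lambda>j w. relu (ya k j w) / sqrt (real n * real L)" "\<lambda>j w. relu (yb k j w) / sqrt (real n * real L)"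
    "\<Union>i<n. (\<lambda>j. Inr (Suc k, i, j)) ` {..<n}"
    by (rule hidden_rows[OF k(1)])
  define s t r where "s = qa l - qa (Suc k)" and "t = qb l - qb (Suc k)" and "r = qx l - qx (Suc k)"
  have st: "0 \<le> s" "s \<le> \<gamma>" "0 \<le> t" "t \<le> \<gamma>" "psd s t r"
    unfolding s_def t_def r_def using incr_bounds[OF k(2) kl(2)] by auto
  have sub: "(\<Union>i<n. (\<lambda>j. Inr (Suc k, i, j)) ` {..<n}) \<subseteq> after k" by (auto simp: after_def)
  have mart: "mart h l k w = (\<Sum>i<n. R.m s t r h i w) / real n" for w
    unfolding mart_def comp_def R.m_def layer_V[OF k(1)] s_def t_def r_def ..
  define B where "B = (\<lambda>i w. (K w)\<^sup>2 * (48 * ((ya k i w)\<^sup>2 + (yb k i w)\<^sup>2 + s + t) * (R.V1 w + R.V2 w) + 72 * ((R.V1 w)\<^sup>2 + (R.V2 w)\<^sup>2)))"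
  have pB: "pb I (B i)" if "i < n" for i
    unfolding B_def using k that by (intro pbd_mult pbd_add pbd_power K pb_const pb_ab R.pbs) auto
  have step: "(\<integral>w. (Z w + K w * mart h l k w)\<^sup>2 \<partial>gprod I) \<le> (\<integral>w. (Z w)\<^sup>2 \<partial>gprod I) + (\<Sum>i<n. \<integral>w. B i w \<partial>gprod I) / (real n)\<^sup>2"
    unfolding mart B_def
    by (rule R.martingale_step[OF h Z(1) frozen_mono[OF Z(2) sub] K(1) frozen_mono[OF K(2) sub] st(5)])
  have "(\<Sum>i<n. \<integral>w. B i w \<partial>gprod I) / (real n)\<^sup>2 = (\<integral>w. (\<Sum>i<n. B i w) / real n \<partial>gprod I) / real n"
    using int_mean[of B] pB by (simp add: pb_integrable fin power2_eq_square)
  also have "\<dots> \<le> (\<integral>w. (264 * (msq n L a k w)\<^sup>2 + (264 * (msq n L b k w)\<^sup>2 + 48 * \<gamma>\<^sup>2)) / real L \<partial>gprod I) / real n"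
  proof (intro divide_right_mono integral_mono)
    show "integrable (gprod I) (\<lambda>w. (\<Sum>i<n. B i w) / real n)"
      by (intro pb_integrable fin mean_pb pB)
    show "integrable (gprod I) (\<lambda>w. (264 * (msq n L a k w)\<^sup>2 + (264 * (msq n L b k w)\<^sup>2 + 48 * \<gamma>\<^sup>2)) / real L)"
      unfolding divide_inverse using k by (intro pb_integrable fin pbd_mult pbd_add pbd_power pb_means pb_const) auto
    fix w
    define A A' where "A = msq n L a k w" and "A' = msq n L b k w"
    define v v' where "v = R.V1 w" and "v' = R.V2 w"
    have nn: "0 \<le> A" "0 \<le> A'" by (auto simp: A_def A'_def msq_nonneg)
    have L1: "1 \<le> real L" using L by simp
    have v: "0 \<le> v" "v \<le> A / real L" "0 \<le> v'" "v' \<le> A' / real L"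
      using rsq_le_msq[of n L a k w] rsq_le_msq[of n L b k w] L1
      by (simp_all add: v_def v'_def layer_V[OF k(1)] A_def A'_def divide_right_mono)
    have n0: "real n > 0" using n by simp
    have "(\<Sum>i<n. B i w) / real n = (K w)\<^sup>2 * (48 * (A + A' + s + t) * (v + v') + 72 * (v\<^sup>2 + v'\<^sup>2))"
    proof -
      have "(\<Sum>i<n. B i w) = (K w)\<^sup>2 * (48 * ((\<Sum>i<n. (ya k i w)\<^sup>2) + (\<Sum>i<n. (yb k i w)\<^sup>2) + real n * s + real n * t) * (v + v') + real n * (72 * (v\<^sup>2 + v'\<^sup>2)))"
        unfolding B_def v_def[symmetric] v'_def[symmetric]
        by (simp add: sum.distrib sum_distrib_left[symmetric] sum_distrib_right[symmetric] distrib_left distrib_right)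
      moreover have "(\<Sum>i<n. (ya k i w)\<^sup>2) = real n * A" "(\<Sum>i<n. (yb k i w)\<^sup>2) = real n * A'"
        using n0 by (simp_all add: A_def A'_def msq_def)
      ultimately have "(\<Sum>i<n. B i w) = real n * ((K w)\<^sup>2 * (48 * (A + A' + s + t) * (v + v') + 72 * (v\<^sup>2 + v'\<^sup>2)))"
        by (simp add: algebra_simps)
      then show ?thesis using n0 by simp
    qed
    also have "\<dots> \<le> 1 * (48 * (A + A' + s + t) * (v + v') + 72 * (v\<^sup>2 + v'\<^sup>2))"
      using K(3)[of w] nn st v by (intro mult_right_mono) (auto simp: abs_square_le_1)
    also have "\<dots> \<le> 48 * (A + A' + \<gamma> + \<gamma>) * (A / real L + A' / real L) + 72 * ((A / real L)\<^sup>2 + (A' / real L)\<^sup>2)"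
      unfolding mult_1 using nn st v by (intro add_mono mult_mono power_mono) auto
    also have "\<dots> \<le> 48 * (A + A' + \<gamma> + \<gamma>) * (A / real L + A' / real L) + 72 * (A\<^sup>2 / real L + A'\<^sup>2 / real L)"
    proof -
      have "(x / real L)\<^sup>2 \<le> x\<^sup>2 / real L" for x
      proof -
        have "(x / real L)\<^sup>2 = x\<^sup>2 / real L / real L" by (simp add: power2_eq_square)
        also have "\<dots> \<le> x\<^sup>2 / real L / 1" using L1 by (intro divide_left_mono) auto
        finally show ?thesis by simp
      qed
      then show ?thesis by (intro add_mono mult_left_mono order_refl) auto
    qed
    also have "\<dots> = (48 * (A + A' + \<gamma> + \<gamma>) * (A + A') + 72 * (A\<^sup>2 + A'\<^sup>2)) / real L"
    proof -
      have "x * (A / real L + A' / real L) + 72 * (A\<^sup>2 / real L + A'\<^sup>2 / real L) = (x * (A + A') + 72 * (A\<^sup>2 + A'\<^sup>2)) / real L" for x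
        by (simp add: add_divide_distrib distrib_left)
      then show ?thesis .
    qed
    also have "\<dots> \<le> (264 * A\<^sup>2 + (264 * A'\<^sup>2 + 48 * \<gamma>\<^sup>2)) / real L"
    proof (rule divide_right_mono)
      \<comment> \<open>The constants 264 and 48 are such that the difference of the two sides is
        exactly this sum of squares.\<close>
      have "0 \<le> 48 * (A + A' - \<gamma>)\<^sup>2 + 96 * (A - A')\<^sup>2" by simp
      then show "48 * (A + A' + \<gamma> + \<gamma>) * (A + A') + 72 * (A\<^sup>2 + A'\<^sup>2) \<le> 264 * A\<^sup>2 + (264 * A'\<^sup>2 + 48 * \<gamma>\<^sup>2)"
        by (simp add: power2_eq_square algebra_simps)
    qed simp
    finally show "(\<Sum>i<n. B i w) / real n \<le> (264 * (msq n L a k w)\<^sup>2 + (264 * (msq n L b k w)\<^sup>2 + 48 * \<gamma>\<^sup>2)) / real L"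
      by (simp add: A_def A'_def)
  qed simp
  also have "(\<integral>w. (264 * (msq n L a k w)\<^sup>2 + (264 * (msq n L b k w)\<^sup>2 + 48 * \<gamma>\<^sup>2)) / real L \<partial>gprod I)
     = (264 * (\<integral>w. (msq n L a k w)\<^sup>2 \<partial>gprod I) + (264 * (\<integral>w. (msq n L b k w)\<^sup>2 \<partial>gprod I) + 48 * \<gamma>\<^sup>2)) / real L"
  proof -
    have "integrable (gprod I) (\<lambda>w. (msq n L a k w)\<^sup>2)" "integrable (gprod I) (\<lambda>w. (msq n L b k w)\<^sup>2)"
      using k by (intro pb_integrable fin pbd_power pb_means; simp)+
    then show ?thesis by simp
  qed
  \<comment> \<open>The second-moment bound enters for both inputs: 2 * 264 * 3 = 1584.\<close>
  also have "\<dots> / real n \<le> (264 * (3 * exp 9 * \<gamma>\<^sup>2) + (264 * (3 * exp 9 * \<gamma>\<^sup>2) + 48 * \<gamma>\<^sup>2)) / real L / real n"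
  proof (intro divide_right_mono add_mono mult_left_mono)
    have sq: "\<alpha>\<^sup>2 \<le> \<gamma>\<^sup>2" "\<beta>\<^sup>2 \<le> \<gamma>\<^sup>2" using pos \<gamma> by (auto intro!: power_mono)
    have "(\<integral>w. (msq n L a k w)\<^sup>2 \<partial>gprod I) \<le> 3 * exp 9 * \<alpha>\<^sup>2" unfolding \<alpha> using k n by (intro msq_second_moment) auto
    also have "\<dots> \<le> 3 * exp 9 * \<gamma>\<^sup>2" using sq by (intro mult_left_mono) auto
    finally show "(\<integral>w. (msq n L a k w)\<^sup>2 \<partial>gprod I) \<le> 3 * exp 9 * \<gamma>\<^sup>2" .
    have "(\<integral>w. (msq n L b k w)\<^sup>2 \<partial>gprod I) \<le> 3 * exp 9 * \<beta>\<^sup>2" unfolding \<beta> using k n by (intro msq_second_moment) auto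
    also have "\<dots> \<le> 3 * exp 9 * \<gamma>\<^sup>2" using sq by (intro mult_left_mono) auto
    finally show "(\<integral>w. (msq n L b k w)\<^sup>2 \<partial>gprod I) \<le> 3 * exp 9 * \<gamma>\<^sup>2" .
  qed auto
  also have "\<dots> = (1584 * exp 9 + 48) * \<gamma>\<^sup>2 / (real n * real L)" by (simp add: algebra_simps)
  finally show ?thesis using step by simp
qed

text \<open>The input layer has the deterministic covariance q_0, which completes q_l - q_0 to q_l
  exactly; so there is noise but no drift. The constant is 336 = 48 * 4 + 72 * 2.\<close>

lemma input_step:
  assumes h: "qlip h" and l: "l \<le> L"
  shows "(\<integral>w. (T h l 0 w - gcov (qa l) (qb l) (qx l) h (0, 0))\<^sup>2 \<partial>gprod I) \<le> 336 * \<gamma>\<^sup>2 / real n"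
proof -
  interpret R: rows I n "\<lambda>i j. Inl (i, j)" "UNIV :: 'd set" "\<lambda>_ _. 0" "\<lambda>_ _. 0"
    "\<lambda>j w. a $ j / sqrt (real CARD('d))" "\<lambda>j w. b $ j / sqrt (real CARD('d))" "\<Union>i<n. (\<lambda>j. Inl (i, j)) ` UNIV"
    by (rule rows_input[OF n])
  have V: "R.V1 w = \<alpha>" "R.V2 w = \<beta>" "R.V12 w = qx 0" for w
  proof -
    show "R.V1 w = \<alpha>" "R.V2 w = \<beta>"
      by (simp_all add: R.V1_def R.V2_def \<alpha> \<beta> power_divide sum_divide_distrib[symmetric] norm_vec_def L2_set_def sum_nonneg)
    have "x / sqrt (real CARD('d)) * (y / sqrt (real CARD('d))) = x * y / real CARD('d)" for x y by simp
    then show "R.V12 w = qx 0"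
      by (simp add: R.V12_def qx_def tm_def u0 inner_vec_def sum_divide_distrib)
  qed
  define s t r where "s = qa l - qa 0" and "t = qb l - qb 0" and "r = qx l - qx 0"
  have st: "0 \<le> s" "s \<le> \<gamma>" "0 \<le> t" "t \<le> \<gamma>" "psd s t r"
    unfolding s_def t_def r_def using incr_bounds[OF _ l, of 0] by auto
  have q: "s + \<alpha> = qa l" "t + \<beta> = qb l" "r + qx 0 = qx l" by (simp_all add: s_def t_def r_def qa_def qb_def tm_def)
  have m: "R.m s t r h i w = gcov s t r h (ya 0 i w, yb 0 i w) - gcov (qa l) (qb l) (qx l) h (0, 0)" for i w
    by (simp add: R.m_def R.x1_def R.x2_def V q)
  have n0: "real n > 0" using n by simp
  have T: "T h l 0 w - gcov (qa l) (qb l) (qx l) h (0, 0) = 0 + 1 * ((\<Sum>i<n. R.m s t r h i w) / real n)" for w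
    using n0 by (simp add: m T_def s_def[symmetric] t_def[symmetric] r_def[symmetric] sum_subtractf diff_divide_distrib del: act.simps)
  have "(\<integral>w. (T h l 0 w - gcov (qa l) (qb l) (qx l) h (0, 0))\<^sup>2 \<partial>gprod I)
    \<le> (\<integral>w. 0\<^sup>2 \<partial>gprod I) + (\<Sum>i<n. (\<integral>w. 1\<^sup>2 * (48 * (0\<^sup>2 + 0\<^sup>2 + s + t) * (R.V1 w + R.V2 w) + 72 * ((R.V1 w)\<^sup>2 + (R.V2 w)\<^sup>2)) \<partial>gprod I)) / (real n)\<^sup>2"
    unfolding T by (rule R.martingale_step[OF h pb_const _ pb_const _ st(5)]) (simp_all add: frozen_def)
  also have "\<dots> = (48 * (s + t) * (\<alpha> + \<beta>) + 72 * (\<alpha>\<^sup>2 + \<beta>\<^sup>2)) / real n"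
    using n0 by (simp add: V power2_eq_square)
  also have "\<dots> \<le> (48 * (\<gamma> + \<gamma>) * (\<gamma> + \<gamma>) + 72 * (\<gamma>\<^sup>2 + \<gamma>\<^sup>2)) / real n"
    using st pos \<gamma> by (intro divide_right_mono add_mono mult_mono power_mono) auto
  also have "\<dots> = 336 * \<gamma>\<^sup>2 / real n" by (simp add: power2_eq_square algebra_simps)
  finally show ?thesis .
qed

text \<open>\<open>K k\<close> is the indicator of not having been stopped before layer \<open>k\<close>.\<close>

definition stopping :: "(nat \<Rightarrow> ('d weight_index \<Rightarrow> real) \<Rightarrow> real) \<Rightarrow> bool" where
  "stopping K \<longleftrightarrow> (\<forall>k\<le>L. pb I (K k) \<and> frozen (after k) (K k)) \<and> (\<forall>k w. K k w = 0 \<or> K k w = 1) \<and> (\<forall>k w. K (Suc k) w \<le> K k w)"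

lemma stopping_anti:
  assumes "stopping K" "j \<le> k" shows "K k w \<le> K j w"
  using assms(2) by (rule lift_Suc_antimono_le[of "\<lambda>k. K k w", rotated]) (use assms(1) in \<open>simp add: stopping_def\<close>)

text \<open>The noise is handled by orthogonality and contributes the order 1 / sqrt n once; the
  drifts are added by the triangle inequality. The indicators \<open>K k\<close> sit inside both
  sums, so a drift has to be estimated only where the process has not yet been stopped.\<close>

lemma telescoping_bound:
  assumes h: "qlip h" and l: "l \<le> L" and K: "stopping K"
  shows "nrm I (\<lambda>w. K l w * (T h l l w - gcov (qa l) (qb l) (qx l) h (0, 0)))
    \<le> noise_const * \<gamma> / sqrt (real n) + (\<Sum>k<l. nrm I (\<lambda>w. K k w * drift h l k w))"
proof -
  have g: "pgrow h" using h by (simp add: qlip_def)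
  define m0 where "m0 = gcov (qa l) (qb l) (qx l) h (0, 0)"
  \<comment> \<open>The accumulated stopped noise, starting from the input layer. \<open>K j\<close>
    is known at layer j, so multiplying by it keeps the increments orthogonal to the past.\<close>
  define Z where "Z k w = (T h l 0 w - m0) + (\<Sum>j<k. K j w * mart h l j w)" for k w
  have Kp: "pb I (K k)" "frozen (after k) (K k)" "\<bar>K k w\<bar> \<le> 1" if "k \<le> L" for k w
    using K that unfolding stopping_def by (auto, metis abs_0 abs_1 le_numeral_extra(1,4) zero_le_one order_refl)
  have pbZ: "pb I (Z k)" if "k \<le> l" for k
    unfolding Z_def[abs_def] using that l
    by (intro pbd_add pbd_minus pbd_sum pbd_mult pb_T pb_const pb_mart g Kp) (auto simp: sum_nonneg)
  have frZ: "frozen (after k) (Z k)" if "k \<le> l" for k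
    using that
  proof (induction k)
    case 0
    show ?case unfolding Z_def[abs_def] T_def by (auto simp: frozen_def frozenD[OF frozen_act] simp del: act.simps)
  next
    case (Suc k)
    have kL: "k \<le> L" "k \<le> l" using Suc.prems l by auto
    have eq: "Z (Suc k) = (\<lambda>w. Z k w + K k w * mart h l k w)" by (simp add: Z_def fun_eq_iff)
    show ?case unfolding eq
      by (intro frozen_funs frozen_mart frozen_mono[OF Suc.IH[OF kL(2)]] frozen_mono[OF Kp(2)[OF kL(1)]] after_mono) auto
  qed
  define D where "D = (1584 * exp 9 + 48) * \<gamma>\<^sup>2 / (real n * real L)"
  have bZ: "(\<integral>w. (Z k w)\<^sup>2 \<partial>gprod I) \<le> 336 * \<gamma>\<^sup>2 / real n + real k * D" if "k \<le> l" for k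
    using that
  proof (induction k)
    case 0
    show ?case using input_step[OF h l] by (simp add: Z_def m0_def)
  next
    case (Suc k)
    have "(\<integral>w. (Z (Suc k) w)\<^sup>2 \<partial>gprod I) = (\<integral>w. (Z k w + K k w * mart h l k w)\<^sup>2 \<partial>gprod I)" by (simp add: Z_def add.assoc)
    also have "\<dots> \<le> (\<integral>w. (Z k w)\<^sup>2 \<partial>gprod I) + D"
      unfolding D_def using Suc.prems l by (intro mart_step h pbZ frZ Kp) auto
    finally show ?case using Suc by (simp add: algebra_simps)
  qed
  have "(\<integral>w. (Z l w)\<^sup>2 \<partial>gprod I) \<le> (1584 * exp 9 + 384) * \<gamma>\<^sup>2 / real n"
  proof -
    have "real l * D = (real l / real L) * ((1584 * exp 9 + 48) * \<gamma>\<^sup>2 / real n)" by (simp add: D_def)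
    also have "\<dots> \<le> 1 * ((1584 * exp 9 + 48) * \<gamma>\<^sup>2 / real n)" using l L by (intro mult_right_mono) auto
    finally have "(\<integral>w. (Z l w)\<^sup>2 \<partial>gprod I) \<le> 336 * \<gamma>\<^sup>2 / real n + (1584 * exp 9 + 48) * \<gamma>\<^sup>2 / real n" using bZ[of l] by simp
    also have "\<dots> = (1584 * exp 9 + 384) * \<gamma>\<^sup>2 / real n" by (simp add: add_divide_distrib[symmetric] algebra_simps)
    finally show ?thesis .
  qed
  then have "nrm I (Z l) \<le> sqrt ((1584 * exp 9 + 384) * \<gamma>\<^sup>2 / real n)" unfolding nrm_def by (rule real_sqrt_le_mono)
  also have "\<dots> = noise_const * \<gamma> / sqrt (real n)" using \<gamma> by (simp add: noise_const_def real_sqrt_mult real_sqrt_divide)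
  finally have nZ: "nrm I (Z l) \<le> noise_const * \<gamma> / sqrt (real n)" .
  define R where "R w = Z l w + (\<Sum>k<l. K k w * drift h l k w)" for w
  have pbd: "pb I (\<lambda>w. K k w * drift h l k w)" if "k < l" for k
    using that l by (intro pbd_mult Kp pb_drift g) auto
  have pbS: "pb I (\<lambda>w. \<Sum>k<l. K k w * drift h l k w)" using pbd by (intro pbd_sum) (auto simp: sum_nonneg)
  have pbR: "pb I R" unfolding R_def[abs_def] by (intro pbd_add pbZ pbS order_refl)
  \<comment> \<open>Where \<open>K l\<close> is nonzero, monotonicity forces all earlier indicators
    to be 1 and the stopped sums telescope; elsewhere both sides vanish.\<close>
  have tele: "K l w * (T h l l w - m0) = K l w * R w" for w
  proof (cases "K l w = 0")
    case False
    have one: "K k w = 1" if "k \<le> l" for k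
    proof -
      have "K l w \<le> K k w" by (rule stopping_anti[OF K that])
      moreover have "K l w = 1" "K k w = 0 \<or> K k w = 1" using False K unfolding stopping_def by auto
      ultimately show ?thesis by auto
    qed
    have "R w = (T h l 0 w - m0) + (\<Sum>k<l. K k w * mart h l k w + K k w * drift h l k w)"
      by (simp add: R_def Z_def sum.distrib)
    also have "(\<Sum>k<l. K k w * mart h l k w + K k w * drift h l k w) = (\<Sum>k<l. T h l (Suc k) w - T h l k w)"
      using one by (intro sum.cong refl) (simp add: T_Suc)
    also have "\<dots> = T h l l w - T h l 0 w" by (rule sum_lessThan_telescope)
    finally show ?thesis by simp
  qed simp
  have "nrm I (\<lambda>w. K l w * (T h l l w - m0)) \<le> nrm I R"
  proof (rule nrm_mono[OF fin _ pbR])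
    show "pb I (\<lambda>w. K l w * (T h l l w - m0))" using l by (intro pbd_mult pbd_minus pb_T g Kp pb_const) auto
    show "\<bar>K l w * (T h l l w - m0)\<bar> \<le> \<bar>R w\<bar>" for w
      unfolding tele abs_mult using Kp(3)[OF l, of w] by (simp add: mult_left_le_one_le)
  qed
  also have "\<dots> \<le> nrm I (Z l) + nrm I (\<lambda>w. \<Sum>k<l. K k w * drift h l k w)"
    unfolding R_def[abs_def] by (intro nrm_triangle fin pbZ pbS order_refl)
  also have "\<dots> \<le> noise_const * \<gamma> / sqrt (real n) + (\<Sum>k<l. nrm I (\<lambda>w. K k w * drift h l k w))"
    using pbd by (intro add_mono nZ nrm_sum fin) auto
  finally show ?thesis by (simp add: m0_def)
qed

end

section \<open>Diagonal errors and the good event\<close>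

text \<open>The variance of the flow is at most 2 \<gamma>; the additional 1 is the gap an
  exceptional path has to cross, and it makes the maximal inequality effective.\<close>

definition good :: "nat \<Rightarrow> nat \<Rightarrow> real \<Rightarrow> real ^ 'd::finite \<Rightarrow> nat \<Rightarrow> ('d weight_index \<Rightarrow> real) \<Rightarrow> real" where
  "good n L \<gamma> x k w = (\<Prod>j\<le>k. if msq n L x j w \<le> 2 * \<gamma> + 1 then 1 else 0)"

lemma good_Suc: "good n L \<gamma> x (Suc k) w = good n L \<gamma> x k w * (if msq n L x (Suc k) w \<le> 2 * \<gamma> + 1 then 1 else 0)"
  by (simp add: good_def)

lemma good_01: "good n L \<gamma> x k w = 0 \<or> good n L \<gamma> x k w = 1"
proof (induction k)
  case 0
  show ?case by (auto simp: good_def)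
next
  case (Suc k)
  then show ?case by (auto simp: good_Suc)
qed

lemma good_bounds: "0 \<le> good n L \<gamma> x k w" "good n L \<gamma> x k w \<le> 1"
  using good_01[of n L \<gamma> x k w] by auto

lemma good_1: "good n L \<gamma> x k w = 1 \<Longrightarrow> msq n L x k w \<le> 2 * \<gamma> + 1"
  by (cases k) (auto simp: good_Suc good_def split: if_splits)

lemma pb_good:
  assumes "k \<le> L"
  shows "pb (weight_indices n L) (good n L \<gamma> x k)"
proof (rule pbdI)
  have "msq n L x j \<in> borel_measurable (gprod (weight_indices n L))" if "j \<le> k" for j
    using pb_means(1)[of j L n x] assms that by (intro pbd_measurable) auto
  then show "good n L \<gamma> x k \<in> borel_measurable (gprod (weight_indices n L))"
    unfolding good_def[abs_def] by (intro borel_measurable_prod measurable_If) auto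
  show "norm (good n L \<gamma> x k w) \<le> 1 * (1 + (\<Sum>i\<in>weight_indices n L. \<bar>w i\<bar>)) ^ 0" for w
    using good_bounds[of n L \<gamma> x k w] by simp
qed (simp add: sum_nonneg)

lemma frozen_good: "frozen (after k) (good n L \<gamma> x k)"
proof (induction k)
  case 0
  show ?case unfolding good_def[abs_def] by (simp add: frozen_def frozenD[OF frozen_means(1)])
next
  case (Suc k)
  have "frozen (after (Suc k)) (good n L \<gamma> x k)" by (rule frozen_mono[OF Suc after_mono]) simp
  then show ?case unfolding good_Suc[abs_def] by (simp add: frozen_def frozenD[OF frozen_means(1)])
qed

lemma mean_abs_le:
  assumes "1 \<le> n" "\<And>i. i < n \<Longrightarrow> \<bar>f i\<bar> \<le> (c::real)"
  shows "\<bar>(\<Sum>i<n. f i) / real n\<bar> \<le> c"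
proof -
  have "\<bar>\<Sum>i<n. f i\<bar> \<le> (\<Sum>i<n. c)" using assms by (intro order_trans[OF sum_abs] sum_mono) auto
  then have "\<bar>\<Sum>i<n. f i\<bar> / real n \<le> real n * c / real n" by (intro divide_right_mono) auto
  then show ?thesis using assms by simp
qed

context net
begin

text \<open>The constants are included so that the noise and the accumulated Euler error \<gamma> /
  L are together at most \<open>rate\<close>.\<close>

definition rate where "rate = noise_const * \<gamma> * (1 / sqrt (real n) + 1 / sqrt (real L))"

lemma rate_bounds: "noise_const * \<gamma> / sqrt (real n) + \<gamma> / real L \<le> rate" "noise_const * \<gamma> / sqrt (real n) \<le> rate" "\<gamma> / real L \<le> rate" "0 \<le> rate"
proof -
  have L1: "1 \<le> real L" using L by simp
  then have "sqrt (real L) \<le> real L" by (intro real_le_lsqrt) (auto simp: power2_eq_square)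
  then have "1 / real L \<le> 1 / sqrt (real L)" using L1 by (intro divide_left_mono) auto
  then have "\<gamma> * (1 / real L) \<le> \<gamma> * (1 / sqrt (real L))" using \<gamma> by (intro mult_left_mono) auto
  also have "\<dots> \<le> noise_const * \<gamma> * (1 / sqrt (real L))" using noise_const_ge \<gamma> L1 by (intro mult_right_mono) auto
  finally have 1: "\<gamma> / real L \<le> noise_const * \<gamma> / sqrt (real L)" by simp
  have 2: "0 \<le> noise_const * \<gamma> / sqrt (real n)" "0 \<le> \<gamma> / real L" using noise_const_ge \<gamma> by auto
  have "rate = noise_const * \<gamma> / sqrt (real n) + noise_const * \<gamma> / sqrt (real L)" by (simp add: rate_def distrib_left)
  then show "noise_const * \<gamma> / sqrt (real n) + \<gamma> / real L \<le> rate" "noise_const * \<gamma> / sqrt (real n) \<le> rate" "\<gamma> / real L \<le> rate" "0 \<le> rate"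
    using 1 2 by linarith+
qed

lemma sum_const_L2: "l \<le> L \<Longrightarrow> 0 \<le> c \<Longrightarrow> (\<Sum>k<l. c / (real L)\<^sup>2) \<le> c / real L"
proof -
  assume l: "l \<le> L" and c: "0 \<le> c"
  have "(\<Sum>k<l. c / (real L)\<^sup>2) = (real l / real L) * (c / real L)" by (simp add: power2_eq_square)
  also have "\<dots> \<le> 1 * (c / real L)" using l c L by (intro mult_right_mono) auto
  finally show ?thesis by simp
qed

text \<open>Half the variance of the flow is both its time derivative and the mean of relu(X)^2
  under it.\<close>

definition ea where "ea k = nrm I (\<lambda>w. rsq n L a k w - qa k / 2)"

lemma euler_qa: 
  assumes "k < L" shows "\<bar>qa (Suc k) - qa k - qa k / 2 / real L\<bar> \<le> \<gamma> / (real L)\<^sup>2"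
proof -
  have t: "0 \<le> tm k" "tm k + 1 / real L \<le> 1" using tm[of k] tm(2)[of "Suc k"] assms by (auto simp: tm)
  have "qa (Suc k) - qa k - qa k / 2 / real L = \<alpha> * (exp ((tm k + 1 / real L) / 2) - exp (tm k / 2) - 1 / real L * (exp (tm k / 2) / 2))"
    by (simp add: qa_def tm(4) algebra_simps)
  then have "\<bar>qa (Suc k) - qa k - qa k / 2 / real L\<bar> \<le> \<alpha> * (1 / real L)\<^sup>2"
    using exp_half_taylor[OF t(1) _ t(2)] pos by (simp add: abs_mult mult_left_mono)
  also have "\<dots> \<le> \<gamma> * (1 / real L)\<^sup>2" using \<gamma> by (intro mult_right_mono) auto
  finally show ?thesis by (simp add: power_divide)
qed

lemma ea_step:
  assumes "k < L"
  shows "nrm I (\<lambda>w. rsq n L a k w / real L - (qa (Suc k) - qa k)) \<le> ea k / real L + \<gamma> / (real L)\<^sup>2"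
proof -
  let ?c = "qa k / 2 / real L - (qa (Suc k) - qa k)"
  have e: "rsq n L a k w / real L - (qa (Suc k) - qa k) = 1 / real L * (rsq n L a k w - qa k / 2) + ?c" for w
    by (simp add: diff_divide_distrib)
  have "nrm I (\<lambda>w. rsq n L a k w / real L - (qa (Suc k) - qa k)) \<le> nrm I (\<lambda>w. 1 / real L * (rsq n L a k w - qa k / 2)) + nrm I (\<lambda>w. ?c)"
    unfolding e using assms by (intro nrm_triangle fin pbd_mult pbd_minus pb_means pb_const) auto
  also have "\<dots> = ea k / real L + \<bar>?c\<bar>" by (simp only: nrm_cmult nrm_const ea_def) simp
  also have "\<bar>?c\<bar> \<le> \<gamma> / (real L)\<^sup>2" using euler_qa[OF assms] by (simp add: abs_minus_commute)
  finally show ?thesis by simp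
qed

lemma stopping_1: "stopping (\<lambda>_ _. 1)"
  by (auto simp: stopping_def pb_const frozen_def)

text \<open>The recursion closes on \<open>ea\<close> alone: the smoothing of relu(x)^2 is
  1-Lipschitz in the variance, so the drift at layer k is at most \<open>ea k\<close> / L plus an
  Euler error. The process is not stopped here, and 3 bounds the Gronwall factor exp 1.\<close>

lemma diag_relu:
  assumes l: "l \<le> L"
  shows "ea l \<le> 3 * rate"
proof -
  define h where "h = (\<lambda>p::real\<times>real. (relu (fst p))\<^sup>2)"
  have h: "qlip h" unfolding h_def by (rule qlip_relu)
  have g: "pgrow h" using h by (simp add: qlip_def)
  have "ea l \<le> rate + (\<Sum>k<l. 1 / real L * ea k)" if l: "l \<le> L" for l
  proof -
    have drift: "nrm I (\<lambda>w. 1 * drift h l k w) \<le> ea k / real L + \<gamma> / (real L)\<^sup>2" if k: "k < l" for k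
    proof -
      have "nrm I (\<lambda>w. 1 * drift h l k w) \<le> nrm I (\<lambda>w. rsq n L a k w / real L - (qa (Suc k) - qa k))"
      proof (rule nrm_mono[OF fin])
        show "pb I (\<lambda>w. 1 * drift h l k w)" using k l by (intro pbd_mult pb_const pb_drift g) auto
        show "pb I (\<lambda>w. rsq n L a k w / real L - (qa (Suc k) - qa k))"
          unfolding divide_inverse using k l by (intro pbd_minus pbd_mult pb_means pb_const) auto
        show "\<bar>1 * drift h l k w\<bar> \<le> \<bar>rsq n L a k w / real L - (qa (Suc k) - qa k)\<bar>" for w
          unfolding mult_1 drift_def
        proof (rule mean_abs_le[OF n])
          fix i assume "i < n"
          have kl: "Suc k \<le> l" "k \<le> l" using k by auto
          show "\<bar>comp h l k i w - gcov (qa l - qa k) (qb l - qb k) (qx l - qx k) h (ya k i w, yb k i w)\<bar> \<le> \<bar>rsq n L a k w / real L - (qa (Suc k) - qa k)\<bar>"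
            unfolding comp_def h_def using gcov_relu_square_diff(1)[OF incr_bounds(8)[OF kl(2) l] psd_comp[OF kl(1) l, of w], of "(ya k i w, yb k i w)"]
            by (simp add: algebra_simps)
        qed
      qed
      also have "\<dots> \<le> ea k / real L + \<gamma> / (real L)\<^sup>2" using k l by (intro ea_step) auto
      finally show ?thesis .
    qed
    have n0: "real n > 0" using n by simp
    have T: "T h l l w = rsq n L a l w" for w by (simp add: T_def rsq_def h_def)
    have m0: "gcov (qa l) (qb l) (qx l) h (0, 0) = qa l / 2" unfolding h_def by (rule gcov_relu_square_0[OF psd_q[OF l]])
    have "ea l \<le> noise_const * \<gamma> / sqrt (real n) + (\<Sum>k<l. nrm I (\<lambda>w. 1 * drift h l k w))"
      using telescoping_bound[OF h l stopping_1] unfolding T m0 by (simp add: ea_def)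
    also have "\<dots> \<le> noise_const * \<gamma> / sqrt (real n) + (\<Sum>k<l. ea k / real L + \<gamma> / (real L)\<^sup>2)"
      using drift by (intro add_left_mono sum_mono) auto
    also have "\<dots> \<le> rate + (\<Sum>k<l. ea k / real L)"
      using sum_const_L2[OF l, where c = \<gamma>] rate_bounds(1) \<gamma> by (simp add: sum.distrib)
    finally show ?thesis by simp
  qed
  then have "ea l \<le> rate * exp 1" by (intro discrete_gronwall[where c = 1 and e = rate and L = L and x = ea and l = l] rate_bounds L l) auto
  also have "\<dots> \<le> rate * 3" using exp_le rate_bounds by (intro mult_left_mono) auto
  finally show ?thesis by simp
qed

lemma ea_step':
  assumes "k < L"
  shows "nrm I (\<lambda>w. rsq n L a k w / real L - (qa (Suc k) - qa k)) \<le> 4 * rate / real L"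
proof -
  have "ea k / real L \<le> 3 * rate / real L" using diag_relu[of k] assms by (intro divide_right_mono) auto
  moreover have "\<gamma> / (real L)\<^sup>2 \<le> rate / real L"
    using divide_right_mono[OF rate_bounds(3), of "real L"] by (simp add: power2_eq_square)
  ultimately show ?thesis using ea_step[OF assms] by linarith
qed

lemma sum_over_L: 
  assumes "l \<le> L" "0 \<le> c" "\<And>k. k < l \<Longrightarrow> f k \<le> c / real L"
  shows "(\<Sum>k<l. f k) \<le> c"
proof -
  have "(\<Sum>k<l. f k) \<le> (\<Sum>k<l. c / real L)" using assms by (intro sum_mono) auto
  also have "\<dots> = (real l / real L) * c" by simp
  also have "\<dots> \<le> 1 * c" using assms L by (intro mult_right_mono) auto
  finally show ?thesis by simp
qed

text \<open>For h = x^2 the drift is the variance defect itself, which the bound on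
  \<open>ea\<close> already controls; 5 is 1 for the noise plus 4 for the drift.\<close>

lemma diag_square:
  assumes l: "l \<le> L"
  shows "nrm I (\<lambda>w. msq n L a l w - qa l) \<le> 5 * rate"
proof -
  define h where "h = (\<lambda>p::real\<times>real. (fst p)\<^sup>2)"
  have h: "qlip h" unfolding h_def by (rule qlip_id)
  have n0: "real n > 0" using n by simp
  have drift: "drift h l k w = rsq n L a k w / real L - (qa (Suc k) - qa k)" if k: "k < l" for k w
  proof -
    have kl: "Suc k \<le> l" "k \<le> l" using k by auto
    have "comp h l k i w - gcov (qa l - qa k) (qb l - qb k) (qx l - qx k) h (ya k i w, yb k i w) = rsq n L a k w / real L - (qa (Suc k) - qa k)" for i
      unfolding comp_def h_def gcov_moments(1)[OF incr_bounds(8)[OF kl(2) l]] gcov_moments(1)[OF psd_comp[OF kl(1) l]] by simp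
    then show ?thesis unfolding drift_def using n0 by simp
  qed
  have "T h l l w = msq n L a l w" for w by (simp add: T_def msq_def h_def)
  moreover have "gcov (qa l) (qb l) (qx l) h (0, 0) = qa l" unfolding h_def gcov_moments(1)[OF psd_q[OF l]] by simp
  ultimately have "nrm I (\<lambda>w. msq n L a l w - qa l) \<le> noise_const * \<gamma> / sqrt (real n) + (\<Sum>k<l. nrm I (\<lambda>w. drift h l k w))"
    using telescoping_bound[OF h l stopping_1] by simp
  also have "(\<Sum>k<l. nrm I (\<lambda>w. drift h l k w)) \<le> 4 * rate"
  proof (rule sum_over_L[OF l])
    show "nrm I (\<lambda>w. drift h l k w) \<le> 4 * rate / real L" if "k < l" for k
      unfolding drift[OF that] using that l by (intro ea_step') auto
  qed (simp add: rate_bounds)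
  finally show ?thesis using rate_bounds(2) by simp
qed

text \<open>The weak form of a submartingale property: since \<open>rsq\<close> is nonnegative,
  \<open>msq\<close> increases in mean when tested against nonnegative functions of the layers up to
  k.\<close>

lemma msq_mean_step:
  assumes k: "k < L" and F: "pb I F" "frozen (after k) F"
  shows "(\<integral>w. F w * msq n L a (Suc k) w \<partial>gprod I) = (\<integral>w. F w * (msq n L a k w + rsq n L a k w / real L) \<partial>gprod I)"
proof -
  interpret R: rows I n "\<lambda>i j. Inr (Suc k, i, j)" "{..<n}" "ya k" "yb k"
    "\<lambda>j w. relu (ya k j w) / sqrt (real n * real L)" "\<lambda>j w. relu (yb k j w) / sqrt (real n * real L)"
    "\<Union>i<n. (\<lambda>j. Inr (Suc k, i, j)) ` {..<n}"
    by (rule hidden_rows[OF k])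
  have h: "pgrow (\<lambda>q::real\<times>real. (fst q)\<^sup>2)" by (intro pbd_intros)
  have sub: "(\<lambda>j. Inr (Suc k, i, j)) ` {..<n} \<subseteq> after k" for i by (auto simp: after_def)
  have one: "(\<integral>w. F w * (ya (Suc k) i w)\<^sup>2 \<partial>gprod I) = (\<integral>w. F w * ((ya k i w)\<^sup>2 + rsq n L a k w / real L) \<partial>gprod I)" if i: "i < n" for i
  proof -
    have "(\<integral>w. F w * gcov 0 0 0 (\<lambda>q. (fst q)\<^sup>2) (ya k i w + R.x1 i w, yb k i w + R.x2 i w) \<partial>gprod I)
      = (\<integral>w. F w * gcov (0 + R.V1 w) (0 + R.V2 w) (0 + R.V12 w) (\<lambda>q. (fst q)\<^sup>2) (ya k i w, yb k i w) \<partial>gprod I)"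
      by (rule R.average[OF h i F(1) frozen_mono[OF F(2) sub] psd_0 R.p1(1)[OF i] frozen_mono[OF R.p1(2)[OF i] R.subE[OF i]] R.p2(1)[OF i] frozen_mono[OF R.p2(2)[OF i] R.subE[OF i]]])
    moreover have "gcov (R.V1 w) (R.V2 w) (R.V12 w) (\<lambda>q. (fst q)\<^sup>2) (ya k i w, yb k i w) = (ya k i w)\<^sup>2 + R.V1 w" for w
      by (simp add: gcov_moments[OF R.psdV])
    ultimately show ?thesis by (simp add: layer_V[OF k] del: act.simps)
  qed
  have n0: "real n > 0" using n by simp
  have "(\<integral>w. F w * msq n L a (Suc k) w \<partial>gprod I) = (\<integral>w. (\<Sum>i<n. F w * (ya (Suc k) i w)\<^sup>2) / real n \<partial>gprod I)"
    by (simp add: msq_def sum_distrib_left del: act.simps)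
  also have "\<dots> = (\<Sum>i<n. \<integral>w. F w * (ya (Suc k) i w)\<^sup>2 \<partial>gprod I) / real n"
    using k by (intro int_mean pb_integrable fin pbd_mult pbd_power F pb_ab) auto
  also have "\<dots> = (\<Sum>i<n. \<integral>w. F w * ((ya k i w)\<^sup>2 + rsq n L a k w / real L) \<partial>gprod I) / real n"
    using one by simp
  also have "\<dots> = (\<integral>w. (\<Sum>i<n. F w * ((ya k i w)\<^sup>2 + rsq n L a k w / real L)) / real n \<partial>gprod I)"
    unfolding divide_inverse[of "rsq _ _ _ _ _"] using k by (intro int_mean[symmetric] pb_integrable fin pbd_mult pbd_add pbd_power F pb_ab pb_means pb_const) auto
  also have "\<dots> = (\<integral>w. F w * (msq n L a k w + rsq n L a k w / real L) \<partial>gprod I)"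
  proof -
    have "(\<Sum>i<n. F w * ((ya k i w)\<^sup>2 + rsq n L a k w / real L)) / real n = F w * (msq n L a k w + rsq n L a k w / real L)" for w
    proof -
      have "(\<Sum>i<n. F w * ((ya k i w)\<^sup>2 + rsq n L a k w / real L)) = F w * ((\<Sum>i<n. (ya k i w)\<^sup>2) + real n * (rsq n L a k w / real L))"
        by (simp add: sum_distrib_left[symmetric] sum.distrib)
      also have "\<dots> = real n * (F w * (msq n L a k w + rsq n L a k w / real L))"
        using n0 by (simp add: msq_def algebra_simps)
      finally show ?thesis using n0 by simp
    qed
    then show ?thesis by simp
  qed
  finally show ?thesis .
qed

text \<open>Doob's maximal inequality for the submartingale \<open>max (msq n L a k - 2\<gamma>) 0\<close>.\<close>

lemma bad_probability:
  assumes l: "l \<le> L"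
  shows "(\<integral>w. 1 - good n L \<gamma> a l w \<partial>gprod I) \<le> (5 * rate)\<^sup>2"
proof -
  define p where "p k w = max (msq n L a k w - 2 * \<gamma>) 0" for k w
  define g where "g = good n L \<gamma> a"
  have pp: "pb I (p k)" if "k \<le> L" for k
  proof -
    have "pb I (\<lambda>w. msq n L a k w - 2 * \<gamma>)" using that by (intro pbd_minus pb_means pb_const)
    from pbd_relu[OF this] show ?thesis by (simp add: relu_def p_def[abs_def])
  qed
  have pg: "pb I (g k)" if "k \<le> L" for k unfolding g_def using that by (rule pb_good)
  have p0: "0 \<le> p k w" for k w by (simp add: p_def)
  have g01: "0 \<le> g k w" "g k w \<le> 1" for k w unfolding g_def by (rule good_bounds)+
  have int: "integrable (gprod I) (\<lambda>w. (1 - g k w) * (p j w)\<^sup>2)" "integrable (gprod I) (\<lambda>w. 1 - g k w)"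
    "integrable (gprod I) (\<lambda>w. (1 - g k w) * (2 * p k w) * f w)" if "k \<le> L" "j \<le> L" "pb I f" for k j f
    using that by (intro pb_integrable fin pbd_mult pbd_minus pbd_power pp pg pb_const; simp)+
  \<comment> \<open>Induction over the layers takes the place of a stopping time. Paths that turn
    bad at layer k + 1 have p >= 1 there and pay for themselves; paths already bad keep their share
    because (p k)^2 increases in mean on them.\<close>
  have key: "(\<integral>w. 1 - g k w \<partial>gprod I) \<le> (\<integral>w. (1 - g k w) * (p k w)\<^sup>2 \<partial>gprod I)" if "k \<le> L" for k
    using that
  proof (induction k)
    case 0
    show ?case
    proof (rule integral_mono)
      show "1 - g 0 w \<le> (1 - g 0 w) * (p 0 w)\<^sup>2" for w
      proof (cases "msq n L a 0 w \<le> 2 * \<gamma> + 1")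
        case False
        then have "1 \<le> p 0 w" by (simp add: p_def)
        then have "1 \<le> (p 0 w)\<^sup>2" by (simp add: one_le_power)
        then show ?thesis using g01[of 0 w] by (simp add: mult_le_cancel_left1)
      qed (simp add: g_def good_def)
    qed (use int(1,2)[of 0 0] pb_const in auto)
  next
    case (Suc k)
    have k: "k < L" "k \<le> L" "Suc k \<le> L" using Suc.prems by auto
    have "(\<integral>w. 1 - g (Suc k) w \<partial>gprod I) = (\<integral>w. 1 - g k w \<partial>gprod I) + (\<integral>w. g k w - g (Suc k) w \<partial>gprod I)"
      by (subst Bochner_Integration.integral_add[symmetric]) (auto intro!: pb_integrable fin pbd_minus pg pb_const k)
    also have "\<dots> \<le> (\<integral>w. (1 - g k w) * (p k w)\<^sup>2 \<partial>gprod I) + (\<integral>w. (g k w - g (Suc k) w) * (p (Suc k) w)\<^sup>2 \<partial>gprod I)"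
    proof (intro add_mono Suc.IH k integral_mono)
      show "integrable (gprod I) (\<lambda>w. g k w - g (Suc k) w)" "integrable (gprod I) (\<lambda>w. (g k w - g (Suc k) w) * (p (Suc k) w)\<^sup>2)"
        by (intro pb_integrable fin pbd_minus pbd_mult pbd_power pp pg k)+
      show "g k w - g (Suc k) w \<le> (g k w - g (Suc k) w) * (p (Suc k) w)\<^sup>2" for w
      proof (cases "msq n L a (Suc k) w \<le> 2 * \<gamma> + 1")
        case False
        then have "1 \<le> p (Suc k) w" by (simp add: p_def)
        then have "1 \<le> (p (Suc k) w)\<^sup>2" by (simp add: one_le_power)
        moreover have "0 \<le> g k w - g (Suc k) w" using False g01[of k w] by (simp add: g_def good_Suc)
        ultimately show ?thesis by (simp add: mult_le_cancel_left1)
      qed (simp add: g_def good_Suc)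
    qed
    also have "(\<integral>w. (1 - g k w) * (p k w)\<^sup>2 \<partial>gprod I) \<le> (\<integral>w. (1 - g k w) * (p (Suc k) w)\<^sup>2 \<partial>gprod I)"
    proof -
      \<comment> \<open>The slope of the tangent to the square of the positive part, restricted to
        the paths already bad; it is nonnegative and known at layer k.\<close>
      define F where "F w = (1 - g k w) * (2 * p k w)" for w
      have pF: "pb I F" unfolding F_def[abs_def] by (intro pbd_mult pbd_minus pp pg k pb_const)
      have fF: "frozen (after k) F"
        unfolding F_def[abs_def] p_def g_def by (simp add: frozen_def frozenD[OF frozen_good] frozenD[OF frozen_means(1)])
      have F0: "0 \<le> F w" for w unfolding F_def using g01[of k w] p0[of k w] by (intro mult_nonneg_nonneg) auto
      have iF: "integrable (gprod I) (\<lambda>w. F w * msq n L a (Suc k) w)" "integrable (gprod I) (\<lambda>w. F w * msq n L a k w)"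
        "integrable (gprod I) (\<lambda>w. F w * (msq n L a k w + rsq n L a k w / real L))"
        unfolding divide_inverse by (intro pb_integrable fin pbd_mult pbd_add pF pb_means k pb_const)+
      have ge: "(\<integral>w. F w * msq n L a k w \<partial>gprod I) \<le> (\<integral>w. F w * msq n L a (Suc k) w \<partial>gprod I)"
        unfolding msq_mean_step[OF k(1) pF fF]
        using iF F0 rsq_le_msq(1)[of n L a k] by (intro integral_mono) (auto intro!: mult_left_mono)
      have "(\<integral>w. (1 - g k w) * (p k w)\<^sup>2 + (F w * msq n L a (Suc k) w - F w * msq n L a k w) \<partial>gprod I) \<le> (\<integral>w. (1 - g k w) * (p (Suc k) w)\<^sup>2 \<partial>gprod I)"
      proof (rule integral_mono)
        show "integrable (gprod I) (\<lambda>w. (1 - g k w) * (p k w)\<^sup>2 + (F w * msq n L a (Suc k) w - F w * msq n L a k w))"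
          using int(1)[OF k(2,2) pb_const[of I 0]] iF by simp
        show "integrable (gprod I) (\<lambda>w. (1 - g k w) * (p (Suc k) w)\<^sup>2)" by (rule int(1)[OF k(2,3) pb_const[of I 0]])
        fix w
        \<comment> \<open>The tangent line inequality for the convex function (max x 0)^2.\<close>
        have conv: "(max x 0)\<^sup>2 + 2 * max x 0 * (y - x) \<le> (max y 0)\<^sup>2" for x y :: real
        proof (cases "x \<le> 0")
          case False
          define m where "m = max y 0"
          have "x * y \<le> x * m" using False unfolding m_def by (intro mult_left_mono) auto
          moreover have "0 \<le> (m - x)\<^sup>2" by simp
          moreover have "(m - x)\<^sup>2 = m\<^sup>2 - 2 * (x * m) + x\<^sup>2" "x\<^sup>2 + 2 * x * (y - x) = 2 * (x * y) - x\<^sup>2"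
            by (simp_all add: power2_eq_square algebra_simps)
          moreover have "max x 0 = x" using False by simp
          ultimately show ?thesis unfolding m_def[symmetric] by simp
        qed simp
        have "(1 - g k w) * ((p k w)\<^sup>2 + 2 * p k w * (msq n L a (Suc k) w - msq n L a k w)) \<le> (1 - g k w) * (p (Suc k) w)\<^sup>2"
          using conv[of "msq n L a k w - 2 * \<gamma>" "msq n L a (Suc k) w - 2 * \<gamma>"] g01[of k w]
          by (intro mult_left_mono) (auto simp: p_def)
        then show "(1 - g k w) * (p k w)\<^sup>2 + (F w * msq n L a (Suc k) w - F w * msq n L a k w) \<le> (1 - g k w) * (p (Suc k) w)\<^sup>2"
          by (simp add: F_def algebra_simps)
      qed
      moreover have "(\<integral>w. (1 - g k w) * (p k w)\<^sup>2 + (F w * msq n L a (Suc k) w - F w * msq n L a k w) \<partial>gprod I)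
        = (\<integral>w. (1 - g k w) * (p k w)\<^sup>2 \<partial>gprod I) + ((\<integral>w. F w * msq n L a (Suc k) w \<partial>gprod I) - (\<integral>w. F w * msq n L a k w \<partial>gprod I))"
        using int(1)[OF k(2,2) pb_const[of I 0]] iF by simp
      ultimately show ?thesis using ge by linarith
    qed
    also have "(\<integral>w. (1 - g k w) * (p (Suc k) w)\<^sup>2 \<partial>gprod I) + (\<integral>w. (g k w - g (Suc k) w) * (p (Suc k) w)\<^sup>2 \<partial>gprod I)
      = (\<integral>w. (1 - g (Suc k) w) * (p (Suc k) w)\<^sup>2 \<partial>gprod I)"
    proof -
      have "integrable (gprod I) (\<lambda>w. (g k w - g (Suc k) w) * (p (Suc k) w)\<^sup>2)"
        by (intro pb_integrable fin pbd_minus pbd_mult pbd_power pp pg k)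
      from Bochner_Integration.integral_add[OF int(1)[OF k(2,3) pb_const[of I 0]] this, symmetric] show ?thesis
        by (simp add: algebra_simps)
    qed
    finally show ?case by simp
  qed
  have "(\<integral>w. 1 - g l w \<partial>gprod I) \<le> (\<integral>w. (1 - g l w) * (p l w)\<^sup>2 \<partial>gprod I)" by (rule key[OF l])
  also have "\<dots> \<le> (\<integral>w. (msq n L a l w - qa l)\<^sup>2 \<partial>gprod I)"
  proof (rule integral_mono)
    show "integrable (gprod I) (\<lambda>w. (1 - g l w) * (p l w)\<^sup>2)" by (rule int(1)[OF l l pb_const])
    show "integrable (gprod I) (\<lambda>w. (msq n L a l w - qa l)\<^sup>2)" by (intro pb_integrable fin pbd_power pbd_minus pb_means pb_const l)
    fix w
    \<comment> \<open>The threshold 2 \<gamma> lies above \<open>qa l\<close>, so an excess over it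
      is a deviation from the flow, whose second moment is of order \<open>rate\<close>
      squared.\<close>
    have "p l w \<le> \<bar>msq n L a l w - qa l\<bar>" using q_bounds(2)[OF l] by (auto simp: p_def)
    then have "(p l w)\<^sup>2 \<le> (msq n L a l w - qa l)\<^sup>2" using p0[of l w] by (metis power2_abs power_mono)
    moreover have "(1 - g l w) * (p l w)\<^sup>2 \<le> 1 * (p l w)\<^sup>2" using g01[of l w] by (intro mult_right_mono) auto
    ultimately show "(1 - g l w) * (p l w)\<^sup>2 \<le> (msq n L a l w - qa l)\<^sup>2" by simp
  qed
  also have "\<dots> = (nrm I (\<lambda>w. msq n L a l w - qa l))\<^sup>2" by (simp add: nrm_square)
  also have "\<dots> \<le> (5 * rate)\<^sup>2" by (rule power_mono[OF diag_square[OF l] nrm_nonneg])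
  finally show ?thesis by (simp add: g_def)
qed

end

section \<open>The cross covariance\<close>

text \<open>\<open>net\<close> proves the diagonal estimates for its first input only; the second
  copy \<open>B\<close>, with both inputs equal to b, supplies them for b.\<close>

locale net2 = net a b n L \<alpha> \<beta> \<gamma> u + B: net b b n L \<beta> \<beta> \<gamma> u'
  for a b :: "real ^ 'd::finite" and n L :: nat and \<alpha> \<beta> \<gamma> :: real and u u' :: "real \<Rightarrow> real"
begin

lemma B_q: "B.qa k = qb k"
  by (simp add: B.qa_def qb_def)

lemma diag_b:
  "k < L \<Longrightarrow> nrm I (\<lambda>w. rsq n L b k w / real L - (qb (Suc k) - qb k)) \<le> 4 * rate / real L"
  "l \<le> L \<Longrightarrow> nrm I (\<lambda>w. msq n L b l w - qb l) \<le> 5 * rate"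
  "l \<le> L \<Longrightarrow> (\<integral>w. 1 - good n L \<gamma> b l w \<partial>gprod I) \<le> (5 * rate)\<^sup>2"
  using B.ea_step'[of k] B.diag_square[of l] B.bad_probability[of l] by (simp_all add: B_q B.rate_def rate_def)

definition K where "K k w = good n L \<gamma> a k w * good n L \<gamma> b k w"

lemma K_01: "K k w = 0 \<or> K k w = 1"
  using good_01[of n L \<gamma> a k w] good_01[of n L \<gamma> b k w] by (auto simp: K_def)

lemma K_bounds: "0 \<le> K k w" "K k w \<le> 1" "\<bar>K k w\<bar> \<le> 1"
  using K_01[of k w] by auto

lemma pb_K: "k \<le> L \<Longrightarrow> pb I (K k)"
  unfolding K_def[abs_def] by (intro pbd_mult pb_good)

lemma stopping_K: "stopping K"
  unfolding stopping_def
proof (intro conjI allI impI pb_K K_01)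
  show "frozen (after k) (K k)" for k
    unfolding K_def[abs_def] by (intro frozen_funs frozen_good)
  have "good n L \<gamma> x (Suc k) w \<le> good n L \<gamma> x k w" for x :: "real ^ 'd" and k w
    using good_bounds[of n L \<gamma> x k w] by (simp add: good_Suc)
  then show "K (Suc k) w \<le> K k w" for k w
    unfolding K_def using good_bounds by (intro mult_mono) auto
qed

lemma K_1:
  assumes "K k w = 1" shows "msq n L a k w \<le> 2 * \<gamma> + 1" "msq n L b k w \<le> 2 * \<gamma> + 1"
  using assms good_01[of n L \<gamma> a k w] good_01[of n L \<gamma> b k w] by (auto simp: K_def intro: good_1)

text \<open>The 7 is 1 for the mean size of the neurons and 6 for the standard deviations, in units
  of sqrt(2 \<gamma> + 1). The last root comes from the lower bound min \<alpha> \<beta> (l - k) /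
  (2 L) for the variances of a flow increment.\<close>

definition H where "H = 7 * sqrt (2 * \<gamma> + 1) * sqrt (2 / min \<alpha> \<beta>)"

lemma H_nonneg: "0 \<le> H"
  using \<gamma> pos by (simp add: H_def)

text \<open>\<open>gcov_relu2_diff\<close> is applied with the flow increment as the reference,
  whose variances have a positive lower bound since k < l. The actual covariance may be singular.
  Stopping enters by bounding the mean of the absolute values of the neurons and the actual
  variance.\<close>

lemma relu2_drift:
  assumes k: "k < l" "l \<le> L" and K: "K k w = 1"
  shows "\<bar>drift relu2 l k w\<bar> \<le> 2 * \<bar>rcr n L a b k w / real L - (qx (Suc k) - qx k)\<bar>
    + H * sqrt (real L / real (l - k)) * (\<bar>rsq n L a k w / real L - (qa (Suc k) - qa k)\<bar> + \<bar>rsq n L b k w / real L - (qb (Suc k) - qb k)\<bar>)"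
proof -
  define \<kappa> where "\<kappa> = 2 * \<gamma> + 1"
  have \<kappa>: "1 \<le> \<kappa>" "\<gamma> \<le> \<kappa>" using \<gamma> by (auto simp: \<kappa>_def)
  have kl: "Suc k \<le> l" "k \<le> l" using k by auto
  define s t r where "s = qa l - qa k" and "t = qb l - qb k" and "r = qx l - qx k"
  define s' t' r' where "s' = qa l - qa (Suc k) + rsq n L a k w / real L"
    and "t' = qb l - qb (Suc k) + rsq n L b k w / real L" and "r' = qx l - qx (Suc k) + rcr n L a b k w / real L"
  define ds dt dr where "ds = \<bar>rsq n L a k w / real L - (qa (Suc k) - qa k)\<bar>"
    and "dt = \<bar>rsq n L b k w / real L - (qb (Suc k) - qb k)\<bar>" and "dr = \<bar>rcr n L a b k w / real L - (qx (Suc k) - qx k)\<bar>"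
  have d: "\<bar>s' - s\<bar> = ds" "\<bar>t' - t\<bar> = dt" "\<bar>r' - r\<bar> = dr"
    by (auto simp: s_def t_def r_def s'_def t'_def r'_def ds_def dt_def dr_def)
  have L1: "1 \<le> real L" using L by simp
  note b = incr_bounds[OF kl(2) k(2)] and b' = incr_bounds[OF kl(1) k(2)]
  define x where "x = real (l - k) / real L"
  have x: "0 < x" "tm l - tm k = x"
  proof -
    show "0 < x" unfolding x_def using k L1 by (intro divide_pos_pos) auto
    show "tm l - tm k = x" using k by (simp add: x_def tm_def diff_divide_distrib of_nat_diff)
  qed
  have mu: "0 < min \<alpha> \<beta>" using pos by auto
  have st: "min \<alpha> \<beta> * (x / 2) \<le> s" "min \<alpha> \<beta> * (x / 2) \<le> t"
  proof -
    have "min \<alpha> \<beta> * (x / 2) \<le> \<alpha> * (x / 2)" "min \<alpha> \<beta> * (x / 2) \<le> \<beta> * (x / 2)"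
      using x by (intro mult_right_mono; simp)+
    then show "min \<alpha> \<beta> * (x / 2) \<le> s" "min \<alpha> \<beta> * (x / 2) \<le> t"
      using b(1,4) unfolding x(2) s_def t_def by linarith+
  qed
  have mx: "0 < min \<alpha> \<beta> * (x / 2)" using mu x by simp
  have pos': "0 < s" "0 < t" using st mx by linarith+
  \<comment> \<open>An upper bound for the inverse standard deviations of the flow increment; it
    carries the singular factor in l - k.\<close>
  define \<eta> where "\<eta> = sqrt (2 / min \<alpha> \<beta>) * sqrt (real L / real (l - k))"
  have \<eta>0: "0 \<le> \<eta>" using mu by (simp add: \<eta>_def)
  have inv: "1 / sqrt y \<le> \<eta>" if "min \<alpha> \<beta> * (x / 2) \<le> y" for y
  proof -
    have "1 / y \<le> 1 / (min \<alpha> \<beta> * (x / 2))" using that mx by (intro divide_left_mono) auto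
    also have "\<dots> = 2 / min \<alpha> \<beta> * (real L / real (l - k))" by (simp add: x_def)
    finally have "sqrt (1 / y) \<le> sqrt (2 / min \<alpha> \<beta> * (real L / real (l - k)))" by (rule real_sqrt_le_mono)
    then show ?thesis unfolding \<eta>_def real_sqrt_mult[symmetric] by (simp add: real_sqrt_divide)
  qed
  have A: "msq n L a k w \<le> \<kappa>" "msq n L b k w \<le> \<kappa>" using K_1[OF K] by (auto simp: \<kappa>_def)
  have small: "sqrt y \<le> 2 * sqrt \<kappa>" if "y \<le> 2 * \<kappa>" for y
  proof -
    have "sqrt y \<le> sqrt (4 * \<kappa>)" using that \<kappa> by simp
    then show ?thesis by (simp add: real_sqrt_mult)
  qed
  have t'le: "sqrt t' \<le> 2 * sqrt \<kappa>"
  proof (rule small)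
    have "rsq n L b k w / real L \<le> \<kappa> / 1" using rsq_le_msq[of n L b k w] A L1 by (intro frac_le) auto
    then show "t' \<le> 2 * \<kappa>" using b'(5) \<kappa> by (simp add: t'_def)
  qed
  have sle: "sqrt s \<le> 2 * sqrt \<kappa>" using b(2) \<kappa> by (intro small) (simp add: s_def)
  have n0: "real n > 0" using n by simp
  have mean_abs: "(\<Sum>i<n. \<bar>act n L x k i w\<bar>) / real n \<le> sqrt \<kappa>" if "msq n L x k w \<le> \<kappa>" for x
  proof (rule real_le_rsqrt)
    show "((\<Sum>i<n. \<bar>act n L x k i w\<bar>) / real n)\<^sup>2 \<le> \<kappa>"
      using mean_square_le[of "\<lambda>i. \<bar>act n L x k i w\<bar>" n] that by (simp add: msq_def)
  qed
  have r0: "0 \<le> r" "0 \<le> r'" using b(7) b'(7) rcr_nonneg[of n L a b k w] by (auto simp: r_def r'_def)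
  have psd: "psd s t r" "psd s' t' r'" unfolding s_def t_def r_def s'_def t'_def r'_def by (rule b(8), rule psd_comp[OF kl(1) k(2)])
  have "\<bar>drift relu2 l k w\<bar> \<le> (\<Sum>i<n. \<bar>comp relu2 l k i w - gcov s t r relu2 (ya k i w, yb k i w)\<bar>) / real n"
    unfolding drift_def s_def t_def r_def using n0 by (simp add: divide_right_mono sum_abs)
  also have "\<dots> \<le> (\<Sum>i<n. 2 * dr + (ds * \<eta>) * (\<bar>yb k i w\<bar> + 6 * sqrt \<kappa>) + (dt * \<eta>) * (\<bar>ya k i w\<bar> + 6 * sqrt \<kappa>)) / real n"
  proof (intro divide_right_mono sum_mono)
    fix i
    have "\<bar>comp relu2 l k i w - gcov s t r relu2 (ya k i w, yb k i w)\<bar>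
      \<le> 2 * dr + ds / sqrt s * (\<bar>yb k i w\<bar> + 3 * sqrt t') + dt / sqrt t * (\<bar>ya k i w\<bar> + 3 * sqrt s)"
      using gcov_relu2_diff[OF psd pos' r0, of "ya k i w" "yb k i w"]
      unfolding d
      unfolding comp_def s'_def t'_def r'_def .
    also have "\<dots> \<le> 2 * dr + (ds * \<eta>) * (\<bar>yb k i w\<bar> + 6 * sqrt \<kappa>) + (dt * \<eta>) * (\<bar>ya k i w\<bar> + 6 * sqrt \<kappa>)"
    proof (rule add_mono[OF add_mono[OF order_refl mult_mono] mult_mono])
      show "ds / sqrt s \<le> ds * \<eta>" "dt / sqrt t \<le> dt * \<eta>"
        using mult_left_mono[OF inv[OF st(1)], of ds] mult_left_mono[OF inv[OF st(2)], of dt] by (auto simp: ds_def dt_def)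
      show "\<bar>yb k i w\<bar> + 3 * sqrt t' \<le> \<bar>yb k i w\<bar> + 6 * sqrt \<kappa>" "\<bar>ya k i w\<bar> + 3 * sqrt s \<le> \<bar>ya k i w\<bar> + 6 * sqrt \<kappa>"
        using t'le sle by simp_all
    qed (use \<eta>0 pos' psd in \<open>auto simp: ds_def dt_def psd_def\<close>)
    finally show "\<bar>comp relu2 l k i w - gcov s t r relu2 (ya k i w, yb k i w)\<bar>
      \<le> 2 * dr + (ds * \<eta>) * (\<bar>yb k i w\<bar> + 6 * sqrt \<kappa>) + (dt * \<eta>) * (\<bar>ya k i w\<bar> + 6 * sqrt \<kappa>)" .
  qed (use n0 in simp)
  also have "\<dots> = 2 * dr + (ds * \<eta>) * ((\<Sum>i<n. \<bar>yb k i w\<bar>) / real n + 6 * sqrt \<kappa>) + (dt * \<eta>) * ((\<Sum>i<n. \<bar>ya k i w\<bar>) / real n + 6 * sqrt \<kappa>)"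
    using n0 by (simp add: sum.distrib sum_distrib_left[symmetric] add_divide_distrib distrib_left)
  also have "\<dots> \<le> 2 * dr + (ds * \<eta>) * (sqrt \<kappa> + 6 * sqrt \<kappa>) + (dt * \<eta>) * (sqrt \<kappa> + 6 * sqrt \<kappa>)"
    using mean_abs[OF A(1)] mean_abs[OF A(2)] \<eta>0 by (intro add_mono mult_left_mono order_refl) (auto simp: ds_def dt_def)
  also have "\<dots> = 2 * dr + H * sqrt (real L / real (l - k)) * (ds + dt)"
    by (simp add: H_def \<eta>_def \<kappa>_def algebra_simps)
  finally show ?thesis unfolding ds_def dt_def dr_def .
qed

text \<open>The slope in the Euler step of \<open>flow_path\<close> for the off-diagonal
  entry.\<close>

definition Fx where "Fx k = gcov (qa k) (qb k) (qx k) relu2 (0, 0)"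
definition eb where "eb k = nrm I (\<lambda>w. K k w * (rcr n L a b k w - Fx k))"

lemma euler_qx:
  assumes "k < L" shows "\<bar>qx (Suc k) - qx k - Fx k / real L\<bar> \<le> 2 * \<gamma> / (real L)\<^sup>2"
proof -
  have t: "0 \<le> tm k" "tm k + 1 / real L \<le> 1" using tm[of k] tm(2)[of "Suc k"] assms by (auto simp: tm)
  have "\<bar>u (tm k + 1 / real L) - u (tm k) - 1 / real L * gcov (\<alpha> * exp (tm k / 2)) (\<beta> * exp (tm k / 2)) (u (tm k)) relu2 (0, 0)\<bar> \<le> 2 * sqrt (\<alpha> * \<beta>) * (1 / real L)\<^sup>2"
  proof -
    have "\<And>t \<delta>. 0 \<le> t \<Longrightarrow> 0 \<le> \<delta> \<Longrightarrow> t + \<delta> \<le> 1 \<Longrightarrow>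
        \<bar>u (t + \<delta>) - u t - \<delta> * gcov (\<alpha> * exp (t / 2)) (\<beta> * exp (t / 2)) (u t) relu2 (0, 0)\<bar> \<le> 2 * sqrt (\<alpha> * \<beta>) * \<delta>\<^sup>2"
      using flow unfolding flow_path_def by blast
    from this[OF t(1) _ t(2)] show ?thesis by simp
  qed
  also have "\<dots> \<le> 2 * \<gamma> * (1 / real L)\<^sup>2" using sqrt_prod_le by (intro mult_right_mono) auto
  finally show ?thesis by (simp add: Fx_def qx_def qa_def qb_def tm(4) power_divide)
qed

lemma eb_step:
  assumes k: "k < L"
  shows "nrm I (\<lambda>w. K k w * (rcr n L a b k w / real L - (qx (Suc k) - qx k))) \<le> eb k / real L + 2 * \<gamma> / (real L)\<^sup>2"
proof -
  let ?c = "Fx k / real L - (qx (Suc k) - qx k)"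
  have kL: "k \<le> L" using k by simp
  have e: "K k w * (rcr n L a b k w / real L - (qx (Suc k) - qx k)) = 1 / real L * (K k w * (rcr n L a b k w - Fx k)) + ?c * K k w" for w
    by (simp add: diff_divide_distrib algebra_simps)
  have "nrm I (\<lambda>w. K k w * (rcr n L a b k w / real L - (qx (Suc k) - qx k))) \<le> nrm I (\<lambda>w. 1 / real L * (K k w * (rcr n L a b k w - Fx k))) + nrm I (\<lambda>w. ?c * K k w)"
    unfolding e using kL by (intro nrm_triangle fin pbd_mult pbd_minus pb_means pb_const pb_K)
  also have "\<dots> = eb k / real L + \<bar>?c\<bar> * nrm I (K k)" by (simp only: nrm_cmult eb_def) simp
  also have "\<dots> \<le> eb k / real L + 2 * \<gamma> / (real L)\<^sup>2 * 1"
  proof (intro add_left_mono mult_mono)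
    show "\<bar>?c\<bar> \<le> 2 * \<gamma> / (real L)\<^sup>2" using euler_qx[OF k] by (simp add: abs_minus_commute)
    have "nrm I (K k) \<le> nrm I (\<lambda>_. 1)" using K_bounds kL by (intro nrm_mono fin pb_K pb_const) auto
    then show "nrm I (K k) \<le> 1" by simp
  qed (use \<gamma> nrm_nonneg in auto)
  finally show ?thesis by simp
qed

text \<open>The correlation defect has constant 2, which becomes the Gronwall constant. The variance
  defects are at most 4 \<open>rate\<close> / L, and their singular weights sum to 2, so both
  diagonals together give 16 H. The 5 is 1 for the noise and 4 for the Euler errors.\<close>

lemma relu_cross:
  assumes l: "l \<le> L"
  shows "eb l \<le> (5 + 16 * H) * rate * exp 2"
proof -
  have g: "pgrow relu2" by (rule pgrow_relu2)
  have "eb l \<le> (5 + 16 * H) * rate + (\<Sum>k<l. 2 / real L * eb k)" if l: "l \<le> L" for l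
  proof -
    have drift: "nrm I (\<lambda>w. K k w * drift relu2 l k w) \<le> 2 / real L * eb k + 4 * \<gamma> / (real L)\<^sup>2 + (8 * H * rate) * (sqrt (real L / real (l - k)) / real L)"
      if k: "k < l" for k
    proof -
      have kL: "k < L" "k \<le> L" using k l by auto
      define c where "c = H * sqrt (real L / real (l - k))"
      have c: "0 \<le> c" using H_nonneg by (simp add: c_def)
      define X where "X w = K k w * (rcr n L a b k w / real L - (qx (Suc k) - qx k))" for w
      define Y where "Y w = rsq n L a k w / real L - (qa (Suc k) - qa k)" for w
      define Y' where "Y' w = rsq n L b k w / real L - (qb (Suc k) - qb k)" for w
      have pX: "pb I X" "pb I Y" "pb I Y'"
        unfolding X_def[abs_def] Y_def[abs_def] Y'_def[abs_def] divide_inverse by (intro pbd_mult pbd_minus pb_K pb_means pb_const kL(2))+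
      have "nrm I (\<lambda>w. K k w * drift relu2 l k w) \<le> nrm I (\<lambda>w. 2 * \<bar>X w\<bar> + (c * \<bar>Y w\<bar> + c * \<bar>Y' w\<bar>))"
      proof (rule nrm_mono[OF fin])
        show "pb I (\<lambda>w. K k w * drift relu2 l k w)" using k l kL by (intro pbd_mult pb_K pb_drift g) auto
        show "pb I (\<lambda>w. 2 * \<bar>X w\<bar> + (c * \<bar>Y w\<bar> + c * \<bar>Y' w\<bar>))" by (intro pbd_add pbd_mult pbd_abs pX pb_const)
        show "\<bar>K k w * drift relu2 l k w\<bar> \<le> \<bar>2 * \<bar>X w\<bar> + (c * \<bar>Y w\<bar> + c * \<bar>Y' w\<bar>)\<bar>" for w
        proof (cases "K k w = 1")
          case True
          have "\<bar>drift relu2 l k w\<bar> \<le> 2 * \<bar>X w\<bar> + c * (\<bar>Y w\<bar> + \<bar>Y' w\<bar>)"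
            using relu2_drift[OF k l True] unfolding X_def Y_def Y'_def c_def True mult_1 .
          then show ?thesis using True c by (simp add: distrib_left)
        next
          case False
          then show ?thesis using K_01[of k w] by simp
        qed
      qed
      also have "\<dots> \<le> nrm I (\<lambda>w. 2 * \<bar>X w\<bar>) + (nrm I (\<lambda>w. c * \<bar>Y w\<bar>) + nrm I (\<lambda>w. c * \<bar>Y' w\<bar>))"
        by (intro order_trans[OF nrm_triangle] add_left_mono nrm_triangle fin pbd_add pbd_mult pbd_abs pX pb_const)
      also have "\<dots> = 2 * nrm I X + (c * nrm I Y + c * nrm I Y')"
      proof -
        have "nrm I (\<lambda>w. \<bar>f w\<bar>) = nrm I f" for f :: "('d weight_index \<Rightarrow> real) \<Rightarrow> real" by (simp add: nrm_def)
        then show ?thesis using c by (simp add: nrm_cmult)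
      qed
      also have "\<dots> \<le> 2 * (eb k / real L + 2 * \<gamma> / (real L)\<^sup>2) + (c * (4 * rate / real L) + c * (4 * rate / real L))"
        unfolding X_def[abs_def] Y_def[abs_def] Y'_def[abs_def]
        by (intro add_mono mult_left_mono eb_step ea_step' diag_b kL c) simp
      also have "\<dots> = 2 / real L * eb k + 4 * \<gamma> / (real L)\<^sup>2 + (8 * H * rate) * (sqrt (real L / real (l - k)) / real L)"
        by (simp add: c_def)
      finally show ?thesis .
    qed
    have "T relu2 l l w = rcr n L a b l w" for w by (simp add: T_def rcr_def relu2_def)
    then have "eb l \<le> noise_const * \<gamma> / sqrt (real n) + (\<Sum>k<l. nrm I (\<lambda>w. K k w * drift relu2 l k w))"
      using telescoping_bound[OF qlip_relu2 l stopping_K] by (simp add: eb_def Fx_def)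
    also have "\<dots> \<le> noise_const * \<gamma> / sqrt (real n) + (\<Sum>k<l. 2 / real L * eb k + 4 * \<gamma> / (real L)\<^sup>2 + (8 * H * rate) * (sqrt (real L / real (l - k)) / real L))"
      using drift by (intro add_left_mono sum_mono) auto
    also have "\<dots> = noise_const * \<gamma> / sqrt (real n) + ((\<Sum>k<l. 2 / real L * eb k) + (\<Sum>k<l. 4 * \<gamma> / (real L)\<^sup>2) + (8 * H * rate) * (\<Sum>k<l. sqrt (real L / real (l - k)) / real L))"
      unfolding sum.distrib sum_distrib_left ..
    also have "\<dots> \<le> rate + ((\<Sum>k<l. 2 / real L * eb k) + 4 * rate + (8 * H * rate) * 2)"
    proof (intro add_mono order_refl mult_left_mono)
      show "(\<Sum>k<l. 4 * \<gamma> / (real L)\<^sup>2) \<le> 4 * rate"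
        using sum_const_L2[OF l, where c = "4 * \<gamma>"] rate_bounds(3) \<gamma> by simp
      show "(\<Sum>k<l. sqrt (real L / real (l - k)) / real L) \<le> 2" by (rule sum_inverse_sqrt[OF L l])
    qed (use rate_bounds H_nonneg in auto)
    finally show ?thesis by (simp add: algebra_simps)
  qed
  then show ?thesis
    using discrete_gronwall[where c = 2 and e = "(5 + 16 * H) * rate" and L = L and x = eb and l = l] l L rate_bounds H_nonneg by simp
qed

definition err where "err l w = (\<Sum>i<n. ya l i w * yb l i w) / real n - qx l"

lemma pb_err: "l \<le> L \<Longrightarrow> pb I (err l)"
  unfolding err_def[abs_def] by (intro pbd_minus mean_pb pbd_mult pb_ab pb_const)

text \<open>For h = x y the drift is the correlation defect itself, with no singular factor, so the
  stopped bounds on \<open>eb\<close> can simply be added. The 3 is 1 for the noise and 2 for the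
  Euler errors.\<close>

lemma cross_stopped:
  assumes l: "l \<le> L"
  shows "nrm I (\<lambda>w. K l w * err l w) \<le> (3 + (5 + 16 * H) * exp 2) * rate"
proof -
  define h where "h = (\<lambda>p::real\<times>real. fst p * snd p)"
  have h: "qlip h" unfolding h_def by (rule qlip_id)
  have n0: "real n > 0" using n by simp
  have drift: "drift h l k w = rcr n L a b k w / real L - (qx (Suc k) - qx k)" if k: "k < l" for k w
  proof -
    have kl: "Suc k \<le> l" "k \<le> l" using k by auto
    have "comp h l k i w - gcov (qa l - qa k) (qb l - qb k) (qx l - qx k) h (ya k i w, yb k i w) = rcr n L a b k w / real L - (qx (Suc k) - qx k)" for i
      unfolding comp_def h_def gcov_moments(3)[OF incr_bounds(8)[OF kl(2) l]] gcov_moments(3)[OF psd_comp[OF kl(1) l]] by simp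
    then show ?thesis unfolding drift_def using n0 by simp
  qed
  have "T h l l w = (\<Sum>i<n. ya l i w * yb l i w) / real n" for w by (simp add: T_def h_def)
  moreover have "gcov (qa l) (qb l) (qx l) h (0, 0) = qx l" unfolding h_def gcov_moments(3)[OF psd_q[OF l]] by simp
  ultimately have "nrm I (\<lambda>w. K l w * err l w) \<le> noise_const * \<gamma> / sqrt (real n) + (\<Sum>k<l. nrm I (\<lambda>w. K k w * drift h l k w))"
    using telescoping_bound[OF h l stopping_K] by (simp add: err_def)
  also have "(\<Sum>k<l. nrm I (\<lambda>w. K k w * drift h l k w)) \<le> (5 + 16 * H) * rate * exp 2 + 2 * rate"
  proof (rule sum_over_L[OF l])
    show "0 \<le> (5 + 16 * H) * rate * exp 2 + 2 * rate" using rate_bounds H_nonneg by simp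
    fix k assume k: "k < l"
    have "nrm I (\<lambda>w. K k w * drift h l k w) \<le> eb k / real L + 2 * \<gamma> / (real L)\<^sup>2"
      unfolding drift[OF k] using k l by (intro eb_step) auto
    also have "\<dots> = (eb k + 2 * (\<gamma> / real L)) / real L" by (simp add: add_divide_distrib power2_eq_square)
    also have "\<dots> \<le> ((5 + 16 * H) * rate * exp 2 + 2 * rate) / real L"
      using k l relu_cross[of k] rate_bounds(3) by (intro divide_right_mono add_mono mult_left_mono) auto
    finally show "nrm I (\<lambda>w. K k w * drift h l k w) \<le> ((5 + 16 * H) * rate * exp 2 + 2 * rate) / real L" .
  qed
  finally show ?thesis using rate_bounds(2) by (simp add: algebra_simps)
qed

text \<open>Off the good event no cancellation is sought: the squared error is at most the squared
  diagonal deviations plus the constant 24 \<gamma>^2, and that constant is paid only on an event of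
  probability of order \<open>rate\<close> squared.\<close>

lemma cross_bad:
  assumes l: "l \<le> L"
  shows "nrm I (\<lambda>w. (1 - K l w) * err l w) \<le> (10 + 35 * \<gamma>) * rate"
proof -
  define A B where "A = (\<lambda>w. msq n L a l w - qa l)" and "B = (\<lambda>w. msq n L b l w - qb l)"
  define g g' where "g = good n L \<gamma> a l" and "g' = good n L \<gamma> b l"
  have pAB: "pb I A" "pb I B" "pb I g" "pb I g'"
    unfolding A_def B_def g_def g'_def by (intro pbd_minus pb_means pb_const pb_good l)+
  have q: "0 < qa l" "qa l \<le> 2 * \<gamma>" "0 < qb l" "qb l \<le> 2 * \<gamma>" "\<bar>qx l\<bar> \<le> 2 * \<gamma>" using q_bounds[OF l] by auto
  have pt: "((1 - K l w) * err l w)\<^sup>2 \<le> 2 * (A w)\<^sup>2 + (2 * (B w)\<^sup>2 + 24 * \<gamma>\<^sup>2 * ((1 - g w) + (1 - g' w)))" for w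
  proof -
    define m where "m = (\<Sum>i<n. ya l i w * yb l i w) / real n"
    have sq: "(x + y)\<^sup>2 \<le> 2 * (x\<^sup>2 + y\<^sup>2)" for x y :: real
      using zero_le_power2[of "x - y"] by (simp add: power2_eq_square algebra_simps)
    have "m\<^sup>2 \<le> msq n L a l w * msq n L b l w" unfolding m_def msq_def by (rule mean_CS)
    also have "\<dots> \<le> ((msq n L a l w)\<^sup>2 + (msq n L b l w)\<^sup>2) / 2"
      using zero_le_power2[of "msq n L a l w - msq n L b l w"] by (simp add: power2_eq_square algebra_simps)
    also have "\<dots> \<le> (2 * ((A w)\<^sup>2 + (qa l)\<^sup>2) + 2 * ((B w)\<^sup>2 + (qb l)\<^sup>2)) / 2"
      using sq[of "A w" "qa l"] sq[of "B w" "qb l"] by (simp add: A_def B_def)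
    also have "\<dots> = (A w)\<^sup>2 + (B w)\<^sup>2 + ((qa l)\<^sup>2 + (qb l)\<^sup>2)" by simp
    also have "(qa l)\<^sup>2 \<le> (2 * \<gamma>)\<^sup>2" using q by (intro power_mono) auto
    also have "(qb l)\<^sup>2 \<le> (2 * \<gamma>)\<^sup>2" using q by (intro power_mono) auto
    finally have m: "m\<^sup>2 \<le> (A w)\<^sup>2 + (B w)\<^sup>2 + 8 * \<gamma>\<^sup>2" by (simp add: power_mult_distrib)
    have "\<bar>qx l\<bar>\<^sup>2 \<le> (2 * \<gamma>)\<^sup>2" using q by (intro power_mono) auto
    \<comment> \<open>Here 24 = 2 * (8 + 4), with 8 \<gamma>^2 from the two variances of the flow
      and 4 \<gamma>^2 from its correlation entry.\<close>
    then have "(err l w)\<^sup>2 \<le> 2 * ((A w)\<^sup>2 + (B w)\<^sup>2 + 8 * \<gamma>\<^sup>2 + 4 * \<gamma>\<^sup>2)"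
      using m sq[of m "- qx l"] by (simp add: err_def m_def[symmetric] power_mult_distrib)
    then have e: "(err l w)\<^sup>2 \<le> 2 * (A w)\<^sup>2 + 2 * (B w)\<^sup>2 + 24 * \<gamma>\<^sup>2" by simp
    have gs: "0 \<le> g w" "g w \<le> 1" "0 \<le> g' w" "g' w \<le> 1" unfolding g_def g'_def by (rule good_bounds)+
    show ?thesis
    proof (cases "K l w = 1")
      case True
      then show ?thesis using gs by simp
    next
      case False
      then have K0: "K l w = 0" using K_01[of l w] by auto
      then have "g w = 0 \<or> g' w = 0" by (simp add: K_def g_def g'_def)
      then have "1 \<le> (1 - g w) + (1 - g' w)" using gs by auto
      then have "24 * \<gamma>\<^sup>2 * 1 \<le> 24 * \<gamma>\<^sup>2 * ((1 - g w) + (1 - g' w))" by (intro mult_left_mono) auto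
      then show ?thesis using e K0 by simp
    qed
  qed
  have iA: "integrable (gprod I) (\<lambda>w. (A w)\<^sup>2)" "integrable (gprod I) (\<lambda>w. (B w)\<^sup>2)" "integrable (gprod I) (\<lambda>w. 1 - g w)" "integrable (gprod I) (\<lambda>w. 1 - g' w)"
    by (intro pb_integrable fin pbd_power pbd_minus pAB pb_const)+
  have "(\<integral>w. ((1 - K l w) * err l w)\<^sup>2 \<partial>gprod I) \<le> (\<integral>w. 2 * (A w)\<^sup>2 + (2 * (B w)\<^sup>2 + 24 * \<gamma>\<^sup>2 * ((1 - g w) + (1 - g' w))) \<partial>gprod I)"
    by (intro integral_mono pt pb_integrable fin pbd_power pbd_mult pbd_add pbd_minus pAB pb_const pb_K pb_err l)
  also have "\<dots> = 2 * (\<integral>w. (A w)\<^sup>2 \<partial>gprod I) + (2 * (\<integral>w. (B w)\<^sup>2 \<partial>gprod I) + 24 * \<gamma>\<^sup>2 * ((\<integral>w. 1 - g w \<partial>gprod I) + (\<integral>w. 1 - g' w \<partial>gprod I)))"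
  proof -
    have "(\<integral>w. (1 - g w) + (1 - g' w) \<partial>gprod I) = (\<integral>w. 1 - g w \<partial>gprod I) + (\<integral>w. 1 - g' w \<partial>gprod I)"
      by (rule Bochner_Integration.integral_add[OF iA(3,4)])
    moreover have "integrable (gprod I) (\<lambda>w. (1 - g w) + (1 - g' w))" by (rule Bochner_Integration.integrable_add[OF iA(3,4)])
    moreover have "(\<integral>w. c1 * f1 w + (c2 * f2 w + c3 * f3 w) \<partial>gprod I) = c1 * (\<integral>w. f1 w \<partial>gprod I) + (c2 * (\<integral>w. f2 w \<partial>gprod I) + c3 * (\<integral>w. f3 w \<partial>gprod I))"
      if "integrable (gprod I) f1" "integrable (gprod I) f2" "integrable (gprod I) f3" for f1 f2 f3 and c1 c2 c3 :: real
      using that by simp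
    ultimately show ?thesis using iA(1,2) by (simp only:)
  qed
  also have "\<dots> \<le> 2 * (5 * rate)\<^sup>2 + (2 * (5 * rate)\<^sup>2 + 24 * \<gamma>\<^sup>2 * ((5 * rate)\<^sup>2 + (5 * rate)\<^sup>2))"
  proof (intro add_mono mult_left_mono)
    show "(\<integral>w. (A w)\<^sup>2 \<partial>gprod I) \<le> (5 * rate)\<^sup>2" "(\<integral>w. (B w)\<^sup>2 \<partial>gprod I) \<le> (5 * rate)\<^sup>2"
      unfolding nrm_square[symmetric] A_def B_def
      by (intro power_mono diag_square[OF l] nrm_nonneg, intro power_mono diag_b(2)[OF l] nrm_nonneg)
    show "(\<integral>w. 1 - g w \<partial>gprod I) \<le> (5 * rate)\<^sup>2" "(\<integral>w. 1 - g' w \<partial>gprod I) \<le> (5 * rate)\<^sup>2"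
      unfolding g_def g'_def by (rule bad_probability[OF l], rule diag_b(3)[OF l])
  qed auto
  also have "\<dots> = (100 + 1200 * \<gamma>\<^sup>2) * rate\<^sup>2" by (simp add: power_mult_distrib algebra_simps)
  \<comment> \<open>The coefficients are 100 = 4 * 25 and 1200 = 24 * 50; the square on the right
    dominates since 35^2 = 1225.\<close>
  also have "\<dots> \<le> (10 + 35 * \<gamma>)\<^sup>2 * rate\<^sup>2"
    using \<gamma> by (intro mult_right_mono) (auto simp: power2_eq_square algebra_simps)
  finally have "(nrm I (\<lambda>w. (1 - K l w) * err l w))\<^sup>2 \<le> ((10 + 35 * \<gamma>) * rate)\<^sup>2"
    by (simp add: nrm_square power_mult_distrib)
  then show ?thesis by (rule power2_le_imp_le) (use \<gamma> rate_bounds in auto)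
qed

lemma cross_error:
  assumes l: "l \<le> L"
  shows "nrm I (err l) \<le> (13 + (5 + 16 * H) * exp 2 + 35 * \<gamma>) * rate"
proof -
  have "nrm I (\<lambda>w. K l w * err l w + (1 - K l w) * err l w) \<le> nrm I (\<lambda>w. K l w * err l w) + nrm I (\<lambda>w. (1 - K l w) * err l w)"
    using l by (intro nrm_triangle fin pbd_mult pbd_minus pb_K pb_err pb_const)
  also have "\<dots> \<le> (3 + (5 + 16 * H) * exp 2) * rate + (10 + 35 * \<gamma>) * rate"
    by (intro add_mono cross_stopped cross_bad l)
  finally show ?thesis by (simp add: algebra_simps)
qed

end

section \<open>Transfer to the given random weights\<close>

text \<open>The restriction to the index set matters: points of a product space take the value
  \<open>undefined\<close> outside it.\<close>

definition standardized ::
  "nat \<Rightarrow> nat \<Rightarrow> (nat \<Rightarrow> 'd::finite \<Rightarrow> 'w \<Rightarrow> real) \<Rightarrow> (nat \<Rightarrow> nat \<Rightarrow> nat \<Rightarrow> 'w \<Rightarrow> real) \<Rightarrow> 'w \<Rightarrow> 'd weight_index \<Rightarrow> real" where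
  "standardized n L Win W \<omega> = (\<lambda>k\<in>weight_indices n L.
     case k of Inl (i, j) \<Rightarrow> sqrt (real CARD('d)) * Win i j \<omega> | Inr (l, i, j) \<Rightarrow> sqrt (real n) * W l i j \<omega>)"

lemma distr_normal_gauss:
  assumes M: "prob_space M" and X: "distributed M lborel X (\<lambda>x. ennreal (normal_density 0 (sqrt (1 / c)) x))" and c: "0 < c"
  shows "distr M borel (\<lambda>\<omega>. sqrt c * X \<omega>) = gauss"
proof -
  interpret prob_space M by (rule M)
  have s: "0 < sqrt (1 / c)" "sqrt c \<noteq> 0" using c by auto
  have "distributed M lborel (\<lambda>\<omega>. 0 + sqrt c * X \<omega>) (\<lambda>x. ennreal (normal_density (0 + sqrt c * 0) (\<bar>sqrt c\<bar> * sqrt (1 / c)) x))"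
    by (rule normal_density_affine[OF X s])
  moreover have "\<bar>sqrt c\<bar> * sqrt (1 / c) = 1" using c by (simp add: real_sqrt_divide)
  ultimately have "distributed M lborel (\<lambda>\<omega>. sqrt c * X \<omega>) std_normal_density" by simp
  then have "distr M lborel (\<lambda>\<omega>. sqrt c * X \<omega>) = density lborel std_normal_density"
    by (rule distributed_distr_eq_density)
  moreover have "distr M borel (\<lambda>\<omega>. sqrt c * X \<omega>) = distr M lborel (\<lambda>\<omega>. sqrt c * X \<omega>)"
    by (rule distr_cong) auto
  ultimately show ?thesis by (simp add: gauss_def)
qed

text \<open>Independence and the rescaled marginals identify the joint law with
  \<open>gprod\<close>, so an estimate on this one space serves every \<open>M\<close>.\<close>

lemma standardized_distr:
  fixes Win :: "nat \<Rightarrow> 'd::finite \<Rightarrow> 'w \<Rightarrow> real"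
  assumes G: "gaussian_resnet_weights M n L Win W" and n: "1 \<le> n"
  shows "standardized n L Win W \<in> measurable M (gprod (weight_indices n L))"
    "distr M (gprod (weight_indices n L)) (standardized n L Win W) = gprod (weight_indices n L)"
proof -
  let ?I = "weight_indices n L :: 'd weight_index set"
  interpret prob_space M using G by (simp add: gaussian_resnet_weights_def)
  define X where "X = case_sum (\<lambda>(i, j). Win i j) (\<lambda>(l, i, j). W l i j)"
  define c where "c = (\<lambda>k :: 'd weight_index. case k of Inl _ \<Rightarrow> sqrt (real CARD('d)) | Inr _ \<Rightarrow> sqrt (real n))"
  define Y where "Y = (\<lambda>k \<omega>. c k * X k \<omega>)"
  have ind: "indep_vars (\<lambda>_. borel) X ?I"
    using G by (simp add: gaussian_resnet_weights_def X_def weight_indices_def)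
  have indY: "indep_vars (\<lambda>_. borel) Y ?I"
    unfolding Y_def by (rule indep_vars_compose2[OF ind, of "\<lambda>k x. c k * x"]) auto
  have rv: "random_variable borel (Y k)" if "k \<in> ?I" for k
    using indY that by (auto simp: indep_vars_def)
  have st: "standardized n L Win W = (\<lambda>\<omega>. \<lambda>k\<in>?I. Y k \<omega>)"
    by (auto simp: standardized_def Y_def X_def c_def fun_eq_iff split: sum.splits)
  have dY: "distr M borel (Y k) = gauss" if k: "k \<in> ?I" for k
  proof (cases k)
    case (Inl p)
    then obtain i j where ij: "k = Inl (i, j)" "i < n" using k by (auto simp: weight_indices_def)
    have "distributed M lborel (Win i j) (\<lambda>x. ennreal (normal_density 0 (sqrt (1 / real CARD('d))) x))"
      using G ij by (simp add: gaussian_resnet_weights_def)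
    from distr_normal_gauss[OF prob_space_axioms this] show ?thesis by (simp add: Y_def X_def c_def ij)
  next
    case (Inr p)
    then obtain l i j where ij: "k = Inr (l, i, j)" "l \<in> {1..L}" "i < n" "j < n" using k by (auto simp: weight_indices_def)
    have "distributed M lborel (W l i j) (\<lambda>x. ennreal (normal_density 0 (sqrt (1 / real n)) x))"
      using G ij by (simp add: gaussian_resnet_weights_def)
    from distr_normal_gauss[OF prob_space_axioms this] n show ?thesis by (simp add: Y_def X_def c_def ij)
  qed
  have sets: "sets (gprod ?I) = sets (\<Pi>\<^sub>M k\<in>?I. borel)" unfolding gprod_def by (rule sets_PiM_cong) auto
  have meas: "(\<lambda>\<omega>. \<lambda>k\<in>?I. Y k \<omega>) \<in> measurable M (\<Pi>\<^sub>M k\<in>?I. borel)"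
    by (rule measurable_restrict) (rule rv)
  then show "standardized n L Win W \<in> measurable M (gprod ?I)"
    unfolding st using sets by (simp cong: measurable_cong_sets)
  have ne: "?I \<noteq> {}"
  proof -
    have "Inl (0, j) \<in> ?I" for j :: 'd using n by (auto simp: weight_indices_def)
    then show ?thesis by blast
  qed
  have "distr M (gprod ?I) (standardized n L Win W) = distr M (\<Pi>\<^sub>M k\<in>?I. borel) (\<lambda>\<omega>. \<lambda>k\<in>?I. Y k \<omega>)"
    unfolding st using sets by (intro distr_cong) auto
  also have "\<dots> = (\<Pi>\<^sub>M k\<in>?I. distr M borel (Y k))"
    using indep_vars_iff_distr_eq_PiM'[OF ne, where M' = "\<lambda>_. borel" and X = Y] rv indY by blast
  also have "\<dots> = gprod ?I" unfolding gprod_def by (rule PiM_cong) (auto simp: dY)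
  finally show "distr M (gprod ?I) (standardized n L Win W) = gprod ?I" .
qed

lemma resnet_eq_act:
  fixes Win :: "nat \<Rightarrow> 'd::finite \<Rightarrow> 'w \<Rightarrow> real"
  assumes n: "1 \<le> n" and L: "1 \<le> L" and k: "k \<le> L" and i: "i < n"
  shows "resnet n L (\<lambda>i j. Win i j \<omega>) (\<lambda>l i j. W l i j \<omega>) x k i = act n L x k i (standardized n L Win W \<omega>)"
  using k i
proof (induction k arbitrary: i)
  case 0
  have "standardized n L Win W \<omega> (Inl (i, j)) = sqrt (real CARD('d)) * Win i j \<omega>" for j
  proof -
    have "Inl (i, j) \<in> weight_indices n L" using 0 by (auto simp: weight_indices_def)
    then show ?thesis by (simp add: standardized_def)
  qed
  then show ?case by simp
next
  case (Suc k)
  have s: "standardized n L Win W \<omega> (Inr (Suc k, i, j)) = sqrt (real n) * W (Suc k) i j \<omega>" if "j < n" for j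
  proof -
    have "Inr (Suc k, i, j) \<in> (weight_indices n L :: 'd weight_index set)" using Suc.prems that by (auto simp: weight_indices_def)
    then show ?thesis by (simp add: standardized_def)
  qed
  have "1 / sqrt (real L) * (\<Sum>j<n. W (Suc k) i j \<omega> * relu (resnet n L (\<lambda>i j. Win i j \<omega>) (\<lambda>l i j. W l i j \<omega>) x k j))
    = (\<Sum>j<n. standardized n L Win W \<omega> (Inr (Suc k, i, j)) * (relu (act n L x k j (standardized n L Win W \<omega>)) / sqrt (real n * real L)))"
    unfolding sum_distrib_left
    by (intro sum.cong refl) (use Suc n in \<open>simp add: s real_sqrt_mult\<close>)
  then show ?case using Suc by simp
qed

theorem theorem2:
  shows "\<exists>C :: real \<Rightarrow> real \<Rightarrow> real.
    \<forall>(a :: real ^ 'd::finite) (b :: real ^ 'd) (q :: real \<Rightarrow> real ^ 'd \<Rightarrow> real ^ 'd \<Rightarrow> real)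
      (n :: nat) (L :: nat) (M :: 'w measure)
      (Win :: nat \<Rightarrow> 'd \<Rightarrow> 'w \<Rightarrow> real) (W :: nat \<Rightarrow> nat \<Rightarrow> nat \<Rightarrow> 'w \<Rightarrow> real).
      a \<noteq> 0 \<longrightarrow> b \<noteq> 0 \<longrightarrow> a \<noteq> b \<longrightarrow> covariance_flow q \<longrightarrow>
      n \<ge> 1 \<longrightarrow> L \<ge> 1 \<longrightarrow> gaussian_resnet_weights M n L Win W \<longrightarrow>
      (SUP t\<in>{0..1::real}.
         L2_norm M (\<lambda>\<omega>. neural_kernel n L (\<lambda>i j. Win i j \<omega>) (\<lambda>l i j. W l i j \<omega>) t a b - q t a b))
      \<le> ennreal (C (norm a) (norm b) * (1 / sqrt (real n) + 1 / sqrt (real L)))"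
proof -
  define \<alpha> where "\<alpha> x = x\<^sup>2 / real CARD('d)" for x :: real
  define \<gamma> where "\<gamma> x y = \<alpha> x + \<alpha> y + 1" for x y
  \<comment> \<open>The constant of \<open>cross_error\<close> with the definition of
    \<open>H\<close> inserted, where 14 = 13 + 1 allows one more \<open>rate\<close> for rounding t
    down to a layer. The choice of \<open>\<gamma>\<close> dominates both variances and 1.\<close>
  define C where "C x y = noise_const * \<gamma> x y * (14 + (5 + 16 * (7 * sqrt (2 * \<gamma> x y + 1) * sqrt (2 / min (\<alpha> x) (\<alpha> y)))) * exp 2 + 35 * \<gamma> x y)" for x y
  have "L2_norm M (\<lambda>\<omega>. neural_kernel n L (\<lambda>i j. Win i j \<omega>) (\<lambda>l i j. W l i j \<omega>) t a b - q t a b)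
      \<le> ennreal (C (norm a) (norm b) * (1 / sqrt (real n) + 1 / sqrt (real L)))"
    if ab: "a \<noteq> 0" "b \<noteq> 0" and q: "covariance_flow q" and n: "1 \<le> n" and L: "1 \<le> L"
      and G: "gaussian_resnet_weights M n L Win W" and t: "t \<in> {0..1}"
    for a b :: "real ^ 'd" and q n L and M :: "'w measure" and Win W t
  proof -
    have q0: "q 0 x y = inner x y / real CARD('d)" if "x \<noteq> 0" "y \<noteq> 0" for x y
      using q that by (simp add: covariance_flow_def)
    have pos: "0 \<le> \<alpha> x" for x by (simp add: \<alpha>_def)
    interpret N: net2 a b n L "\<alpha> (norm a)" "\<alpha> (norm b)" "\<gamma> (norm a) (norm b)" "\<lambda>t. q t a b" "\<lambda>t. q t b b"
      by unfold_locales
        (use n L q0 ab pos covariance_flow_path[OF q ab] covariance_flow_path[OF q ab(2,2)] in \<open>simp_all add: \<alpha>_def \<gamma>_def\<close>)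
    let ?I = "weight_indices n L :: 'd weight_index set"
    define l where "l = nat \<lfloor>t * real L\<rfloor>"
    have tL: "0 \<le> t * real L" "t * real L \<le> real L" using t L by (auto simp: mult_left_le_one_le)
    have fl: "real l \<le> t * real L" "t * real L < real l + 1"
      using tL by (simp_all add: l_def of_nat_nat of_int_floor_le)
    have l: "l \<le> L" using fl(1) tL(2) by simp
    have tm: "N.tm l \<le> t" "t - N.tm l \<le> 1 / real L"
    proof -
      have L0: "0 < real L" using L by simp
      have tt: "t = (t * real L) / real L" using L0 by simp
      have "real l / real L \<le> (t * real L) / real L" using fl(1) L0 by (intro divide_right_mono) auto
      then show "N.tm l \<le> t" using L0 by (simp add: N.tm_def)
      have "(t * real L - real l) / real L \<le> 1 / real L" using fl(2) L0 by (intro divide_right_mono) auto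
      then show "t - N.tm l \<le> 1 / real L" using L0 by (simp add: N.tm_def diff_divide_distrib)
    qed
    \<comment> \<open>The error at the layer reached at time t, plus the deterministic movement of
      the flow since that layer; this movement takes at most the time 1 / L.\<close>
    define e where "e w = N.err l w + (N.qx l - q t a b)" for w
    have pe: "pb ?I e" unfolding e_def[abs_def] by (intro pbd_add N.pb_err[OF l] pb_const)
    have "neural_kernel n L (\<lambda>i j. Win i j \<omega>) (\<lambda>l i j. W l i j \<omega>) t a b - q t a b = e (standardized n L Win W \<omega>)" for \<omega>
    proof -
      have "(\<Sum>i<n. resnet n L (\<lambda>i j. Win i j \<omega>) (\<lambda>l i j. W l i j \<omega>) a l i * resnet n L (\<lambda>i j. Win i j \<omega>) (\<lambda>l i j. W l i j \<omega>) b l i)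
        = (\<Sum>i<n. act n L a l i (standardized n L Win W \<omega>) * act n L b l i (standardized n L Win W \<omega>))"
        by (intro sum.cong refl) (simp add: resnet_eq_act[OF n L l])
      then show ?thesis by (simp add: neural_kernel_def Let_def l_def[symmetric] e_def N.err_def)
    qed
    then have "(\<integral>\<^sup>+\<omega>. ennreal ((norm (neural_kernel n L (\<lambda>i j. Win i j \<omega>) (\<lambda>l i j. W l i j \<omega>) t a b - q t a b))\<^sup>2) \<partial>M)
      = (\<integral>\<^sup>+\<omega>. ennreal ((e (standardized n L Win W \<omega>))\<^sup>2) \<partial>M)" by simp
    also have "\<dots> = (\<integral>\<^sup>+w. ennreal ((e w)\<^sup>2) \<partial>distr M (gprod ?I) (standardized n L Win W))"
      using pbd_measurable[OF pe] by (subst nn_integral_distr[OF standardized_distr(1)[OF G n]]) auto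
    also have "\<dots> = ennreal (\<integral>w. (e w)\<^sup>2 \<partial>gprod ?I)"
      unfolding standardized_distr(2)[OF G n]
      by (rule nn_integral_eq_integral) (auto intro!: pb_integrable N.fin pbd_power pe)
    finally have "L2_norm M (\<lambda>\<omega>. neural_kernel n L (\<lambda>i j. Win i j \<omega>) (\<lambda>l i j. W l i j \<omega>) t a b - q t a b) = ennreal (nrm ?I e)"
      by (simp add: L2_norm_def nrm_def)
    also have "nrm ?I e \<le> nrm ?I (N.err l) + nrm ?I (\<lambda>_. N.qx l - q t a b)"
      unfolding e_def[abs_def] by (intro nrm_triangle N.fin N.pb_err[OF l] pb_const)
    also have "\<dots> \<le> (13 + (5 + 16 * N.H) * exp 2 + 35 * \<gamma> (norm a) (norm b)) * N.rate + N.rate"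
    proof (intro add_mono N.cross_error[OF l])
      have bnd: "0 \<le> N.tm l" "N.tm l \<le> t" "t \<le> 1" using N.tm(1)[OF l] tm t by auto
      have "0 \<le> q t a b - N.qx l" "q t a b - N.qx l \<le> sqrt (\<alpha> (norm a) * \<alpha> (norm b)) * (exp (t / 2) - exp (N.tm l / 2))"
        using N.flow bnd unfolding flow_path_def N.qx_def by blast+
      moreover have "sqrt (\<alpha> (norm a) * \<alpha> (norm b)) * (exp (t / 2) - exp (N.tm l / 2)) \<le> \<gamma> (norm a) (norm b) * (1 / real L)"
        using N.sqrt_prod_le exp_half_bounds(1,2)[OF bnd] bnd tm N.\<gamma> by (intro mult_mono) auto
      ultimately show "nrm ?I (\<lambda>_. N.qx l - q t a b) \<le> N.rate" using N.rate_bounds(3) by simp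
    qed
    also have "\<dots> = C (norm a) (norm b) * (1 / sqrt (real n) + 1 / sqrt (real L))"
      by (simp add: C_def N.H_def N.rate_def algebra_simps)
    finally show ?thesis by (simp add: ennreal_leI)
  qed
  then have "\<forall>(a :: real ^ 'd::finite) (b :: real ^ 'd) (q :: real \<Rightarrow> real ^ 'd \<Rightarrow> real ^ 'd \<Rightarrow> real)
      (n :: nat) (L :: nat) (M :: 'w measure)
      (Win :: nat \<Rightarrow> 'd \<Rightarrow> 'w \<Rightarrow> real) (W :: nat \<Rightarrow> nat \<Rightarrow> nat \<Rightarrow> 'w \<Rightarrow> real).
      a \<noteq> 0 \<longrightarrow> b \<noteq> 0 \<longrightarrow> a \<noteq> b \<longrightarrow> covariance_flow q \<longrightarrow>
      n \<ge> 1 \<longrightarrow> L \<ge> 1 \<longrightarrow> gaussian_resnet_weights M n L Win W \<longrightarrow>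
      (SUP t\<in>{0..1::real}.
         L2_norm M (\<lambda>\<omega>. neural_kernel n L (\<lambda>i j. Win i j \<omega>) (\<lambda>l i j. W l i j \<omega>) t a b - q t a b))
      \<le> ennreal (C (norm a) (norm b) * (1 / sqrt (real n) + 1 / sqrt (real L)))"
    by (intro allI impI SUP_least) blast
  then show ?thesis by blast
qed

end
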